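(* Let $d=2$ or $d=3$. Almost surely, the random graph $G=(V,E)$ (the perturbed directed spanning forest) is connected and consists of a single tree.
   Context: Let $\{U_{w}: w\in\mathbb{Z}^d\}$ be i.i.d. random variables, each uniformly distributed on $[-1,1]^d$, and let $V:=\{w+U_w : w\in\mathbb{Z}^d\}$ be the set of perturbed lattice points. For $x\in\mathbb{R}^d$ let $x(i)$ be its $i$-th coordinate and $\|\cdot\|_1$ the $\ell_1$ norm. For $x\in\mathbb{R}^d$ define $h(x):=\operatorname{argmin}\{\|y-x\|_1 : y\in V,\ y(d)>x(d)\}$, the closest point of $V$ with strictly larger $d$-th coordinate; it is almost surely well defined and unique. The perturbed directed spanning forest is the random graph $G=(V,E)$ with vertex set $V$ and edge set $E:=\{\langle x,h(x)\rangle : x\in V\}$ (for connectedness and being a tree, edges are regarded as undirected). *)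

theory Defs
  imports "HOL-Probability.Probability" "Graph_Theory.Digraph_Component"
begin

definition l1_norm :: "real ^ 'n \<Rightarrow> real" where
  "l1_norm x = (\<Sum>i\<in>UNIV. \<bar>x $ i\<bar>)"

text \<open>With \<open>d = CARD('n)\<close> and the linearly ordered finite index type \<open>'n\<close> in the role of
  \<open>{1,\<dots>,d}\<close>, the coordinate \<open>x(d)\<close> is the one at the largest index.\<close>

definition last_coord :: "real ^ 'n::{finite,linorder} \<Rightarrow> real" where
  "last_coord x = x $ Max UNIV"

text \<open>\<open>u\<close> is one realisation of the family of perturbations, indexed by the points of the
  integer lattice.\<close>

definition perturbed_lattice :: "(int ^ 'n \<Rightarrow> real ^ 'n) \<Rightarrow> (real ^ 'n) set" where
  "perturbed_lattice u = range (\<lambda>w. (\<chi> i. real_of_int (w $ i)) + u w)"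

text \<open>\<^const>\<open>arg_min\<close> chooses among several minimisers and is unspecified if there is none;
  for the random set considered here, almost surely neither happens.\<close>

definition next_point :: "(real ^ 'n::{finite,linorder}) set \<Rightarrow>
    real ^ 'n::{finite,linorder} \<Rightarrow> real ^ 'n::{finite,linorder}" where
  "next_point V x = (ARG_MIN (\<lambda>y. l1_norm (y - x)) y. y \<in> V \<and> last_coord y > last_coord x)"

definition perturbed_DSF ::
  "(int ^ 'n::{finite,linorder} \<Rightarrow> real ^ 'n::{finite,linorder}) \<Rightarrow>
   (real ^ 'n::{finite,linorder}, (real ^ 'n::{finite,linorder}) \<times> (real ^ 'n::{finite,linorder})) pre_digraph"
where
  "perturbed_DSF u = (let V = perturbed_lattice u in
     with_proj \<lparr> pverts = V, parcs = {(x, next_point V x) | x. x \<in> V} \<rparr>)"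

text \<open>\<^const>\<open>Digraph_Component.connected\<close> already ignores the direction of the arcs, but
  \<^const>\<open>forest\<close> and \<^const>\<open>tree\<close> from the same theory only exclude directed cycles.
  For the undirected notion we exclude cycles in the symmetrised graph. There every
  edge \<open>{a, b}\<close> with \<open>a \<noteq> b\<close> gives the closed walk \<open>a, b, a\<close>, which is not a cycle of an
  undirected graph, and all closed walks of length 2 counted by
  \<^const>\<open>pre_digraph.cycle\<close> are of this form. A loop does count as a cycle; parallel and opposite arcs are
  identified, in accordance with an edge set of unordered pairs.\<close>

definition undirected_forest :: "('a, 'b) pre_digraph \<Rightarrow> bool" where
  "undirected_forest G \<longleftrightarrow>
     \<not> (\<exists>p. pre_digraph.cycle (with_proj (mk_symmetric G)) p \<and> length p \<noteq> 2)"

definition undirected_tree :: "('a, 'b) pre_digraph \<Rightarrow> bool" where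
  "undirected_tree G \<longleftrightarrow> Digraph_Component.connected G \<and> undirected_forest G"

end

theory Submission
  imports Defs "HOL-Real_Asymp.Real_Asymp"
begin

text \<open>The path of successors from a vertex moves upwards, and a Peierls count of increasing chains
  shows that its length up to a given height has exponential tails. On every twentieth row there is
  a positive chance, given all lower rows, that the perturbations form a trap: a tilted patch that
  leads a path entering it to a single point, from which it continues independently of its past.
  Watched at the levels where both are trapped, the gap of two paths therefore performs a random
  walk on the horizontal lattice, with symmetric isotropic increments of finite moments, as long as
  the regions explored by the two paths are disjoint.

  Let \<open>c s\<close> be the probability that two freshly trapped paths at horizontal distance \<open>s\<close> coalesce.
  Then \<open>c\<close> is superharmonic for this walk killed with a probability decaying faster than every power
  of \<open>\<bar>s\<bar>\<close>. Because \<open>d - 1 \<le> 2\<close>, the function \<open>1/2 + 1/(2 a) - (ln a)/L\<close> with \<open>a = 1 + \<bar>s\<bar>\<^sup>2\<close> is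
  subharmonic for it where it is positive and \<open>\<bar>s\<bar>\<close> is large; comparing both on discs and letting
  \<open>L \<longrightarrow> \<infinity>\<close> bounds \<open>c\<close> from below. So two paths that have not met below some level meet with a
  conditional probability bounded away from zero, hence they meet almost surely.\<close>

text \<open>A step of a path reveals that a whole neighbourhood holds no closer point, so the past
  of a path carries information about rows above its head and the visited sites form no Markov
  chain. This is why the trap has two layers: \<open>Tilt\<close> reads only row \<open>n\<close>,
  \<open>Gam\<close> only the two rows above it, and after both the path sits at
  \<open>up z\<close>, higher than \<open>n + 1\<close>, where rows up to \<open>n\<close> no longer
  matter. But \<open>Gam\<close> concerns rows that the continuation uses again. It is therefore
  carried along as the state after a renewal: the law \<open>QQ\<close> of the walk and the
  probability \<open>cc\<close> both refer to \<open>Gam\<close> at the two starts. A trap of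
  bounded size is useless if the path makes many steps just below row \<open>n\<close> and drifts
  off the patch. \<open>Bad\<close> excludes this by a condition decided below row \<open>n\<close>,
  so that the trap stays independent of it. For a walk in the plane the logarithm is harmonic only
  up to an error of order \<open>1 / a^2\<close> of unknown sign, and killing costs probability as
  well. The term \<open>1 / (2 a)\<close> gains a drift of exactly this order, with a definite sign;
  dividing the logarithm by a large \<open>L\<close> makes its error smaller than this gain.\<close>

type_synonym 'n site = "int ^ 'n"
type_synonym 'n env = "int ^ 'n \<Rightarrow> real ^ 'n"

section \<open>Vocabulary: sites, successors, traps and renewals\<close>

definition dd :: "'n::{finite,linorder}" where "dd = Max UNIV"

definition ubox :: "(real ^ 'n::finite) set" where "ubox = cbox (\<chi> i. -1) (\<chi> i. 1)"

text \<open>Perturbations outside the cube are replaced by \<open>0\<close>, so that the geometric estimates hold for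
  every environment and not only almost surely.\<close>

definition clip :: "real ^ 'n::finite \<Rightarrow> real ^ 'n" where
  "clip x = (if x \<in> ubox then x else 0)"

definition pos :: "'n::finite env \<Rightarrow> 'n site \<Rightarrow> real ^ 'n" where
  "pos \<omega> w = (\<chi> i. real_of_int (w $ i)) + clip (\<omega> w)"

definition ht :: "'n::{finite,linorder} env \<Rightarrow> 'n site \<Rightarrow> real" where
  "ht \<omega> w = pos \<omega> w $ dd"

definition ds :: "'n::finite env \<Rightarrow> 'n site \<Rightarrow> 'n site \<Rightarrow> real" where
  "ds \<omega> w v = l1_norm (pos \<omega> v - pos \<omega> w)"

definition nb :: "'n::finite site \<Rightarrow> 'n site set" where
  "nb w = {v. \<forall>i. \<bar>v $ i - w $ i\<bar> \<le> 9}"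

text \<open>The nearest higher point always lies at distance at most \<open>6\<close>, and the points outside
  \<^term>\<open>nb w\<close> are at distance at least \<open>8\<close>, so only finitely many candidates need to be compared.\<close>

definition suc :: "'n::{finite,linorder} env \<Rightarrow> 'n site \<Rightarrow> 'n site \<Rightarrow> bool" where
  "suc \<omega> w v \<longleftrightarrow> v \<in> nb w \<and> ht \<omega> w < ht \<omega> v \<and>
     (\<forall>u\<in>nb w. ht \<omega> w < ht \<omega> u \<longrightarrow> u \<noteq> v \<longrightarrow> ds \<omega> w v < ds \<omega> w u)"

definition notie :: "'n::{finite,linorder} env \<Rightarrow> bool" where
  "notie \<omega> \<longleftrightarrow> (\<forall>w u v. u \<noteq> v \<longrightarrow> ht \<omega> w < ht \<omega> u \<longrightarrow> ht \<omega> w < ht \<omega> v \<longrightarrow> ds \<omega> w u \<noteq> ds \<omega> w v)"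

text \<open>A step is shorter than the \<open>7\<close> units that separate height \<open>n - 8\<close> from the lowest possible
  point of row \<open>n\<close>. Hence the path up to its first vertex above height \<open>n - 8\<close>, which
  \<open>Ent\<close> describes, is determined by the rows below \<open>n\<close>.\<close>

definition sucL :: "'n::{finite,linorder} env \<Rightarrow> int \<Rightarrow> 'n site \<Rightarrow> 'n site \<Rightarrow> bool" where
  "sucL \<omega> n u v \<longleftrightarrow> ht \<omega> u \<le> real_of_int n - 8 \<and> suc \<omega> u v"

definition Ent :: "'n::{finite,linorder} env \<Rightarrow> 'n site \<Rightarrow> int \<Rightarrow> 'n site \<Rightarrow> bool" where
  "Ent \<omega> x n v \<longleftrightarrow> (sucL \<omega> n)\<^sup>*\<^sup>* x v \<and> real_of_int n - 8 < ht \<omega> v"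

text \<open>A step changes each lattice coordinate by at most 9, so the negation confines everything
  the path has read before crossing height \<open>n - 8\<close> to a box of radius
  \<open>9 * m\<close> around \<open>x\<close>.\<close>

definition Long :: "'n::{finite,linorder} env \<Rightarrow> 'n site \<Rightarrow> int \<Rightarrow> nat \<Rightarrow> bool" where
  "Long \<omega> x n m \<longleftrightarrow> (\<exists>v. (sucL \<omega> n ^^ m) x v)"

text \<open>Arbitrary upward moves replace successor steps here because the successor of a site just
  below row \<open>n\<close> may depend on row \<open>n\<close> itself, whereas this relation reads
  only heights in the nine rows below \<open>n\<close>.\<close>

definition inc :: "'n::{finite,linorder} env \<Rightarrow> int \<Rightarrow> 'n site \<Rightarrow> 'n site \<Rightarrow> bool" where
  "inc \<omega> n a b \<longleftrightarrow> b \<in> nb a \<and> ht \<omega> a < ht \<omega> b \<and> n - 9 \<le> b $ dd \<and> b $ dd < n"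

text \<open>If this fails, a path that enters at \<open>v\<close> has to leave the slab below row
  \<open>n\<close> after fewer than \<open>A\<close> moves inside it, hence while it is still over
  the trap.\<close>

definition Bad :: "nat \<Rightarrow> 'n::{finite,linorder} env \<Rightarrow> int \<Rightarrow> 'n site \<Rightarrow> bool" where
  "Bad A \<omega> n v \<longleftrightarrow> n - 9 \<le> v $ dd \<and> v $ dd < n \<and> real_of_int n - 8 < ht \<omega> v \<and> (\<exists>u. (inc \<omega> n ^^ A) v u)"

definition h1 :: "'n::{finite,linorder} site \<Rightarrow> 'n site \<Rightarrow> int" where
  "h1 a b = (\<Sum>i\<in>-{dd}. \<bar>a $ i - b $ i\<bar>)"

text \<open>The target heights decrease with the horizontal distance \<open>k\<close> from the centre of the trap, so
  that a path that has entered the trap moves towards the centre.\<close>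

definition tbox :: "nat \<Rightarrow> int \<Rightarrow> (real ^ 'n::{finite,linorder}) set" where
  "tbox r k = {x. (\<forall>i. i \<noteq> dd \<longrightarrow> \<bar>x $ i\<bar> \<le> 1/100) \<and>
     1/10 - (2 * real_of_int k + 1) / (40 * (real r + 1)) < x $ dd \<and>
     x $ dd < 1/10 - 2 * real_of_int k / (40 * (real r + 1))}"

definition Tilt :: "nat \<Rightarrow> 'n::{finite,linorder} env \<Rightarrow> 'n site \<Rightarrow> bool" where
  "Tilt r \<omega> z \<longleftrightarrow> (\<forall>w. w $ dd = z $ dd \<longrightarrow> h1 w z \<le> int r \<longrightarrow> \<omega> w \<in> tbox r (h1 w z))"

text \<open>The vertical gap between 7/10 and 9/10 exceeds the spread 1/20 of the heights in
  \<open>tbox\<close> plus two horizontal offsets of 1/50 each. The bound -1/10 is the threshold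
  9/10 seen from one row higher.\<close>

definition gbox :: "'n::{finite,linorder} site \<Rightarrow> 'n site \<Rightarrow> (real, 'n) vec set" where
  "gbox y w = (if w = y then {x. (\<forall>i. i \<noteq> dd \<longrightarrow> \<bar>x $ i\<bar> \<le> 1/100) \<and> 6/10 < x $ dd \<and> x $ dd < 7/10}
     else if w $ dd = y $ dd then ubox \<inter> {x. 9/10 \<le> x $ dd}
     else ubox \<inter> {x. - 1/10 \<le> x $ dd})"

text \<open>A path that has reached the centre \<open>z\<close> of a trap continues with \<open>up z\<close> if \<open>Gam\<close> holds there,
  since every other point of the next two rows near \<open>up z\<close> is higher.\<close>

definition Gam :: "nat \<Rightarrow> 'n::{finite,linorder} env \<Rightarrow> 'n site \<Rightarrow> bool" where
  "Gam r \<omega> y \<longleftrightarrow> (\<forall>w. w $ dd \<in> {y $ dd, y $ dd + 1} \<longrightarrow> h1 w y \<le> int r \<longrightarrow> \<omega> w \<in> gbox y w)"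

definition up :: "'n::{finite,linorder} site \<Rightarrow> 'n site" where
  "up z = (\<chi> i. if i = dd then z $ i + 1 else z $ i)"

text \<open>The part of a renewal that is decided by the rows up to \<open>n\<close>;
  \<open>Gam\<close> at \<open>up z\<close> is added later. The centre may be off by one from the
  column of the entry \<open>v\<close>; this slack is used in \<open>gap_nontriv\<close> to produce
  a nonzero gap.\<close>

definition Rgp :: "nat \<Rightarrow> nat \<Rightarrow> 'n::{finite,linorder} env \<Rightarrow> 'n site \<Rightarrow> int \<Rightarrow> 'n site \<Rightarrow> bool" where
  "Rgp A r \<omega> x n z \<longleftrightarrow> (\<exists>v. Ent \<omega> x n v \<and> \<not> Bad A \<omega> n v \<and> z $ dd = n \<and> h1 z v \<le> 1 \<and> Tilt r \<omega> z)"

definition Coal :: "'n::{finite,linorder} env \<Rightarrow> 'n site \<Rightarrow> 'n site \<Rightarrow> bool" where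
  "Coal \<omega> x y \<longleftrightarrow> (\<exists>u. (suc \<omega>)\<^sup>*\<^sup>* x u \<and> (suc \<omega>)\<^sup>*\<^sup>* y u)"

subsection \<open>Geometry of one step\<close>

lemma clip_bound: "\<bar>clip x $ i\<bar> \<le> 1"
  by (auto simp: clip_def ubox_def mem_box_cart abs_le_iff minus_le_iff)

lemma clip_id: "x \<in> ubox \<Longrightarrow> clip x = x"
  by (simp add: clip_def)

lemma ubox_iff: "x \<in> ubox \<longleftrightarrow> (\<forall>i. \<bar>x $ i\<bar> \<le> 1)"
  by (auto simp: ubox_def mem_box_cart abs_le_iff minus_le_iff)

lemma pos_nth: "pos \<omega> w $ i = real_of_int (w $ i) + clip (\<omega> w) $ i"
  by (simp add: pos_def)

lemma pos_bound: "\<bar>pos \<omega> w $ i - real_of_int (w $ i)\<bar> \<le> 1"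
  using clip_bound[of "\<omega> w" i] by (simp add: pos_nth)

lemma ht_bound: "- 1 \<le> ht \<omega> w - real_of_int (w $ dd)" "ht \<omega> w \<le> real_of_int (w $ dd) + 1"
  using pos_bound[of \<omega> w dd] by (auto simp: ht_def)

lemma l1_norm_split:
  "l1_norm (x::real^'n::{finite,linorder}) = \<bar>x $ dd\<bar> + (\<Sum>i\<in>-{dd}. \<bar>x $ i\<bar>)"
proof -
  have "(\<Sum>i\<in>UNIV. \<bar>x $ i\<bar>) = \<bar>x $ dd\<bar> + (\<Sum>i\<in>UNIV-{dd}. \<bar>x $ i\<bar>)"
    by (rule sum.remove) auto
  thus ?thesis unfolding l1_norm_def Compl_eq_Diff_UNIV .
qed

lemma ds_split:
  "ds \<omega> w v = \<bar>ht \<omega> v - ht \<omega> w\<bar> + (\<Sum>i\<in>-{dd}. \<bar>pos \<omega> v $ i - pos \<omega> w $ i\<bar>)"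
  unfolding ds_def l1_norm_split by (simp add: ht_def)

lemma ds_ge_ht: "ht \<omega> v - ht \<omega> w \<le> ds \<omega> w v"
  unfolding ds_split by (smt (verit) sum_nonneg abs_ge_zero)

lemma ds_ge_coord: "\<bar>pos \<omega> v $ i - pos \<omega> w $ i\<bar> \<le> ds \<omega> w v"
proof -
  have "\<bar>pos \<omega> v $ i - pos \<omega> w $ i\<bar> = (\<Sum>j\<in>{i}. \<bar>pos \<omega> v $ j - pos \<omega> w $ j\<bar>)" by simp
  also have "\<dots> \<le> (\<Sum>j\<in>UNIV. \<bar>pos \<omega> v $ j - pos \<omega> w $ j\<bar>)"
    by (rule sum_mono2) auto
  finally show ?thesis by (simp add: ds_def l1_norm_def)
qed

lemma nb_subset: "nb (w::'n::finite site) \<subseteq> (\<lambda>f. \<chi> i. f i) ` (PiE UNIV (\<lambda>i. {w $ i - 9 .. w $ i + 9}))"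
proof
  fix v assume v: "v \<in> nb w"
  have "v = (\<chi> i. v $ i)" by simp
  moreover have "(\<lambda>i. v $ i) \<in> PiE UNIV (\<lambda>i. {w $ i - 9 .. w $ i + 9})"
    using v by (auto simp: nb_def abs_le_iff algebra_simps)
  ultimately show "v \<in> (\<lambda>f. \<chi> i. f i) ` (PiE UNIV (\<lambda>i. {w $ i - 9 .. w $ i + 9}))" by blast
qed

lemma finite_nb [simp]: "finite (nb (w::'n::finite site))"
  by (rule finite_subset[OF nb_subset]) (auto intro!: finite_imageI finite_PiE)

lemma nb_refl [simp]: "w \<in> nb w" by (simp add: nb_def)

lemma suc_fun: "suc \<omega> w v \<Longrightarrow> suc \<omega> w v' \<Longrightarrow> v = v'"
  unfolding suc_def by (metis order.asym)

lemma suc_ht: "suc \<omega> w v \<Longrightarrow> ht \<omega> w < ht \<omega> v" by (simp add: suc_def)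

lemma suc_nb: "suc \<omega> w v \<Longrightarrow> v \<in> nb w" by (simp add: suc_def)

lemma h1_nonneg [simp]: "0 \<le> h1 a b" by (simp add: h1_def sum_nonneg)

lemma h1_triangle: "h1 a c \<le> h1 a b + h1 b c"
  unfolding h1_def sum.distrib[symmetric] by (rule sum_mono) auto

lemma h1_sym: "h1 a b = h1 b a"
  unfolding h1_def by (rule sum.cong) auto

lemma h1_refl [simp]: "h1 a a = 0" by (simp add: h1_def)

lemma h1_up [simp]: "h1 (up a) b = h1 a b" "h1 a (up b) = h1 a b"
  unfolding h1_def up_def by (auto intro!: sum.cong)

lemma up_dd [simp]: "up z $ dd = z $ dd + 1" by (simp add: up_def)

lemma h1_eq_0: "h1 a b = 0 \<Longrightarrow> a $ dd = b $ dd \<Longrightarrow> a = b"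
proof -
  assume h: "h1 a b = 0" and d: "a $ dd = b $ dd"
  have "\<forall>i\<in>-{dd}. \<bar>a $ i - b $ i\<bar> = 0"
    using h unfolding h1_def by (subst (asm) sum_nonneg_eq_0_iff) auto
  hence "a $ i = b $ i" for i using d by (cases "i = dd") auto
  thus "a = b" by (simp add: vec_eq_iff)
qed

text \<open>The dimension enters through the number of horizontal coordinates, which is at most two:
  in the numerical margins of the geometry, and in the sign of the drift of the logarithm.\<close>

locale lowdim =
  fixes ty :: "'n::{finite,linorder} itself"
  assumes card23: "CARD('n) = 2 \<or> CARD('n) = 3"
begin

lemma card_hor: "card (-{dd::'n}) \<le> 2"
  using card23 by (auto simp: Compl_eq_Diff_UNIV card_Diff_singleton)

lemma hsum_le:
  assumes "\<And>i::'n. i \<noteq> dd \<Longrightarrow> f i \<le> (c::real)" "0 \<le> c"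
  shows "(\<Sum>i\<in>-{dd}. f i) \<le> 2 * c"
proof -
  have "(\<Sum>i\<in>-{dd::'n}. f i) \<le> real (card (-{dd::'n})) * c"
    by (rule sum_bounded_above) (use assms in auto)
  also have "\<dots> \<le> 2 * c" using card_hor assms(2) by (intro mult_right_mono) auto
  finally show ?thesis .
qed

lemma hsum_le_int:
  assumes "\<And>i::'n. i \<noteq> dd \<Longrightarrow> f i \<le> (c::int)" "0 \<le> c"
  shows "(\<Sum>i\<in>-{dd}. f i) \<le> 2 * c"
proof -
  have "(\<Sum>i\<in>-{dd::'n}. f i) \<le> int (card (-{dd::'n})) * c"
    by (rule sum_bounded_above) (use assms in auto)
  also have "\<dots> \<le> 2 * c" using card_hor assms(2) by (intro mult_right_mono) auto
  finally show ?thesis .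
qed

lemma h1_nb: "v \<in> nb w \<Longrightarrow> h1 v (w::'n site) \<le> 18"
  unfolding h1_def using hsum_le_int[of "\<lambda>i. \<bar>v $ i - w $ i\<bar>" 9] by (auto simp: nb_def)

text \<open>In the row two above the integer part of the height, every perturbed point is strictly
  higher, by at most 3. Rounding costs 1/2 and the perturbation 1 in each of at most two horizontal
  coordinates, so the distance is at most 3 + 2 * 3/2.\<close>

lemma near_exists:
  fixes \<omega> :: "'n env"
  shows "\<exists>u\<in>nb w. ht \<omega> w < ht \<omega> u \<and> ds \<omega> w u \<le> 6"
proof -
  define p where "p = pos \<omega> w"
  define u :: "'n site" where "u = (\<chi> i. if i = dd then \<lfloor>p $ dd\<rfloor> + 2 else round (p $ i))"
  have pw: "\<bar>p $ i - real_of_int (w $ i)\<bar> \<le> 1" for i using pos_bound by (simp add: p_def)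
  have r: "\<bar>real_of_int (round (p $ i)) - p $ i\<bar> \<le> 1/2" for i
    using of_int_round_abs_le by blast
  have ui: "u $ i = round (p $ i)" if "i \<noteq> dd" for i using that by (simp add: u_def)
  have ud: "u $ dd = \<lfloor>p $ dd\<rfloor> + 2" by (simp add: u_def)
  have h: "\<bar>pos \<omega> u $ i - p $ i\<bar> \<le> 3/2" if "i \<noteq> dd" for i
    using r[of i] pos_bound[of \<omega> u i] ui[OF that] by linarith
  have v: "0 < ht \<omega> u - p $ dd" "ht \<omega> u - p $ dd \<le> 3"
    using ht_bound[where w=u and \<omega>=\<omega>] ud by linarith+
  have htw: "ht \<omega> w = p $ dd" by (simp add: ht_def p_def)
  have "ds \<omega> w u \<le> 3 + 2 * (3/2)"
    unfolding ds_split using v htw hsum_le[of "\<lambda>i. \<bar>pos \<omega> u $ i - pos \<omega> w $ i\<bar>" "3/2"] h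
    by (auto simp: p_def)
  moreover have "\<bar>u $ i - w $ i\<bar> \<le> 9" for i
  proof (cases "i = dd")
    case True
    then show ?thesis using pw[of dd] ud by simp linarith
  next
    case False
    have "\<bar>real_of_int (u $ i) - real_of_int (w $ i)\<bar> \<le> 3/2"
      using r[of i] pw[of i] ui[OF False] by linarith
    then show ?thesis by linarith
  qed
  ultimately show ?thesis using v htw by (intro bexI[of _ u]) (auto simp: nb_def)
qed

lemma suc_ds_le:
  fixes \<omega> :: "'n env"
  assumes "suc \<omega> w v" shows "ds \<omega> w v \<le> 6"
  using near_exists[of w \<omega>] assms unfolding suc_def by (metis le_less_trans less_le)

lemma not_nb_ds:
  fixes \<omega> :: "'n env"
  assumes "u \<notin> nb w" shows "8 \<le> ds \<omega> w u"
proof -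
  obtain i where "\<bar>u $ i - w $ i\<bar> > 9" using assms by (auto simp: nb_def not_le)
  hence "\<bar>real_of_int (u $ i) - real_of_int (w $ i)\<bar> \<ge> 10" by linarith
  hence "\<bar>pos \<omega> u $ i - pos \<omega> w $ i\<bar> \<ge> 8"
    using pos_bound[of \<omega> u i] pos_bound[of \<omega> w i] by linarith
  thus ?thesis using ds_ge_coord[of \<omega> u i w] by linarith
qed

lemma suc_global:
  fixes \<omega> :: "'n env"
  assumes "suc \<omega> w v" "ht \<omega> w < ht \<omega> u" "u \<noteq> v"
  shows "ds \<omega> w v < ds \<omega> w u"
  using assms not_nb_ds[of u w \<omega>] suc_ds_le[of \<omega> w v] unfolding suc_def
  by (cases "u \<in> nb w") auto

lemma suc_exists:
  fixes \<omega> :: "'n env"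
  assumes "notie \<omega>" shows "\<exists>v. suc \<omega> w v"
proof -
  let ?S = "{u \<in> nb w. ht \<omega> w < ht \<omega> u}"
  have S: "finite ?S" "?S \<noteq> {}" using near_exists[of w \<omega>] by auto
  obtain v where v: "v \<in> ?S" "\<forall>u\<in>?S. ds \<omega> w v \<le> ds \<omega> w u"
    using ex_is_arg_min_if_finite[OF S, of "ds \<omega> w"] by (auto simp: is_arg_min_linorder)
  have "suc \<omega> w v" unfolding suc_def
    using v assms unfolding notie_def by (auto simp: less_le)
  thus ?thesis ..
qed

lemma suc_ht_le:
  fixes \<omega> :: "'n env"
  assumes "suc \<omega> w v" shows "ht \<omega> v \<le> ht \<omega> w + 6"
  using suc_ds_le[OF assms] ds_ge_ht[of \<omega> v w] by linarith

end

section \<open>The product law of the environments\<close>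

definition mu0 :: "(real ^ 'n::finite) measure" where
  "mu0 = uniform_measure lborel ubox"

definition PS :: "('i \<Rightarrow> real ^ 'n::finite) measure" where
  "PS = (\<Pi>\<^sub>M i\<in>UNIV. mu0)"

lemma ubox_sets [measurable, simp]: "ubox \<in> sets borel" by (simp add: ubox_def)

lemma sets_mu0 [measurable_cong, simp]: "sets mu0 = sets borel" by (simp add: mu0_def)

lemma space_mu0 [simp]: "space mu0 = UNIV" by (simp add: mu0_def)

lemma emeasure_ubox: "emeasure lborel (ubox :: (real^'n::finite) set) = ennreal (2 ^ CARD('n))"
proof -
  have "cbox (\<chi> i. -1) (\<chi> i. 1) \<noteq> ({} :: (real^'n) set)"
    by (simp add: interval_ne_empty_cart)
  hence "measure lborel (cbox (\<chi> i. -1) (\<chi> i. 1) :: (real^'n) set) = 2 ^ CARD('n)"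
    by (subst content_cbox_cart) auto
  thus ?thesis unfolding ubox_def
    by (subst emeasure_eq_ennreal_measure) (auto simp: emeasure_lborel_cbox_eq)
qed

lemma prob_space_mu0: "prob_space (mu0 :: (real^'n::finite) measure)"
  unfolding mu0_def by (rule prob_space_uniform_measure) (auto simp: emeasure_ubox)

interpretation mu0: prob_space "mu0 :: (real^'n::finite) measure" by (rule prob_space_mu0)

interpretation PP: product_prob_space "\<lambda>i::'i. mu0 :: (real^'n::finite) measure" UNIV
  by unfold_locales

lemma prob_space_PS: "prob_space (PS :: ('i \<Rightarrow> real^'n::finite) measure)"
  unfolding PS_def by unfold_locales

interpretation PS: prob_space "PS :: ('i \<Rightarrow> real^'n::finite) measure" by (rule prob_space_PS)

lemma space_PS [simp]: "space PS = UNIV" by (simp add: PS_def space_PiM PiE_UNIV_domain)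

lemma measurable_PS_comp [measurable]: "(\<lambda>\<omega>. \<omega> i) \<in> PS \<rightarrow>\<^sub>M borel"
proof -
  have "(\<lambda>\<omega>. \<omega> i) \<in> PS \<rightarrow>\<^sub>M mu0" unfolding PS_def by (rule measurable_component_singleton) simp
  thus ?thesis by (simp cong: measurable_cong_sets)
qed

lemma measurable_PS_I:
  assumes "\<And>i. (\<lambda>x. f x i) \<in> M \<rightarrow>\<^sub>M borel" shows "f \<in> M \<rightarrow>\<^sub>M PS"
proof -
  have "(\<lambda>x. \<lambda>i\<in>UNIV. f x i) \<in> M \<rightarrow>\<^sub>M PS" unfolding PS_def
    by (rule measurable_restrict) (use assms in \<open>simp cong: measurable_cong_sets\<close>)
  thus ?thesis by (simp add: restrict_UNIV)
qed

lemma sets_PS_I: "Measurable.pred PS P \<Longrightarrow> {\<omega>. P \<omega>} \<in> sets PS"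
  by (simp add: pred_def)

lemma pred_PS_cyl:
  assumes "finite J" "\<And>i. i \<in> J \<Longrightarrow> X i \<in> sets borel"
  shows "Measurable.pred PS (\<lambda>\<omega>. \<forall>i\<in>J. \<omega> i \<in> X i)"
proof (rule pred_intros_finite(3)[OF assms(1)])
  fix i assume "i \<in> J"
  from measurable_sets[OF measurable_PS_comp assms(2)[OF this], of i]
  show "Measurable.pred PS (\<lambda>\<omega>. \<omega> i \<in> X i)" by (simp add: pred_def vimage_def)
qed

lemma emeasure_PS_cyl:
  assumes "finite J" "\<And>i. i \<in> J \<Longrightarrow> X i \<in> sets borel"
  shows "emeasure PS {\<omega>. \<forall>i\<in>J. \<omega> i \<in> X i} = (\<Prod>i\<in>J. emeasure mu0 (X i))"
  using PP.emeasure_PiM_Collect[of J X] assms by (simp add: PS_def[symmetric])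

lemma measure_PS_cyl:
  assumes "finite J" "\<And>i. i \<in> J \<Longrightarrow> X i \<in> sets borel"
  shows "measure PS {\<omega>. \<forall>i\<in>J. \<omega> i \<in> X i} = (\<Prod>i\<in>J. measure mu0 (X i))"
  using emeasure_PS_cyl[OF assms]
  by (simp add: mu0.emeasure_eq_measure PS.emeasure_eq_measure prod_ennreal prod_nonneg)

lemma PS_eqI:
  fixes M :: "('i \<Rightarrow> real^'n::finite) measure"
  assumes "sets M = sets PS"
    and "\<And>J X. finite J \<Longrightarrow> (\<And>i. i \<in> J \<Longrightarrow> X i \<in> sets borel) \<Longrightarrow>
      emeasure M {\<omega>. \<forall>i\<in>J. \<omega> i \<in> X i} = (\<Prod>i\<in>J. emeasure mu0 (X i))"
  shows "M = PS"
  unfolding PS_def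
proof (rule PP.PiM_eq)
  show "sets M = sets (Pi\<^sub>M UNIV (\<lambda>i. mu0))" using assms(1) by (simp add: PS_def)
  fix J :: "'i set" and F assume "finite J" "\<And>j. j \<in> J \<Longrightarrow> F j \<in> sets (mu0 :: (real^'n) measure)"
  moreover have "prod_emb UNIV (\<lambda>i. mu0) J (Pi\<^sub>E J F) = {\<omega>. \<forall>i\<in>J. \<omega> i \<in> F i}"
    by (auto simp: prod_emb_def space_PiM PiE_iff)
  ultimately show "emeasure M (prod_emb UNIV (\<lambda>i. mu0) J (Pi\<^sub>E J F)) = (\<Prod>j\<in>J. emeasure mu0 (F j))"
    using assms(2)[of J F] by simp
qed

text \<open>An injective \<open>g\<close> only selects coordinates and discards the rest. The lemma
  serves the lattice symmetries, the passage to one of two copies of the environment, and the shift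
  of one copy against the other.\<close>

lemma distr_PS_sym:
  fixes g :: "'i \<Rightarrow> 'j" and T :: "'i \<Rightarrow> real^'n::finite \<Rightarrow> real^'n"
  assumes "inj g" and T: "\<And>i. T i \<in> borel \<rightarrow>\<^sub>M borel" "\<And>i. distr mu0 borel (T i) = mu0"
  shows "distr PS PS (\<lambda>\<omega> i. T i (\<omega> (g i))) = PS"
proof (rule PS_eqI)
  fix J and X :: "'i \<Rightarrow> (real^'n) set"
  assume J: "finite J" and X: "\<And>i. i \<in> J \<Longrightarrow> X i \<in> sets borel"
  note T(1)[measurable]
  have [measurable]: "(\<lambda>\<omega> i. T i (\<omega> (g i))) \<in> PS \<rightarrow>\<^sub>M PS"
    by (intro measurable_PS_I) measurable
  have S: "{\<omega>. \<forall>i\<in>J. \<omega> i \<in> X i} \<in> sets PS"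
    using J X by (intro sets_PS_I pred_PS_cyl)
  have Ti: "T (inv g i) -` X (inv g i) \<in> sets borel" if "i \<in> g ` J" for i
    using measurable_sets_borel[OF T(1)[of "inv g i"]] X that assms(1) by auto
  have "emeasure (distr PS PS (\<lambda>\<omega> i. T i (\<omega> (g i)))) {\<omega>. \<forall>i\<in>J. \<omega> i \<in> X i}
      = emeasure PS {\<omega>. \<forall>i\<in>J. T i (\<omega> (g i)) \<in> X i}"
    using S by (subst emeasure_distr) (auto simp: vimage_def)
  also have "{\<omega>. \<forall>i\<in>J. T i (\<omega> (g i)) \<in> X i} = {\<omega>. \<forall>i\<in>g ` J. \<omega> i \<in> T (inv g i) -` X (inv g i)}"
    using assms(1) by auto
  also have "emeasure PS \<dots> = (\<Prod>i\<in>g ` J. emeasure mu0 (T (inv g i) -` X (inv g i)))"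
    using J Ti by (intro emeasure_PS_cyl) auto
  also have "\<dots> = (\<Prod>i\<in>J. emeasure mu0 (T i -` X i))"
    using assms(1) by (subst prod.reindex) (auto simp: inj_def inj_on_def)
  also have "\<dots> = (\<Prod>i\<in>J. emeasure mu0 (X i))"
  proof (rule prod.cong)
    fix i assume "i \<in> J"
    have "emeasure mu0 (X i) = emeasure (distr mu0 borel (T i)) (X i)" by (simp add: T(2))
    also have "\<dots> = emeasure mu0 (T i -` X i)"
      using T(1)[of i] X[OF \<open>i \<in> J\<close>] by (subst emeasure_distr) (auto cong: measurable_cong_sets)
    finally show "emeasure mu0 (T i -` X i) = emeasure mu0 (X i)" ..
  qed simp
  finally show "emeasure (distr PS PS (\<lambda>\<omega> i. T i (\<omega> (g i)))) {\<omega>. \<forall>i\<in>J. \<omega> i \<in> X i}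
      = (\<Prod>i\<in>J. emeasure mu0 (X i))" .
qed simp

lemma distr_PS_reindex:
  fixes g :: "'i \<Rightarrow> 'j"
  assumes "inj g"
  shows "distr PS PS (\<lambda>\<omega> i. \<omega> (g i)) = (PS :: ('i \<Rightarrow> real^'n::finite) measure)"
proof -
  have "distr mu0 borel (\<lambda>x. x) = (mu0 :: (real^'n) measure)"
    by (rule distr_id2) simp
  from distr_PS_sym[OF assms, of "\<lambda>_ x. x", OF _ this] show ?thesis by simp
qed

lemma distr_PS_upd:
  "distr (mu0 \<Otimes>\<^sub>M PS) PS (\<lambda>(x, \<omega>). fun_upd \<omega> i x) = (PS :: ('i \<Rightarrow> real^'n::finite) measure)"
  using distr_pair_PiM_eq_PiM[of UNIV "\<lambda>_::'i. mu0 :: (real^'n) measure" i] prob_space_mu0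
  by (simp add: PS_def)

lemma measurable_PS_upd [measurable]:
  "(\<lambda>(x, \<omega>). fun_upd \<omega> i x) \<in> borel \<Otimes>\<^sub>M PS \<rightarrow>\<^sub>M (PS :: ('i \<Rightarrow> real^'n::finite) measure)"
proof (rule measurable_PS_I)
  fix j
  show "(\<lambda>x. (case x of (x, \<omega>) \<Rightarrow> fun_upd \<omega> i x) j) \<in> borel \<Otimes>\<^sub>M PS \<rightarrow>\<^sub>M borel"
    by (cases "i = j") (simp_all add: split_beta)
qed

text \<open>One site is integrated out while all others are held fixed. The Peierls estimate and the
  absence of ties are both conditional computations of this kind.\<close>

lemma nn_resample:
  fixes f :: "('i \<Rightarrow> real^'n::finite) \<Rightarrow> ennreal"
  assumes [measurable]: "f \<in> borel_measurable PS"
  shows "(\<integral>\<^sup>+\<omega>. f \<omega> \<partial>PS) = (\<integral>\<^sup>+\<omega>. (\<integral>\<^sup>+x. f (fun_upd \<omega> i x) \<partial>mu0) \<partial>PS)"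
proof -
  interpret pair_sigma_finite "mu0 :: (real^'n) measure" "PS :: ('i \<Rightarrow> real^'n) measure" ..
  have "(\<integral>\<^sup>+\<omega>. f \<omega> \<partial>PS) = (\<integral>\<^sup>+\<omega>. f \<omega> \<partial>distr (mu0 \<Otimes>\<^sub>M PS) PS (\<lambda>(x, \<omega>). fun_upd \<omega> i x))"
    by (simp add: distr_PS_upd)
  also have "\<dots> = (\<integral>\<^sup>+p. f (case p of (x, \<omega>) \<Rightarrow> fun_upd \<omega> i x) \<partial>(mu0 \<Otimes>\<^sub>M PS))"
    by (rule nn_integral_distr) measurable
  also have "\<dots> = (\<integral>\<^sup>+\<omega>. (\<integral>\<^sup>+x. f (fun_upd \<omega> i x) \<partial>mu0) \<partial>PS)"
    using nn_integral_snd[of "\<lambda>p. f (case p of (x, \<omega>) \<Rightarrow> fun_upd \<omega> i x)"] by simp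
  finally show ?thesis .
qed

subsection \<open>Events depending on a set of sites\<close>

text \<open>A purely set-theoretic form of being determined by the sites in \<open>A\<close>.
  Measurability is supplied separately where independence is derived, which keeps the locality
  arguments free of sigma-algebras.\<close>

definition dep :: "'i set \<Rightarrow> (('i \<Rightarrow> 'b) \<Rightarrow> bool) \<Rightarrow> bool" where
  "dep A P \<longleftrightarrow> (\<forall>\<omega> \<omega>'. (\<forall>i\<in>A. \<omega> i = \<omega>' i) \<longrightarrow> P \<omega> = P \<omega>')"

lemma depI: "(\<And>\<omega> \<omega>'. (\<And>i. i \<in> A \<Longrightarrow> \<omega> i = \<omega>' i) \<Longrightarrow> P \<omega> \<Longrightarrow> P \<omega>') \<Longrightarrow> dep A P"
  unfolding dep_def by (metis (no_types))

lemma depD: "dep A P \<Longrightarrow> (\<And>i. i \<in> A \<Longrightarrow> \<omega> i = \<omega>' i) \<Longrightarrow> P \<omega> = P \<omega>'"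
  unfolding dep_def by blast

lemma dep_mono: "dep A P \<Longrightarrow> A \<subseteq> B \<Longrightarrow> dep B P"
  unfolding dep_def by blast

lemma dep_conj: "dep A P \<Longrightarrow> dep A Q \<Longrightarrow> dep A (\<lambda>\<omega>. P \<omega> \<and> Q \<omega>)"
  unfolding dep_def by metis

lemma dep_not: "dep A P \<Longrightarrow> dep A (\<lambda>\<omega>. \<not> P \<omega>)"
  unfolding dep_def by metis

lemma dep_ex: "(\<And>x. dep A (P x)) \<Longrightarrow> dep A (\<lambda>\<omega>. \<exists>x. P x \<omega>)"
  unfolding dep_def by metis

lemma dep_ball: "(\<And>x. x \<in> X \<Longrightarrow> dep A (P x)) \<Longrightarrow> dep A (\<lambda>\<omega>. \<forall>x\<in>X. P x \<omega>)"
  unfolding dep_def by metis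

lemma dep_const: "dep A (\<lambda>_. c)" by (simp add: dep_def)

lemma distr_PS_glue:
  fixes A :: "'i set"
  shows "distr (PS \<Otimes>\<^sub>M PS) PS (\<lambda>(\<omega>, \<omega>') i. if i \<in> A then \<omega> i else \<omega>' i) = (PS :: ('i \<Rightarrow> real^'n::finite) measure)"
proof (rule PS_eqI)
  fix J and X :: "'i \<Rightarrow> (real^'n) set"
  assume J: "finite J" and X: "\<And>i. i \<in> J \<Longrightarrow> X i \<in> sets borel"
  let ?g = "\<lambda>(\<omega>::'i \<Rightarrow> real^'n, \<omega>') i. if i \<in> A then \<omega> i else \<omega>' i"
  have m: "?g \<in> PS \<Otimes>\<^sub>M PS \<rightarrow>\<^sub>M PS"
  proof (rule measurable_PS_I)
    fix i show "(\<lambda>x. ?g x i) \<in> PS \<Otimes>\<^sub>M PS \<rightarrow>\<^sub>M borel"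
      by (cases "i \<in> A") (simp_all add: split_beta)
  qed
  have cyl: "{\<omega>. \<forall>i\<in>J'. \<omega> i \<in> X i} \<in> sets PS" if "J' \<subseteq> J" for J'
  proof -
    have "finite J'" "\<And>i. i \<in> J' \<Longrightarrow> X i \<in> sets borel" using that J X by (auto intro: finite_subset)
    thus ?thesis by (intro sets_PS_I pred_PS_cyl)
  qed
  have "emeasure (distr (PS \<Otimes>\<^sub>M PS) PS ?g) {\<omega>. \<forall>i\<in>J. \<omega> i \<in> X i}
     = emeasure (PS \<Otimes>\<^sub>M PS) (?g -` {\<omega>. \<forall>i\<in>J. \<omega> i \<in> X i} \<inter> space (PS \<Otimes>\<^sub>M PS))"
    using m cyl by (intro emeasure_distr) auto
  also have "?g -` {\<omega>. \<forall>i\<in>J. \<omega> i \<in> X i} \<inter> space (PS \<Otimes>\<^sub>M PS)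
      = {\<omega>. \<forall>i\<in>J\<inter>A. \<omega> i \<in> X i} \<times> {\<omega>. \<forall>i\<in>J-A. \<omega> i \<in> X i}"
    by (auto simp: space_pair_measure)
  also have "emeasure (PS \<Otimes>\<^sub>M PS) \<dots> = (\<Prod>i\<in>J\<inter>A. emeasure mu0 (X i)) * (\<Prod>i\<in>J-A. emeasure mu0 (X i))"
    using J X cyl emeasure_PS_cyl[of "J \<inter> A" X] emeasure_PS_cyl[of "J - A" X]
    by (subst PS.emeasure_pair_measure_Times) auto
  also have "\<dots> = (\<Prod>i\<in>(J\<inter>A)\<union>(J-A). emeasure mu0 (X i))"
    using J by (subst prod.union_disjoint) auto
  also have "(J\<inter>A)\<union>(J-A) = J" by auto
  finally show "emeasure (distr (PS \<Otimes>\<^sub>M PS) PS ?g) {\<omega>. \<forall>i\<in>J. \<omega> i \<in> X i} = (\<Prod>i\<in>J. emeasure mu0 (X i))" .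
qed simp

text \<open>Taking the sites of \<open>A\<close> from one sample and all others from an independent
  sample does not change the law, and it decouples the two events. The argument covers infinite sets
  such as all rows below a given one.\<close>

lemma dep_indep:
  fixes P Q :: "('i \<Rightarrow> real^'n::finite) \<Rightarrow> bool"
  assumes [measurable]: "Measurable.pred PS P" "Measurable.pred PS Q"
    and dP: "dep A P" and dQ: "dep B Q" and AB: "A \<inter> B = {}"
  shows "measure PS {\<omega>. P \<omega> \<and> Q \<omega>} = measure PS {\<omega>. P \<omega>} * measure PS {\<omega>. Q \<omega>}"
proof -
  let ?g = "\<lambda>(\<omega>::'i \<Rightarrow> real^'n, \<omega>') i. if i \<in> A then \<omega> i else \<omega>' i"
  have m [measurable]: "?g \<in> PS \<Otimes>\<^sub>M PS \<rightarrow>\<^sub>M PS"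
  proof (rule measurable_PS_I)
    fix i show "(\<lambda>x. ?g x i) \<in> PS \<Otimes>\<^sub>M PS \<rightarrow>\<^sub>M borel"
      by (cases "i \<in> A") (simp_all add: split_beta)
  qed
  have S: "{\<omega>. P \<omega> \<and> Q \<omega>} \<in> sets PS" "{\<omega>. P \<omega>} \<in> sets PS" "{\<omega>. Q \<omega>} \<in> sets PS"
    by (rule sets_PS_I, measurable)+
  have "emeasure PS {\<omega>. P \<omega> \<and> Q \<omega>} = emeasure (distr (PS \<Otimes>\<^sub>M PS) PS ?g) {\<omega>. P \<omega> \<and> Q \<omega>}"
    by (simp add: distr_PS_glue)
  also have "\<dots> = emeasure (PS \<Otimes>\<^sub>M PS) (?g -` {\<omega>. P \<omega> \<and> Q \<omega>} \<inter> space (PS \<Otimes>\<^sub>M PS))"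
    using S m by (intro emeasure_distr) auto
  also have "?g -` {\<omega>. P \<omega> \<and> Q \<omega>} \<inter> space (PS \<Otimes>\<^sub>M PS) = {\<omega>. P \<omega>} \<times> {\<omega>. Q \<omega>}"
  proof -
    have "P (?g (\<omega>, \<omega>')) = P \<omega>" "Q (?g (\<omega>, \<omega>')) = Q \<omega>'" for \<omega> \<omega>'
      using AB by (auto intro!: depD[OF dP] depD[OF dQ])
    thus ?thesis by (auto simp: space_pair_measure)
  qed
  also have "emeasure (PS \<Otimes>\<^sub>M PS) \<dots> = emeasure PS {\<omega>. P \<omega>} * emeasure PS {\<omega>. Q \<omega>}"
    using S by (intro PS.emeasure_pair_measure_Times) auto
  finally show ?thesis
    by (simp add: PS.emeasure_eq_measure ennreal_mult[symmetric])
qed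

text \<open>The embedding of site \<open>i\<close> as \<open>(i, i \<notin> A)\<close> reads copy
  \<open>False\<close> on \<open>A\<close> and copy \<open>True\<close> elsewhere, in particular on
  \<open>B\<close>. Two paths that explore disjoint regions of one environment thus become paths in
  independent environments.\<close>

lemma glue_same:
  fixes \<Phi> :: "('i \<Rightarrow> real^'n::finite) \<Rightarrow> ('i \<Rightarrow> real^'n) \<Rightarrow> bool"
  assumes m [measurable]: "Measurable.pred PS (\<lambda>\<omega>. \<Phi> \<omega> \<omega>)"
    and d1: "\<And>\<omega>'. dep A (\<lambda>\<omega>. \<Phi> \<omega> \<omega>')" and d2: "\<And>\<omega>. dep B (\<lambda>\<omega>'. \<Phi> \<omega> \<omega>')" and AB: "A \<inter> B = {}"
  shows "measure PS {\<omega>. \<Phi> \<omega> \<omega>} = measure PS {\<omega>. \<Phi> (\<lambda>w. \<omega> (w, False)) (\<lambda>w. \<omega> (w, True))}"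
proof -
  let ?g = "\<lambda>i. (i, i \<notin> A)"
  have "inj ?g" by (auto simp: inj_def)
  have meas: "(\<lambda>\<omega> i. \<omega> (?g i)) \<in> PS \<rightarrow>\<^sub>M PS" by (rule measurable_PS_I) measurable
  have "measure PS {\<omega>. \<Phi> \<omega> \<omega>} = measure (distr PS PS (\<lambda>\<omega> i. \<omega> (?g i))) {\<omega>. \<Phi> \<omega> \<omega>}"
    by (subst distr_PS_reindex[OF \<open>inj ?g\<close>]) simp
  also have "\<dots> = measure PS ((\<lambda>\<omega> i. \<omega> (?g i)) -` {\<omega>. \<Phi> \<omega> \<omega>} \<inter> space PS)"
    using m meas by (intro measure_distr) (auto simp: pred_def)
  also have "(\<lambda>\<omega> i. \<omega> (?g i)) -` {\<omega>. \<Phi> \<omega> \<omega>} \<inter> space PS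
     = {\<omega>. \<Phi> (\<lambda>w. \<omega> (w, False)) (\<lambda>w. \<omega> (w, True))}"
  proof -
    have "\<Phi> (\<lambda>i. \<omega> (?g i)) (\<lambda>i. \<omega> (?g i)) = \<Phi> (\<lambda>w. \<omega> (w, False)) (\<lambda>w. \<omega> (w, True))" for \<omega>
    proof -
      have "\<Phi> (\<lambda>i. \<omega> (?g i)) (\<lambda>i. \<omega> (?g i)) = \<Phi> (\<lambda>w. \<omega> (w, False)) (\<lambda>i. \<omega> (?g i))"
        by (rule depD[OF d1]) auto
      also have "\<dots> = \<Phi> (\<lambda>w. \<omega> (w, False)) (\<lambda>w. \<omega> (w, True))"
      proof (rule depD[OF d2])
        fix i assume "i \<in> B"
        hence "i \<notin> A" using AB by blast
        thus "\<omega> (?g i) = \<omega> (i, True)" by simp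
      qed
      finally show ?thesis .
    qed
    thus ?thesis by auto
  qed
  finally show ?thesis .
qed

subsection \<open>The uniform law on the cube\<close>

text \<open>The density of the cube is a product over the axes. Every axis but the vertical one
  contributes the length 2, and these factors cancel against the volume.\<close>

lemma nn_mu0_dd:
  fixes g :: "real \<Rightarrow> ennreal"
  assumes [measurable]: "g \<in> borel_measurable borel"
  shows "(\<integral>\<^sup>+x. g (x $ dd) \<partial>(mu0 :: ((real,'n::{finite,linorder}) vec) measure))
     = (\<integral>\<^sup>+t. g t * indicator {-1..1} t \<partial>lborel) / 2"
proof -
  let ?e = "axis dd 1 :: (real, 'n) vec"
  define f where "f = (\<lambda>(b::(real,'n) vec) t. (if b = ?e then g t * indicator {-1..1::real} t else indicator {-1..1} t))"
  have [measurable]: "(f b) \<in> borel_measurable borel" for b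
    unfolding f_def by (cases "b = ?e") simp_all
  have Basis_eq: "Basis = range (\<lambda>i::'n. axis i (1::real))" by (auto simp: Basis_vec_def)
  have ax_inj: "inj (\<lambda>i::'n. axis i (1::real))" by (auto simp: inj_def axis_eq_axis)
  have dd_meas: "(\<lambda>x::(real,'n) vec. x $ dd) \<in> borel_measurable borel" by measurable
  have prodf: "(\<Prod>b\<in>Basis. f b (x \<bullet> b)) = g (x $ dd) * indicator ubox x" for x :: "(real,'n) vec"
  proof -
    have "(\<Prod>b\<in>Basis. f b (x \<bullet> b)) = (\<Prod>i\<in>UNIV. f (axis i 1) (x $ i))"
      unfolding Basis_eq by (subst prod.reindex[OF ax_inj]) (simp add: inner_axis)
    also have "\<dots> = f ?e (x $ dd) * (\<Prod>i\<in>UNIV-{dd}. f (axis i 1) (x $ i))"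
      by (rule prod.remove) auto
    also have "(\<Prod>i\<in>UNIV-{dd}. f (axis i 1) (x $ i)) = (\<Prod>i\<in>UNIV-{dd}. indicator {-1..1} (x $ i))"
      by (rule prod.cong) (auto simp: f_def axis_eq_axis)
    also have "f ?e (x $ dd) = g (x $ dd) * indicator {-1..1} (x $ dd)" by (simp add: f_def)
    also have "g (x $ dd) * indicator {-1..1} (x $ dd) * (\<Prod>i\<in>UNIV-{dd}. indicator {-1..1} (x $ i))
       = g (x $ dd) * (\<Prod>i\<in>UNIV. indicator {-1..1} (x $ i))"
      using prod.remove[of UNIV dd "\<lambda>i. indicator {-1..1} (x $ i) :: ennreal"] by (simp add: mult.assoc)
    also have "(\<Prod>i\<in>UNIV. indicator {-1..1} (x $ i)) = (indicator ubox x :: ennreal)"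
      by (auto simp: indicator_def ubox_def mem_box_cart prod_eq_1_iff intro!: prod.neutral)
    finally show ?thesis .
  qed
  have "(\<integral>\<^sup>+x. g (x $ dd) * indicator ubox x \<partial>(lborel :: ((real,'n) vec) measure)) = (\<Prod>b\<in>Basis. (\<integral>\<^sup>+t. f b t \<partial>lborel))"
    by (subst nn_integral_lborel_prod[symmetric]) (auto simp: prodf)
  also have "\<dots> = (\<Prod>i\<in>UNIV. (\<integral>\<^sup>+t. f (axis i 1) t \<partial>lborel))"
    unfolding Basis_eq by (subst prod.reindex[OF ax_inj]) simp
  also have "\<dots> = (\<integral>\<^sup>+t. f ?e t \<partial>lborel) * (\<Prod>i\<in>UNIV-{dd}. (\<integral>\<^sup>+t. f (axis i 1) t \<partial>lborel))"
    by (rule prod.remove) auto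
  also have "(\<Prod>i\<in>UNIV-{dd}. (\<integral>\<^sup>+t. f (axis i 1) t \<partial>lborel)) = (\<Prod>i\<in>UNIV-{dd::'n}. 2)"
    by (rule prod.cong) (auto simp: f_def axis_eq_axis)
  also have "\<dots> = 2 ^ (CARD('n) - 1)" by (simp add: card_Diff_singleton)
  also have "(\<integral>\<^sup>+t. f ?e t \<partial>lborel) = (\<integral>\<^sup>+t. g t * indicator {-1..1} t \<partial>lborel)" by (simp add: f_def)
  finally have *: "(\<integral>\<^sup>+x. g (x $ dd) * indicator ubox x \<partial>(lborel :: ((real,'n) vec) measure))
     = (\<integral>\<^sup>+t. g t * indicator {-1..1} t \<partial>lborel) * 2 ^ (CARD('n) - 1)" .
  have "(\<integral>\<^sup>+x. g (x $ dd) \<partial>(mu0 :: ((real,'n) vec) measure))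
      = (\<integral>\<^sup>+x. g (x $ dd) * indicator ubox x \<partial>(lborel :: ((real,'n) vec) measure)) / emeasure lborel (ubox :: ((real,'n) vec) set)"
    unfolding mu0_def by (rule nn_integral_uniform_measure) auto
  also have "\<dots> = (\<integral>\<^sup>+t. g t * indicator {-1..1} t \<partial>lborel) * 2 ^ (CARD('n) - 1) / ennreal (2 ^ CARD('n))"
    unfolding * emeasure_ubox ..
  also have "ennreal (2 ^ CARD('n)) = 2 * 2 ^ (CARD('n) - 1)"
    by (simp add: ennreal_power[symmetric] power_Suc[symmetric] del: power_Suc)
  also have "(\<integral>\<^sup>+t. g t * indicator {-1..1} t \<partial>lborel) * 2 ^ (CARD('n) - 1) / (2 * 2 ^ (CARD('n) - 1))
      = (\<integral>\<^sup>+t. g t * indicator {-1..1} t \<partial>lborel) / 2"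
  proof -
    have two: "a = a / 2 * 2" for a :: ennreal
      by (simp add: ennreal_divide_times)
    have "a * c = (a / 2) * (2 * c)" for a c :: ennreal
      by (subst two[of a]) (simp add: mult.assoc)
    moreover have "(2 * 2 ^ k :: ennreal) \<noteq> 0" "(2 * 2 ^ k :: ennreal) \<noteq> top" for k
      by (auto simp: ennreal_mult_eq_top_iff power_eq_top_ennreal)
    ultimately show ?thesis by (metis mult_divide_eq_ennreal)
  qed
  finally show ?thesis .
qed

lemma AE_mu0: "AE x in mu0. x \<in> ubox"
  unfolding mu0_def by (rule AE_uniform_measureI) auto

lemma clip_measurable [measurable]: "clip \<in> borel \<rightarrow>\<^sub>M (borel :: (real^'n::finite) measure)"
  unfolding clip_def[abs_def] by measurable

lemma nn_exp_half:
  fixes b l :: real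
  assumes "l > 0"
  shows "(\<integral>\<^sup>+t. ennreal (exp (- l * (t - b))) * indicator {b..} t \<partial>lborel) = ennreal (1 / l)"
proof -
  have "((\<lambda>t. - exp (- l * (t - b)) / l) \<longlongrightarrow> 0) at_top"
    using assms by real_asymp
  hence "(\<integral>\<^sup>+t. ennreal (exp (- l * (t - b))) * indicator {b..} t \<partial>lborel) = ennreal (0 - (- exp (- l * (b - b)) / l))"
    using assms by (intro nn_integral_FTC_atLeast) (auto intro!: derivative_eq_intros simp: field_simps)
  thus ?thesis by simp
qed

text \<open>The height of a fresh point has density at most 1/2, and the exponential beyond the
  threshold integrates to \<open>1 / l\<close>. This is the factor that each step of an increasing
  chain contributes to the Peierls count.\<close>

lemma mu0_exp:
  fixes a c l :: real
  assumes l: "l > 0"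
  shows "(\<integral>\<^sup>+x. ennreal (exp (- l * (c + clip x $ dd - a))) * indicator {x. a < c + clip x $ dd} x
      \<partial>(mu0 :: (real^'n::{finite,linorder}) measure)) \<le> ennreal (1 / (2 * l))"
proof -
  define g where "g = (\<lambda>t::real. ennreal (exp (- l * (t - (a - c)))) * indicator {a - c..} t)"
  have [measurable]: "g \<in> borel_measurable borel" unfolding g_def by measurable
  have "(\<integral>\<^sup>+x. ennreal (exp (- l * (c + clip x $ dd - a))) * indicator {x. a < c + clip x $ dd} x
      \<partial>(mu0 :: (real,'n) vec measure)) \<le> (\<integral>\<^sup>+x. g (x $ dd) \<partial>(mu0 :: (real,'n) vec measure))"
    using AE_mu0
    by (intro nn_integral_mono_AE, eventually_elim)
       (auto simp: g_def clip_def indicator_def algebra_simps)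
  also have "\<dots> = (\<integral>\<^sup>+t. g t * indicator {-1..1} t \<partial>lborel) / 2"
    by (rule nn_mu0_dd) measurable
  also have "\<dots> \<le> (\<integral>\<^sup>+t. g t \<partial>lborel) / 2"
    by (intro divide_right_mono_ennreal nn_integral_mono) (auto simp: indicator_def)
  also have "(\<integral>\<^sup>+t. g t \<partial>lborel) = ennreal (1 / l)"
    unfolding g_def by (rule nn_exp_half[OF l])
  also have "ennreal (1 / l) / 2 = ennreal (1 / (2 * l))"
    using divide_ennreal[of "1 / l" 2] l by (simp add: mult.commute)
  finally show ?thesis .
qed

lemma emeasure_mu0_null:
  assumes "S \<in> null_sets (lborel :: (real^'n::finite) measure)"
  shows "emeasure mu0 S = 0"
proof -
  have "emeasure mu0 S = emeasure lborel (ubox \<inter> S) / emeasure lborel (ubox :: (real^'n) set)"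
    unfolding mu0_def using assms by (intro emeasure_uniform_measure) auto
  also have "emeasure lborel (ubox \<inter> S) = 0"
    using null_set_Int1[OF assms, of ubox] by (simp add: null_sets_def Int_commute)
  finally show ?thesis by simp
qed

lemma mu0_pos:
  assumes "open O'" "O' \<noteq> {}" "O' \<subseteq> ubox" "O' \<subseteq> S" "S \<in> sets borel"
  shows "0 < measure (mu0 :: (real^'n::finite) measure) S"
proof -
  have "emeasure lborel O' \<noteq> 0"
  proof
    assume "emeasure lborel O' = 0"
    hence "O' \<in> null_sets lborel" using assms(1) by (auto simp: null_sets_def)
    hence "negligible O'" by (simp add: negligible_iff_null_sets null_sets_completionI)
    thus False using open_not_negligible assms(1,2) by blast
  qed
  hence "emeasure lborel (ubox \<inter> S) \<noteq> 0"
    using assms emeasure_mono[of O' "ubox \<inter> S" lborel] by auto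
  moreover have "emeasure mu0 S = emeasure lborel (ubox \<inter> S) / emeasure lborel (ubox :: (real^'n) set)"
    unfolding mu0_def using assms by (intro emeasure_uniform_measure) auto
  ultimately have "emeasure mu0 S \<noteq> 0"
    by (simp add: emeasure_ubox ennreal_divide_eq_0_iff)
  thus ?thesis by (simp add: mu0.emeasure_eq_measure zero_less_measure_iff)
qed

lemma l1_norm_triangle: "l1_norm (x + y) \<le> l1_norm x + l1_norm y"
  unfolding l1_norm_def sum.distrib[symmetric] by (rule sum_mono) auto

lemma l1_norm_scale: "l1_norm (c *\<^sub>R x) = \<bar>c\<bar> * l1_norm x"
  unfolding l1_norm_def by (simp add: abs_mult sum_distrib_left)

lemma l1_norm_measurable [measurable]: "(l1_norm :: real^'n::finite \<Rightarrow> real) \<in> borel_measurable borel"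
  unfolding l1_norm_def[abs_def] by measurable

text \<open>Apart from the centre, which belongs to the sphere only for radius 0, scaling away from
  the centre leaves the ball. So the sphere lies in the frontier of a convex set together with one
  point, and such frontiers are negligible.\<close>

lemma l1_sphere_null: "{x :: real^'n::finite. l1_norm (x + a) = r} \<in> null_sets lborel"
proof -
  let ?S = "{x :: real^'n. l1_norm (x + a) = r}" and ?C = "{x :: real^'n. l1_norm (x + a) \<le> r}"
  have cv: "convex ?C"
  proof (rule convexI)
    fix x y :: "real^'n" and u v :: real
    assume xy: "x \<in> ?C" "y \<in> ?C" and uv: "0 \<le> u" "0 \<le> v" "u + v = 1"
    have "u *\<^sub>R x + v *\<^sub>R y + a = u *\<^sub>R (x + a) + v *\<^sub>R (y + a)"
      using uv(3) by (simp add: algebra_simps) (metis scaleR_add_left scaleR_one add.assoc)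
    hence "l1_norm (u *\<^sub>R x + v *\<^sub>R y + a) \<le> u * l1_norm (x + a) + v * l1_norm (y + a)"
      using l1_norm_triangle[of "u *\<^sub>R (x + a)" "v *\<^sub>R (y + a)"] uv by (simp add: l1_norm_scale)
    also have "\<dots> \<le> u * r + v * r" using xy uv by (intro add_mono mult_left_mono) auto
    also have "\<dots> = r" using uv by (metis distrib_right mult_1)
    finally show "u *\<^sub>R x + v *\<^sub>R y \<in> ?C" by simp
  qed
  have "?S \<subseteq> frontier ?C \<union> {-a}"
  proof
    fix x assume x: "x \<in> ?S"
    show "x \<in> frontier ?C \<union> {-a}"
    proof (cases "x = -a")
      case False
      have "x \<notin> interior ?C"
      proof
        assume "x \<in> interior ?C"
        then obtain e where e: "e > 0" "cball x e \<subseteq> ?C" by (auto simp: mem_interior_cball)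
        have nz: "norm (x + a) > 0" using False by (simp add: add_eq_0_iff2)
        define t where "t = e / norm (x + a)"
        have t: "t > 0" using e nz by (simp add: t_def)
        have "x + t *\<^sub>R (x + a) \<in> cball x e" using nz e by (simp add: t_def dist_norm)
        hence "l1_norm (x + t *\<^sub>R (x + a) + a) \<le> r" using e by auto
        moreover have "x + t *\<^sub>R (x + a) + a = (1 + t) *\<^sub>R (x + a)" by (simp add: algebra_simps)
        ultimately have "(1 + t) * r \<le> r" using x t by (simp add: l1_norm_scale)
        hence "r \<le> 0" using t by (simp add: algebra_simps mult_le_0_iff)
        moreover have "0 < l1_norm (x + a)"
        proof -
          obtain i where "(x + a) $ i \<noteq> 0" using nz by (metis norm_zero less_irrefl vec_eq_iff zero_index)
          hence "0 < \<bar>(x + a) $ i\<bar>" by simp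
          also have "\<dots> \<le> l1_norm (x + a)" unfolding l1_norm_def by (rule member_le_sum) auto
          finally show ?thesis .
        qed
        ultimately show False using x by simp
      qed
      moreover have "x \<in> closure ?C" using x closure_subset by fastforce
      ultimately show ?thesis by (simp add: frontier_def)
    qed simp
  qed
  hence "negligible ?S"
    using negligible_convex_frontier[OF cv] negligible_subset negligible_Un negligible_sing by metis
  moreover have "?S \<in> sets borel" by measurable
  ultimately show ?thesis
    by (metis negligible_iff_null_sets null_sets_completion_iff sets_lborel)
qed

subsection \<open>The trap\<close>

lemma up_nth: "i \<noteq> dd \<Longrightarrow> up z $ i = z $ i" by (simp add: up_def)

lemma row_bounds:
  "ht \<omega> w \<le> real_of_int m \<Longrightarrow> w $ dd \<le> m + 1" "real_of_int m < ht \<omega> w \<Longrightarrow> m \<le> w $ dd"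
  using ht_bound[of \<omega> w] by linarith+

text \<open>The staircase of intervals for \<open>k \<le> r\<close> has total height at most
  \<open>(2 * r + 2) / (40 * (r + 1)) = 1/20\<close>, whatever \<open>r\<close> is; enlarging a trap
  therefore does not affect the numerical margins.\<close>

lemma tbox_bounds:
  assumes "x \<in> tbox r k" "0 \<le> k" "k \<le> int r"
  shows "1/20 < x $ dd" "x $ dd < 1/10" "i \<noteq> dd \<Longrightarrow> \<bar>x $ i\<bar> \<le> 1/100" "x \<in> ubox"
proof -
  have k: "0 \<le> real_of_int k" "real_of_int k \<le> real r" using assms by auto
  have "(2 * real_of_int k + 1) / (40 * (real r + 1)) \<le> (2 * real r + 2) / (40 * (real r + 1))"
    using k by (intro divide_right_mono) auto
  also have "\<dots> = 1/20" by (simp add: field_simps)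
  finally have f: "(2 * real_of_int k + 1) / (40 * (real r + 1)) \<le> 1/20" .
  have x: "1/10 - (2 * real_of_int k + 1) / (40 * (real r + 1)) < x $ dd"
    "x $ dd < 1/10 - 2 * real_of_int k / (40 * (real r + 1))"
    using assms(1) unfolding tbox_def mem_Collect_eq by blast+
  show a: "1/20 < x $ dd" using x(1) f by linarith
  have "0 \<le> 2 * real_of_int k / (40 * (real r + 1))" using k by simp
  then show b: "x $ dd < 1/10" using x(2) by linarith
  show c: "\<bar>x $ i\<bar> \<le> 1/100" if "i \<noteq> dd" for i using assms that by (auto simp: tbox_def)
  show "x \<in> ubox" unfolding ubox_iff
  proof
    fix i show "\<bar>x $ i\<bar> \<le> 1" using a b c[of i] by (cases "i = dd") auto
  qed
qed

lemma tbox_mono: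
  assumes "x \<in> tbox r k" "y \<in> tbox r l" "l < k"
  shows "x $ dd < y $ dd"
proof -
  have "2 * real_of_int l + 1 \<le> 2 * real_of_int k" using assms(3) by linarith
  hence "(2 * real_of_int l + 1) / (40 * (real r + 1)) \<le> 2 * real_of_int k / (40 * (real r + 1))"
    by (rule divide_right_mono) simp
  moreover have "x $ dd < 1/10 - 2 * real_of_int k / (40 * (real r + 1))"
    "1/10 - (2 * real_of_int l + 1) / (40 * (real r + 1)) < y $ dd"
    using assms(1,2) unfolding tbox_def mem_Collect_eq by blast+
  ultimately show ?thesis by linarith
qed

lemma Tilt_site:
  assumes "Tilt r \<omega> z" "w $ dd = z $ dd" "h1 w z \<le> int r"
  shows "ht \<omega> w < real_of_int (z $ dd) + 1/10" "real_of_int (z $ dd) + 1/20 < ht \<omega> w"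
    "i \<noteq> dd \<Longrightarrow> \<bar>pos \<omega> w $ i - real_of_int (w $ i)\<bar> \<le> 1/100"
proof -
  have t: "\<omega> w \<in> tbox r (h1 w z)" using assms by (auto simp: Tilt_def)
  note b = tbox_bounds[OF t h1_nonneg assms(3)]
  show "ht \<omega> w < real_of_int (z $ dd) + 1/10" "real_of_int (z $ dd) + 1/20 < ht \<omega> w"
    using b assms(2) by (auto simp: ht_def pos_nth clip_id)
  show "\<bar>pos \<omega> w $ i - real_of_int (w $ i)\<bar> \<le> 1/100" if "i \<noteq> dd"
    using b(3)[OF that] b(4) by (simp add: pos_nth clip_id)
qed

lemma Tilt_mono:
  assumes "Tilt r \<omega> z" "w $ dd = z $ dd" "h1 w z \<le> int r" "u $ dd = z $ dd" "h1 u z \<le> int r" "h1 u z < h1 w z"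
  shows "ht \<omega> w < ht \<omega> u"
proof -
  have t: "\<omega> w \<in> tbox r (h1 w z)" "\<omega> u \<in> tbox r (h1 u z)" using assms by (auto simp: Tilt_def)
  show ?thesis using tbox_mono[OF t assms(6)] tbox_bounds(4)[OF t(1) h1_nonneg assms(3)]
      tbox_bounds(4)[OF t(2) h1_nonneg assms(5)] assms by (auto simp: ht_def pos_nth clip_id)
qed

lemma Gam_centre:
  assumes "Gam r \<omega> y"
  shows "real_of_int (y $ dd) + 6/10 < ht \<omega> y" "ht \<omega> y < real_of_int (y $ dd) + 7/10"
    "i \<noteq> dd \<Longrightarrow> \<bar>pos \<omega> y $ i - real_of_int (y $ i)\<bar> \<le> 1/100"
proof -
  have t: "\<omega> y \<in> gbox y y" using assms by (auto simp: Gam_def)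
  have u: "\<omega> y \<in> ubox" unfolding ubox_iff
  proof
    fix i show "\<bar>\<omega> y $ i\<bar> \<le> 1" using t by (cases "i = dd") (auto simp: gbox_def dest: spec[of _ i])
  qed
  show "real_of_int (y $ dd) + 6/10 < ht \<omega> y" "ht \<omega> y < real_of_int (y $ dd) + 7/10"
    using t u by (auto simp: gbox_def ht_def pos_nth clip_id)
  show "\<bar>pos \<omega> y $ i - real_of_int (y $ i)\<bar> \<le> 1/100" if "i \<noteq> dd"
    using t u that by (auto simp: gbox_def pos_nth clip_id)
qed

text \<open>The bound comes from the explicit box in the row of \<open>y\<close>, from the threshold
  -1/10 one row higher, and from the size of the perturbations alone two or more rows
  higher.\<close>

lemma Gam_other:
  assumes "Gam r \<omega> y" "h1 w y \<le> int r" "w \<noteq> y" "y $ dd \<le> w $ dd"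
  shows "real_of_int (y $ dd) + 9/10 \<le> ht \<omega> w"
proof -
  consider "w $ dd = y $ dd" | "w $ dd = y $ dd + 1" | "y $ dd + 2 \<le> w $ dd" using assms(4) by linarith
  thus ?thesis
  proof cases
    case 1
    hence "\<omega> w \<in> gbox y w" using assms by (auto simp: Gam_def)
    thus ?thesis using 1 assms(3) by (auto simp: gbox_def ht_def pos_nth clip_id)
  next
    case 2
    hence "\<omega> w \<in> gbox y w" using assms by (auto simp: Gam_def)
    thus ?thesis using 2 assms(3) by (auto simp: gbox_def ht_def pos_nth clip_id)
  next
    case 3
    thus ?thesis using ht_bound[of \<omega> w] by linarith
  qed
qed

text \<open>Absolute values keep parity, and the signed differences add up to an even number in each
  coordinate. Inside a trap this excludes a unit step that keeps the distance to the centre.\<close>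

lemma h1_parity: "even (h1 a z + h1 a b + h1 b z)"
  unfolding h1_def sum.distrib[symmetric] by (rule dvd_sum) presburger

context lowdim begin

text \<open>Horizontal offsets cost at most 1/50 in each of two coordinates and heights differ by at
  most 1/20, which gives 1/25 below and 1/25 + 1/20 = 9/100 above. Distances within the patch are
  thus integers up to errors far below 1.\<close>

lemma Tilt_ds:
  fixes \<omega> :: "'n env"
  assumes "Tilt r \<omega> z" "a $ dd = z $ dd" "h1 a z \<le> int r" "b $ dd = z $ dd" "h1 b z \<le> int r"
  shows "real_of_int (h1 a b) - 1/25 \<le> ds \<omega> a b" "ds \<omega> a b \<le> real_of_int (h1 a b) + 9/100"
proof -
  let ?p = "\<lambda>i. \<bar>pos \<omega> b $ i - pos \<omega> a $ i\<bar>" and ?q = "\<lambda>i. \<bar>real_of_int (a $ i) - real_of_int (b $ i)\<bar>"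
  have e: "\<bar>?p i - ?q i\<bar> \<le> 1/50" if "i \<noteq> dd" for i
    using Tilt_site(3)[OF assms(1-3) that] Tilt_site(3)[OF assms(1,4,5) that] by linarith
  have q: "(\<Sum>i\<in>-{dd}. ?q i) = real_of_int (h1 a b)" by (simp add: h1_def)
  have "(\<Sum>i\<in>-{dd::'n}. ?p i - ?q i) \<le> 2 * (1/50)"
    by (rule hsum_le; (frule e, linarith)?; simp?)
  moreover have "(\<Sum>i\<in>-{dd::'n}. ?q i - ?p i) \<le> 2 * (1/50)"
    by (rule hsum_le; (frule e, linarith)?; simp?)
  ultimately have s: "\<bar>(\<Sum>i\<in>-{dd}. ?p i) - real_of_int (h1 a b)\<bar> \<le> 1/25"
    unfolding q[symmetric] sum_subtractf by linarith
  have "\<bar>ht \<omega> b - ht \<omega> a\<bar> \<le> 1/20"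
    using Tilt_site(1,2)[OF assms(1-3)] Tilt_site(1,2)[OF assms(1,4,5)] by linarith
  thus "real_of_int (h1 a b) - 1/25 \<le> ds \<omega> a b" "ds \<omega> a b \<le> real_of_int (h1 a b) + 9/100"
    using s abs_ge_zero[of "ht \<omega> b - ht \<omega> a"] unfolding ds_split by linarith+
qed

text \<open>Row \<open>n\<close> has a point almost above \<open>a\<close>, at distance at most
  \<open>n - ht \<omega> a + 112/100\<close>, while all points of higher rows near the trap are at
  height at least \<open>n + 16/10\<close>. Hence no step jumps over row \<open>n\<close>.\<close>

lemma trap_enter:
  fixes \<omega> :: "'n env"
  assumes T: "Tilt r \<omega> z" "Gam r \<omega> (up z)" and n: "z $ dd = n"
    and a: "n - 9 \<le> a $ dd" "a $ dd < n" "real_of_int n - 8 < ht \<omega> a" "h1 a z + 40 \<le> int r"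
    and s: "suc \<omega> a b"
  shows "b $ dd = n \<or> inc \<omega> n a b"
proof -
  define t :: "'n site" where "t = (\<chi> i. if i = dd then n else round (pos \<omega> a $ i))"
  have td: "t $ dd = n" by (simp add: t_def)
  have ti: "t $ i = round (pos \<omega> a $ i)" if "i \<noteq> dd" for i using that by (simp add: t_def)
  have r: "\<bar>real_of_int (round (pos \<omega> a $ i)) - pos \<omega> a $ i\<bar> \<le> 1/2" for i
    using of_int_round_abs_le by blast
  have near: "\<bar>t $ i - a $ i\<bar> \<le> 1" if "i \<noteq> dd" for i
    using r[of i] pos_bound[of \<omega> a i] ti[OF that] by linarith
  have an: "n - 8 \<le> a $ dd" using row_bounds(2)[of "n - 8" \<omega> a] a(3) by simp
  have t_nb: "t \<in> nb a"
  proof -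
    have "\<bar>t $ i - a $ i\<bar> \<le> 9" for i
      using near[of i] td an a(2) by (cases "i = dd") auto
    thus ?thesis by (simp add: nb_def)
  qed
  have "h1 t z \<le> h1 t a + h1 a z" by (rule h1_triangle)
  hence tz: "h1 t z \<le> int r" using h1_nb[OF t_nb] a(4) by linarith
  have tz': "t $ dd = z $ dd" using td n by simp
  note tt = Tilt_site[OF T(1) tz' tz]
  have hta: "ht \<omega> a \<le> real_of_int n" using ht_bound[of \<omega> a] a(2) by linarith
  \<comment> \<open>Rounding contributes 1/2 and the trap 1/100 per coordinate; together with the
    height bound 1/10 this becomes the constant 112/100.\<close>
  have "(\<Sum>i\<in>-{dd}. \<bar>pos \<omega> t $ i - pos \<omega> a $ i\<bar>) \<le> 2 * (51/100)"
  proof (rule hsum_le)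
    fix i :: 'n assume i: "i \<noteq> dd"
    show "\<bar>pos \<omega> t $ i - pos \<omega> a $ i\<bar> \<le> 51/100" using tt(3)[OF i] r[of i] ti[OF i] by linarith
  qed simp
  hence dt: "ds \<omega> a t \<le> real_of_int n - ht \<omega> a + 112/100"
    unfolding ds_split using tt(1,2) hta n by linarith
  have "ds \<omega> a b \<le> real_of_int n - ht \<omega> a + 112/100"
  proof (cases "b = t")
    case False
    have "ht \<omega> a < ht \<omega> t" using tt(2) hta n by linarith
    from suc_global[OF s this] False dt show ?thesis by fastforce
  qed (use dt in simp)
  hence htb: "ht \<omega> b \<le> real_of_int n + 112/100" using ds_ge_ht[of \<omega> b a] by linarith
  have bz: "h1 b z \<le> int r" using h1_triangle[of b z a] h1_nb[OF suc_nb[OF s]] a(4) by linarith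
  have "b $ dd \<le> n"
  proof (rule ccontr)
    assume "\<not> b $ dd \<le> n"
    hence "up z $ dd \<le> b $ dd" using n by simp
    hence "real_of_int n + 16/10 \<le> ht \<omega> b"
      using Gam_other[OF T(2), of b] Gam_centre(1)[OF T(2)] bz n by (cases "b = up z") auto
    thus False using htb by linarith
  qed
  moreover have "n - 9 \<le> b $ dd"
    using row_bounds(2)[of "n - 8" \<omega> b] a(3) suc_ht[OF s] by simp
  ultimately show ?thesis using s unfolding inc_def suc_def by auto
qed

text \<open>One lattice step towards the centre leads to a higher point at distance about 1, so the
  successor is no farther. Points above row \<open>n\<close> are too high for that, hence the
  successor is a lattice neighbour in the row. Being higher, it is not farther from the centre, and
  parity excludes equal distance.\<close>

lemma trap_row:
  fixes \<omega> :: "'n env"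
  assumes T: "Tilt r \<omega> z" "Gam r \<omega> (up z)" and n: "z $ dd = n"
    and a: "a $ dd = n" "h1 a z + 20 \<le> int r" "0 < h1 a z"
    and s: "suc \<omega> a b"
  shows "b $ dd = n \<and> h1 b z < h1 a z"
proof -
  have "\<exists>i. i \<noteq> dd \<and> a $ i \<noteq> z $ i"
  proof (rule ccontr)
    assume "\<not> ?thesis"
    hence "h1 a z = 0" unfolding h1_def by (intro sum.neutral) auto
    thus False using a(3) by simp
  qed
  then obtain i where i: "i \<noteq> dd" "a $ i \<noteq> z $ i" by blast
  define t :: "'n site" where "t = (\<chi> j. if j = i then a $ j + sgn (z $ j - a $ j) else a $ j)"
  have ti: "t $ i = a $ i + sgn (z $ i - a $ i)" and tj: "\<And>j. j \<noteq> i \<Longrightarrow> t $ j = a $ j" by (auto simp: t_def)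
  have h_ta: "h1 a t = 1"
  proof -
    have "h1 a t = \<bar>a $ i - t $ i\<bar> + (\<Sum>j\<in>-{dd}-{i}. \<bar>a $ j - t $ j\<bar>)"
      unfolding h1_def by (rule sum.remove) (use i in auto)
    also have "(\<Sum>j\<in>-{dd}-{i}. \<bar>a $ j - t $ j\<bar>) = 0" by (rule sum.neutral) (auto simp: tj)
    finally show ?thesis using ti i by (auto simp: sgn_if)
  qed
  have h_tz: "h1 t z = h1 a z - 1"
  proof -
    have "h1 t z = \<bar>t $ i - z $ i\<bar> + (\<Sum>j\<in>-{dd}-{i}. \<bar>t $ j - z $ j\<bar>)"
      unfolding h1_def by (rule sum.remove) (use i in auto)
    also have "(\<Sum>j\<in>-{dd}-{i}. \<bar>t $ j - z $ j\<bar>) = (\<Sum>j\<in>-{dd}-{i}. \<bar>a $ j - z $ j\<bar>)"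
      by (rule sum.cong) (auto simp: tj)
    also have "\<bar>t $ i - z $ i\<bar> = \<bar>a $ i - z $ i\<bar> - 1" using ti i by (auto simp: sgn_if)
    also have "\<bar>a $ i - z $ i\<bar> - 1 + (\<Sum>j\<in>-{dd}-{i}. \<bar>a $ j - z $ j\<bar>)
       = (\<bar>a $ i - z $ i\<bar> + (\<Sum>j\<in>-{dd}-{i}. \<bar>a $ j - z $ j\<bar>)) - 1" by simp
    also have "\<bar>a $ i - z $ i\<bar> + (\<Sum>j\<in>-{dd}-{i}. \<bar>a $ j - z $ j\<bar>) = h1 a z"
      unfolding h1_def by (rule sum.remove[symmetric]) (use i in auto)
    finally show ?thesis .
  qed
  have td: "t $ dd = z $ dd" "a $ dd = z $ dd" using tj[of dd] i a n by auto
  have az: "h1 a z \<le> int r" and tz: "h1 t z \<le> int r" using a(2) h_tz by auto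
  have hat: "ht \<omega> a < ht \<omega> t" by (rule Tilt_mono[OF T(1) td(2) az td(1) tz]) (use h_tz in simp)
  have "ds \<omega> a t \<le> 109/100" using Tilt_ds(2)[OF T(1) td(2) az td(1) tz] h_ta by simp
  hence dsb: "ds \<omega> a b \<le> 109/100"
    using suc_global[OF s hat] by (cases "b = t") auto
  have hta: "ht \<omega> a < real_of_int n + 1/10" "real_of_int n + 1/20 < ht \<omega> a"
    using Tilt_site(1,2)[OF T(1) td(2) az] n by auto
  have htb: "ht \<omega> b \<le> real_of_int n + 119/100" using ds_ge_ht[of \<omega> b a] dsb hta by linarith
  have bz: "h1 b z \<le> int r" using h1_triangle[of b z a] h1_nb[OF suc_nb[OF s]] a(2) by linarith
  have "b $ dd \<le> n"
  proof (rule ccontr)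
    assume "\<not> b $ dd \<le> n"
    hence "up z $ dd \<le> b $ dd" using n by simp
    hence "real_of_int n + 16/10 \<le> ht \<omega> b"
      using Gam_other[OF T(2), of b] Gam_centre(1)[OF T(2)] bz n by (cases "b = up z") auto
    thus False using htb by linarith
  qed
  moreover have "n \<le> b $ dd"
    using ht_bound(2)[of \<omega> b] suc_ht[OF s] hta by linarith
  ultimately have bd: "b $ dd = n" by simp
  hence bdz: "b $ dd = z $ dd" using n by simp
  have "real_of_int (h1 a b) \<le> 113/100" using Tilt_ds(1)[OF T(1) td(2) az bdz bz] dsb by linarith
  hence "h1 a b \<le> 1" by linarith
  moreover have "h1 a b \<noteq> 0" using h1_eq_0[of a b] bd a(1) suc_ht[OF s] by auto
  ultimately have "h1 a b = 1" using h1_nonneg[of a b] by linarith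
  hence "h1 b z \<noteq> h1 a z" using h1_parity[of a z b] by auto
  moreover have "\<not> h1 a z < h1 b z"
    using Tilt_mono[OF T(1) bdz bz td(2) az] suc_ht[OF s] by auto
  ultimately show ?thesis using bd by simp
qed

text \<open>The point at \<open>up z\<close> is within 169/100. Every other point of a higher row
  near the trap is more than 18/10 above the centre, and all remaining points of row
  \<open>z $ dd\<close> and of the rows below are lower than the centre.\<close>

lemma trap_centre:
  fixes \<omega> :: "'n env"
  assumes T: "Tilt r \<omega> z" "Gam r \<omega> (up z)" and r: "40 \<le> r" and s: "suc \<omega> z b"
  shows "b = up z"
proof (rule ccontr)
  assume ne: "b \<noteq> up z"
  let ?n = "real_of_int (z $ dd)"
  have z: "h1 z z \<le> int r" by simp
  note c = Tilt_site[OF T(1) refl z]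
  have htu: "?n + 16/10 < ht \<omega> (up z)" "ht \<omega> (up z) < ?n + 17/10" using Gam_centre(1,2)[OF T(2)] by auto
  have "(\<Sum>i\<in>-{dd}. \<bar>pos \<omega> (up z) $ i - pos \<omega> z $ i\<bar>) \<le> 2 * (1/50)"
  proof (rule hsum_le)
    fix i :: 'n assume i: "i \<noteq> dd"
    show "\<bar>pos \<omega> (up z) $ i - pos \<omega> z $ i\<bar> \<le> 1/50"
      using c(3)[OF i] Gam_centre(3)[OF T(2) i] up_nth[OF i, of z] by linarith
  qed simp
  hence "ds \<omega> z (up z) \<le> 169/100" unfolding ds_split using htu c(1,2) by linarith
  moreover have "ds \<omega> z b < ds \<omega> z (up z)" using suc_global[OF s, of "up z"] htu c ne by auto
  ultimately have dsb: "ds \<omega> z b < 169/100" by simp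
  hence htb: "ht \<omega> b < ?n + 179/100" using ds_ge_ht[of \<omega> b z] c(1) by linarith
  have bz: "h1 b z \<le> int r" using h1_nb[OF suc_nb[OF s]] r by linarith
  have "\<not> up z $ dd \<le> b $ dd"
    using Gam_other[OF T(2), of b] ne bz htb by auto
  hence "b $ dd \<le> z $ dd" by simp
  moreover have "\<not> b $ dd < z $ dd"
  proof
    assume "b $ dd < z $ dd"
    hence "ht \<omega> b \<le> ?n" using ht_bound[of \<omega> b] by linarith
    thus False using suc_ht[OF s] c(2) by linarith
  qed
  ultimately have bd: "b $ dd = z $ dd" by simp
  have "b \<noteq> z" using suc_ht[OF s] by auto
  hence "h1 b z > 0" using h1_eq_0[of b z] bd h1_nonneg[of b z] by (metis less_le)
  hence "ht \<omega> b < ht \<omega> z" using Tilt_mono[OF T(1) bd bz refl z] by simp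
  thus False using suc_ht[OF s] by simp
qed

text \<open>A start nine rows below \<open>n\<close> has height at most \<open>n - 8\<close>, so the
  entry is reached by a genuine step from below that height, and a step gains at most 6.\<close>

lemma Ent_bounds:
  fixes \<omega> :: "'n env"
  assumes "Ent \<omega> x n v" "x $ dd \<le> n - 9"
  shows "ht \<omega> v \<le> real_of_int n - 2" "v $ dd < n" "n - 8 \<le> v $ dd" "(suc \<omega>)\<^sup>*\<^sup>* x v" "real_of_int n - 8 < ht \<omega> v"
proof -
  have r: "(sucL \<omega> n)\<^sup>*\<^sup>* x v" and h: "real_of_int n - 8 < ht \<omega> v" using assms by (auto simp: Ent_def)
  have "ht \<omega> x \<le> real_of_int n - 8" using ht_bound[of \<omega> x] assms(2) by linarith
  hence "x \<noteq> v" using h by auto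
  then obtain u where "sucL \<omega> n u v" using r by (metis rtranclp.cases)
  thus a: "ht \<omega> v \<le> real_of_int n - 2" using suc_ht_le[of \<omega> u v] by (auto simp: sucL_def)
  show "v $ dd < n" using row_bounds(1)[of \<omega> v "n - 2"] a by simp
  show "n - 8 \<le> v $ dd" using row_bounds(2)[of "n - 8" \<omega> v] h by simp
  show "(suc \<omega>)\<^sup>*\<^sup>* x v" using r by (rule rtranclp_mono[THEN predicate2D, rotated]) (auto simp: sucL_def)
  show "real_of_int n - 8 < ht \<omega> v" by (rule h)
qed

text \<open>As long as the path avoids row \<open>n\<close>, each of its steps is an
  \<open>inc\<close> step, and \<open>A\<close> of them would make \<open>v\<close> bad. So row
  \<open>n\<close> is reached within \<open>A\<close> steps, with a horizontal drift of at most 18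
  per step, and from there the distance to the centre decreases to 0. The margin 60 keeps all
  comparison sites inside the patch.\<close>

lemma trap:
  fixes \<omega> :: "'n env"
  assumes nt: "notie \<omega>" and T: "Tilt r \<omega> z" "Gam r \<omega> (up z)" and n: "z $ dd = n"
    and E: "Ent \<omega> x n v" "x $ dd \<le> n - 9" and B: "\<not> Bad A \<omega> n v" and r: "h1 v z + 18 * int A + 60 \<le> int r"
  shows "(suc \<omega>)\<^sup>*\<^sup>* x z" "suc \<omega> z (up z)"
proof -
  note Eb = Ent_bounds[OF E]
  have "\<exists>b. (suc \<omega>)\<^sup>*\<^sup>* v b \<and> b $ dd = n \<and> h1 b z + 20 \<le> int r"
  proof (rule ccontr)
    assume no: "\<not> ?thesis"
    have "\<exists>a. (inc \<omega> n ^^ k) v a \<and> (suc \<omega>)\<^sup>*\<^sup>* v a \<and> n - 9 \<le> a $ dd \<and> a $ dd < n \<and> real_of_int n - 8 < ht \<omega> a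
       \<and> h1 a z \<le> h1 v z + 18 * int k" if "k \<le> A" for k
      using that
    proof (induction k)
      case 0
      then show ?case using Eb by (intro exI[of _ v]) auto
    next
      case (Suc k)
      then obtain a where a: "(inc \<omega> n ^^ k) v a" "(suc \<omega>)\<^sup>*\<^sup>* v a" "n - 9 \<le> a $ dd" "a $ dd < n"
        "real_of_int n - 8 < ht \<omega> a" "h1 a z \<le> h1 v z + 18 * int k" by auto
      obtain b where s: "suc \<omega> a b" using suc_exists[OF nt] by blast
      have vb: "(suc \<omega>)\<^sup>*\<^sup>* v b" using a(2) s by (rule rtranclp.rtrancl_into_rtrancl)
      have bz: "h1 b z \<le> h1 v z + 18 * int (Suc k)"
        using h1_triangle[of b z a] h1_nb[OF suc_nb[OF s]] a(6) by simp
      have az: "h1 a z + 40 \<le> int r" "h1 b z + 20 \<le> int r" using a(6) bz r Suc.prems by auto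
      have "b $ dd \<noteq> n" using no vb az by blast
      hence "inc \<omega> n a b" using trap_enter[OF T n a(3-5) az(1) s] by blast
      moreover have "real_of_int n - 8 < ht \<omega> b" using a(5) suc_ht[OF s] by simp
      ultimately show ?case using a(1) vb bz by (intro exI[of _ b]) (auto simp: inc_def[of \<omega> n a b])
    qed
    from this[of A] B Eb show False by (auto simp: Bad_def)
  qed
  then obtain b where b: "(suc \<omega>)\<^sup>*\<^sup>* v b" "b $ dd = n" "h1 b z + 20 \<le> int r" by blast
  have "(suc \<omega>)\<^sup>*\<^sup>* b z" if "b $ dd = n" "h1 b z + 20 \<le> int r" for b
    using that
  proof (induction "nat (h1 b z)" arbitrary: b rule: less_induct)
    case less
    show ?case
    proof (cases "h1 b z = 0")
      case True
      then show ?thesis using h1_eq_0[of b z] less.prems n by auto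
    next
      case False
      hence pos: "0 < h1 b z" using h1_nonneg[of b z] by linarith
      obtain c where s: "suc \<omega> b c" using suc_exists[OF nt] by blast
      from trap_row[OF T n less.prems pos s] have c: "c $ dd = n" "h1 c z < h1 b z" by auto
      hence "(suc \<omega>)\<^sup>*\<^sup>* c z" using less.prems pos by (intro less.hyps) auto
      thus ?thesis using s by (rule converse_rtranclp_into_rtranclp[rotated])
    qed
  qed
  from this[OF b(2,3)] show "(suc \<omega>)\<^sup>*\<^sup>* x z" using b(1) Eb(4) by (meson rtranclp_trans)
  obtain c where "suc \<omega> z c" using suc_exists[OF nt] by blast
  moreover have "40 \<le> r" using r h1_nonneg[of v z] by linarith
  ultimately show "suc \<omega> z (up z)" using trap_centre[OF T] by blast
qed

end

subsection \<open>Measurability\<close>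

lemma pos_meas [measurable]: "(\<lambda>\<omega>. pos \<omega> w $ i) \<in> borel_measurable PS"
proof -
  have "(\<lambda>x. clip x $ i) \<in> borel_measurable borel"
    by (rule measurable_compose[OF clip_measurable]) measurable
  from measurable_compose[OF measurable_PS_comp this] show ?thesis unfolding pos_nth by measurable
qed

lemma ht_meas [measurable]: "(\<lambda>\<omega>. ht \<omega> w) \<in> borel_measurable PS"
  unfolding ht_def by measurable

lemma ds_meas [measurable]: "(\<lambda>\<omega>. ds \<omega> w v) \<in> borel_measurable PS"
  unfolding ds_def l1_norm_def vector_minus_component by measurable

lemma suc_meas [measurable]: "Measurable.pred PS (\<lambda>\<omega>. suc \<omega> w v)"
  unfolding suc_def by measurable

lemma notie_meas [measurable]: "Measurable.pred PS notie"
  unfolding notie_def[abs_def] neq_iff[where 'a=real] by measurable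

lemma sucL_meas [measurable]: "Measurable.pred PS (\<lambda>\<omega>. sucL \<omega> n w v)"
  unfolding sucL_def by measurable

lemma inc_meas [measurable]: "Measurable.pred PS (\<lambda>\<omega>. inc \<omega> n w v)"
  unfolding inc_def by measurable

lemma pred_relpowp:
  fixes x v :: "'a::countable"
  assumes [measurable]: "\<And>a b. Measurable.pred M (\<lambda>\<omega>. R \<omega> a b)"
  shows "Measurable.pred M (\<lambda>\<omega>. (R \<omega> ^^ m) x v)"
proof (induction m arbitrary: v)
  case (Suc m)
  note Suc[measurable]
  show ?case unfolding relpowp.simps OO_def by measurable
qed simp

lemma pred_rtranclp:
  fixes x v :: "'a::countable"
  assumes "\<And>a b. Measurable.pred M (\<lambda>\<omega>. R \<omega> a b)"
  shows "Measurable.pred M (\<lambda>\<omega>. (R \<omega>)\<^sup>*\<^sup>* x v)"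
proof -
  note pred_relpowp[OF assms, measurable]
  have "(\<lambda>\<omega>. (R \<omega>)\<^sup>*\<^sup>* x v) = (\<lambda>\<omega>. \<exists>m. (R \<omega> ^^ m) x v)"
    by (simp add: rtranclp_power fun_eq_iff)
  thus ?thesis by simp
qed

lemma Ent_meas [measurable]: "Measurable.pred PS (\<lambda>\<omega>. Ent \<omega> x n v)"
  unfolding Ent_def using pred_rtranclp[OF sucL_meas, measurable] by measurable

lemma Long_meas [measurable]: "Measurable.pred PS (\<lambda>\<omega>. Long \<omega> x n m)"
  unfolding Long_def using pred_relpowp[OF sucL_meas, measurable] by measurable

lemma Bad_meas [measurable]: "Measurable.pred PS (\<lambda>\<omega>. Bad A \<omega> n v)"
  unfolding Bad_def using pred_relpowp[OF inc_meas, measurable] by measurable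

lemma Coal_meas [measurable]: "Measurable.pred PS (\<lambda>\<omega>. Coal \<omega> x y)"
  unfolding Coal_def using pred_rtranclp[OF suc_meas, measurable] by measurable

lemma tbox_sets [measurable, simp]: "tbox r k \<in> sets borel"
  unfolding tbox_def by measurable

lemma gbox_sets [measurable, simp]: "gbox y w \<in> sets borel"
  by (cases "w = y"; cases "w $ dd = y $ dd") (simp_all add: gbox_def, measurable)

lemma pred_PS_in: "X \<in> sets borel \<Longrightarrow> Measurable.pred PS (\<lambda>\<omega>. \<omega> i \<in> X)"
  using pred_PS_cyl[of "{i}" "\<lambda>_. X"] by simp

lemma Tilt_meas [measurable]: "Measurable.pred PS (\<lambda>\<omega>. Tilt r \<omega> z)"
  unfolding Tilt_def using pred_PS_in[OF tbox_sets, measurable] by measurable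

lemma Gam_meas [measurable]: "Measurable.pred PS (\<lambda>\<omega>. Gam r \<omega> z)"
  unfolding Gam_def using pred_PS_in[OF gbox_sets, measurable] by measurable

lemma Rgp_meas [measurable]: "Measurable.pred PS (\<lambda>\<omega>. Rgp A r \<omega> x n z)"
  unfolding Rgp_def by measurable

subsection \<open>Dependence on sites\<close>

lemma ht_cong: "\<omega> w = \<omega>' w \<Longrightarrow> ht \<omega> w = ht \<omega>' w" by (simp add: ht_def pos_def)
lemma ds_cong: "\<omega> w = \<omega>' w \<Longrightarrow> \<omega> v = \<omega>' v \<Longrightarrow> ds \<omega> w v = ds \<omega>' w v" by (simp add: ds_def pos_def)

lemma suc_cong:
  assumes "suc \<omega> w v" "\<And>u. u \<in> nb w \<Longrightarrow> \<omega> u = \<omega>' u"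
  shows "suc \<omega>' w v"
proof -
  have "ht \<omega>' u = ht \<omega> u" "ds \<omega>' w u = ds \<omega> w u" if "u \<in> nb w" for u
    using ht_cong[of \<omega> u \<omega>'] ds_cong[of \<omega> w \<omega>' u] assms(2)[OF that] assms(2)[OF nb_refl] by simp_all
  thus ?thesis using assms(1) unfolding suc_def by simp
qed

lemma Tilt_dep: "dep {w. w $ dd = z $ dd \<and> h1 w z \<le> int r} (\<lambda>\<omega>. Tilt r \<omega> z)"
  unfolding Tilt_def by (rule depI) auto

lemma Gam_dep: "dep {w. w $ dd \<in> {y $ dd, y $ dd + 1} \<and> h1 w y \<le> int r} (\<lambda>\<omega>. Gam r \<omega> y)"
  unfolding Gam_def by (rule depI) auto

lemma inc_dep:
  assumes "(inc \<omega> n ^^ k) v u" "n - 9 \<le> v $ dd" "v $ dd < n"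
    and "\<And>w. n - 9 \<le> w $ dd \<Longrightarrow> w $ dd < n \<Longrightarrow> (\<forall>i. \<bar>w $ i - v $ i\<bar> \<le> 9 * int k) \<Longrightarrow> \<omega> w = \<omega>' w"
  shows "(inc \<omega>' n ^^ k) v u \<and> n - 9 \<le> u $ dd \<and> u $ dd < n \<and> (\<forall>i. \<bar>u $ i - v $ i\<bar> \<le> 9 * int k)"
  using assms
proof (induction k arbitrary: u)
  case (Suc k)
  then obtain a where a: "(inc \<omega> n ^^ k) v a" "inc \<omega> n a u" by auto
  have IH: "(inc \<omega>' n ^^ k) v a \<and> n - 9 \<le> a $ dd \<and> a $ dd < n \<and> (\<forall>i. \<bar>a $ i - v $ i\<bar> \<le> 9 * int k)"
  proof (rule Suc.IH[OF a(1) Suc.prems(2,3)])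
    fix w assume w: "n - 9 \<le> w $ dd" "w $ dd < n" "\<forall>i. \<bar>w $ i - v $ i\<bar> \<le> 9 * int k"
    have "\<bar>w $ i - v $ i\<bar> \<le> 9 * int (Suc k)" for i
    proof -
      have "\<bar>w $ i - v $ i\<bar> \<le> 9 * int k" using w(3) by blast
      thus ?thesis by simp
    qed
    thus "\<omega> w = \<omega>' w" using w Suc.prems(4) by blast
  qed
  have u: "\<bar>u $ i - v $ i\<bar> \<le> 9 * int (Suc k)" for i
  proof -
    have "\<bar>u $ i - a $ i\<bar> \<le> 9" "\<bar>a $ i - v $ i\<bar> \<le> 9 * int k"
      using a(2) IH by (auto simp: inc_def nb_def)
    thus ?thesis by simp
  qed
  have "\<bar>a $ i - v $ i\<bar> \<le> 9 * int (Suc k)" for i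
  proof -
    have "\<bar>a $ i - v $ i\<bar> \<le> 9 * int k" using IH by blast
    thus ?thesis by simp
  qed
  hence "\<omega> a = \<omega>' a" using IH Suc.prems(4)[of a] by blast
  moreover have "\<omega> u = \<omega>' u" using a(2) u Suc.prems(4)[of u] by (auto simp: inc_def)
  ultimately have "inc \<omega>' n a u" using a(2) ht_cong[of \<omega> a \<omega>'] ht_cong[of \<omega> u \<omega>'] unfolding inc_def by simp
  hence "(inc \<omega>' n ^^ Suc k) v u" using IH by auto
  moreover have "n - 9 \<le> u $ dd" "u $ dd < n" using a(2) by (auto simp: inc_def)
  ultimately show ?case using u by blast
qed auto

text \<open>Two localisations at once: the rows give independence between levels, and the box gives
  independence between distant paths.\<close>

lemma Bad_cong:
  assumes "Bad A \<omega> n v"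
    and "\<And>w. n - 9 \<le> w $ dd \<Longrightarrow> w $ dd < n \<Longrightarrow> (\<forall>i. \<bar>w $ i - v $ i\<bar> \<le> 9 * int A) \<Longrightarrow> \<omega> w = \<omega>' w"
  shows "Bad A \<omega>' n v"
proof -
  have v: "n - 9 \<le> v $ dd" "v $ dd < n" using assms(1) by (auto simp: Bad_def)
  hence "\<omega> v = \<omega>' v" by (intro assms(2)) auto
  hence h: "ht \<omega> v = ht \<omega>' v" by (rule ht_cong)
  obtain u where u: "(inc \<omega> n ^^ A) v u" using assms(1) by (auto simp: Bad_def)
  have "(inc \<omega>' n ^^ A) v u" using inc_dep[OF u v assms(2)] by blast
  thus ?thesis using assms(1) h unfolding Bad_def by auto
qed

lemma Bad_dep: "dep {w. n - 9 \<le> w $ dd \<and> w $ dd < n} (\<lambda>\<omega>. Bad A \<omega> n v)"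
  by (rule depI) (erule Bad_cong, simp)

definition Bx :: "'n::finite site \<Rightarrow> int \<Rightarrow> 'n site set" where
  "Bx x l = {w. \<forall>i. \<bar>w $ i - x $ i\<bar> \<le> l}"

lemma Bx_mono: "l \<le> l' \<Longrightarrow> Bx x l \<subseteq> Bx x l'"
  unfolding Bx_def by (auto intro: order_trans)

lemma Bx_trans: "a \<in> Bx x l \<Longrightarrow> b \<in> Bx a m \<Longrightarrow> b \<in> Bx x (l + m)"
proof -
  assume *: "a \<in> Bx x l" "b \<in> Bx a m"
  have "\<bar>b $ i - x $ i\<bar> \<le> l + m" for i
  proof -
    have "\<bar>a $ i - x $ i\<bar> \<le> l" "\<bar>b $ i - a $ i\<bar> \<le> m" using * by (auto simp: Bx_def)
    thus ?thesis by linarith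
  qed
  thus ?thesis by (simp add: Bx_def)
qed

lemma nb_Bx: "nb x = Bx x 9" by (simp add: nb_def Bx_def)

lemma h1_Bx:
  assumes "h1 w z \<le> l" "\<bar>w $ dd - z $ dd\<bar> \<le> l" shows "w \<in> Bx z l"
proof -
  have "\<bar>w $ i - z $ i\<bar> \<le> l" for i
  proof (cases "i = dd")
    case False
    hence "\<bar>w $ i - z $ i\<bar> \<le> h1 w z" unfolding h1_def by (intro member_le_sum) auto
    thus ?thesis using assms by simp
  qed (use assms in simp)
  thus ?thesis by (simp add: Bx_def)
qed

lemma sucL_Bx: "(sucL \<omega> n ^^ k) x v \<Longrightarrow> v \<in> Bx x (9 * int k)"
proof (induction k arbitrary: v)
  case (Suc k)
  then obtain a where a: "(sucL \<omega> n ^^ k) x a" "sucL \<omega> n a v" by auto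
  hence "v \<in> Bx a 9" by (auto simp: sucL_def suc_def nb_Bx)
  from Bx_trans[OF Suc.IH[OF a(1)] this] show ?case by (simp add: algebra_simps)
qed (auto simp: Bx_def)

lemma sucL_pow_cong_ball:
  assumes "(sucL \<omega> n ^^ k) x v" "\<And>w. w \<in> Bx x (9 * int k) \<Longrightarrow> \<omega> w = \<omega>' w"
  shows "(sucL \<omega>' n ^^ k) x v"
  using assms
proof (induction k arbitrary: v)
  case (Suc k)
  then obtain a where a: "(sucL \<omega> n ^^ k) x a" "sucL \<omega> n a v" by auto
  have sub: "Bx x (9 * int k) \<subseteq> Bx x (9 * int (Suc k))" by (rule Bx_mono) simp
  have 1: "(sucL \<omega>' n ^^ k) x a" using Suc.IH[OF a(1)] Suc.prems(2) sub by blast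
  have aB: "a \<in> Bx x (9 * int k)" by (rule sucL_Bx[OF a(1)])
  have 2: "\<omega> u = \<omega>' u" if "u \<in> nb a" for u
    using Bx_trans[OF aB that[unfolded nb_Bx]] Suc.prems(2) by (simp add: algebra_simps)
  have "sucL \<omega>' n a v" unfolding sucL_def
    using a(2) suc_cong[of \<omega> a v \<omega>', OF _ 2] ht_cong[of \<omega> a \<omega>'] 2[OF nb_refl] unfolding sucL_def by simp
  thus ?case using 1 by auto
qed simp

lemma sucL_mono: "n' \<le> n \<Longrightarrow> (sucL \<omega> n' ^^ k) x v \<Longrightarrow> (sucL \<omega> n ^^ k) x v"
proof -
  assume n: "n' \<le> n" and p: "(sucL \<omega> n' ^^ k) x v"
  have "sucL \<omega> n a b" if "sucL \<omega> n' a b" for a b using that n by (simp add: sucL_def)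
  thus ?thesis using p by (rule relpowp_mono)
qed

lemma Long_down:
  assumes "(sucL \<omega> n ^^ k) x v" "m \<le> k" shows "Long \<omega> x n m"
proof -
  have "(sucL \<omega> n ^^ m OO sucL \<omega> n ^^ (k - m)) x v"
    using assms by (simp add: relpowp_add[symmetric])
  thus ?thesis by (auto simp: Long_def)
qed

lemma Long_mono: "Long \<omega> x n k \<Longrightarrow> m \<le> k \<Longrightarrow> n \<le> n' \<Longrightarrow> Long \<omega> x n' m"
  unfolding Long_def[of \<omega> x n k] using Long_down sucL_mono by blast

lemma Long_cong_ball:
  assumes "Long \<omega> x n m" "\<And>w. w \<in> Bx x (9 * int m) \<Longrightarrow> \<omega> w = \<omega>' w"
  shows "Long \<omega>' x n m"
  using assms sucL_pow_cong_ball unfolding Long_def by blast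

text \<open>The path up to an earlier level is an initial piece of the path up to level
  \<open>n\<close>. One bound on the number of steps at \<open>n\<close> therefore localises the
  entries at all earlier levels.\<close>

lemma Ent_not_Long:
  assumes "Ent \<omega> x n' v" "\<not> Long \<omega> x n m" "n' \<le> n"
  shows "\<exists>k<m. (sucL \<omega> n' ^^ k) x v"
proof -
  obtain k where k: "(sucL \<omega> n' ^^ k) x v" using assms(1) by (auto simp: Ent_def rtranclp_power)
  have "k < m" using Long_down[OF sucL_mono[OF assms(3) k], of m] assms(2) by (meson not_le)
  thus ?thesis using k by blast
qed

lemma Ent_ball: "Ent \<omega> x n' v \<Longrightarrow> \<not> Long \<omega> x n m \<Longrightarrow> n' \<le> n \<Longrightarrow> v \<in> Bx x (9 * int m)"
proof -
  assume *: "Ent \<omega> x n' v" "\<not> Long \<omega> x n m" "n' \<le> n"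
  obtain k where k: "k < m" "(sucL \<omega> n' ^^ k) x v" using Ent_not_Long[OF *] by blast
  show ?thesis using sucL_Bx[OF k(2)] Bx_mono[of "9 * int k" "9 * int m" x] k(1) by auto
qed

lemma Ent_cong_ball:
  assumes "Ent \<omega> x n' v" "\<not> Long \<omega> x n m" "n' \<le> n" "\<And>w. w \<in> Bx x (9 * int m) \<Longrightarrow> \<omega> w = \<omega>' w"
  shows "Ent \<omega>' x n' v"
proof -
  obtain k where k: "k < m" "(sucL \<omega> n' ^^ k) x v" using Ent_not_Long[OF assms(1-3)] by blast
  have sub: "Bx x (9 * int k) \<subseteq> Bx x (9 * int m)" using k by (intro Bx_mono) auto
  have "(sucL \<omega>' n' ^^ k) x v"
    by (rule sucL_pow_cong_ball[OF k(2)]) (use sub assms(4) in blast)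
  moreover have "ht \<omega> v = ht \<omega>' v" using sucL_Bx[OF k(2)] sub assms(4) by (intro ht_cong) blast
  ultimately show ?thesis using assms(1) unfolding Ent_def by (auto simp: rtranclp_power)
qed

context lowdim begin

lemma sucL_row:
  fixes \<omega> :: "'n env"
  assumes "\<And>w. w $ dd < n \<Longrightarrow> \<omega> w = \<omega>' w" "sucL \<omega> n u v" "u $ dd < n"
  shows "sucL \<omega>' n u v \<and> v $ dd < n"
proof -
  have u: "ht \<omega> u \<le> real_of_int n - 8" "suc \<omega> u v" using assms(2) by (auto simp: sucL_def)
  have "ht \<omega> v \<le> real_of_int n - 2" using suc_ht_le[OF u(2)] u(1) by simp
  hence v: "v $ dd < n" using row_bounds(1)[of \<omega> v "n - 2"] by simp
  have eq: "\<omega> u = \<omega>' u" "\<omega> v = \<omega>' v" using assms(1,3) v by auto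
  have hteq: "ht \<omega> u = ht \<omega>' u" "ht \<omega> v = ht \<omega>' v" "ds \<omega> u v = ds \<omega>' u v"
    using eq by (auto intro: ht_cong ds_cong)
  have "ds \<omega>' u v < ds \<omega>' u b" if b: "b \<in> nb u" "ht \<omega>' u < ht \<omega>' b" "b \<noteq> v" for b
  proof (cases "b $ dd < n")
    case True
    hence "\<omega> b = \<omega>' b" by (rule assms(1))
    hence "ht \<omega> b = ht \<omega>' b" "ds \<omega> u b = ds \<omega>' u b" using eq by (auto intro: ht_cong ds_cong)
    thus ?thesis using b u(2) hteq unfolding suc_def by auto
  next
    case False
    have "ds \<omega>' u b \<ge> 7"
      using False ht_bound(1)[of \<omega>' b] ds_ge_ht[of \<omega>' b u] u(1) hteq by linarith
    moreover have "ds \<omega>' u v \<le> 6" using suc_ds_le[OF u(2)] hteq by simp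
    ultimately show ?thesis by simp
  qed
  hence "suc \<omega>' u v" using u(2) hteq unfolding suc_def by auto
  thus ?thesis using u(1) v hteq by (simp add: sucL_def)
qed

lemma sucL_pow_row:
  fixes \<omega> :: "'n env"
  assumes "\<And>w. w $ dd < n \<Longrightarrow> \<omega> w = \<omega>' w" "x $ dd < n"
  shows "(sucL \<omega> n ^^ k) x v \<Longrightarrow> (sucL \<omega>' n ^^ k) x v \<and> v $ dd < n"
proof (induction k arbitrary: v)
  case (Suc k)
  then obtain a where a: "(sucL \<omega> n ^^ k) x a" "sucL \<omega> n a v" by auto
  from Suc.IH[OF a(1)] sucL_row[OF assms(1) a(2)] show ?case by auto
qed (use assms in auto)

lemma Long_dep: "x $ dd < n \<Longrightarrow> dep {w. w $ dd < n} (\<lambda>\<omega>::'n env. Long \<omega> x n m)"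
  unfolding Long_def by (rule depI) (use sucL_pow_row in blast)

lemma Ent_dep: "x $ dd < n \<Longrightarrow> dep {w. w $ dd < n} (\<lambda>\<omega>::'n env. Ent \<omega> x n v)"
proof (rule depI)
  fix \<omega> \<omega>' :: "'n env"
  assume x: "x $ dd < n" and eq: "\<And>w. w \<in> {w. w $ dd < n} \<Longrightarrow> \<omega> w = \<omega>' w" and E: "Ent \<omega> x n v"
  obtain k where "(sucL \<omega> n ^^ k) x v" using E by (auto simp: Ent_def rtranclp_power)
  with sucL_pow_row[of n \<omega> \<omega>' x k v] x eq have "(sucL \<omega>' n ^^ k) x v" "v $ dd < n" by auto
  moreover have "ht \<omega> v = ht \<omega>' v" using \<open>v $ dd < n\<close> eq by (intro ht_cong) auto
  ultimately show "Ent \<omega>' x n v" using E unfolding Ent_def by (auto simp: rtranclp_power)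
qed

lemma Rgp_dep: "x $ dd < n \<Longrightarrow> dep {w. w $ dd \<le> n} (\<lambda>\<omega>::'n env. Rgp A r \<omega> x n z)"
proof (cases "z $ dd = n")
  case True
  assume x: "x $ dd < n"
  have "dep {w. w $ dd \<le> n} (\<lambda>\<omega>::'n env. Ent \<omega> x n v)" for v
    by (rule dep_mono[OF Ent_dep[OF x]]) auto
  moreover have "dep {w. w $ dd \<le> n} (\<lambda>\<omega>::'n env. Bad A \<omega> n v)" for v
    by (rule dep_mono[OF Bad_dep]) auto
  moreover have "dep {w. w $ dd \<le> n} (\<lambda>\<omega>::'n env. Tilt r \<omega> z)"
    by (rule dep_mono[OF Tilt_dep]) (use True in auto)
  ultimately show ?thesis unfolding Rgp_def
    by (intro dep_ex dep_conj dep_not dep_const)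
qed (simp add: Rgp_def dep_const)

text \<open>Heights increase along a path, so both its vertices and their competitors are higher
  than \<open>m\<close>, and such points sit in rows from \<open>m\<close> on.\<close>

lemma reach_cong:
  fixes \<omega> :: "'n env"
  assumes "\<And>w. m \<le> w $ dd \<Longrightarrow> \<omega> w = \<omega>' w" "real_of_int m < ht \<omega> x"
  shows "(suc \<omega>)\<^sup>*\<^sup>* x u \<Longrightarrow> (suc \<omega>')\<^sup>*\<^sup>* x u \<and> real_of_int m < ht \<omega> u"
proof (induction rule: rtranclp_induct)
  case (step u v)
  have row: "m \<le> b $ dd" if "real_of_int m < ht \<omega>'' b" for b and \<omega>'' :: "'n env"
    using row_bounds(2)[OF that] .
  have eqw: "ht \<omega> b = ht \<omega>' b" if "m \<le> b $ dd" for b using ht_cong assms(1)[OF that] by blast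
  have hu: "real_of_int m < ht \<omega> u" and hv: "real_of_int m < ht \<omega> v" using step suc_ht[OF step(2)] by auto
  have "ds \<omega>' u v < ds \<omega>' u b" if b: "b \<in> nb u" "ht \<omega>' u < ht \<omega>' b" "b \<noteq> v" for b
  proof -
    have mb: "m \<le> b $ dd" using row[of \<omega>' b] b(2) eqw[OF row[OF hu]] hu by simp
    have "ds \<omega> u b = ds \<omega>' u b" "ds \<omega> u v = ds \<omega>' u v"
      using assms(1) row[OF hu] row[OF hv] mb by (auto intro!: ds_cong)
    thus ?thesis using b step(2) eqw[OF row[OF hu]] eqw[OF mb] unfolding suc_def by auto
  qed
  hence "suc \<omega>' u v" using step(2) eqw[OF row[OF hu]] eqw[OF row[OF hv]] unfolding suc_def by auto
  thus ?case using step hv by auto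
qed (use assms in auto)

text \<open>Coalescence alone is not decided by the rows from \<open>m\<close> on: a start that is
  perturbed downwards may have points of row \<open>m - 1\<close> above it. \<open>Gam\<close> lifts
  both starts above height \<open>m\<close> and so removes this dependence.\<close>

lemma Coal_dep:
  fixes x y :: "'n site"
  assumes "x $ dd = m" "y $ dd = m"
  shows "dep {w. m \<le> w $ dd} (\<lambda>\<omega>. Gam r \<omega> x \<and> Gam r \<omega> y \<and> Coal \<omega> x y)"
proof (rule depI)
  fix \<omega> \<omega>' :: "'n env"
  assume eq: "\<And>w. w \<in> {w. m \<le> w $ dd} \<Longrightarrow> \<omega> w = \<omega>' w" and P: "Gam r \<omega> x \<and> Gam r \<omega> y \<and> Coal \<omega> x y"
  have "Gam r \<omega> p = Gam r \<omega>' p" if "p $ dd = m" for p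
    by (rule depD[OF Gam_dep]) (use that eq in auto)
  hence "Gam r \<omega>' x" "Gam r \<omega>' y" using P assms by auto
  moreover have "real_of_int m < ht \<omega> x" "real_of_int m < ht \<omega> y"
    using Gam_centre(1)[of r \<omega> x] Gam_centre(1)[of r \<omega> y] P assms by auto
  hence "Coal \<omega>' x y" using P reach_cong[of m \<omega> \<omega>'] eq unfolding Coal_def by blast
  ultimately show "Gam r \<omega>' x \<and> Gam r \<omega>' y \<and> Coal \<omega>' x y" by blast
qed

text \<open>The radius is composed of \<open>9 * m\<close> for the path, \<open>9 * A\<close> for
  the chains in \<open>Bad\<close>, and \<open>r\<close> plus a constant for the trap, whose centre
  lies within 8 of the entry in every coordinate.\<close>

lemma Rgp_ball:
  fixes \<omega> :: "'n env"
  assumes R: "Rgp A r \<omega> x n' z" and L: "\<not> Long \<omega> x n m" and n: "n' \<le> n" "x $ dd \<le> n' - 9"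
    and eq: "\<And>w. w \<in> Bx x (9 * int m + (9 * int A + int r + 20)) \<Longrightarrow> \<omega> w = \<omega>' w"
  shows "Rgp A r \<omega>' x n' z" "z \<in> Bx x (9 * int m + 8)" "Gam r \<omega> (up z) = Gam r \<omega>' (up z)"
proof -
  obtain v where v: "Ent \<omega> x n' v" "\<not> Bad A \<omega> n' v" "z $ dd = n'" "h1 z v \<le> 1" "Tilt r \<omega> z"
    using R by (auto simp: Rgp_def)
  have sub: "Bx x (9 * int m) \<subseteq> Bx x (9 * int m + (9 * int A + int r + 20))" by (rule Bx_mono) simp
  have E': "Ent \<omega>' x n' v" by (rule Ent_cong_ball[OF v(1) L n(1)]) (use sub eq in blast)
  have vB: "v \<in> Bx x (9 * int m)" by (rule Ent_ball[OF v(1) L n(1)])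
  have eqv: "\<omega> w = \<omega>' w" if "w \<in> Bx v l" "l \<le> 9 * int A + int r + 20" for w l
    using Bx_trans[OF vB that(1)] Bx_mono[of "9 * int m + l" "9 * int m + (9 * int A + int r + 20)" x] that(2) eq
    by (auto simp: subset_iff)
  have B': "\<not> Bad A \<omega>' n' v"
  proof
    assume "Bad A \<omega>' n' v"
    hence "Bad A \<omega> n' v"
    proof (rule Bad_cong)
      fix w assume "\<forall>i. \<bar>w $ i - v $ i\<bar> \<le> 9 * int A"
      hence "w \<in> Bx v (9 * int A)" by (simp add: Bx_def)
      from eqv[OF this] show "\<omega>' w = \<omega> w" by simp
    qed
    thus False using v(2) by simp
  qed
  have zv: "z \<in> Bx v 8" using v(3,4) Ent_bounds(2,3)[OF v(1) n(2)] by (intro h1_Bx) auto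
  have eqz: "\<omega> w = \<omega>' w" if "w \<in> Bx z (int r + 2)" for w
    using Bx_trans[OF zv that] eqv by (auto simp: algebra_simps)
  have T': "Tilt r \<omega>' z"
  proof -
    have "Tilt r \<omega> z = Tilt r \<omega>' z"
    proof (rule depD[OF Tilt_dep])
      fix w assume "w \<in> {w. w $ dd = z $ dd \<and> h1 w z \<le> int r}"
      hence "w \<in> Bx z (int r + 2)" by (intro h1_Bx) auto
      thus "\<omega> w = \<omega>' w" by (rule eqz)
    qed
    thus ?thesis using v(5) by simp
  qed
  show "Rgp A r \<omega>' x n' z" using E' B' T' v unfolding Rgp_def by blast
  show "z \<in> Bx x (9 * int m + 8)" using Bx_trans[OF vB zv] .
  show "Gam r \<omega> (up z) = Gam r \<omega>' (up z)"
  proof (rule depD[OF Gam_dep])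
    fix w assume "w \<in> {w. w $ dd \<in> {up z $ dd, up z $ dd + 1} \<and> h1 w (up z) \<le> int r}"
    hence "w \<in> Bx z (int r + 2)" by (intro h1_Bx) auto
    thus "\<omega> w = \<omega>' w" by (rule eqz)
  qed
qed

end

subsection \<open>Counting increasing chains\<close>

text \<open>Chains are stored with the most recent site first.\<close>

fun CH :: "'n::finite site \<Rightarrow> nat \<Rightarrow> 'n site list set" where
  "CH x 0 = {[x]}"
| "CH x (Suc m) = (\<Union>p\<in>CH x m. (\<lambda>v. v # p) ` nb (hd p))"

fun incr :: "'n::{finite,linorder} env \<Rightarrow> 'n site list \<Rightarrow> bool" where
  "incr \<omega> (v # u # p) \<longleftrightarrow> ht \<omega> u < ht \<omega> v \<and> incr \<omega> (u # p)"
| "incr \<omega> _ \<longleftrightarrow> True"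

text \<open>Exponential tilting turns the constraint on the total height gained into a product over
  the steps, each of which can be integrated on its own.\<close>

fun wt :: "real \<Rightarrow> 'n::{finite,linorder} env \<Rightarrow> 'n site list \<Rightarrow> ennreal" where
  "wt l \<omega> (v # u # p) = ennreal (exp (- l * (ht \<omega> v - ht \<omega> u))) * indicator {x. ht \<omega> u < x} (ht \<omega> v) * wt l \<omega> (u # p)"
| "wt l \<omega> _ = 1"

lemma finite_CH [simp]: "finite (CH x m)"
  by (induction m) auto

lemma CH_length: "p \<in> CH x m \<Longrightarrow> length p = Suc m \<and> last p = x \<and> p \<noteq> []"
  by (induction m arbitrary: p) auto

lemma card_nb: "card (nb (w::'n::finite site)) \<le> 19 ^ CARD('n)"
proof -
  have "card (nb w) \<le> card ((\<lambda>f. (\<chi> i. f i) :: 'n site) ` (PiE UNIV (\<lambda>i. {w $ i - 9 .. w $ i + 9})))"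
    by (rule card_mono[OF _ nb_subset]) (auto intro!: finite_imageI finite_PiE)
  also have "\<dots> \<le> card (PiE UNIV (\<lambda>i. {w $ i - 9 .. w $ i + 9}))"
    by (rule card_image_le) (auto intro!: finite_PiE)
  also have "\<dots> = 19 ^ CARD('n)" by (subst card_PiE) auto
  finally show ?thesis .
qed

lemma card_CH: "card (CH (x::'n::finite site) m) \<le> (19 ^ CARD('n)) ^ m"
proof (induction m)
  case (Suc m)
  have "card (CH x (Suc m)) \<le> (\<Sum>p\<in>CH x m. card ((\<lambda>v. v # p) ` nb (hd p)))"
    by (simp add: card_UN_le)
  also have "\<dots> \<le> (\<Sum>p\<in>CH x m. 19 ^ CARD('n))"
    by (intro sum_mono order_trans[OF card_image_le card_nb]) simp
  also have "\<dots> = card (CH x m) * 19 ^ CARD('n)" by simp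
  also have "\<dots> \<le> (19 ^ CARD('n)) ^ m * 19 ^ CARD('n)" using Suc by (intro mult_right_mono) auto
  finally show ?case by (simp add: mult.commute)
qed simp

lemma wt_meas [measurable]: "(\<lambda>\<omega>. wt l \<omega> p) \<in> borel_measurable PS"
proof (induction p rule: induct_list012)
  case (3 v u p)
  note 3(2)[measurable]
  show ?case unfolding wt.simps indicator_def by measurable
qed simp_all

lemma wt_nonzero: "wt l \<omega> (v # p) \<noteq> 0 \<Longrightarrow> u \<in> set p \<Longrightarrow> ht \<omega> u < ht \<omega> v"
proof (induction p arbitrary: v)
  case (Cons a p)
  have a: "ht \<omega> a < ht \<omega> v" "wt l \<omega> (a # p) \<noteq> 0"
    using Cons.prems(1) by (auto simp: indicator_def split: if_splits)
  show ?case
  proof (cases "u = a")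
    case False
    hence "ht \<omega> u < ht \<omega> a" using Cons.IH[OF a(2)] Cons.prems(2) by simp
    thus ?thesis using a(1) by simp
  qed (use a in simp)
qed simp

lemma wt_cong: "(\<And>u. u \<in> set p \<Longrightarrow> \<omega> u = \<omega>' u) \<Longrightarrow> wt l \<omega> p = wt l \<omega>' p"
proof (induction p rule: induct_list012)
  case (3 v u p)
  have "ht \<omega> v = ht \<omega>' v" "ht \<omega> u = ht \<omega>' u" using 3(3) by (auto intro!: ht_cong)
  thus ?case using 3 by simp
qed simp_all

lemma mu0_exp_meas:
  "(\<lambda>x. ennreal (exp (- l * (c + clip x $ dd - a))) * indicator {x. a < c + clip x $ dd} x)
     \<in> borel_measurable (mu0 :: (real^'n::{finite,linorder}) measure)"
proof -
  have [measurable]: "(\<lambda>x. clip x $ dd :: real) \<in> borel_measurable (borel :: (real,'n) vec measure)"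
    by (rule measurable_compose[OF clip_measurable]) measurable
  have [measurable]: "{x. a < c + clip x $ dd} \<in> sets (borel :: (real,'n) vec measure)"
    by measurable
  have "(\<lambda>x. ennreal (exp (- l * (c + clip x $ dd - a))) * indicator {x. a < c + clip x $ dd} x)
     \<in> borel_measurable (borel :: (real,'n) vec measure)" by measurable
  thus ?thesis using measurable_cong_sets[OF sets_mu0 refl] by blast
qed

text \<open>A chain that revisits a site has weight zero, since heights would have to increase
  strictly along it. Otherwise the newest site is fresh, and integrating it out produces the factor
  \<open>1 / (2 * l)\<close>.\<close>

lemma nn_wt:
  fixes p :: "'n::{finite,linorder} site list"
  assumes l: "l > 0"
  shows "(\<integral>\<^sup>+\<omega>. wt l \<omega> p \<partial>PS) \<le> ennreal ((1 / (2 * l)) ^ (length p - 1))"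
proof (induction p rule: induct_list012)
  case (3 v u p)
  show ?case
  proof (cases "v \<in> set (u # p)")
    case True
    have "wt l \<omega> (v # u # p) = 0" for \<omega>
      using wt_nonzero[of l \<omega> v "u # p" v] True by blast
    thus ?thesis by (simp del: wt.simps)
  next
    case False
    have "(\<integral>\<^sup>+\<omega>. wt l \<omega> (v # u # p) \<partial>PS) = (\<integral>\<^sup>+\<omega>. (\<integral>\<^sup>+x. wt l (fun_upd \<omega> v x) (v # u # p) \<partial>mu0) \<partial>PS)"
      by (rule nn_resample) measurable
    also have "\<dots> \<le> (\<integral>\<^sup>+\<omega>. ennreal (1 / (2 * l)) * wt l \<omega> (u # p) \<partial>PS)"
    proof (rule nn_integral_mono)
      fix \<omega> :: "'n env"
      have hv: "ht (fun_upd \<omega> v x) v = real_of_int (v $ dd) + clip x $ dd" for x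
        by (simp add: ht_def pos_nth)
      have hu: "ht (fun_upd \<omega> v x) u = ht \<omega> u" for x
        by (rule ht_cong) (use False in auto)
      have w: "wt l (fun_upd \<omega> v x) (u # p) = wt l \<omega> (u # p)" for x
        by (rule wt_cong) (use False in auto)
      have "(\<integral>\<^sup>+x. wt l (fun_upd \<omega> v x) (v # u # p) \<partial>(mu0 :: (real,'n) vec measure))
         = (\<integral>\<^sup>+x. ennreal (exp (- l * (real_of_int (v $ dd) + clip x $ dd - ht \<omega> u)))
             * indicator {x. ht \<omega> u < real_of_int (v $ dd) + clip x $ dd} x * wt l \<omega> (u # p) \<partial>(mu0 :: (real,'n) vec measure))"
        unfolding wt.simps hv hu w by (simp add: indicator_def)
      also have "\<dots> = (\<integral>\<^sup>+x. ennreal (exp (- l * (real_of_int (v $ dd) + clip x $ dd - ht \<omega> u)))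
             * indicator {x. ht \<omega> u < real_of_int (v $ dd) + clip x $ dd} x \<partial>(mu0 :: (real,'n) vec measure)) * wt l \<omega> (u # p)"
      by (rule nn_integral_multc[OF mu0_exp_meas])
      also have "\<dots> \<le> ennreal (1 / (2 * l)) * wt l \<omega> (u # p)"
        by (intro mult_right_mono mu0_exp[OF l]) simp
      finally show "(\<integral>\<^sup>+x. wt l (fun_upd \<omega> v x) (v # u # p) \<partial>mu0) \<le> ennreal (1 / (2 * l)) * wt l \<omega> (u # p)" .
    qed
    also have "\<dots> = ennreal (1 / (2 * l)) * (\<integral>\<^sup>+\<omega>. wt l \<omega> (u # p) \<partial>PS)"
      by (rule nn_integral_cmult) measurable
    also have "\<dots> \<le> ennreal (1 / (2 * l)) * ennreal ((1 / (2 * l)) ^ (length (u # p) - 1))"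
      by (intro mult_left_mono 3) simp
    also have "\<dots> = ennreal ((1 / (2 * l)) ^ (length (v # u # p) - 1))"
      using l by (simp add: ennreal_mult[symmetric])
    finally show ?thesis .
  qed
qed (simp_all add: PS.emeasure_space_1[simplified])

lemma wt_incr: "incr \<omega> p \<Longrightarrow> p \<noteq> [] \<Longrightarrow> wt l \<omega> p = ennreal (exp (- l * (ht \<omega> (hd p) - ht \<omega> (last p))))"
proof (induction p rule: induct_list012)
  case (3 v u p)
  hence "wt l \<omega> (v # u # p) = ennreal (exp (- l * (ht \<omega> v - ht \<omega> u))) * ennreal (exp (- l * (ht \<omega> u - ht \<omega> (last (u # p)))))"
    by (simp add: indicator_def)
  also have "\<dots> = ennreal (exp (- l * (ht \<omega> v - ht \<omega> u)) * exp (- l * (ht \<omega> u - ht \<omega> (last (u # p)))))"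
    by (simp add: ennreal_mult)
  also have "exp (- l * (ht \<omega> v - ht \<omega> u)) * exp (- l * (ht \<omega> u - ht \<omega> (last (u # p))))
     = exp (- l * (ht \<omega> v - ht \<omega> (last (u # p))))"
    by (simp add: exp_add[symmetric] algebra_simps)
  finally show ?case by simp
qed simp_all

lemma incr_meas [measurable]: "Measurable.pred PS (\<lambda>\<omega>. incr \<omega> p)"
proof (induction p rule: induct_list012)
  case (3 v u p)
  note 3(2)[measurable]
  show ?case unfolding incr.simps by measurable
qed simp_all

text \<open>On the event in question the weight is at least \<open>exp (- l * t)\<close>, so
  Markov's inequality applies to its integral.\<close>

lemma chain_prob:
  assumes l: "l > 0" and p: "p \<noteq> []"
  shows "measure PS {\<omega>. incr \<omega> p \<and> ht \<omega> (hd p) - ht \<omega> (last p) \<le> t} \<le> (1 / (2 * l)) ^ (length p - 1) * exp (l * t)"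
proof -
  let ?E = "{\<omega>. incr \<omega> p \<and> ht \<omega> (hd p) - ht \<omega> (last p) \<le> t}"
  have E: "?E \<in> sets PS" by (rule sets_PS_I) measurable
  have "emeasure PS ?E = (\<integral>\<^sup>+\<omega>. indicator ?E \<omega> \<partial>PS)" using E by simp
  also have "\<dots> \<le> (\<integral>\<^sup>+\<omega>. ennreal (exp (l * t)) * wt l \<omega> p \<partial>PS)"
  proof (rule nn_integral_mono)
    fix \<omega>
    show "indicator ?E \<omega> \<le> ennreal (exp (l * t)) * wt l \<omega> p"
    proof (cases "\<omega> \<in> ?E")
      case True
      have "l * (ht \<omega> (hd p) - ht \<omega> (last p)) \<le> l * t"
        using True l by (intro mult_left_mono) auto
      hence "1 \<le> exp (l * t + - l * (ht \<omega> (hd p) - ht \<omega> (last p)))" by simp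
      hence "1 \<le> ennreal (exp (l * t) * exp (- l * (ht \<omega> (hd p) - ht \<omega> (last p))))"
        by (simp add: exp_add[symmetric])
      also have "\<dots> = ennreal (exp (l * t)) * wt l \<omega> p"
        using True wt_incr[of \<omega> p l] p by (simp add: ennreal_mult)
      finally show ?thesis using True by simp
    qed simp
  qed
  also have "\<dots> = ennreal (exp (l * t)) * (\<integral>\<^sup>+\<omega>. wt l \<omega> p \<partial>PS)"
    by (rule nn_integral_cmult) measurable
  also have "\<dots> \<le> ennreal (exp (l * t)) * ennreal ((1 / (2 * l)) ^ (length p - 1))"
    by (intro mult_left_mono nn_wt l) simp
  also have "\<dots> = ennreal ((1 / (2 * l)) ^ (length p - 1) * exp (l * t))"
    using l by (simp add: ennreal_mult[symmetric] mult.commute)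
  finally show ?thesis using l by (simp add: PS.emeasure_eq_measure)
qed

text \<open>A union bound with at most \<open>19 ^ CARD('n)\<close> continuations per step. Any
  \<open>l\<close> larger than half of this number makes the bound geometrically small in
  \<open>m\<close>.\<close>

lemma chains_prob:
  fixes x :: "'n::{finite,linorder} site"
  assumes l: "l > 0"
  shows "measure PS {\<omega>. \<exists>p\<in>CH x m. incr \<omega> p \<and> ht \<omega> (hd p) - ht \<omega> x \<le> t}
     \<le> (real (19 ^ CARD('n)) / (2 * l)) ^ m * exp (l * t)"
proof -
  let ?E = "\<lambda>p. {\<omega>. incr \<omega> p \<and> ht \<omega> (hd p) - ht \<omega> (last p) \<le> t}"
  have "{\<omega>. \<exists>p\<in>CH x m. incr \<omega> p \<and> ht \<omega> (hd p) - ht \<omega> x \<le> t} = (\<Union>p\<in>CH x m. ?E p)"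
    using CH_length by auto
  also have "measure PS \<dots> \<le> (\<Sum>p\<in>CH x m. measure PS (?E p))"
    by (rule PS.finite_measure_subadditive_finite) (auto intro!: sets_PS_I)
  also have "\<dots> \<le> (\<Sum>p\<in>CH x m. (1 / (2 * l)) ^ m * exp (l * t))"
  proof (rule sum_mono)
    fix p assume "p \<in> CH x m"
    from CH_length[OF this] chain_prob[OF l, of p t]
    show "measure PS (?E p) \<le> (1 / (2 * l)) ^ m * exp (l * t)" by simp
  qed
  also have "\<dots> = real (card (CH x m)) * ((1 / (2 * l)) ^ m * exp (l * t))" by simp
  also have "\<dots> \<le> real ((19 ^ CARD('n)) ^ m) * ((1 / (2 * l)) ^ m * exp (l * t))"
    using l card_CH[of x m] by (intro mult_right_mono) (auto simp del: of_nat_power)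
  also have "\<dots> = (real (19 ^ CARD('n)) / (2 * l)) ^ m * exp (l * t)"
    by (simp add: power_divide power_mult_distrib)
  finally show ?thesis .
qed

lemma sucL_CH: "(sucL \<omega> n ^^ m) x v \<Longrightarrow> \<exists>p\<in>CH x m. incr \<omega> p \<and> hd p = v"
proof (induction m arbitrary: v)
  case (Suc m)
  then obtain a where a: "(sucL \<omega> n ^^ m) x a" "sucL \<omega> n a v" by auto
  from Suc.IH[OF a(1)] obtain p where p: "p \<in> CH x m" "incr \<omega> p" "hd p = a" by blast
  have v: "v \<in> nb (hd p)" "ht \<omega> a < ht \<omega> v" using a(2) p(3) by (auto simp: sucL_def suc_def)
  hence "v # p \<in> CH x (Suc m)" using p(1) by auto
  moreover have "incr \<omega> (v # p)" using p v by (cases p) auto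
  ultimately show ?case by force
qed auto

lemma inc_CH: "(inc \<omega> n ^^ m) x v \<Longrightarrow> \<exists>p\<in>CH x m. incr \<omega> p \<and> hd p = v"
proof (induction m arbitrary: v)
  case (Suc m)
  then obtain a where a: "(inc \<omega> n ^^ m) x a" "inc \<omega> n a v" by auto
  from Suc.IH[OF a(1)] obtain p where p: "p \<in> CH x m" "incr \<omega> p" "hd p = a" by blast
  have v: "v \<in> nb (hd p)" "ht \<omega> a < ht \<omega> v" using a(2) p(3) by (auto simp: inc_def)
  hence "v # p \<in> CH x (Suc m)" using p(1) by auto
  moreover have "incr \<omega> (v # p)" using p v by (cases p) auto
  ultimately show ?case by force
qed auto

text \<open>A path that stops early is padded by repeating its last site, which is a neighbour of
  itself. A deterministic finite family of chains thus covers whatever the random path visits in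
  \<open>m\<close> steps, as a union bound requires.\<close>

lemma CH_exists:
  "\<exists>p\<in>CH x m. (\<forall>k\<le>m. \<forall>v. (sucL \<omega> n ^^ k) x v \<longrightarrow> v \<in> set p) \<and> (\<forall>v. (sucL \<omega> n ^^ m) x v \<longrightarrow> hd p = v)"
proof (induction m)
  case (Suc m)
  then obtain p where p: "p \<in> CH x m" "\<forall>k\<le>m. \<forall>v. (sucL \<omega> n ^^ k) x v \<longrightarrow> v \<in> set p"
    "\<forall>v. (sucL \<omega> n ^^ m) x v \<longrightarrow> hd p = v" by blast
  have uniq: "v = v'" if "sucL \<omega> n a v" "sucL \<omega> n a v'" for a v v'
    using that suc_fun by (auto simp: sucL_def)
  define b where "b = (if \<exists>v. sucL \<omega> n (hd p) v then SOME v. sucL \<omega> n (hd p) v else hd p)"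
  have b: "sucL \<omega> n (hd p) v \<Longrightarrow> v = b" for v
    unfolding b_def by (metis someI_ex uniq)
  have bn: "b \<in> nb (hd p)"
  proof (cases "\<exists>v. sucL \<omega> n (hd p) v")
    case True
    hence "sucL \<omega> n (hd p) b" unfolding b_def by (simp add: someI_ex)
    thus ?thesis by (simp add: sucL_def suc_def)
  qed (simp add: b_def)
  have "(sucL \<omega> n ^^ Suc m) x v \<Longrightarrow> v = b" for v
    using p(3) b by auto
  hence "(\<forall>k\<le>Suc m. \<forall>v. (sucL \<omega> n ^^ k) x v \<longrightarrow> v \<in> set (b # p)) \<and>
      (\<forall>v. (sucL \<omega> n ^^ Suc m) x v \<longrightarrow> hd (b # p) = v)"
    using p(2) by (auto simp: le_Suc_eq simp del: relpowp.simps)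
  moreover have "b # p \<in> CH x (Suc m)" using p(1) bn by auto
  ultimately show ?case by blast
qed auto

lemma dep_indep_finite:
  fixes Q :: "'j \<Rightarrow> ('i \<Rightarrow> real^'n::finite) \<Rightarrow> bool"
  assumes "finite K" "\<And>j. j \<in> K \<Longrightarrow> Measurable.pred PS (Q j)" "\<And>j. j \<in> K \<Longrightarrow> dep (D j) (Q j)"
    "disjoint_family_on D K"
  shows "measure PS {\<omega>. \<forall>j\<in>K. Q j \<omega>} = (\<Prod>j\<in>K. measure PS {\<omega>. Q j \<omega>})"
  using assms
proof (induction K rule: finite_induct)
  case empty
  then show ?case using PS.prob_space by simp
next
  case (insert k K)
  have m: "Measurable.pred PS (\<lambda>\<omega>. \<forall>j\<in>K. Q j \<omega>)"
    using insert by (intro pred_intros_finite) auto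
  have d: "dep (\<Union>j\<in>K. D j) (\<lambda>\<omega>. \<forall>j\<in>K. Q j \<omega>)"
    using insert.prems(2) by (intro dep_ball dep_mono[where B="\<Union>j\<in>K. D j"]) auto
  have "measure PS {\<omega>. Q k \<omega> \<and> (\<forall>j\<in>K. Q j \<omega>)} = measure PS {\<omega>. Q k \<omega>} * measure PS {\<omega>. \<forall>j\<in>K. Q j \<omega>}"
    by (rule dep_indep[OF _ m _ d]) (use insert in \<open>auto simp: disjoint_family_on_def\<close>)
  thus ?case using insert by (simp add: disjoint_family_on_insert)
qed

text \<open>A spacing of 20 keeps the nine rows below a level, which \<open>Bad\<close> reads, apart
  from the rows up to two above the previous level, which \<open>Gam\<close> reads at a renewal. The
  offset puts \<open>up z\<close> for a centre at level \<open>k\<close> into row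
  \<open>20 * k\<close>, a translate of the initial row 0.\<close>

definition lev :: "nat \<Rightarrow> int" where "lev j = 20 * int j - 1"

definition nbrs :: "'n::finite itself \<Rightarrow> real" where "nbrs _ = real (19 ^ CARD('n))"

lemma nbrs_pos: "nbrs TYPE('n::finite) > 0" "nbrs TYPE('n) \<ge> 1" by (simp_all add: nbrs_def)

section \<open>Exponential tails: long paths and obstructed levels\<close>

context lowdim begin

text \<open>With \<open>l\<close> equal to the bound on the number of neighbours every step costs a
  factor 1/2, against an exponential in the number of rows to be climbed.\<close>

lemma Long_prob:
  fixes x :: "'n site"
  shows "measure PS {\<omega>. Long \<omega> x n m} \<le> (1/2) ^ m * exp (nbrs TYPE('n) * real_of_int (n - x $ dd)) \<or> n < x $ dd"
proof (cases "n < x $ dd")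
  case False
  let ?N = "nbrs TYPE('n)"
  have "{\<omega>. Long \<omega> x n m} \<subseteq> {\<omega>. \<exists>p\<in>CH x m. incr \<omega> p \<and> ht \<omega> (hd p) - ht \<omega> x \<le> real_of_int (n - x $ dd)}"
  proof
    fix \<omega> :: "'n env" assume "\<omega> \<in> {\<omega>. Long \<omega> x n m}"
    then obtain v where v: "(sucL \<omega> n ^^ m) x v" by (auto simp: Long_def)
    have "ht \<omega> v - ht \<omega> x \<le> real_of_int (n - x $ dd)"
    proof (cases m)
      case (Suc k)
      then obtain a where "sucL \<omega> n a v" using v by auto
      hence "ht \<omega> v \<le> real_of_int n - 2" using suc_ht_le[of \<omega> a v] by (simp add: sucL_def)
      thus ?thesis using ht_bound(1)[of \<omega> x] by simp
    qed (use v False in simp)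
    thus "\<omega> \<in> {\<omega>. \<exists>p\<in>CH x m. incr \<omega> p \<and> ht \<omega> (hd p) - ht \<omega> x \<le> real_of_int (n - x $ dd)}"
      using sucL_CH[OF v] by auto
  qed
  hence "measure PS {\<omega>. Long \<omega> x n m}
      \<le> measure PS {\<omega>. \<exists>p\<in>CH x m. incr \<omega> p \<and> ht \<omega> (hd p) - ht \<omega> x \<le> real_of_int (n - x $ dd)}"
    by (rule PS.finite_measure_mono) (rule sets_PS_I, measurable)
  also have "\<dots> \<le> (?N / (2 * ?N)) ^ m * exp (?N * real_of_int (n - x $ dd))"
    unfolding nbrs_def by (rule chains_prob) simp
  finally show ?thesis using nbrs_pos[where 'n='n] by simp
qed simp

text \<open>All heights of the chain lie between \<open>n - 8\<close> and \<open>n\<close>, a window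
  of fixed size, so the probability becomes arbitrarily small by the choice of
  \<open>A\<close>.\<close>

lemma Bad_prob:
  fixes v :: "'n site"
  shows "measure PS {\<omega>. Bad A \<omega> n v} \<le> (1/2) ^ A * exp (nbrs TYPE('n) * 8)"
proof -
  let ?N = "nbrs TYPE('n)"
  have "{\<omega>. Bad A \<omega> n v} \<subseteq> {\<omega>. \<exists>p\<in>CH v A. incr \<omega> p \<and> ht \<omega> (hd p) - ht \<omega> v \<le> 8}"
  proof
    fix \<omega> :: "'n env" assume "\<omega> \<in> {\<omega>. Bad A \<omega> n v}"
    then obtain u where v: "(inc \<omega> n ^^ A) v u" "real_of_int n - 8 < ht \<omega> v" "v $ dd < n" by (auto simp: Bad_def)
    have "u $ dd < n" using v(1,3) by (cases A) (auto simp: inc_def)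
    hence "ht \<omega> u - ht \<omega> v \<le> 8" using v(2) ht_bound(2)[of \<omega> u] by linarith
    thus "\<omega> \<in> {\<omega>. \<exists>p\<in>CH v A. incr \<omega> p \<and> ht \<omega> (hd p) - ht \<omega> v \<le> 8}"
      using inc_CH[OF v(1)] by auto
  qed
  hence "measure PS {\<omega>. Bad A \<omega> n v} \<le> measure PS {\<omega>. \<exists>p\<in>CH v A. incr \<omega> p \<and> ht \<omega> (hd p) - ht \<omega> v \<le> 8}"
    by (rule PS.finite_measure_mono) (rule sets_PS_I, measurable)
  also have "\<dots> \<le> (?N / (2 * ?N)) ^ A * exp (?N * 8)"
    unfolding nbrs_def by (rule chains_prob) simp
  finally show ?thesis using nbrs_pos[where 'n='n] by simp
qed

text \<open>For a fixed list of sites the events at different levels read disjoint slabs and are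
  independent. The bound \<open>k \<le> 2 ^ k\<close> turns the number of list entries in each slab
  into a factor, and all slabs together contain at most \<open>length p\<close> entries.\<close>

lemma many_bad_chain:
  fixes p :: "'n site list"
  assumes q: "\<And>n v. measure PS {\<omega>::'n env. Bad A \<omega> n v} \<le> q" "0 \<le> q" and K: "finite K"
  shows "measure PS {\<omega>. \<forall>j\<in>K. \<exists>u\<in>set p. Bad A \<omega> (lev j) u} \<le> 2 ^ length p * q ^ card K"
proof -
  let ?B = "\<lambda>j. {u \<in> set p. lev j - 9 \<le> u $ dd \<and> u $ dd < lev j}"
  let ?D = "\<lambda>j. {w::'n site. lev j - 9 \<le> w $ dd \<and> w $ dd < lev j}"
  let ?Q = "\<lambda>j \<omega>. \<exists>u\<in>set p. Bad A \<omega> (lev j) u"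
  have disj: "i = j" if "w \<in> ?D i" "w \<in> ?D j" for w i j
    using that by (auto simp: lev_def)
  have "measure PS {\<omega>. \<forall>j\<in>K. ?Q j \<omega>} = (\<Prod>j\<in>K. measure PS {\<omega>. ?Q j \<omega>})"
  proof (rule dep_indep_finite[where D="?D"])
    show "dep (?D j) (?Q j)" for j
      using depD[OF Bad_dep[of "lev j" A]] unfolding dep_def by blast
    show "disjoint_family_on ?D K" using disj by (force simp: disjoint_family_on_def)
  qed (use K in \<open>auto intro!: pred_intros_finite\<close>)
  also have "\<dots> \<le> (\<Prod>j\<in>K. 2 ^ card (?B j) * q)"
  proof (rule prod_mono, intro conjI)
    fix j
    have "{\<omega>. ?Q j \<omega>} = (\<Union>u\<in>?B j. {\<omega>. Bad A \<omega> (lev j) u})" by (auto simp: Bad_def)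
    also have "measure PS \<dots> \<le> (\<Sum>u\<in>?B j. measure PS {\<omega>. Bad A \<omega> (lev j) u})"
      by (rule PS.finite_measure_subadditive_finite) (auto intro!: sets_PS_I)
    also have "\<dots> \<le> (\<Sum>u\<in>?B j. q)" by (rule sum_mono) (rule q)
    also have "\<dots> = real (card (?B j)) * q" by simp
    also have "\<dots> \<le> 2 ^ card (?B j) * q"
      using q(2) of_nat_less_two_power[of "card (?B j)", where 'a=real] by (intro mult_right_mono) auto
    finally show "measure PS {\<omega>. ?Q j \<omega>} \<le> 2 ^ card (?B j) * q" .
  qed simp
  also have "\<dots> = 2 ^ (\<Sum>j\<in>K. card (?B j)) * q ^ card K"
    by (simp add: prod.distrib power_sum)
  also have "(\<Sum>j\<in>K. card (?B j)) = card (\<Union>j\<in>K. ?B j)"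
    by (rule card_UN_disjoint[symmetric]) (use K disj in \<open>auto\<close>)
  also have "(2::real) ^ card (\<Union>j\<in>K. ?B j) \<le> 2 ^ length p"
  proof (rule power_increasing)
    have "card (\<Union>j\<in>K. ?B j) \<le> card (set p)" by (rule card_mono) auto
    thus "card (\<Union>j\<in>K. ?B j) \<le> length p" using card_length[of p] by simp
  qed simp
  finally show ?thesis using q(2) by (simp add: mult_right_mono)
qed

definition Fail :: "nat \<Rightarrow> 'n env \<Rightarrow> 'n site \<Rightarrow> nat \<Rightarrow> bool" where
  "Fail A \<omega> x j \<longleftrightarrow> (\<exists>v. Ent \<omega> x (lev j) v \<and> Bad A \<omega> (lev j) v)"

lemma Fail_meas [measurable]: "Measurable.pred PS (\<lambda>\<omega>. Fail A \<omega> x j)"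
  unfolding Fail_def by measurable

text \<open>The path is random, but its visited sites belong to one of finitely many chains, so the
  union runs over these chains and over the sets of failing levels. The fourth power in the
  hypothesis compensates that only a quarter of the levels need fail.\<close>

lemma many_bad:
  fixes x :: "'n site"
  assumes q: "\<And>n v. measure PS {\<omega>::'n env. Bad A \<omega> n v} \<le> s ^ 4" "0 \<le> s" "s \<le> 1"
  shows "measure PS {\<omega>. \<not> Long \<omega> x (lev t) m \<and> t \<le> 4 * card {j\<in>{1..t}. Fail A \<omega> x j}}
    \<le> 2 * (2 * nbrs TYPE('n)) ^ m * (2 * s) ^ t"
proof -
  let ?I = "CH x m \<times> {K. K \<subseteq> {1..t} \<and> t \<le> 4 * card K}"
  let ?E = "\<lambda>(p, K). {\<omega>::'n env. \<forall>j\<in>K. \<exists>u\<in>set p. Bad A \<omega> (lev j) u}"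
  have fin: "finite ?I" by simp
  have meas: "?E pk \<in> sets PS" if "pk \<in> ?I" for pk
  proof -
    have "finite (snd pk)" using that finite_subset[of "snd pk" "{1..t}"] by auto
    thus ?thesis using that by (cases pk) (auto intro!: sets_PS_I pred_intros_finite)
  qed
  have "{\<omega>. \<not> Long \<omega> x (lev t) m \<and> t \<le> 4 * card {j\<in>{1..t}. Fail A \<omega> x j}} \<subseteq> (\<Union>pk\<in>?I. ?E pk)"
  proof
    fix \<omega> :: "'n env" assume "\<omega> \<in> {\<omega>. \<not> Long \<omega> x (lev t) m \<and> t \<le> 4 * card {j\<in>{1..t}. Fail A \<omega> x j}}"
    hence w: "\<not> Long \<omega> x (lev t) m" "t \<le> 4 * card {j\<in>{1..t}. Fail A \<omega> x j}" by auto
    obtain p where p: "p \<in> CH x m" "\<forall>k\<le>m. \<forall>v. (sucL \<omega> (lev t) ^^ k) x v \<longrightarrow> v \<in> set p"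
      using CH_exists[of x m \<omega> "lev t"] by blast
    have "\<exists>u\<in>set p. Bad A \<omega> (lev j) u" if j: "j \<in> {j\<in>{1..t}. Fail A \<omega> x j}" for j
    proof -
      obtain v where v: "Ent \<omega> x (lev j) v" "Bad A \<omega> (lev j) v" using j by (auto simp: Fail_def)
      have le: "lev j \<le> lev t" using j by (simp add: lev_def)
      obtain k where k: "k < m" "(sucL \<omega> (lev j) ^^ k) x v" using Ent_not_Long[OF v(1) w(1) le] by blast
      hence "v \<in> set p" using p(2) sucL_mono[OF le k(2)] k(1) by (meson less_imp_le)
      thus ?thesis using v(2) by blast
    qed
    hence "\<omega> \<in> ?E (p, {j\<in>{1..t}. Fail A \<omega> x j})" by auto
    moreover have "(p, {j\<in>{1..t}. Fail A \<omega> x j}) \<in> ?I" using p(1) w(2) by auto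
    ultimately show "\<omega> \<in> (\<Union>pk\<in>?I. ?E pk)" by blast
  qed
  hence "measure PS {\<omega>. \<not> Long \<omega> x (lev t) m \<and> t \<le> 4 * card {j\<in>{1..t}. Fail A \<omega> x j}} \<le> measure PS (\<Union>pk\<in>?I. ?E pk)"
    using meas fin by (intro PS.finite_measure_mono sets.finite_UN)
  also have "\<dots> \<le> (\<Sum>pk\<in>?I. measure PS (?E pk))"
    using meas fin by (intro PS.finite_measure_subadditive_finite) auto
  also have "\<dots> \<le> (\<Sum>pk\<in>?I. 2 ^ Suc m * s ^ t)"
  proof (rule sum_mono)
    fix pk assume pk: "pk \<in> ?I"
    obtain p K where [simp]: "pk = (p, K)" by (cases pk)
    have K: "finite K" "t \<le> 4 * card K" and p: "length p = Suc m" using pk CH_length finite_subset[of K "{1..t}"] by auto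
    have "measure PS (?E pk) \<le> 2 ^ Suc m * (s ^ 4) ^ card K"
      using many_bad_chain[OF q(1) _ K(1), of p] q(2) p by simp
    also have "(s ^ 4) ^ card K = s ^ (4 * card K)" by (simp add: power_mult)
    also have "\<dots> \<le> s ^ t" using K(2) q by (intro power_decreasing) auto
    finally show "measure PS (?E pk) \<le> 2 ^ Suc m * s ^ t" by simp
  qed
  also have "\<dots> = real (card ?I) * (2 ^ Suc m * s ^ t)" by simp
  also have "\<dots> \<le> (nbrs TYPE('n) ^ m * 2 ^ t) * (2 ^ Suc m * s ^ t)"
  proof (rule mult_right_mono)
    have "card {K. K \<subseteq> {1..t} \<and> t \<le> 4 * card K} \<le> card (Pow {1..t})" by (rule card_mono) auto
    hence "card {K. K \<subseteq> {1..t} \<and> t \<le> 4 * card K} \<le> 2 ^ t" by (simp add: card_Pow)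
    hence "card ?I \<le> (19 ^ CARD('n)) ^ m * 2 ^ t"
      unfolding card_cartesian_product using card_CH[of x m] by (intro mult_le_mono)
    hence "real (card ?I) \<le> real ((19 ^ CARD('n)) ^ m * 2 ^ t)" by (simp only: of_nat_le_iff)
    thus "real (card ?I) \<le> nbrs TYPE('n) ^ m * 2 ^ t" by (simp add: nbrs_def)
  qed (use q in simp)
  also have "\<dots> = 2 * (2 * nbrs TYPE('n)) ^ m * (2 * s) ^ t" by (simp add: power_mult_distrib)
  finally show ?thesis .
qed

text \<open>The constants are chosen in the order \<open>C\<close>, \<open>s\<close>,
  \<open>A\<close>. First \<open>C\<close> makes long paths unlikely in spite of the 20 rows per
  level; then \<open>s\<close> outweighs the number \<open>(2 * N) ^ C\<close> of chains per level,
  where \<open>N\<close> bounds the number of neighbours; finally \<open>A\<close> makes bad entries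
  as rare as \<open>s ^ 4\<close>.\<close>

lemma good_levels:
  "\<exists>C A::nat. \<forall>x::'n site. \<forall>t. measure PS {\<omega>. Long \<omega> x (lev t) (C * t)} \<le> exp (nbrs TYPE('n) * real_of_int \<bar>x $ dd\<bar>) * (1/2) ^ t
    \<and> measure PS {\<omega>. \<not> Long \<omega> x (lev t) (C * t) \<and> t \<le> 4 * card {j\<in>{1..t}. Fail A \<omega> x j}} \<le> 2 * (1/2) ^ t"
proof -
  let ?N = "nbrs TYPE('n)"
  have N: "?N \<ge> 1" by (rule nbrs_pos)
  define e where "e = exp (- 20 * ?N)"
  have e: "e \<le> 1" "e > 0" unfolding e_def using N by auto
  obtain C where C: "(1/2 :: real) ^ C < e / 2"
    using real_arch_pow_inv[of "e / 2" "1/2"] e by auto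
  have C0: "C \<noteq> 0" using C e by (cases "C = 0") auto
  have C': "(1/2) ^ C * exp (20 * ?N) \<le> 1/2"
  proof -
    have "(1/2) ^ C * exp (20 * ?N) \<le> e / 2 * exp (20 * ?N)"
      using C by (intro mult_right_mono) auto
    also have "\<dots> = 1/2" by (simp add: e_def exp_minus field_simps)
    finally show ?thesis .
  qed
  define Q where "Q = (2 * ?N) ^ C"
  have Q: "1 \<le> Q" unfolding Q_def using N by (intro one_le_power) simp
  define s where "s = 1 / (4 * Q)"
  have s: "0 < s" "s \<le> 1" unfolding s_def using Q by (auto simp: field_simps)
  have "Q * (2 * s) = 1/2" unfolding s_def using Q by (auto simp: field_simps)
  hence s': "(2 * ?N) ^ C * (2 * s) = 1/2" unfolding Q_def .
  obtain A where A: "(1/2 :: real) ^ A < s ^ 4 * exp (- ?N * 8)"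
    using real_arch_pow_inv[of "s ^ 4 * exp (- ?N * 8)" "1/2"] s by auto
  have A': "(1/2) ^ A * exp (?N * 8) \<le> s ^ 4"
  proof -
    have "(1/2) ^ A * exp (?N * 8) \<le> s ^ 4 * exp (- ?N * 8) * exp (?N * 8)"
      using A by (intro mult_right_mono) auto
    also have "\<dots> = s ^ 4" by (simp add: exp_minus field_simps)
    finally show ?thesis .
  qed
  have bad: "measure PS {\<omega>::'n env. Bad A \<omega> n v} \<le> s ^ 4" for n v
    using Bad_prob[of A n v] A' by linarith
  have 1: "measure PS {\<omega>::'n env. Long \<omega> x (lev t) (C * t)} \<le> exp (?N * real_of_int \<bar>x $ dd\<bar>) * (1/2) ^ t" for x t
    proof (cases "lev t < x $ dd")
      case True
      show ?thesis
      \<comment> \<open>Zero steps are always possible, so for \<open>t = 0\<close> the bound holds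
        only because its right-hand side is at least 1. For \<open>t > 0\<close> a start above the
        level is too high to make even one step.\<close>
      proof (cases "t = 0")
        case True
        have "(1::real) \<le> exp (?N * real_of_int \<bar>x $ dd\<bar>)" using N by simp
        hence "1 \<le> exp (?N * real_of_int \<bar>x $ dd\<bar>) * (1/2) ^ t" using True by simp
        thus ?thesis by (rule order_trans[OF PS.prob_le_1])
      next
        case False
        then obtain k where k: "C * t = Suc k" using C0 by (metis mult_eq_0_iff not0_implies_Suc)
        have "\<not> Long \<omega> x (lev t) (C * t)" for \<omega> :: "'n env"
        proof
          assume "Long \<omega> x (lev t) (C * t)"
          then obtain v where "(sucL \<omega> (lev t) ^^ Suc k) x v" unfolding Long_def k by blast
          then obtain y where "sucL \<omega> (lev t) x y" by (metis relpowp_Suc_D2)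
          thus False using True ht_bound(1)[of \<omega> x] by (simp add: sucL_def)
        qed
        thus ?thesis by simp
      qed
    next
      case False
      hence "measure PS {\<omega>. Long \<omega> x (lev t) (C * t)} \<le> (1/2) ^ (C * t) * exp (?N * real_of_int (lev t - x $ dd))"
        using Long_prob[of x "lev t" "C * t"] by simp
      also have "\<dots> \<le> (1/2) ^ (C * t) * exp (real t * (20 * ?N) + ?N * real_of_int \<bar>x $ dd\<bar>)"
      proof -
        have "?N * real_of_int (lev t - x $ dd) \<le> ?N * (20 * real t + real_of_int \<bar>x $ dd\<bar>)"
          using N by (intro mult_left_mono) (auto simp: lev_def)
        thus ?thesis by (simp add: algebra_simps)
      qed
      also have "\<dots> = exp (?N * real_of_int \<bar>x $ dd\<bar>) * ((1/2) ^ C * exp (20 * ?N)) ^ t"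
        by (simp add: exp_add exp_of_nat_mult power_mult power_mult_distrib)
      also have "\<dots> \<le> exp (?N * real_of_int \<bar>x $ dd\<bar>) * (1/2) ^ t"
        using C' by (intro mult_left_mono power_mono) auto
      finally show ?thesis .
    qed
  have 2: "measure PS {\<omega>::'n env. \<not> Long \<omega> x (lev t) (C * t) \<and> t \<le> 4 * card {j\<in>{1..t}. Fail A \<omega> x j}} \<le> 2 * (1/2) ^ t" for x t
  proof -
    have "measure PS {\<omega>::'n env. \<not> Long \<omega> x (lev t) (C * t) \<and> t \<le> 4 * card {j\<in>{1..t}. Fail A \<omega> x j}}
      \<le> 2 * (2 * ?N) ^ (C * t) * (2 * s) ^ t"
      by (rule many_bad[OF bad]) (use s in auto)
    also have "\<dots> = 2 * ((2 * ?N) ^ C * (2 * s)) ^ t"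
      by (simp add: power_mult power_mult_distrib)
    also have "\<dots> = 2 * (1/2) ^ t" unfolding s' ..
    finally show ?thesis .
  qed
  show ?thesis by (intro exI[of _ C] exI[of _ A] allI conjI 1 2)
qed

end

subsection \<open>Almost surely there are no ties\<close>

text \<open>Resampling the perturbation of \<open>u\<close> alone keeps the distance from
  \<open>w\<close> to \<open>v\<close> fixed, while the distance to \<open>u\<close> takes a given
  value only on an l1 sphere.\<close>

lemma AE_no_tie1:
  fixes w u v :: "'n::{finite,linorder} site"
  assumes "u \<noteq> v" "u \<noteq> w"
  shows "AE \<omega> in PS. ds \<omega> w u \<noteq> ds \<omega> w v"
proof -
  let ?E = "{\<omega>. ds \<omega> w u = ds \<omega> w v}"
  have "?E = {\<omega>. \<not> ds \<omega> w u < ds \<omega> w v \<and> \<not> ds \<omega> w v < ds \<omega> w u}" by auto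
  hence E: "?E \<in> sets PS" by (simp only:) (rule sets_PS_I, measurable)
  have "emeasure PS ?E = (\<integral>\<^sup>+\<omega>. indicator ?E \<omega> \<partial>PS)" using E by simp
  also have "\<dots> = (\<integral>\<^sup>+\<omega>. (\<integral>\<^sup>+x. indicator ?E (fun_upd \<omega> u x) \<partial>mu0) \<partial>PS)"
    by (rule nn_resample) (use E in simp)
  also have "\<dots> = (\<integral>\<^sup>+\<omega>. 0 \<partial>(PS :: 'n env measure))"
  proof (rule nn_integral_cong)
    fix \<omega> :: "'n env"
    define a where "a = (\<chi> i. real_of_int (u $ i)) - pos \<omega> w"
    define b where "b = ds \<omega> w v"
    have 1: "ds (fun_upd \<omega> u x) w u = l1_norm (clip x + a)" for x
      using assms(2) by (simp add: ds_def pos_def a_def algebra_simps)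
    have 2: "ds (fun_upd \<omega> u x) w v = b" for x
      unfolding b_def by (rule ds_cong) (use assms in auto)
    have "AE x in mu0. l1_norm (clip x + a) \<noteq> b"
    proof -
      have "{x. l1_norm (x + a) = b} \<in> null_sets mu0"
        using emeasure_mu0_null[OF l1_sphere_null[of a b]] l1_sphere_null[of a b] by (auto simp: null_sets_def)
      hence "AE x in mu0. x \<notin> {x. l1_norm (x + a) = b}" by (rule AE_not_in)
      thus ?thesis using AE_mu0 by eventually_elim (auto simp: clip_id)
    qed
    hence "(\<integral>\<^sup>+x. indicator ?E (fun_upd \<omega> u x) \<partial>mu0) = (\<integral>\<^sup>+x. 0 \<partial>(mu0 :: (real,'n) vec measure))"
      by (intro nn_integral_cong_AE) (auto simp: 1 2)
    thus "(\<integral>\<^sup>+x. indicator ?E (fun_upd \<omega> u x) \<partial>mu0) = 0" by simp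
  qed
  finally have "?E \<in> null_sets PS" using E by (auto simp: null_sets_def)
  from AE_not_in[OF this] show ?thesis by eventually_elim auto
qed

lemma AE_notie: "AE \<omega> in PS. notie (\<omega> :: 'n::{finite,linorder} env)"
proof -
  have "AE \<omega> in PS. u \<noteq> v \<longrightarrow> ht \<omega> w < ht \<omega> u \<longrightarrow> ht \<omega> w < ht \<omega> v \<longrightarrow> ds \<omega> w u \<noteq> ds \<omega> w v"
    for w u v :: "'n site"
  proof (cases "u = v \<or> u = w")
    case False
    from AE_no_tie1[of u v w] False show ?thesis by auto
  qed auto
  thus ?thesis unfolding notie_def by (simp add: AE_all_countable)
qed

subsection \<open>Symmetries\<close>

text \<open>Signed coordinate permutations. The ring is left generic because the same map acts on
  lattice sites and on real perturbations.\<close>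

definition Lsym :: "('n::finite \<Rightarrow> 'a) \<Rightarrow> ('n \<Rightarrow> 'n) \<Rightarrow> ('a::comm_ring_1) ^ 'n \<Rightarrow> 'a ^ 'n" where
  "Lsym s p x = (\<chi> i. s i * x $ p i)"

lemma Lsym_nth [simp]: "Lsym s p x $ i = s i * x $ p i" by (simp add: Lsym_def)

text \<open>\<open>pp\<close> and \<open>ss\<close> make the linear part an involution, so it serves
  as its own inverse in \<open>gi\<close>. Translations, reflections in one coordinate and
  transpositions of coordinates are the instances used.\<close>

locale symm = lowdim ty for ty :: "'n::{finite,linorder} itself" +
  fixes s :: "'n \<Rightarrow> int" and p :: "'n \<Rightarrow> 'n" and a :: "'n site"
  assumes pp: "p (p i) = i" and ss: "s i * s (p i) = 1" and pdd: "p dd = dd" and sdd: "s dd = 1"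
begin

abbreviation "sr i \<equiv> real_of_int (s i)"

definition g :: "'n site \<Rightarrow> 'n site" where "g w = Lsym s p w + a"

definition gi :: "'n site \<Rightarrow> 'n site" where "gi w = Lsym s p (w - a)"

text \<open>With the perturbation transformed along with the site, the point of \<open>w\<close> in
  the new environment is the image of the point of \<open>g w\<close> under the inverse isometry;
  hence all relations between points are preserved.\<close>

definition \<Phi> :: "'n env \<Rightarrow> 'n env" where "\<Phi> \<omega> w = Lsym sr p (\<omega> (g w))"

lemma s_cases: "s i = 1 \<or> s i = -1"
  using ss[of i] by (metis zmult_eq_1_iff)

lemma abs_s [simp]: "\<bar>s i\<bar> = 1" using s_cases[of i] by auto

lemma sp: "s (p i) = s i" using ss[of i] s_cases[of i] s_cases[of "p i"] by auto

lemma bij_p: "bij p" by (metis bijI' pp)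

lemma p_dd_iff: "p i = dd \<longleftrightarrow> i = dd" by (metis pp pdd)

lemma g_gi [simp]: "g (gi w) = w"
proof -
  have "g (gi w) $ i = w $ i" for i
    using ss[of i] pp[of i] by (simp add: g_def gi_def mult.assoc[symmetric])
  thus ?thesis by (simp add: vec_eq_iff)
qed

lemma gi_g [simp]: "gi (g w) = w"
proof -
  have "gi (g w) $ i = w $ i" for i
    using ss[of i] pp[of i] by (simp add: g_def gi_def mult.assoc[symmetric])
  thus ?thesis by (simp add: vec_eq_iff)
qed

lemma g_inj: "g v = g w \<longleftrightarrow> v = w" by (metis gi_g)

lemma inj_g: "inj g" by (metis injI gi_g)

lemma all_g: "(\<forall>w. P (g w)) \<longleftrightarrow> (\<forall>w. P w)" by (metis g_gi)

lemma ex_g: "(\<exists>w. P (g w)) \<longleftrightarrow> (\<exists>w. P w)" by (metis g_gi)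

lemma g_dd [simp]: "g w $ dd = w $ dd + a $ dd" by (simp add: g_def pdd sdd)

lemma abs_sr: "\<bar>sr i\<bar> = 1" using s_cases[of i] by auto

lemma Lsym_ubox: "Lsym sr p x \<in> ubox \<longleftrightarrow> x \<in> ubox"
proof -
  have "(\<forall>i. \<bar>x $ p i\<bar> \<le> 1) \<longleftrightarrow> (\<forall>i. \<bar>x $ i\<bar> \<le> 1)" by (metis pp)
  thus ?thesis by (simp add: ubox_iff abs_mult abs_sr)
qed

lemma clip_Lsym: "clip (Lsym sr p x) = Lsym sr p (clip x)"
  by (auto simp: clip_def Lsym_ubox vec_eq_iff)

lemma pos_\<Phi>: "pos (\<Phi> \<omega>) w $ i = sr i * (pos \<omega> (g w) $ p i - real_of_int (a $ p i))"
proof -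
  have "g w $ p i = s i * w $ i + a $ p i" by (simp add: g_def sp pp)
  hence "pos \<omega> (g w) $ p i - real_of_int (a $ p i) = sr i * real_of_int (w $ i) + clip (\<omega> (g w)) $ p i"
    by (simp add: pos_nth)
  thus ?thesis using s_cases[of i] by (auto simp: pos_nth \<Phi>_def clip_Lsym)
qed

lemma ht_\<Phi>: "ht (\<Phi> \<omega>) w = ht \<omega> (g w) - real_of_int (a $ dd)"
  by (simp add: ht_def pos_\<Phi> sdd pdd)

lemma ht_\<Phi>_less: "ht (\<Phi> \<omega>) w < ht (\<Phi> \<omega>) v \<longleftrightarrow> ht \<omega> (g w) < ht \<omega> (g v)"
  by (simp add: ht_\<Phi>)

lemma ds_\<Phi>: "ds (\<Phi> \<omega>) w v = ds \<omega> (g w) (g v)"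
proof -
  have "ds (\<Phi> \<omega>) w v = (\<Sum>i\<in>UNIV. \<bar>pos \<omega> (g v) $ p i - pos \<omega> (g w) $ p i\<bar>)"
    unfolding ds_def l1_norm_def
  proof (rule sum.cong)
    fix i
    have "(pos (\<Phi> \<omega>) v - pos (\<Phi> \<omega>) w) $ i = sr i * (pos \<omega> (g v) $ p i - pos \<omega> (g w) $ p i)"
      by (simp add: pos_\<Phi> algebra_simps)
    thus "\<bar>(pos (\<Phi> \<omega>) v - pos (\<Phi> \<omega>) w) $ i\<bar> = \<bar>pos \<omega> (g v) $ p i - pos \<omega> (g w) $ p i\<bar>"
      by (simp add: abs_mult abs_sr)
  qed simp
  also have "\<dots> = (\<Sum>i\<in>UNIV. \<bar>pos \<omega> (g v) $ i - pos \<omega> (g w) $ i\<bar>)"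
    using bij_p by (rule sum.reindex_bij_betw)
  finally show ?thesis by (simp add: ds_def l1_norm_def)
qed

lemma g_diff: "g v $ i - g w $ i = s i * (v $ p i - w $ p i)"
  by (simp add: g_def algebra_simps)

lemma nb_g: "g v \<in> nb (g w) \<longleftrightarrow> v \<in> nb w"
proof -
  have "(\<forall>i. \<bar>v $ p i - w $ p i\<bar> \<le> 9) \<longleftrightarrow> (\<forall>i. \<bar>v $ i - w $ i\<bar> \<le> 9)" by (metis pp)
  thus ?thesis by (simp add: nb_def g_diff abs_mult)
qed

lemma h1_g: "h1 (g v) (g w) = h1 v w"
proof -
  have "h1 (g v) (g w) = (\<Sum>i\<in>-{dd}. \<bar>v $ p i - w $ p i\<bar>)"
    unfolding h1_def by (rule sum.cong) (auto simp: g_diff abs_mult)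
  also have "\<dots> = h1 v w" unfolding h1_def
    by (rule sum.reindex_bij_betw[of p "-{dd}" "-{dd}" "\<lambda>i. \<bar>v $ i - w $ i\<bar>"])
       (auto simp: bij_betw_def inj_on_def p_dd_iff image_iff intro: bexI[of _ "p _"], metis pp, metis pp p_dd_iff Compl_iff singletonD)
  finally show ?thesis .
qed

lemma suc_\<Phi>: "suc (\<Phi> \<omega>) w v \<longleftrightarrow> suc \<omega> (g w) (g v)"
proof -
  have "(\<forall>u\<in>nb (g w). ht \<omega> (g w) < ht \<omega> u \<longrightarrow> u \<noteq> g v \<longrightarrow> ds \<omega> (g w) (g v) < ds \<omega> (g w) u)
    \<longleftrightarrow> (\<forall>u. g u\<in>nb (g w) \<longrightarrow> ht \<omega> (g w) < ht \<omega> (g u) \<longrightarrow> g u \<noteq> g v \<longrightarrow> ds \<omega> (g w) (g v) < ds \<omega> (g w) (g u))"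
    unfolding Ball_def by (metis g_gi)
  thus ?thesis unfolding suc_def by (auto simp: ht_\<Phi>_less ds_\<Phi> nb_g g_inj)
qed

lemma relpowp_g:
  assumes "\<And>x y. R' x y \<longleftrightarrow> R (g x) (g y)"
  shows "(R' ^^ k) x v \<longleftrightarrow> (R ^^ k) (g x) (g v)"
proof (induction k arbitrary: v)
  case (Suc k)
  have "(R' ^^ Suc k) x v \<longleftrightarrow> (\<exists>y. (R' ^^ k) x y \<and> R' y v)" by (auto simp: OO_def)
  also have "\<dots> \<longleftrightarrow> (\<exists>y. (R ^^ k) (g x) (g y) \<and> R (g y) (g v))"
    by (simp only: Suc assms)
  also have "\<dots> \<longleftrightarrow> (R ^^ Suc k) (g x) (g v)"
    using ex_g[of "\<lambda>y. (R ^^ k) (g x) y \<and> R y (g v)"] by (auto simp: OO_def)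
  finally show ?case .
qed (simp add: g_inj)

lemma rtranclp_g:
  assumes "\<And>x y. R' x y \<longleftrightarrow> R (g x) (g y)"
  shows "R'\<^sup>*\<^sup>* x v \<longleftrightarrow> R\<^sup>*\<^sup>* (g x) (g v)"
  using relpowp_g[of R' R, OF assms] by (simp add: rtranclp_power)

lemma sucL_\<Phi>: "sucL (\<Phi> \<omega>) n w v \<longleftrightarrow> sucL \<omega> (n + a $ dd) (g w) (g v)"
  unfolding sucL_def suc_\<Phi> ht_\<Phi> by auto

lemma Ent_\<Phi>: "Ent (\<Phi> \<omega>) x n v \<longleftrightarrow> Ent \<omega> (g x) (n + a $ dd) (g v)"
  unfolding Ent_def using rtranclp_g[of "sucL (\<Phi> \<omega>) n" "sucL \<omega> (n + a $ dd)", OF sucL_\<Phi>]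
  by (auto simp: ht_\<Phi>)

lemma Long_\<Phi>: "Long (\<Phi> \<omega>) x n m \<longleftrightarrow> Long \<omega> (g x) (n + a $ dd) m"
  unfolding Long_def using relpowp_g[of "sucL (\<Phi> \<omega>) n" "sucL \<omega> (n + a $ dd)", OF sucL_\<Phi>] ex_g
  by (metis (mono_tags, lifting))

lemma inc_\<Phi>: "inc (\<Phi> \<omega>) n w v \<longleftrightarrow> inc \<omega> (n + a $ dd) (g w) (g v)"
  unfolding inc_def ht_\<Phi>_less nb_g by auto

lemma Bad_\<Phi>: "Bad A (\<Phi> \<omega>) n v \<longleftrightarrow> Bad A \<omega> (n + a $ dd) (g v)"
proof -
  have "(\<exists>u. (inc (\<Phi> \<omega>) n ^^ A) v u) \<longleftrightarrow> (\<exists>u. (inc \<omega> (n + a $ dd) ^^ A) (g v) u)"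
    using relpowp_g[of "inc (\<Phi> \<omega>) n" "inc \<omega> (n + a $ dd)", OF inc_\<Phi>]
      ex_g[of "\<lambda>u. (inc \<omega> (n + a $ dd) ^^ A) (g v) u"] by auto
  thus ?thesis unfolding Bad_def by (auto simp: ht_\<Phi>)
qed

lemma abs_p: "(\<forall>i. i \<noteq> dd \<longrightarrow> \<bar>sr i * x $ p i\<bar> \<le> c) \<longleftrightarrow> (\<forall>i. i \<noteq> dd \<longrightarrow> \<bar>x $ i\<bar> \<le> c)"
  by (simp add: abs_mult abs_sr) (metis pp p_dd_iff)

lemma tbox_\<Phi>: "Lsym sr p x \<in> tbox r k \<longleftrightarrow> x \<in> tbox r k"
  unfolding tbox_def mem_Collect_eq Lsym_nth abs_p by (simp add: pdd sdd)

lemma Tilt_\<Phi>: "Tilt r (\<Phi> \<omega>) z \<longleftrightarrow> Tilt r \<omega> (g z)"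
proof -
  have "Tilt r \<omega> (g z) \<longleftrightarrow> (\<forall>w. g w $ dd = g z $ dd \<longrightarrow> h1 (g w) (g z) \<le> int r \<longrightarrow> \<omega> (g w) \<in> tbox r (h1 (g w) (g z)))"
    unfolding Tilt_def by (rule all_g[symmetric])
  thus ?thesis unfolding Tilt_def h1_g \<Phi>_def tbox_\<Phi> by simp
qed

lemma gbox_\<Phi>: "Lsym sr p x \<in> gbox y w \<longleftrightarrow> x \<in> gbox (g y) (g w)"
proof (cases "w = y")
  case True
  show ?thesis unfolding gbox_def True simp_thms(6) if_True mem_Collect_eq Lsym_nth abs_p by (simp add: pdd sdd)
next
  case False
  thus ?thesis by (simp add: gbox_def g_inj Lsym_ubox pdd sdd)
qed

lemma Gam_\<Phi>: "Gam r (\<Phi> \<omega>) y \<longleftrightarrow> Gam r \<omega> (g y)"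
proof -
  have "Gam r \<omega> (g y) \<longleftrightarrow> (\<forall>w. g w $ dd \<in> {g y $ dd, g y $ dd + 1} \<longrightarrow> h1 (g w) (g y) \<le> int r \<longrightarrow> \<omega> (g w) \<in> gbox (g y) (g w))"
    unfolding Gam_def by (rule all_g[symmetric])
  thus ?thesis unfolding Gam_def h1_g \<Phi>_def gbox_\<Phi> by simp
qed

lemma up_g: "up (g z) = g (up z)"
  by (auto simp: vec_eq_iff up_def g_def pdd sdd p_dd_iff)

lemma Rgp_\<Phi>: "Rgp A r (\<Phi> \<omega>) x n z \<longleftrightarrow> Rgp A r \<omega> (g x) (n + a $ dd) (g z)"
proof -
  have "Rgp A r \<omega> (g x) (n + a $ dd) (g z) \<longleftrightarrow> (\<exists>v. Ent \<omega> (g x) (n + a $ dd) (g v) \<and> \<not> Bad A \<omega> (n + a $ dd) (g v)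
      \<and> g z $ dd = n + a $ dd \<and> h1 (g z) (g v) \<le> 1 \<and> Tilt r \<omega> (g z))"
    unfolding Rgp_def by (rule ex_g[symmetric])
  thus ?thesis unfolding Rgp_def Ent_\<Phi> Bad_\<Phi> Tilt_\<Phi> h1_g by simp
qed

lemma Coal_\<Phi>: "Coal (\<Phi> \<omega>) x y \<longleftrightarrow> Coal \<omega> (g x) (g y)"
  unfolding Coal_def rtranclp_g[of "suc (\<Phi> \<omega>)" "suc \<omega>", OF suc_\<Phi>]
  using ex_g[of "\<lambda>u. (suc \<omega>)\<^sup>*\<^sup>* (g x) u \<and> (suc \<omega>)\<^sup>*\<^sup>* (g y) u"] by simp

lemma Lsym_meas: "Lsym sr p \<in> borel \<rightarrow>\<^sub>M (borel :: (real,'n) vec measure)"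
proof -
  have "linear (Lsym sr p :: (real,'n) vec \<Rightarrow> (real,'n) vec)"
    by (rule linearI) (auto simp: vec_eq_iff algebra_simps)
  thus ?thesis by (intro borel_measurable_continuous_onI linear_continuous_on linear_linear[THEN iffD2])
qed

text \<open>The preimage of a box is a box with the same side lengths in another order; a negative
  sign exchanges the two ends of a side.\<close>

lemma distr_lborel_Lsym: "distr lborel borel (Lsym sr p) = (lborel :: (real,'n) vec measure)"
proof (rule lborel_eqI[symmetric])
  fix l u :: "(real,'n) vec"
  assume lu: "\<And>b. b \<in> Basis \<Longrightarrow> l \<bullet> b \<le> u \<bullet> b"
  have lu': "l $ i \<le> u $ i" for i using lu[of "axis i 1"] by (simp add: inner_axis axis_in_Basis_iff)
  have Basis_eq: "Basis = range (\<lambda>i::'n. axis i (1::real))" by (auto simp: Basis_vec_def)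
  have ax_inj: "inj (\<lambda>i::'n. axis i (1::real))" by (auto simp: inj_def axis_eq_axis)
  have prodB: "(\<Prod>b\<in>Basis. (y - x) \<bullet> b) = (\<Prod>i\<in>UNIV. y $ i - x $ i)" for x y :: "(real,'n) vec"
    unfolding Basis_eq by (subst prod.reindex[OF ax_inj]) (simp add: inner_axis)
  define l' :: "(real,'n) vec" where "l' = (\<chi> i. if s i = 1 then l $ p i else - u $ p i)"
  define u' :: "(real,'n) vec" where "u' = (\<chi> i. if s i = 1 then u $ p i else - l $ p i)"
  have "Lsym sr p -` box l u = box l' u'"
  proof -
    have "(l $ i < sr i * x $ p i \<and> sr i * x $ p i < u $ i) \<longleftrightarrow> (l' $ p i < x $ p i \<and> x $ p i < u' $ p i)" for x i
      using s_cases[of i] by (auto simp: l'_def u'_def pp sp)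
    hence "Lsym sr p x \<in> box l u \<longleftrightarrow> (\<forall>i. l' $ p i < x $ p i \<and> x $ p i < u' $ p i)" for x
      by (auto simp: mem_box_cart)
    also have "(\<forall>i. l' $ p i < x $ p i \<and> x $ p i < u' $ p i) \<longleftrightarrow> x \<in> box l' u'" for x
      unfolding mem_box_cart by (metis pp)
    finally show ?thesis by auto
  qed
  hence "emeasure (distr lborel borel (Lsym sr p)) (box l u) = emeasure lborel (box l' u')"
    using Lsym_meas by (subst emeasure_distr) auto
  also have "\<dots> = (\<Prod>i\<in>UNIV. u' $ i - l' $ i)"
  proof -
    have "\<forall>b\<in>Basis. l' \<bullet> b \<le> u' \<bullet> b"
      unfolding Basis_eq using lu' by (auto simp: inner_axis l'_def u'_def)
    thus ?thesis by (simp add: emeasure_lborel_box_eq prodB)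
  qed
  also have "(\<Prod>i\<in>UNIV. u' $ i - l' $ i) = (\<Prod>i\<in>UNIV. u $ p i - l $ p i)"
    by (rule prod.cong) (auto simp: l'_def u'_def)
  also have "\<dots> = (\<Prod>i\<in>UNIV. u $ i - l $ i)" using bij_p by (rule prod.reindex_bij_betw)
  finally show "emeasure (distr lborel borel (Lsym sr p)) (box l u) = (\<Prod>b\<in>Basis. (u - l) \<bullet> b)"
    by (simp add: prodB)
qed simp

lemma distr_mu0_Lsym: "distr mu0 borel (Lsym sr p) = (mu0 :: (real,'n) vec measure)"
proof (rule measure_eqI)
  fix X :: "(real,'n) vec set" assume "X \<in> sets (distr mu0 borel (Lsym sr p))"
  hence X: "X \<in> sets borel" by simp
  have pre: "Lsym sr p -` Y \<in> sets borel" if "Y \<in> sets borel" for Y :: "(real,'n) vec set"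
    using measurable_sets_borel[OF Lsym_meas that] by simp
  have "emeasure (distr mu0 borel (Lsym sr p)) X = emeasure mu0 (Lsym sr p -` X)"
    using X Lsym_meas by (subst emeasure_distr) (auto cong: measurable_cong_sets)
  also have "\<dots> = emeasure lborel (ubox \<inter> (Lsym sr p -` X)) / emeasure lborel (ubox :: (real,'n) vec set)"
    unfolding mu0_def using pre[OF X] by (intro emeasure_uniform_measure) auto
  also have "ubox \<inter> (Lsym sr p -` X) = Lsym sr p -` (ubox \<inter> X)" using Lsym_ubox by auto
  also have "emeasure lborel \<dots> = emeasure (distr lborel borel (Lsym sr p)) (ubox \<inter> X)"
    using X Lsym_meas by (subst emeasure_distr) auto
  also have "\<dots> = emeasure lborel (ubox \<inter> X)" by (simp add: distr_lborel_Lsym)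
  also have "emeasure lborel (ubox \<inter> X) / emeasure lborel (ubox :: (real,'n) vec set) = emeasure mu0 X"
    unfolding mu0_def using X by (intro emeasure_uniform_measure[symmetric]) auto
  finally show "emeasure (distr mu0 borel (Lsym sr p)) X = emeasure mu0 X" .
qed simp

lemma distr_\<Phi>: "distr PS PS \<Phi> = PS"
  using distr_PS_sym[OF inj_g, of "\<lambda>_. Lsym sr p", OF Lsym_meas distr_mu0_Lsym]
  unfolding \<Phi>_def[abs_def] .

lemma \<Phi>_meas [measurable]: "\<Phi> \<in> PS \<rightarrow>\<^sub>M PS"
proof (rule measurable_PS_I)
  fix i show "(\<lambda>\<omega>. \<Phi> \<omega> i) \<in> PS \<rightarrow>\<^sub>M borel"
    unfolding \<Phi>_def by (rule measurable_compose[OF measurable_PS_comp Lsym_meas])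
qed

lemma prob_\<Phi>:
  assumes "Measurable.pred PS P"
  shows "measure PS {\<omega>. P (\<Phi> \<omega>)} = measure PS {\<omega>. P \<omega>}"
proof -
  have "measure PS {\<omega>. P \<omega>} = measure (distr PS PS \<Phi>) {\<omega>. P \<omega>}" by (simp add: distr_\<Phi>)
  also have "\<dots> = measure PS (\<Phi> -` {\<omega>. P \<omega>} \<inter> space PS)"
    by (rule measure_distr) (use assms sets_PS_I in auto)
  finally show ?thesis by (simp add: vimage_def)
qed

end

subsection \<open>Probability of the trap\<close>

lemma mu0_pos_box:
  fixes l u :: "'n::finite \<Rightarrow> real"
  assumes "\<And>i. l i < u i" "\<And>i. -1 \<le> l i" "\<And>i. u i \<le> 1"
    and "\<And>x. (\<And>i. l i < x $ i \<and> x $ i < u i) \<Longrightarrow> x \<in> S" "S \<in> sets borel"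
  shows "0 < measure (mu0 :: (real^'n) measure) S"
proof (rule mu0_pos[of "box (\<chi> i. l i) (\<chi> i. u i)"])
  show "box (\<chi> i. l i) (\<chi> i. u i) \<noteq> ({} :: (real^'n) set)"
    using assms(1) by (simp add: interval_ne_empty_cart)
  show "box (\<chi> i. l i) (\<chi> i. u i) \<subseteq> (ubox :: (real^'n) set)"
  proof
    fix x :: "real^'n" assume "x \<in> box (\<chi> i. l i) (\<chi> i. u i)"
    hence *: "l i < x $ i \<and> x $ i < u i" for i by (simp add: mem_box_cart)
    show "x \<in> ubox" unfolding ubox_iff
    proof
      fix i show "\<bar>x $ i\<bar> \<le> 1" using *[of i] assms(2,3)[of i] by linarith
    qed
  qed
  show "box (\<chi> i. l i) (\<chi> i. u i) \<subseteq> S" using assms(4) by (auto simp: mem_box_cart)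
qed (use assms in auto)

lemma mu0_tbox_pos:
  assumes "0 \<le> k" "k \<le> int r"
  shows "0 < measure mu0 (tbox r k)"
proof -
  define lo where "lo = 1/10 - (2 * real_of_int k + 1) / (40 * (real r + 1))"
  define hi where "hi = 1/10 - 2 * real_of_int k / (40 * (real r + 1))"
  have "(2 * real_of_int k + 1) / (40 * (real r + 1)) \<le> (2 * real r + 2) / (40 * (real r + 1))"
    using assms by (intro divide_right_mono) auto
  also have "\<dots> = 1/20" by (simp add: field_simps)
  finally have lo: "1/20 \<le> lo" unfolding lo_def by linarith
  have hi: "hi \<le> 1/10" unfolding hi_def using assms by simp
  have lh: "lo < hi" unfolding lo_def hi_def by (simp add: divide_strict_right_mono)
  show ?thesis
  proof (rule mu0_pos_box[where l="\<lambda>i. if i = dd then lo else -1/100" and u="\<lambda>i. if i = dd then hi else 1/100"])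
    fix x :: "(real,'a) vec"
    assume *: "\<And>i. (if i = dd then lo else -1/100) < x $ i \<and> x $ i < (if i = dd then hi else 1/100)"
    have "\<bar>x $ i\<bar> \<le> 1/100" if "i \<noteq> dd" for i using *[of i] that by auto
    moreover have "lo < x $ dd \<and> x $ dd < hi" using *[of dd] by simp
    ultimately show "x \<in> tbox r k" unfolding tbox_def lo_def hi_def by blast
  qed (use lo hi lh in auto)
qed

lemma mu0_gbox_pos: "0 < measure mu0 (gbox y w)"
proof -
  consider "w = y" | "w \<noteq> y" "w $ dd = y $ dd" | "w \<noteq> y" "w $ dd \<noteq> y $ dd" by blast
  thus ?thesis
  proof cases
    case 1
    show ?thesis
    proof (rule mu0_pos_box[where l="\<lambda>i. if i = dd then 6/10 else -1/100" and u="\<lambda>i. if i = dd then 7/10 else 1/100"])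
      fix x :: "(real,'a) vec"
      assume *: "\<And>i. (if i = dd then 6/10 else -1/100) < x $ i \<and> x $ i < (if i = dd then 7/10 else 1/100)"
      have "\<bar>x $ i\<bar> \<le> 1/100" if "i \<noteq> dd" for i using *[of i] that by auto
      thus "x \<in> gbox y w" using *[of dd] 1 by (simp add: gbox_def)
    qed auto
  next
    case 2
    show ?thesis
    proof (rule mu0_pos_box[where l="\<lambda>i. if i = dd then 9/10 else -1" and u="\<lambda>i. 1"])
      fix x :: "(real,'a) vec"
      assume *: "\<And>i. (if i = dd then 9/10 else -1) < x $ i \<and> x $ i < 1"
      have "\<bar>x $ i\<bar> \<le> 1" for i using *[of i] by (auto split: if_splits)
      thus "x \<in> gbox y w" using *[of dd] 2 by (simp add: gbox_def ubox_iff)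
    qed auto
  next
    case 3
    show ?thesis
    proof (rule mu0_pos_box[where l="\<lambda>i. if i = dd then -1/10 else -1" and u="\<lambda>i. 1"])
      fix x :: "(real,'a) vec"
      assume *: "\<And>i. (if i = dd then -1/10 else -1) < x $ i \<and> x $ i < 1"
      have "\<bar>x $ i\<bar> \<le> 1" for i using *[of i] by (auto split: if_splits)
      thus "x \<in> gbox y w" using *[of dd] 3 by (simp add: gbox_def ubox_iff)
    qed auto
  qed
qed

lemma finite_Bx [simp]: "finite (Bx (x::'n::finite site) l)"
proof -
  have "Bx x l \<subseteq> (\<lambda>f. \<chi> i. f i) ` (PiE UNIV (\<lambda>i. {x $ i - l .. x $ i + l}))"
  proof
    fix v assume v: "v \<in> Bx x l"
    have "v = (\<chi> i. v $ i)" by simp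
    moreover have "(\<lambda>i. v $ i) \<in> PiE UNIV (\<lambda>i. {x $ i - l .. x $ i + l})"
      using v by (auto simp: Bx_def abs_le_iff algebra_simps)
    ultimately show "v \<in> (\<lambda>f. \<chi> i. f i) ` (PiE UNIV (\<lambda>i. {x $ i - l .. x $ i + l}))" by blast
  qed
  thus ?thesis by (rule finite_subset) (auto intro!: finite_imageI finite_PiE)
qed

lemma Tilt_pos:
  fixes z :: "'n::{finite,linorder} site"
  shows "0 < measure PS {\<omega>. Tilt r \<omega> z}"
proof -
  let ?F = "{w. w $ dd = z $ dd \<and> h1 w z \<le> int r}"
  have "?F \<subseteq> Bx z (int r)" by (auto intro!: h1_Bx)
  hence F: "finite ?F" by (rule finite_subset) simp
  have "{\<omega>. Tilt r \<omega> z} = {\<omega>. \<forall>w\<in>?F. \<omega> w \<in> tbox r (h1 w z)}" by (auto simp: Tilt_def)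
  also have "measure PS \<dots> = (\<Prod>w\<in>?F. measure (mu0 :: (real,'n) vec measure) (tbox r (h1 w z)))"
    by (rule measure_PS_cyl[where X="\<lambda>w. tbox r (h1 w z)", OF F]) simp
  also have "\<dots> > 0" by (rule prod_pos) (auto intro!: mu0_tbox_pos)
  finally show ?thesis .
qed

lemma Gam_pos: "0 < measure PS {\<omega>. Gam r \<omega> y}"
proof -
  let ?F = "{w. w $ dd \<in> {y $ dd, y $ dd + 1} \<and> h1 w y \<le> int r}"
  have "?F \<subseteq> Bx y (int r + 1)" by (auto intro!: h1_Bx)
  hence F: "finite ?F" by (rule finite_subset) simp
  have "{\<omega>. Gam r \<omega> y} = {\<omega>. \<forall>w\<in>?F. \<omega> w \<in> gbox y w}" by (auto simp: Gam_def)
  also have "measure PS \<dots> = (\<Prod>w\<in>?F. measure mu0 (gbox y w))"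
    by (rule measure_PS_cyl[where X="gbox y", OF F]) simp
  also have "\<dots> > 0" by (rule prod_pos) (auto intro!: mu0_gbox_pos)
  finally show ?thesis .
qed

text \<open>The height interval of a centre is disjoint from that of an off-centre site, so a
  configuration cannot be tilted towards two centres that lie in each other's patch.\<close>

lemma Tilt_unique:
  assumes "Tilt r \<omega> z" "Tilt r \<omega> z'" "z $ dd = z' $ dd" "h1 z z' \<le> int r"
  shows "z = z'"
proof (rule ccontr)
  assume "z \<noteq> z'"
  hence "0 < h1 z z'" using h1_eq_0[of z z'] assms(3) h1_nonneg[of z z'] by (metis less_le)
  moreover have "\<omega> z \<in> tbox r (h1 z z')" using assms unfolding Tilt_def by blast
  moreover have "h1 z z \<le> int r \<longrightarrow> \<omega> z \<in> tbox r (h1 z z)" using assms(1) unfolding Tilt_def by blast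
  ultimately show False using tbox_mono[of "\<omega> z" r "h1 z z'" "\<omega> z" 0] by simp
qed

lemma Ent_fun:
  assumes "Ent \<omega> x n v" "Ent \<omega> x n v'" shows "v = v'"
proof -
  have uniq: "b = c" if "sucL \<omega> n a b" "sucL \<omega> n a c" for a b c
    using that suc_fun by (auto simp: sucL_def)
  have stop: "\<not> sucL \<omega> n v b" "\<not> sucL \<omega> n v' b" for b using assms by (auto simp: Ent_def sucL_def)
  have conf: "(sucL \<omega> n)\<^sup>*\<^sup>* x a \<Longrightarrow> (sucL \<omega> n)\<^sup>*\<^sup>* a v'" if "(sucL \<omega> n)\<^sup>*\<^sup>* a v" for a
    using that assms(2)
  proof -
    assume xa: "(sucL \<omega> n)\<^sup>*\<^sup>* x a"
    from xa show ?thesis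
    proof (induction rule: rtranclp_induct)
      case base
      then show ?case using assms(2) by (simp add: Ent_def)
    next
      case (step y z)
      from step.IH step.hyps(2) uniq stop show ?case by (metis converse_rtranclpE)
    qed
  qed
  have "(sucL \<omega> n)\<^sup>*\<^sup>* v v'" using conf[of v] assms(1) by (auto simp: Ent_def)
  thus ?thesis using stop by (metis converse_rtranclpE)
qed

subsection \<open>Repeated attempts\<close>

text \<open>Here \<open>N j\<close> is an opportunity and \<open>J j\<close> a success at time
  \<open>j\<close>. Weight the event of no success after \<open>i\<close> opportunities by
  \<open>(1 / (1 - \<epsilon>)) ^ i\<close>. An opportunity raises the weight by just the factor by
  which survival lowers the probability, so the total never exceeds 1. This is a supermartingale
  argument carried out with finite sums.\<close>

lemma (in prob_space) attempts:
  fixes N J :: "nat \<Rightarrow> 'a \<Rightarrow> bool"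
  assumes [measurable]: "\<And>j. Measurable.pred M (N j)" "\<And>j. Measurable.pred M (J j)"
    and \<epsilon>: "0 < \<epsilon>" "\<epsilon> < 1"
    and step: "\<And>t i. prob {\<omega>\<in>space M. (\<forall>j\<in>{1..t}. \<not> J j \<omega>) \<and> card {j\<in>{1..t}. N j \<omega>} = i \<and> N (Suc t) \<omega> \<and> \<not> J (Suc t) \<omega>}
      \<le> (1 - \<epsilon>) * prob {\<omega>\<in>space M. (\<forall>j\<in>{1..t}. \<not> J j \<omega>) \<and> card {j\<in>{1..t}. N j \<omega>} = i \<and> N (Suc t) \<omega>}"
  shows "prob {\<omega>\<in>space M. (\<forall>j\<in>{1..t}. \<not> J j \<omega>) \<and> k \<le> card {j\<in>{1..t}. N j \<omega>}} \<le> (1 - \<epsilon>) ^ k"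
proof -
  let ?\<beta> = "1 / (1 - \<epsilon>)"
  let ?Q = "\<lambda>t i \<omega>. (\<forall>j\<in>{1..t}. \<not> J j \<omega>) \<and> card {j\<in>{1..t}. N j \<omega>} = i"
  have cardS: "card {j\<in>{1..Suc t}. N j \<omega>} = card {j\<in>{1..t}. N j \<omega>} + (if N (Suc t) \<omega> then 1 else 0)" for t \<omega>
  proof -
    have "{j\<in>{1..Suc t}. N j \<omega>} = {j\<in>{1..t}. N j \<omega>} \<union> (if N (Suc t) \<omega> then {Suc t} else {})"
      by (auto simp: le_Suc_eq)
    thus ?thesis by simp
  qed
  have cardm [measurable]: "(\<lambda>\<omega>. card {j\<in>{1..t}. N j \<omega>}) \<in> measurable M (count_space UNIV)" for t
  proof (induction t)
    case (Suc t)
    note Suc[measurable]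
    show ?case unfolding cardS by measurable
  qed simp
  have Qm [measurable]: "Measurable.pred M (?Q t i)" for t i by measurable
  define q where "q = (\<lambda>t i. prob {\<omega>\<in>space M. ?Q t i \<omega>})"
  define n where "n = (\<lambda>t i. prob {\<omega>\<in>space M. ?Q t i \<omega> \<and> N (Suc t) \<omega>})"
  have card_le: "card {j\<in>{1..t}. N j \<omega>} \<le> t" for t \<omega>
  proof -
    have "{j\<in>{1..t}. N j \<omega>} \<subseteq> {1..t}" by blast
    from card_mono[OF _ this] show ?thesis by simp
  qed
  have q0: "q (Suc t) 0 \<le> q t 0 - n t 0" for t
  proof -
    have "q (Suc t) 0 \<le> prob ({\<omega>\<in>space M. ?Q t 0 \<omega>} - {\<omega>\<in>space M. ?Q t 0 \<omega> \<and> N (Suc t) \<omega>})"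
      unfolding q_def cardS by (rule finite_measure_mono) (auto simp: atLeastAtMostSuc_conv split: if_splits)
    also have "\<dots> = q t 0 - n t 0" unfolding q_def n_def by (rule finite_measure_Diff) auto
    finally show ?thesis .
  qed
  have qS: "q (Suc t) (Suc i) \<le> q t (Suc i) - n t (Suc i) + (1 - \<epsilon>) * n t i" for t i
  proof -
    let ?X = "{\<omega>\<in>space M. ?Q t (Suc i) \<omega>} - {\<omega>\<in>space M. ?Q t (Suc i) \<omega> \<and> N (Suc t) \<omega>}"
    let ?Y = "{\<omega>\<in>space M. (\<forall>j\<in>{1..t}. \<not> J j \<omega>) \<and> card {j\<in>{1..t}. N j \<omega>} = i \<and> N (Suc t) \<omega> \<and> \<not> J (Suc t) \<omega>}"
    have "q (Suc t) (Suc i) \<le> prob (?X \<union> ?Y)"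
      unfolding q_def cardS by (rule finite_measure_mono) (auto simp: atLeastAtMostSuc_conv split: if_splits)
    also have "\<dots> \<le> prob ?X + prob ?Y" by (rule measure_Un_le) auto
    also have "prob ?X = q t (Suc i) - n t (Suc i)" unfolding q_def n_def by (rule finite_measure_Diff) auto
    also have "prob ?Y \<le> (1 - \<epsilon>) * n t i" using step[of t i] by (simp add: n_def conj_assoc)
    finally show ?thesis by simp
  qed
  have n_big: "n t i = 0" if "t < i" for t i
  proof -
    have "{\<omega>\<in>space M. ?Q t i \<omega> \<and> N (Suc t) \<omega>} = {}"
    proof -
      have "card {j\<in>{1..t}. N j \<omega>} \<noteq> i" for \<omega> using card_le[of t \<omega>] that by linarith
      thus ?thesis by blast
    qed
    thus ?thesis by (simp add: n_def del: Collect_empty_eq)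
  qed
  have q_big: "q t i = 0" if "t < i" for t i
  proof -
    have "{\<omega>\<in>space M. ?Q t i \<omega>} = {}"
    proof -
      have "card {j\<in>{1..t}. N j \<omega>} \<noteq> i" for \<omega> using card_le[of t \<omega>] that by linarith
      thus ?thesis by blast
    qed
    thus ?thesis by (simp add: q_def del: Collect_empty_eq)
  qed
  have W: "(\<Sum>i\<le>t. ?\<beta> ^ i * q t i) \<le> 1" for t
  proof (induction t)
    case 0
    then show ?case by (simp add: q_def)
  next
    case (Suc t)
    have b: "?\<beta> * (1 - \<epsilon>) = 1" using \<epsilon> by simp
    have "(\<Sum>i\<le>Suc t. ?\<beta> ^ i * q (Suc t) i) = q (Suc t) 0 + (\<Sum>i\<le>t. ?\<beta> ^ Suc i * q (Suc t) (Suc i))"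
      by (subst sum.atMost_Suc_shift) simp
    also have "\<dots> \<le> (q t 0 - n t 0) + (\<Sum>i\<le>t. ?\<beta> ^ Suc i * (q t (Suc i) - n t (Suc i) + (1 - \<epsilon>) * n t i))"
      using \<epsilon> by (intro add_mono sum_mono mult_left_mono q0 qS) auto
    also have "(\<Sum>i\<le>t. ?\<beta> ^ Suc i * (q t (Suc i) - n t (Suc i) + (1 - \<epsilon>) * n t i))
        = (\<Sum>i\<le>t. ?\<beta> ^ Suc i * (q t (Suc i) - n t (Suc i))) + (\<Sum>i\<le>t. ?\<beta> ^ i * n t i)"
    proof -
      have "?\<beta> ^ Suc i * (q t (Suc i) - n t (Suc i) + (1 - \<epsilon>) * n t i)
         = ?\<beta> ^ Suc i * (q t (Suc i) - n t (Suc i)) + ?\<beta> ^ i * n t i" for i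
      proof -
        have "?\<beta> ^ Suc i * ((1 - \<epsilon>) * n t i) = (?\<beta> * (1 - \<epsilon>)) * (?\<beta> ^ i * n t i)" by (simp only: power_Suc mult_ac)
        thus ?thesis unfolding b by (simp only: distrib_left mult_1)
      qed
      thus ?thesis by (simp only: sum.distrib)
    qed
    also have "(q t 0 - n t 0) + ((\<Sum>i\<le>t. ?\<beta> ^ Suc i * (q t (Suc i) - n t (Suc i))) + (\<Sum>i\<le>t. ?\<beta> ^ i * n t i))
       = (\<Sum>i\<le>Suc t. ?\<beta> ^ i * (q t i - n t i)) + (\<Sum>i\<le>t. ?\<beta> ^ i * n t i)"
      by (subst sum.atMost_Suc_shift) simp
    \<comment> \<open>The top index contributes nothing, because at most \<open>t\<close>
      opportunities have occurred by time \<open>t\<close>.\<close>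
    also have "(\<Sum>i\<le>Suc t. ?\<beta> ^ i * (q t i - n t i)) = (\<Sum>i\<le>t. ?\<beta> ^ i * (q t i - n t i))"
      by (simp add: n_big q_big)
    also have "\<dots> + (\<Sum>i\<le>t. ?\<beta> ^ i * n t i) = (\<Sum>i\<le>t. ?\<beta> ^ i * q t i)"
      by (simp add: sum.distrib[symmetric] right_diff_distrib)
    finally show ?case using Suc by simp
  qed
  have "{\<omega>\<in>space M. (\<forall>j\<in>{1..t}. \<not> J j \<omega>) \<and> k \<le> card {j\<in>{1..t}. N j \<omega>}} \<subseteq> (\<Union>i\<in>{k..t}. {\<omega>\<in>space M. ?Q t i \<omega>})"
    using card_le by auto
  hence "prob {\<omega>\<in>space M. (\<forall>j\<in>{1..t}. \<not> J j \<omega>) \<and> k \<le> card {j\<in>{1..t}. N j \<omega>}} \<le> prob (\<Union>i\<in>{k..t}. {\<omega>\<in>space M. ?Q t i \<omega>})"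
    by (rule finite_measure_mono) auto
  also have "\<dots> \<le> (\<Sum>i\<in>{k..t}. q t i)"
    unfolding q_def by (rule finite_measure_subadditive_finite) auto
  also have "\<dots> \<le> (\<Sum>i\<in>{k..t}. (1 - \<epsilon>) ^ k * (?\<beta> ^ i * q t i))"
  proof (rule sum_mono)
    fix i assume i: "i \<in> {k..t}"
    have "(1 - \<epsilon>) ^ k * ?\<beta> ^ i = ?\<beta> ^ (i - k)"
    proof -
      have "?\<beta> ^ i = ?\<beta> ^ k * ?\<beta> ^ (i - k)" using i by (simp add: power_add[symmetric] del: power_divide)
      hence "(1 - \<epsilon>) ^ k * ?\<beta> ^ i = ((1 - \<epsilon>) * ?\<beta>) ^ k * ?\<beta> ^ (i - k)" by (simp only: power_mult_distrib mult.assoc)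
      thus ?thesis using \<epsilon> by simp
    qed
    moreover have "1 \<le> ?\<beta> ^ (i - k)" using \<epsilon> by (intro one_le_power) simp
    moreover have "0 \<le> q t i" by (simp add: q_def)
    ultimately show "q t i \<le> (1 - \<epsilon>) ^ k * (?\<beta> ^ i * q t i)"
      by (metis mult.assoc mult_1 mult_right_mono)
  qed
  also have "\<dots> = (1 - \<epsilon>) ^ k * (\<Sum>i\<in>{k..t}. ?\<beta> ^ i * q t i)" by (simp add: sum_distrib_left)
  also have "\<dots> \<le> (1 - \<epsilon>) ^ k * (\<Sum>i\<le>t. ?\<beta> ^ i * q t i)"
    using \<epsilon> by (intro mult_left_mono sum_mono2) (auto simp: q_def)
  also have "\<dots> \<le> (1 - \<epsilon>) ^ k * 1" using \<epsilon> W[of t] by (intro mult_left_mono) auto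
  finally show ?thesis by simp
qed

text \<open>A lower bound that holds on each piece of a countable partition is summed over the
  pieces. In the applications the pieces are given by the entry sites, and \<open>Y k\<close> is the
  part of \<open>X k\<close> on which the desired trap is present.\<close>

lemma (in prob_space) disj_mono:
  fixes X Y :: "'k::countable \<Rightarrow> 'a set"
  assumes "\<And>k. X k \<in> events" "\<And>k. Y k \<in> events" "disjoint_family X" "disjoint_family Y"
    and "0 \<le> \<epsilon>" "\<And>k. \<epsilon> * prob (X k) \<le> prob (Y k)"
  shows "\<epsilon> * prob (\<Union>k. X k) \<le> prob (\<Union>k. Y k)"
proof -
  have "ennreal \<epsilon> * emeasure M (\<Union>k. X k) = ennreal \<epsilon> * (\<integral>\<^sup>+k. emeasure M (X k) \<partial>count_space UNIV)"
    using assms by (subst emeasure_UN_countable) (auto simp: disjoint_family_on_def)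
  also have "\<dots> = (\<integral>\<^sup>+k. ennreal \<epsilon> * emeasure M (X k) \<partial>count_space UNIV)"
    by (rule nn_integral_cmult[symmetric]) simp
  also have "\<dots> \<le> (\<integral>\<^sup>+k. emeasure M (Y k) \<partial>count_space UNIV)"
    using assms by (intro nn_integral_mono) (auto simp: emeasure_eq_measure ennreal_mult[symmetric] intro!: ennreal_leI)
  also have "\<dots> = emeasure M (\<Union>k. Y k)"
    using assms by (subst emeasure_UN_countable) (auto simp: disjoint_family_on_def)
  finally show ?thesis using assms(5) by (simp add: emeasure_eq_measure ennreal_mult[symmetric])
qed

context lowdim begin

lemma symm_trans: "symm (\<lambda>_::'n. 1) id"
  by unfold_locales auto

lemma Tilt_trans: "measure PS {\<omega>. Tilt r \<omega> (z::'n site)} = measure PS {\<omega>::'n env. Tilt r \<omega> 0}"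
proof -
  interpret T: symm ty "\<lambda>_. 1" id z by (rule symm_trans)
  have "T.g 0 = z" by (simp add: T.g_def vec_eq_iff)
  thus ?thesis using T.prob_\<Phi>[OF Tilt_meas[of r 0]] by (simp add: T.Tilt_\<Phi>)
qed

lemma Gam_trans: "measure PS {\<omega>. Gam r \<omega> (z::'n site)} = measure PS {\<omega>::'n env. Gam r \<omega> 0}"
proof -
  interpret T: symm ty "\<lambda>_. 1" id z by (rule symm_trans)
  have "T.g 0 = z" by (simp add: T.g_def vec_eq_iff)
  thus ?thesis using T.prob_\<Phi>[OF Gam_meas[of r 0]] by (simp add: T.Gam_\<Phi>)
qed

text \<open>Without ties the path can always be continued; as it cannot make \<open>m\<close> steps
  from below height \<open>n - 8\<close>, it must cross that height.\<close>

lemma Ent_exists: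
  fixes \<omega> :: "'n env"
  assumes "notie \<omega>" "\<not> Long \<omega> x n m"
  shows "\<exists>v. Ent \<omega> x n v"
proof -
  have "\<exists>v. (sucL \<omega> n ^^ k) x v \<or> Ent \<omega> x n v" for k
  proof (induction k)
    case (Suc k)
    then obtain v where v: "(sucL \<omega> n ^^ k) x v \<or> Ent \<omega> x n v" by blast
    show ?case
    proof (cases "ht \<omega> v \<le> real_of_int n - 8 \<and> (sucL \<omega> n ^^ k) x v")
      case True
      obtain u where "suc \<omega> v u" using suc_exists[OF assms(1)] by blast
      hence "(sucL \<omega> n ^^ Suc k) x u" using True by (auto simp: sucL_def)
      thus ?thesis by blast
    next
      case False
      hence "Ent \<omega> x n v" using v by (auto simp: Ent_def rtranclp_power)
      thus ?thesis by blast
    qed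
  qed auto
  from this[of m] assms(2) show ?thesis by (auto simp: Long_def)
qed

end

lemma card_meas [measurable (raw)]:
  fixes P :: "nat \<Rightarrow> 'a \<Rightarrow> bool"
  assumes "\<And>j. Measurable.pred M (P j)"
  shows "(\<lambda>\<omega>. card {j\<in>{1..t}. P j \<omega>}) \<in> measurable M (count_space UNIV)"
proof (induction t)
  case (Suc t)
  note Suc[measurable] assms[measurable]
  have "card {j\<in>{1..Suc t}. P j \<omega>} = card {j\<in>{1..t}. P j \<omega>} + (if P (Suc t) \<omega> then 1 else 0)" for \<omega>
  proof -
    have "{j\<in>{1..Suc t}. P j \<omega>} = {j\<in>{1..t}. P j \<omega>} \<union> (if P (Suc t) \<omega> then {Suc t} else {})"
      by (auto simp: le_Suc_eq)
    thus ?thesis by simp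
  qed
  thus ?case by simp
qed simp

subsection \<open>Two independent environments\<close>

text \<open>Both copies live in one product space over tagged sites, so that everything proved about
  \<open>PS\<close> and \<open>dep\<close> applies to pairs of environments.\<close>

definition cp :: "bool \<Rightarrow> ('i \<times> bool \<Rightarrow> 'c) \<Rightarrow> 'i \<Rightarrow> 'c" where "cp b \<omega> w = \<omega> (w, b)"

lemma cp_meas [measurable]: "cp b \<in> PS \<rightarrow>\<^sub>M PS"
  by (rule measurable_PS_I) (simp add: cp_def)

lemma pred_cp: "Measurable.pred PS P \<Longrightarrow> Measurable.pred PS (\<lambda>\<omega>. P (cp b \<omega>))"
  by (rule measurable_compose[OF cp_meas])

lemma prob_cp:
  fixes P :: "('i \<Rightarrow> real^'n::finite) \<Rightarrow> bool"
  assumes "Measurable.pred PS P"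
  shows "measure PS {\<omega>. P (cp b \<omega>)} = measure PS {\<omega>. P \<omega>}"
proof -
  have "inj (\<lambda>w::'i. (w, b))" by (auto simp: inj_def)
  hence "measure PS {\<omega>. P \<omega>} = measure (distr PS PS (cp b)) {\<omega>. P \<omega>}"
    unfolding cp_def[abs_def] by (subst distr_PS_reindex) auto
  also have "\<dots> = measure PS (cp b -` {\<omega>. P \<omega>} \<inter> space PS)"
    by (rule measure_distr) (use assms sets_PS_I in auto)
  finally show ?thesis by (simp add: vimage_def)
qed

lemma dep_cp: "dep X P \<Longrightarrow> dep (X \<times> {b}) (\<lambda>\<omega>. P (cp b \<omega>))"
  unfolding dep_def
proof (intro allI impI)
  fix \<omega> \<omega>' :: "'a \<times> bool \<Rightarrow> 'b"
  assume P: "\<forall>\<omega> \<omega>'. (\<forall>i\<in>X. \<omega> i = \<omega>' i) \<longrightarrow> P \<omega> = P \<omega>'" and eq: "\<forall>p\<in>X \<times> {b}. \<omega> p = \<omega>' p"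
  show "P (cp b \<omega>) = P (cp b \<omega>')"
    by (rule P[rule_format]) (use eq in \<open>auto simp: cp_def\<close>)
qed

definition Nice :: "nat \<Rightarrow> 'n::{finite,linorder} env \<Rightarrow> 'n site \<Rightarrow> nat \<Rightarrow> bool" where
  "Nice A \<omega> x j \<longleftrightarrow> (\<exists>v. Ent \<omega> x (lev j) v \<and> \<not> Bad A \<omega> (lev j) v)"

definition RG :: "nat \<Rightarrow> nat \<Rightarrow> 'n::{finite,linorder} env \<Rightarrow> 'n site \<Rightarrow> int \<Rightarrow> 'n site \<Rightarrow> bool" where
  "RG A r \<omega> x n z \<longleftrightarrow> Rgp A r \<omega> x n z \<and> Gam r \<omega> (up z)"

lemma Nice_meas [measurable]: "Measurable.pred PS (\<lambda>\<omega>. Nice A \<omega> x j)"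
  unfolding Nice_def by measurable

lemma RG_meas [measurable]: "Measurable.pred PS (\<lambda>\<omega>. RG A r \<omega> x n z)"
  unfolding RG_def by measurable

text \<open>The estimates of \<open>good_levels\<close> with their constants fixed. The bound on
  \<open>r\<close> suffices for \<open>trap\<close> when the centre is within horizontal distance 1
  of the column of the entry.\<close>

locale dsf = lowdim ty for ty :: "'n::{finite,linorder} itself" +
  fixes C A r :: nat
  assumes LongP: "measure PS {\<omega>. Long \<omega> (x::'n site) (lev t) (C * t)} \<le> exp (nbrs TYPE('n) * real_of_int \<bar>x $ dd\<bar>) * (1/2) ^ t"
    and FailP: "measure PS {\<omega>. \<not> Long \<omega> (x::'n site) (lev t) (C * t) \<and> t \<le> 4 * card {j\<in>{1..t}. Fail A \<omega> x j}} \<le> 2 * (1/2) ^ t"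
    and r_ge: "18 * A + 100 \<le> r"
begin

definition \<tau> :: real where "\<tau> = measure PS {\<omega>::'n env. Tilt r \<omega> 0}"
definition \<gamma> :: real where "\<gamma> = measure PS {\<omega>::'n env. Gam r \<omega> 0}"

lemma \<tau>_pos: "0 < \<tau>" and \<tau>_le: "\<tau> \<le> 1" by (auto simp: \<tau>_def Tilt_pos)
lemma \<gamma>_pos: "0 < \<gamma>" and \<gamma>_le: "\<gamma> \<le> 1" by (auto simp: \<gamma>_def Gam_pos)

lemma TG_prob:
  fixes z :: "'n site"
  shows "measure PS {\<omega>. Tilt R \<omega> z \<and> Gam R \<omega> (up z)} = measure PS {\<omega>::'n env. Tilt R \<omega> 0} * measure PS {\<omega>::'n env. Gam R \<omega> 0}"
    and "0 < measure PS {\<omega>. Tilt R \<omega> z \<and> Gam R \<omega> (up z)}"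
    and "dep {w. z $ dd \<le> w $ dd} (\<lambda>\<omega>. Tilt R \<omega> z \<and> Gam R \<omega> (up z))"
proof -
  have "measure PS {\<omega>. Tilt R \<omega> z \<and> Gam R \<omega> (up z)} = measure PS {\<omega>. Tilt R \<omega> z} * measure PS {\<omega>. Gam R \<omega> (up z)}"
    by (rule dep_indep[OF _ _ Tilt_dep Gam_dep]) auto
  thus "measure PS {\<omega>. Tilt R \<omega> z \<and> Gam R \<omega> (up z)} = measure PS {\<omega>::'n env. Tilt R \<omega> 0} * measure PS {\<omega>::'n env. Gam R \<omega> 0}"
    by (simp add: Tilt_trans[of R z] Gam_trans[of R "up z"])
  thus "0 < measure PS {\<omega>. Tilt R \<omega> z \<and> Gam R \<omega> (up z)}"
    using Tilt_pos[of R "0::'n site"] Gam_pos[of R "0::'n site"] by simp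
  show "dep {w. z $ dd \<le> w $ dd} (\<lambda>\<omega>. Tilt R \<omega> z \<and> Gam R \<omega> (up z))"
    by (intro dep_conj dep_mono[OF Tilt_dep] dep_mono[OF Gam_dep]) auto
qed

section \<open>Waiting time for a joint renewal of two independent paths\<close>

definition JX :: "'n env \<Rightarrow> 'n site \<Rightarrow> 'n env \<Rightarrow> 'n site \<Rightarrow> nat \<Rightarrow> bool" where
  "JX \<omega>1 x1 \<omega>2 x2 j \<longleftrightarrow> (\<exists>z1 z2. RG A r \<omega>1 x1 (lev j) z1 \<and> RG A r \<omega>2 x2 (lev j) z2)"

lemma JX_cp_meas [measurable]: "Measurable.pred PS (\<lambda>\<omega>. JX (cp b \<omega>) x1 (cp b' \<omega>) x2 j)"
  unfolding JX_def using pred_cp[OF RG_meas, measurable] by measurable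

lemma JX_meas [measurable]: "Measurable.pred PS (\<lambda>\<omega>. JX \<omega> x1 \<omega> x2 j)"
  unfolding JX_def by measurable

lemma RG_dep: "x $ dd < n \<Longrightarrow> dep {w. w $ dd \<le> n + 2} (\<lambda>\<omega>::'n env. RG A r \<omega> x n z)"
proof (cases "z $ dd = n")
  case True
  assume x: "x $ dd < n"
  have "dep {w. w $ dd \<le> n + 2} (\<lambda>\<omega>::'n env. Rgp A r \<omega> x n z)" by (rule dep_mono[OF Rgp_dep[OF x]]) auto
  moreover have "dep {w. w $ dd \<le> n + 2} (\<lambda>\<omega>::'n env. Gam r \<omega> (up z))" by (rule dep_mono[OF Gam_dep]) (use True in auto)
  ultimately show ?thesis unfolding RG_def by (rule dep_conj)
qed (simp add: RG_def Rgp_def dep_const)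

lemma Nice_dep: "x $ dd < lev j \<Longrightarrow> dep {w. w $ dd < lev j} (\<lambda>\<omega>::'n env. Nice A \<omega> x j)"
  unfolding Nice_def by (intro dep_ex dep_conj dep_not Ent_dep dep_mono[OF Bad_dep]) auto

text \<open>The site of row \<open>n\<close> in the column of \<open>v\<close>, which is the natural
  centre of a trap for an entry at \<open>v\<close>.\<close>

definition cs :: "int \<Rightarrow> 'n site \<Rightarrow> 'n site" where "cs n v = (\<chi> i. if i = dd then n else v $ i)"

lemma cs_dd [simp]: "cs n v $ dd = n" by (simp add: cs_def)

lemma h1_cs [simp]: "h1 (cs n v) v = 0"
  unfolding h1_def by (rule sum.neutral) (auto simp: cs_def)

text \<open>The past event \<open>S\<close> and the two entries are decided below the level. Given
  these, traps centred over the entries, one in each copy, are present with probability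
  \<open>(\<tau> * \<gamma>)\<^sup>2\<close>; the bound follows by summation over the
  entries.\<close>

lemma attempt_pair:
  fixes x1 x2 :: "'n site"
  assumes Sm [measurable]: "Measurable.pred PS S" and Sd: "dep {p. fst p $ dd < lev j} S"
    and x: "x1 $ dd < lev j" "x2 $ dd < lev j"
  shows "measure PS {\<omega>. S \<omega> \<and> (Nice A (cp False \<omega>) x1 j \<and> Nice A (cp True \<omega>) x2 j) \<and> \<not> JX (cp False \<omega>) x1 (cp True \<omega>) x2 j}
     \<le> (1 - (\<tau> * \<gamma>)\<^sup>2) * measure PS {\<omega>. S \<omega> \<and> (Nice A (cp False \<omega>) x1 j \<and> Nice A (cp True \<omega>) x2 j)}"
proof -
  let ?n = "lev j"
  let ?EB = "\<lambda>b x v (\<omega>::'n site \<times> bool \<Rightarrow> (real,'n) vec). Ent (cp b \<omega>) x ?n v \<and> \<not> Bad A (cp b \<omega>) ?n v"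
  let ?TG = "\<lambda>b z (\<omega>::'n site \<times> bool \<Rightarrow> (real,'n) vec). Tilt r (cp b \<omega>) z \<and> Gam r (cp b \<omega>) (up z)"
  define X where "X = (\<lambda>(v1, v2). {\<omega>. S \<omega> \<and> ?EB False x1 v1 \<omega> \<and> ?EB True x2 v2 \<omega>})"
  define Y where "Y = (\<lambda>(v1, v2). {\<omega>. (S \<omega> \<and> ?EB False x1 v1 \<omega> \<and> ?EB True x2 v2 \<omega>) \<and> (?TG False (cs ?n v1) \<omega> \<and> ?TG True (cs ?n v2) \<omega>)})"
  note pred_cp[OF Ent_meas, measurable] pred_cp[OF Bad_meas, measurable] pred_cp[OF Tilt_meas, measurable]
    pred_cp[OF Gam_meas, measurable] pred_cp[OF Nice_meas, measurable]
  have Xm: "X k \<in> sets PS" and Ym: "Y k \<in> sets PS" for k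
    unfolding X_def Y_def by (cases k; simp; intro sets_PS_I; measurable)+
  have Xd: "disjoint_family X"
    unfolding disjoint_family_on_def X_def by (auto dest: Ent_fun)
  have YX: "Y k \<subseteq> X k" for k unfolding X_def Y_def by (cases k) auto
  hence Yd: "disjoint_family Y" using Xd unfolding disjoint_family_on_def by blast
  have "(\<tau> * \<gamma>)\<^sup>2 * measure PS (X k) \<le> measure PS (Y k)" for k
  proof -
    obtain v1 v2 where k: "k = (v1, v2)" by (cases k)
    have EBd: "dep {p. fst p $ dd < ?n} (?EB b x v)" if "x $ dd < ?n" for b x v
    proof -
      have "dep {w. w $ dd < ?n} (\<lambda>\<omega>::'n env. Ent \<omega> x ?n v \<and> \<not> Bad A \<omega> ?n v)"
        using that by (intro dep_conj dep_not Ent_dep dep_mono[OF Bad_dep]) auto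
      from dep_cp[OF this, of b] show ?thesis by (rule dep_mono) auto
    qed
    have TGd: "dep ({w. z $ dd \<le> w $ dd} \<times> {b}) (?TG b z)" for b z
      by (rule dep_cp[OF TG_prob(3)])
    have "measure PS {\<omega>. ?TG False (cs ?n v1) \<omega> \<and> ?TG True (cs ?n v2) \<omega>}
       = measure PS {\<omega>. ?TG False (cs ?n v1) \<omega>} * measure PS {\<omega>. ?TG True (cs ?n v2) \<omega>}"
      by (rule dep_indep[OF _ _ TGd TGd]) auto
    moreover have "measure PS {\<omega>. ?TG b z \<omega>} = \<tau> * \<gamma>" for b z
      using prob_cp[of "\<lambda>\<omega>. Tilt r \<omega> z \<and> Gam r \<omega> (up z)" b] TG_prob(1)[of r z] by (simp add: \<tau>_def \<gamma>_def)
    ultimately have TG: "measure PS {\<omega>. ?TG False (cs ?n v1) \<omega> \<and> ?TG True (cs ?n v2) \<omega>} = (\<tau> * \<gamma>)\<^sup>2"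
      by (simp add: power2_eq_square)
    have d1: "dep {p. fst p $ dd < ?n} (\<lambda>\<omega>. S \<omega> \<and> ?EB False x1 v1 \<omega> \<and> ?EB True x2 v2 \<omega>)"
      by (intro dep_conj[OF Sd] dep_conj[OF EBd[OF x(1)] EBd[OF x(2)]])
    have d2: "dep {p. ?n \<le> fst p $ dd} (\<lambda>\<omega>. ?TG False (cs ?n v1) \<omega> \<and> ?TG True (cs ?n v2) \<omega>)"
      by (rule dep_conj; rule dep_mono[OF TGd]; auto)
    have "measure PS (Y k) = measure PS (X k) * (\<tau> * \<gamma>)\<^sup>2"
      unfolding X_def Y_def k prod.case TG[symmetric]
      by (rule dep_indep[OF _ _ d1 d2]) auto
    thus ?thesis by (simp add: mult.commute)
  qed
  from PS.disj_mono[OF Xm Ym Xd Yd _ this]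
  have le: "(\<tau> * \<gamma>)\<^sup>2 * measure PS (\<Union>k. X k) \<le> measure PS (\<Union>k. Y k)" by simp
  let ?N = "{\<omega>. S \<omega> \<and> (Nice A (cp False \<omega>) x1 j \<and> Nice A (cp True \<omega>) x2 j)}"
  let ?J = "{\<omega>. S \<omega> \<and> (Nice A (cp False \<omega>) x1 j \<and> Nice A (cp True \<omega>) x2 j) \<and> JX (cp False \<omega>) x1 (cp True \<omega>) x2 j}"
  have XN: "(\<Union>k. X k) = ?N" unfolding X_def Nice_def by auto
  have YJ: "(\<Union>k. Y k) \<subseteq> ?J"
  proof
    fix \<omega> assume "\<omega> \<in> (\<Union>k. Y k)"
    then obtain v1 v2 where *: "S \<omega>" "?EB False x1 v1 \<omega>" "?EB True x2 v2 \<omega>" "?TG False (cs ?n v1) \<omega>" "?TG True (cs ?n v2) \<omega>"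
      unfolding Y_def by auto
    have "RG A r (cp False \<omega>) x1 ?n (cs ?n v1)" "RG A r (cp True \<omega>) x2 ?n (cs ?n v2)"
      unfolding RG_def Rgp_def using * by (auto intro: exI[of _ v1])
    thus "\<omega> \<in> ?J" using * unfolding JX_def Nice_def by blast
  qed
  have Jm: "?J \<in> sets PS" and Nm: "?N \<in> sets PS" by (rule sets_PS_I, measurable)+
  have "measure PS {\<omega>. S \<omega> \<and> (Nice A (cp False \<omega>) x1 j \<and> Nice A (cp True \<omega>) x2 j) \<and> \<not> JX (cp False \<omega>) x1 (cp True \<omega>) x2 j}
      = measure PS (?N - ?J)" by (rule arg_cong[where f="measure PS"]) auto
  also have "\<dots> = measure PS ?N - measure PS ?J"
    by (rule PS.finite_measure_Diff[OF Nm Jm]) auto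
  finally have 1: "measure PS {\<omega>. S \<omega> \<and> (Nice A (cp False \<omega>) x1 j \<and> Nice A (cp True \<omega>) x2 j) \<and> \<not> JX (cp False \<omega>) x1 (cp True \<omega>) x2 j}
     = measure PS ?N - measure PS ?J" .
  have 2: "measure PS ?J \<ge> (\<tau> * \<gamma>)\<^sup>2 * measure PS ?N"
    using le PS.finite_measure_mono[OF YJ Jm] unfolding XN by linarith
  show ?thesis unfolding 1 left_diff_distrib using 2 by simp
qed

text \<open>Each path has an entry at every level up to \<open>t\<close>, so a level is nice for
  both paths unless one of them fails there, and each fails at less than a quarter of the
  levels.\<close>

lemma many_nice:
  fixes \<omega>1 \<omega>2 :: "'n env"
  assumes "notie \<omega>1" "notie \<omega>2" "\<not> Long \<omega>1 x1 (lev t) m1" "\<not> Long \<omega>2 x2 (lev t) m2"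
    "4 * card {j\<in>{1..t}. Fail A \<omega>1 x1 j} < t" "4 * card {j\<in>{1..t}. Fail A \<omega>2 x2 j} < t"
  shows "t \<le> 2 * card {j\<in>{1..t}. Nice A \<omega>1 x1 j \<and> Nice A \<omega>2 x2 j}"
proof -
  let ?F1 = "{j\<in>{1..t}. Fail A \<omega>1 x1 j}" and ?F2 = "{j\<in>{1..t}. Fail A \<omega>2 x2 j}"
    and ?N = "{j\<in>{1..t}. Nice A \<omega>1 x1 j \<and> Nice A \<omega>2 x2 j}"
  have "j \<in> ?N \<union> ?F1 \<union> ?F2" if j: "j \<in> {1..t}" for j
  proof -
    have "lev j \<le> lev t" using j by (simp add: lev_def)
    hence "\<not> Long \<omega>1 x1 (lev j) m1" "\<not> Long \<omega>2 x2 (lev j) m2" using assms(3,4) Long_mono by blast+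
    hence "\<exists>v. Ent \<omega>1 x1 (lev j) v" "\<exists>v. Ent \<omega>2 x2 (lev j) v" using Ent_exists assms(1,2) by blast+
    thus ?thesis using j unfolding Nice_def Fail_def by blast
  qed
  hence "{1..t} \<subseteq> ?N \<union> ?F1 \<union> ?F2" by blast
  hence "card {1..t} \<le> card (?N \<union> ?F1 \<union> ?F2)" by (rule card_mono[rotated]) simp
  also have "\<dots> \<le> card ?N + card ?F1 + card ?F2"
    using card_Un_le[of "?N \<union> ?F1" ?F2] card_Un_le[of ?N ?F1] by linarith
  finally show ?thesis using assms(5,6) by simp
qed

lemma AE_notie_cp: "AE \<omega> in PS. notie (cp b \<omega> :: 'n env)"
proof -
  have "measure PS {\<omega>. notie (cp b \<omega> :: 'n env)} = measure PS {\<omega>. notie (\<omega> :: 'n env)}"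
    by (rule prob_cp[OF notie_meas])
  also have "\<dots> = 1" using AE_notie PS.AE_in_set_eq_1[OF sets_PS_I[OF notie_meas]] by auto
  finally show ?thesis
    using PS.AE_in_set_eq_1[OF sets_PS_I[OF pred_cp[OF notie_meas]]] by auto
qed

text \<open>The square root reflects that only half of the levels are guaranteed to be nice. Halving
  \<open>(\<tau> * \<gamma>)\<^sup>2\<close> makes the success probability strictly less than 1, as
  \<open>attempts\<close> demands, and the maximum with 1/2 absorbs the other tails.\<close>

definition \<theta> :: real where "\<theta> = max (1/2) (sqrt (1 - (\<tau> * \<gamma>)\<^sup>2 / 2))"

lemma tg: "0 < (\<tau> * \<gamma>)\<^sup>2" "(\<tau> * \<gamma>)\<^sup>2 \<le> 1"
proof -
  have "0 < \<tau> * \<gamma>" using \<tau>_pos \<gamma>_pos by simp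
  thus "0 < (\<tau> * \<gamma>)\<^sup>2" by (rule zero_less_power)
  have "\<tau> * \<gamma> \<le> 1" using \<tau>_le \<gamma>_le \<tau>_pos \<gamma>_pos mult_le_one by fastforce
  thus "(\<tau> * \<gamma>)\<^sup>2 \<le> 1" using \<open>0 < \<tau> * \<gamma>\<close> by (simp add: power_le_one)
qed

lemma \<theta>: "0 < \<theta>" "\<theta> < 1" "1/2 \<le> \<theta>"
  using tg by (auto simp: \<theta>_def)

text \<open>The constant is 1 + 2 + 4: one term for unsuccessful attempts at many nice levels, two
  for long paths, and two terms with factor 2 for many failures.\<close>

lemma tail:
  "measure PS {\<omega>. \<forall>j\<in>{1..t}. \<not> JX (cp False \<omega>) 0 (cp True \<omega>) 0 j} \<le> 7 * \<theta> ^ t"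
proof -
  let ?N = "\<lambda>j (\<omega>::'n site \<times> bool \<Rightarrow> (real,'n) vec). Nice A (cp False \<omega>) 0 j \<and> Nice A (cp True \<omega>) 0 j"
  let ?J = "\<lambda>j (\<omega>::'n site \<times> bool \<Rightarrow> (real,'n) vec). JX (cp False \<omega>) 0 (cp True \<omega>) 0 j"
  note pred_cp[OF Nice_meas, measurable] pred_cp[OF Fail_meas, measurable] pred_cp[OF Long_meas, measurable]
    pred_cp[OF notie_meas, measurable]
  note card_meas[where P="\<lambda>j \<omega>. Nice A (cp False \<omega>) (0::'n site) j \<and> Nice A (cp True \<omega>) (0::'n site) j", measurable]
    card_meas[where P="\<lambda>j \<omega>. Fail A (cp b \<omega>) (0::'n site) j" for b, measurable]
  have row: "(0::'n site) $ dd < lev j" if "1 \<le> j" for j using that by (simp add: lev_def)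
  have JXd: "dep {p. fst p $ dd < lev (Suc t)} (?J j)" if j: "j \<in> {1..t}" for j t
  proof -
    have "dep {p. fst p $ dd < lev (Suc t)} (\<lambda>\<omega>. RG A r (cp b \<omega>) 0 (lev j) (z::'n site))" for b z
    proof -
      have "dep ({w. w $ dd \<le> lev j + 2} \<times> {b}) (\<lambda>\<omega>. RG A r (cp b \<omega>) 0 (lev j) z)"
        using dep_cp[OF RG_dep[OF row], of j b z] j by simp
      thus ?thesis by (rule dep_mono) (use j in \<open>auto simp: lev_def\<close>)
    qed
    thus ?thesis unfolding JX_def by (intro dep_ex dep_conj)
  qed
  have Nd: "dep {p. fst p $ dd < lev (Suc t)} (?N j)" if j: "j \<in> {1..t}" for j t
  proof -
    have "dep {p. fst p $ dd < lev (Suc t)} (\<lambda>\<omega>. Nice A (cp b \<omega>) (0::'n site) j)" for b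
    proof -
      have "dep ({w. w $ dd < lev j} \<times> {b}) (\<lambda>\<omega>. Nice A (cp b \<omega>) (0::'n site) j)"
        using dep_cp[OF Nice_dep[OF row], of j b] j by simp
      thus ?thesis by (rule dep_mono) (use j in \<open>auto simp: lev_def\<close>)
    qed
    thus ?thesis by (intro dep_conj)
  qed
  have Cd: "dep {p. fst p $ dd < lev (Suc t)} (\<lambda>\<omega>. card {j\<in>{1..t}. ?N j \<omega>} = i)" for t i
    unfolding dep_def
  proof (intro allI impI)
    fix \<omega> \<omega>' :: "'n site \<times> bool \<Rightarrow> (real,'n) vec"
    assume eq: "\<forall>p\<in>{p. fst p $ dd < lev (Suc t)}. \<omega> p = \<omega>' p"
    have "?N j \<omega> = ?N j \<omega>'" if "j \<in> {1..t}" for j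
      by (rule depD[OF Nd[OF that]]) (use eq in auto)
    hence "{j\<in>{1..t}. ?N j \<omega>} = {j\<in>{1..t}. ?N j \<omega>'}" by blast
    thus "(card {j\<in>{1..t}. ?N j \<omega>} = i) = (card {j\<in>{1..t}. ?N j \<omega>'} = i)" by simp
  qed
  have att: "measure PS {\<omega>\<in>space PS. (\<forall>j\<in>{1..t}. \<not> ?J j \<omega>) \<and> k \<le> card {j\<in>{1..t}. ?N j \<omega>}} \<le> (1 - (\<tau> * \<gamma>)\<^sup>2 / 2) ^ k" for k
  proof (rule PS.attempts)
    fix t i
    let ?S = "\<lambda>\<omega>. (\<forall>j\<in>{1..t}. \<not> ?J j \<omega>) \<and> card {j\<in>{1..t}. ?N j \<omega>} = i"
    have [measurable]: "Measurable.pred PS ?S" by measurable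
    have "measure PS {\<omega>. ?S \<omega> \<and> ?N (Suc t) \<omega> \<and> \<not> ?J (Suc t) \<omega>} \<le> (1 - (\<tau> * \<gamma>)\<^sup>2) * measure PS {\<omega>. ?S \<omega> \<and> ?N (Suc t) \<omega>}"
    proof (rule attempt_pair)
      show "dep {p. fst p $ dd < lev (Suc t)} ?S" by (rule dep_conj[OF dep_ball Cd]) (rule dep_not[OF JXd])
    qed (simp_all add: lev_def)
    also have "\<dots> \<le> (1 - (\<tau> * \<gamma>)\<^sup>2 / 2) * measure PS {\<omega>. ?S \<omega> \<and> ?N (Suc t) \<omega>}"
      by (intro mult_right_mono) auto
    finally show "measure PS {\<omega>\<in>space PS. (\<forall>j\<in>{1..t}. \<not> ?J j \<omega>) \<and> card {j\<in>{1..t}. ?N j \<omega>} = i \<and> ?N (Suc t) \<omega> \<and> \<not> ?J (Suc t) \<omega>}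
      \<le> (1 - (\<tau> * \<gamma>)\<^sup>2 / 2) * measure PS {\<omega>\<in>space PS. (\<forall>j\<in>{1..t}. \<not> ?J j \<omega>) \<and> card {j\<in>{1..t}. ?N j \<omega>} = i \<and> ?N (Suc t) \<omega>}"
      by (simp add: conj_assoc)
  qed (use tg in auto)
  \<comment> \<open>Half of \<open>t\<close>, rounded up: it is still a lower bound for the number
    of nice levels, and \<open>2 * ?k\<close> is at least \<open>t\<close>.\<close>
  let ?k = "(t + 1) div 2"
  let ?E0 = "{\<omega>. (\<forall>j\<in>{1..t}. \<not> ?J j \<omega>) \<and> ?k \<le> card {j\<in>{1..t}. ?N j \<omega>}}"
  let ?L = "\<lambda>b. {\<omega>. Long (cp b \<omega> :: 'n env) 0 (lev t) (C * t)}"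
  let ?F = "\<lambda>b. {\<omega>. \<not> Long (cp b \<omega> :: 'n env) 0 (lev t) (C * t) \<and> t \<le> 4 * card {j\<in>{1..t}. Fail A (cp b \<omega>) 0 j}}"
  have meas: "?E0 \<in> sets PS" "?L b \<in> sets PS" "?F b \<in> sets PS" for b
    by (rule sets_PS_I, measurable)+
  have "AE \<omega> in PS. \<omega> \<in> {\<omega>. \<forall>j\<in>{1..t}. \<not> ?J j \<omega>} \<longrightarrow> \<omega> \<in> ?E0 \<union> ((?L False \<union> ?L True) \<union> (?F False \<union> ?F True))"
    using AE_notie_cp[of False] AE_notie_cp[of True]
  proof eventually_elim
    case (elim \<omega>)
    show ?case
    proof (intro impI, rule ccontr)
      assume J: "\<omega> \<in> {\<omega>. \<forall>j\<in>{1..t}. \<not> ?J j \<omega>}" and n: "\<omega> \<notin> ?E0 \<union> ((?L False \<union> ?L True) \<union> (?F False \<union> ?F True))"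
      have "t \<le> 2 * card {j\<in>{1..t}. ?N j \<omega>}"
        by (rule many_nice[OF elim, of 0 t "C * t" 0 "C * t"]) (use n in \<open>auto simp: not_le\<close>)
      hence "?k \<le> card {j\<in>{1..t}. ?N j \<omega>}" by linarith
      thus False using J n by blast
    qed
  qed
  hence "measure PS {\<omega>. \<forall>j\<in>{1..t}. \<not> ?J j \<omega>} \<le> measure PS (?E0 \<union> ((?L False \<union> ?L True) \<union> (?F False \<union> ?F True)))"
    by (rule PS.finite_measure_mono_AE) (use meas in auto)
  also have "\<dots> \<le> measure PS ?E0 + ((measure PS (?L False) + measure PS (?L True)) + (measure PS (?F False) + measure PS (?F True)))"
    by (intro order_trans[OF measure_Un_le] add_mono order_refl) (use meas in auto)
  also have "\<dots> \<le> \<theta> ^ t + (((1/2) ^ t + (1/2) ^ t) + (2 * (1/2) ^ t + 2 * (1/2) ^ t))"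
  proof (intro add_mono)
    have "measure PS ?E0 \<le> (1 - (\<tau> * \<gamma>)\<^sup>2 / 2) ^ ?k" using att[of ?k] by simp
    also have "\<dots> = sqrt (1 - (\<tau> * \<gamma>)\<^sup>2 / 2) ^ (2 * ?k)"
      using tg by (simp add: power_mult)
    also have "\<dots> \<le> sqrt (1 - (\<tau> * \<gamma>)\<^sup>2 / 2) ^ t"
      using tg by (intro power_decreasing) auto
    also have "\<dots> \<le> \<theta> ^ t" using tg by (intro power_mono) (auto simp: \<theta>_def)
    finally show "measure PS ?E0 \<le> \<theta> ^ t" .
    have L: "measure PS (?L b) \<le> (1/2) ^ t" for b
      using prob_cp[OF Long_meas[of "0::'n site" "lev t" "C * t"], of b] LongP[of 0 t] by simp
    have F: "measure PS (?F b) \<le> 2 * (1/2) ^ t" for b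
    proof -
      have "Measurable.pred PS (\<lambda>\<omega>::'n env. \<not> Long \<omega> 0 (lev t) (C * t) \<and> t \<le> 4 * card {j\<in>{1..t}. Fail A \<omega> 0 j})"
        using card_meas[where P="\<lambda>j (\<omega>::'n env). Fail A \<omega> (0::'n site) j", OF Fail_meas, measurable] by measurable
      from prob_cp[OF this, of b] FailP[of 0 t] show ?thesis by simp
    qed
    show "measure PS (?L False) \<le> (1/2) ^ t" "measure PS (?L True) \<le> (1/2) ^ t"
      "measure PS (?F False) \<le> 2 * (1/2) ^ t" "measure PS (?F True) \<le> 2 * (1/2) ^ t" by (rule L F)+
  qed
  also have "\<dots> \<le> \<theta> ^ t + ((\<theta> ^ t + \<theta> ^ t) + (2 * \<theta> ^ t + 2 * \<theta> ^ t))"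
    using \<theta> by (intro add_mono mult_left_mono power_mono) auto
  finally show ?thesis by simp
qed

end

subsection \<open>A maximum principle for a walk that may be killed\<close>

definition qn :: "'n::{finite,linorder} site \<Rightarrow> real" where
  "qn s = (\<Sum>i\<in>-{dd}. (real_of_int (s $ i))\<^sup>2)"

definition dt :: "'n::{finite,linorder} site \<Rightarrow> 'n site \<Rightarrow> real" where
  "dt s t = (\<Sum>i\<in>-{dd}. real_of_int (s $ i) * real_of_int (t $ i))"

lemma qn_nonneg [simp]: "0 \<le> qn s" by (simp add: qn_def sum_nonneg)

lemma qn_add: "qn (s + t) = qn s + 2 * dt s t + qn t"
  by (simp add: qn_def dt_def power2_sum sum.distrib sum_distrib_left algebra_simps)

lemma qn_minus [simp]: "qn (- s) = qn s" by (simp add: qn_def)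

lemma dt_minus [simp]: "dt s (- t) = - dt s t" by (simp add: dt_def sum_negf)

lemma dt_le: "\<bar>dt s t\<bar> \<le> (qn s + qn t) / 2"
proof -
  have "qn (s + t) \<ge> 0" "qn (s + (- t)) \<ge> 0" by (rule qn_nonneg)+
  thus ?thesis unfolding qn_add by (simp add: abs_le_iff)
qed

lemma dt_le2: "2 * dt s t \<le> qn s + qn t"
  using qn_nonneg[of "s + (- t)"] unfolding qn_add by simp

lemma dt_CS: "(dt s t)\<^sup>2 \<le> qn s * qn t"
  unfolding dt_def qn_def by (rule Cauchy_Schwarz_ineq_sum)

lemma finite_qn: "finite {s::'n::{finite,linorder} site. s $ dd = 0 \<and> qn s < K}"
proof (rule finite_subset)
  show "{s::'n site. s $ dd = 0 \<and> qn s < K} \<subseteq> Bx 0 (\<lceil>K\<rceil> + 1)"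
  proof safe
    fix s :: "'n site" assume s: "s $ dd = 0" "qn s < K"
    have "\<bar>s $ i\<bar> \<le> \<lceil>K\<rceil> + 1" for i
    proof (cases "i = dd")
      case True
      have "0 \<le> K" using s(2) qn_nonneg[of s] by linarith
      thus ?thesis using True s by (simp add: le_ceiling_iff)
    next
      case False
      have "\<bar>s $ i\<bar> \<le> (s $ i)\<^sup>2"
      proof (cases "s $ i = 0")
        case False
        hence "\<bar>s $ i\<bar> * 1 \<le> \<bar>s $ i\<bar> * \<bar>s $ i\<bar>" by (intro mult_left_mono) auto
        thus ?thesis by (simp add: power2_eq_square)
      qed simp
      hence "real_of_int \<bar>s $ i\<bar> \<le> (real_of_int (s $ i))\<^sup>2" by (metis of_int_le_iff of_int_power)
      also have "\<dots> \<le> qn s" unfolding qn_def by (rule member_le_sum) (use False in auto)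
      finally show ?thesis using s(2) by linarith
    qed
    thus "s \<in> Bx 0 (\<lceil>K\<rceil> + 1)" by (simp add: Bx_def)
  qed
qed simp

text \<open>Cutting the geometric series after an odd power gives a lower bound on the whole range
  \<open>x > -1\<close>. The jumps of the walk therefore need not be truncated, and a third moment
  of \<open>qn\<close> suffices.\<close>

lemma inv_ge_cubic:
  assumes "(0::real) < 1 + x" shows "1 - x + x ^ 2 - x ^ 3 \<le> 1 / (1 + x)"
proof -
  have "(1 - x + x ^ 2 - x ^ 3) * (1 + x) = 1 - x ^ 4" by (simp add: algebra_simps power2_eq_square power3_eq_cube power4_eq_xxxx)
  also have "\<dots> \<le> 1" by simp
  finally show ?thesis using assms by (simp add: pos_le_divide_eq)
qed

text \<open>The difference of the two sides has derivative \<open>y ^ 3 / (1 + y)\<close>, which has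
  the sign of \<open>y\<close>, so its minimum is at 0. As for the inverse, the bound holds for all
  admissible jumps.\<close>

lemma ln_le_cubic:
  assumes "(0::real) < 1 + x" shows "ln (1 + x) \<le> x - x ^ 2 / 2 + x ^ 3 / 3"
proof -
  define f where "f = (\<lambda>x::real. x - x ^ 2 / 2 + x ^ 3 / 3 - ln (1 + x))"
  have der: "(f has_real_derivative y ^ 3 / (1 + y)) (at y)" if "-1 < y" for y
  proof -
    have "(f has_real_derivative 1 - y + y ^ 2 - 1 / (1 + y)) (at y)"
      unfolding f_def using that by (auto intro!: derivative_eq_intros simp: field_simps)
    also have "1 - y + y ^ 2 - 1 / (1 + y) = y ^ 3 / (1 + y)"
      using that by (simp add: field_simps power2_eq_square power3_eq_cube)
    finally show ?thesis .
  qed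
  have "f 0 \<le> f x"
  proof (cases "0 \<le> x")
    case True
    show ?thesis
      by (rule DERIV_nonneg_imp_nondecreasing[OF True]) (use der in \<open>force\<close>)
  next
    case False
    hence x: "x \<le> 0" by simp
    show ?thesis
    proof (rule DERIV_nonpos_imp_nonincreasing[OF x])
      fix y assume y: "x \<le> y" "y \<le> 0"
      hence "-1 < y" using assms by simp
      moreover have "y ^ 3 / (1 + y) \<le> 0"
        using y \<open>-1 < y\<close> by (intro divide_nonpos_pos) (auto simp: power3_eq_cube mult_nonneg_nonpos mult_nonpos_nonpos)
      ultimately show "\<exists>z. (f has_real_derivative z) (at y) \<and> z \<le> 0" using der by blast
    qed
  qed
  thus ?thesis by (simp add: f_def)
qed

lemma inv_qn_le: "1 / (1 + qn s) \<le> 1" "1 / (2 * (1 + qn s)) \<le> 1/2"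
proof -
  have "0 \<le> qn s" by simp
  thus "1 / (1 + qn s) \<le> 1" "1 / (2 * (1 + qn s)) \<le> 1/2" by (simp_all add: divide_le_eq)
qed

text \<open>\<open>Bd s\<close> is the event that the walk is killed in a step from
  \<open>s\<close>. The proof is a minimum principle for \<open>c - \<epsilon> * u\<close>: at a
  negative minimum, \<open>u\<close> would gain at least \<open>v / (2 * (1 + qn s)\<^sup>2)\<close>
  in mean, while killing costs at most half of this because \<open>u \<le> 1\<close> and
  \<open>c \<ge> 0\<close>; this contradicts \<open>step\<close>.\<close>

lemma (in prob_space) killed_walk:
  fixes D :: "'a \<Rightarrow> 'n::{finite,linorder} site" and c :: "'n site \<Rightarrow> real" and Bd :: "'n site \<Rightarrow> 'a set"
  assumes D [measurable]: "D \<in> measurable M (count_space UNIV)" and Dd: "\<And>\<omega>. D \<omega> $ dd = 0"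
    and D6: "integrable M (\<lambda>\<omega>. qn (D \<omega>) ^ 3)"
    and sym: "distr M (count_space UNIV) D = distr M (count_space UNIV) (\<lambda>\<omega>. - D \<omega>)"
    and iso: "\<And>i j. i \<noteq> dd \<Longrightarrow> j \<noteq> dd \<Longrightarrow> expectation (\<lambda>\<omega>. real_of_int (D \<omega> $ i) * real_of_int (D \<omega> $ j)) = (if i = j then v else 0)"
    and v: "0 < v" and card: "card (-{dd::'n}) \<le> 2"
    and c: "\<And>s. 0 \<le> c s" "\<And>s. c s \<le> B"
    and Bd: "\<And>s. Bd s \<in> events" "\<And>\<eta>. 0 < \<eta> \<Longrightarrow> \<exists>K. \<forall>s. K \<le> qn s \<longrightarrow> prob (Bd s) \<le> \<eta> / (1 + qn s)\<^sup>2"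
    and step: "\<And>s. s $ dd = 0 \<Longrightarrow> R0 \<le> qn s \<Longrightarrow> expectation (\<lambda>\<omega>. indicator (- Bd s) \<omega> * c (s + D \<omega>)) \<le> c s"
    and land: "\<And>s \<omega>. s $ dd = 0 \<Longrightarrow> R0 \<le> qn s \<Longrightarrow> \<omega> \<notin> Bd s \<Longrightarrow> R0 \<le> qn (s + D \<omega>)"
    and pos: "\<And>s. s $ dd = 0 \<Longrightarrow> R0 \<le> qn s \<Longrightarrow> 0 < c s"
  shows "\<exists>\<epsilon>>0. \<forall>s. s $ dd = 0 \<longrightarrow> R0 \<le> qn s \<longrightarrow> \<epsilon> \<le> c s"
proof -
  have fD [measurable]: "(\<lambda>\<omega>. f (D \<omega>)) \<in> borel_measurable M" for f :: "'n site \<Rightarrow> real"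
    by (rule measurable_compose[OF D]) simp
  have int: "integrable M (\<lambda>\<omega>. f (D \<omega>))" if "\<And>t. \<bar>f t\<bar> \<le> k * (1 + qn t ^ 3)" for f k
  proof (rule Bochner_Integration.integrable_bound)
    show "integrable M (\<lambda>\<omega>. k * (1 + qn (D \<omega>) ^ 3))" using D6 by simp
    have "norm (f t) \<le> norm (k * (1 + qn t ^ 3))" for t
      using that[of t] by simp
    thus "AE \<omega> in M. norm (f (D \<omega>)) \<le> norm (k * (1 + qn (D \<omega>) ^ 3))" by simp
  qed simp
  have q1: "qn t \<le> 1 + qn t ^ 3" and q2: "qn t ^ 2 \<le> 1 + qn t ^ 3" for t :: "'n site"
  proof -
    have "0 \<le> qn t" by simp
    hence "qn t \<le> 1 + qn t ^ 3 \<and> qn t ^ 2 \<le> 1 + qn t ^ 3"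
    proof (cases "qn t \<le> 1")
      case True
      thus ?thesis using \<open>0 \<le> qn t\<close> power_le_one[of "qn t" 2] by (smt (verit) zero_le_power)
    next
      case False
      hence "qn t ^ 1 \<le> qn t ^ 3" "qn t ^ 2 \<le> qn t ^ 3" by (intro power_increasing; simp)+
      thus ?thesis by simp
    qed
    thus "qn t \<le> 1 + qn t ^ 3" "qn t ^ 2 \<le> 1 + qn t ^ 3" by auto
  qed
  have odd: "expectation (\<lambda>\<omega>. f (D \<omega>)) = 0" if "\<And>t. f (- t) = - f t" for f :: "'n site \<Rightarrow> real"
  proof -
    have mD: "(\<lambda>\<omega>. - D \<omega>) \<in> measurable M (count_space UNIV)" by (rule measurable_compose[OF D]) simp
    have "expectation (\<lambda>\<omega>. f (D \<omega>)) = integral\<^sup>L (distr M (count_space UNIV) D) f"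
      by (rule integral_distr[symmetric, OF D]) simp
    also have "\<dots> = integral\<^sup>L (distr M (count_space UNIV) (\<lambda>\<omega>. - D \<omega>)) f" by (simp add: sym)
    also have "\<dots> = expectation (\<lambda>\<omega>. f (- D \<omega>))" by (rule integral_distr[OF mD]) simp
    also have "\<dots> = - expectation (\<lambda>\<omega>. f (D \<omega>))" by (simp add: that)
    finally show ?thesis by simp
  qed
  define d where "d = real (card (-{dd::'n}))"
  have d: "0 \<le> d" "d \<le> 2" using card by (auto simp: d_def)
  define m2 where "m2 = expectation (\<lambda>\<omega>. qn (D \<omega>) ^ 2)"
  define m3 where "m3 = expectation (\<lambda>\<omega>. qn (D \<omega>) ^ 3)"
  have m: "0 \<le> m2" "0 \<le> m3" by (simp_all add: m2_def m3_def)
  \<comment> \<open>One constant that dominates the error terms in the expansions of both the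
    inverse and the logarithm.\<close>
  define K where "K = 4 * v + 12 * m2 + m3"
  have K: "0 < K" using v m by (simp add: K_def)
  \<comment> \<open>The increment of \<open>qn\<close> when \<open>s\<close> is moved by
    \<open>t\<close>; both expansions are in powers of \<open>b s t / (1 + qn s)\<close>.\<close>
  define b where "b = (\<lambda>s t :: 'n site. 2 * dt s t + qn t)"
  have iq: "integrable M (\<lambda>\<omega>. qn (D \<omega>))" by (rule int[of qn 1]) (use q1 in auto)
  have iq2: "integrable M (\<lambda>\<omega>. qn (D \<omega>) ^ 2)" by (rule int[of "\<lambda>t. qn t ^ 2" 1]) (use q2 in auto)
  have idd: "integrable M (\<lambda>\<omega>. real_of_int (D \<omega> $ i) * real_of_int (D \<omega> $ j))" if "i \<noteq> dd" "j \<noteq> dd" for i j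
  proof (rule int[of "\<lambda>t. real_of_int (t $ i) * real_of_int (t $ j)" 1])
    fix t :: "'n site"
    have "(real_of_int (t $ i))\<^sup>2 \<le> qn t" "(real_of_int (t $ j))\<^sup>2 \<le> qn t"
      unfolding qn_def by (rule member_le_sum; use that in auto)+
    moreover have "\<bar>real_of_int (t $ i) * real_of_int (t $ j)\<bar> \<le> ((real_of_int (t $ i))\<^sup>2 + (real_of_int (t $ j))\<^sup>2) / 2"
      using sum_squares_bound[of "\<bar>real_of_int (t $ i)\<bar>" "\<bar>real_of_int (t $ j)\<bar>"] by (simp add: abs_mult)
    ultimately have "\<bar>real_of_int (t $ i) * real_of_int (t $ j)\<bar> \<le> qn t" by argo
    thus "\<bar>real_of_int (t $ i) * real_of_int (t $ j)\<bar> \<le> 1 * (1 + qn t ^ 3)" using q1[of t] by simp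
  qed
  have Eq: "expectation (\<lambda>\<omega>. qn (D \<omega>)) = d * v"
  proof -
    have "expectation (\<lambda>\<omega>. qn (D \<omega>)) = (\<Sum>i\<in>-{dd}. expectation (\<lambda>\<omega>. real_of_int (D \<omega> $ i) * real_of_int (D \<omega> $ i)))"
      unfolding qn_def power2_eq_square by (rule Bochner_Integration.integral_sum) (use idd in auto)
    also have "\<dots> = (\<Sum>i\<in>-{dd::'n}. v)" by (rule sum.cong) (use iso in auto)
    finally show ?thesis by (simp add: d_def)
  qed
  have Edt2: "expectation (\<lambda>\<omega>. (dt s (D \<omega>))\<^sup>2) = v * qn s" for s
  proof -
    have "expectation (\<lambda>\<omega>. (dt s (D \<omega>))\<^sup>2) = expectation (\<lambda>\<omega>. \<Sum>i\<in>-{dd}. \<Sum>j\<in>-{dd}.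
        (real_of_int (s $ i) * real_of_int (s $ j)) * (real_of_int (D \<omega> $ i) * real_of_int (D \<omega> $ j)))"
      unfolding dt_def power2_eq_square sum_product by (simp add: mult_ac)
    also have "\<dots> = (\<Sum>i\<in>-{dd}. \<Sum>j\<in>-{dd}. (real_of_int (s $ i) * real_of_int (s $ j)) *
        expectation (\<lambda>\<omega>. real_of_int (D \<omega> $ i) * real_of_int (D \<omega> $ j)))"
    proof -
      have t: "integrable M (\<lambda>\<omega>. (real_of_int (s $ i) * real_of_int (s $ j)) * (real_of_int (D \<omega> $ i) * real_of_int (D \<omega> $ j)))"
        if "i \<in> -{dd}" "j \<in> -{dd}" for i j
        using idd[of i j] that by simp
      have "expectation (\<lambda>\<omega>. \<Sum>i\<in>-{dd}. \<Sum>j\<in>-{dd}. (real_of_int (s $ i) * real_of_int (s $ j)) * (real_of_int (D \<omega> $ i) * real_of_int (D \<omega> $ j)))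
        = (\<Sum>i\<in>-{dd}. expectation (\<lambda>\<omega>. \<Sum>j\<in>-{dd}. (real_of_int (s $ i) * real_of_int (s $ j)) * (real_of_int (D \<omega> $ i) * real_of_int (D \<omega> $ j))))"
        by (rule Bochner_Integration.integral_sum) (rule Bochner_Integration.integrable_sum, rule t)
      also have "\<dots> = (\<Sum>i\<in>-{dd}. \<Sum>j\<in>-{dd}. expectation (\<lambda>\<omega>. (real_of_int (s $ i) * real_of_int (s $ j)) * (real_of_int (D \<omega> $ i) * real_of_int (D \<omega> $ j))))"
        by (rule sum.cong[OF refl], rule Bochner_Integration.integral_sum) (rule t)
      finally show ?thesis by simp
    qed
    also have "\<dots> = (\<Sum>i\<in>-{dd}. \<Sum>j\<in>-{dd}. if i = j then (real_of_int (s $ i) * real_of_int (s $ j)) * v else 0)"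
      by (intro sum.cong) (auto simp: iso)
    also have "\<dots> = (\<Sum>i\<in>-{dd}. (real_of_int (s $ i))\<^sup>2 * v)" by (simp add: power2_eq_square)
    finally show ?thesis by (simp add: qn_def sum_distrib_left mult.commute)
  qed
  have dtq: "\<bar>dt s t ^ i * qn t ^ j\<bar> \<le> 4 * (1 + qn s) ^ 3 * (1 + qn t ^ 3)" if ij: "i + j \<le> 3" for s t :: "'n site" and i j
  proof -
    let ?S = "qn s" and ?Q = "qn t"
    have S: "0 \<le> ?S" and Q: "0 \<le> ?Q" by auto
    have one: "1 \<le> (1 + ?S) * (1 + ?Q)" using mult_mono[of 1 "1 + ?S" 1 "1 + ?Q"] S Q by simp
    have "\<bar>dt s t\<bar> \<le> (1 + ?S) * (1 + ?Q)"
    proof -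
      have "\<bar>dt s t\<bar> \<le> ?S + ?Q" using dt_le[of s t] S Q by argo
      also have "\<dots> \<le> ?S + ?Q + (1 + ?S * ?Q)" using S Q by simp
      also have "\<dots> = (1 + ?S) * (1 + ?Q)" by (simp add: algebra_simps)
      finally show ?thesis .
    qed
    hence 1: "\<bar>dt s t\<bar> ^ i \<le> ((1 + ?S) * (1 + ?Q)) ^ i" by (rule power_mono) simp
    have "?Q \<le> (1 + ?S) * (1 + ?Q)"
      using mult_mono[of 1 "1 + ?S" "?Q" "1 + ?Q"] S Q by simp
    hence 2: "?Q ^ j \<le> ((1 + ?S) * (1 + ?Q)) ^ j" by (rule power_mono) simp
    have "\<bar>dt s t ^ i * ?Q ^ j\<bar> = \<bar>dt s t\<bar> ^ i * ?Q ^ j" by (simp add: abs_mult power_abs)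
    also have "\<dots> \<le> ((1 + ?S) * (1 + ?Q)) ^ i * ((1 + ?S) * (1 + ?Q)) ^ j"
      using 1 2 S Q by (intro mult_mono) auto
    also have "\<dots> = ((1 + ?S) * (1 + ?Q)) ^ (i + j)" by (simp add: power_add)
    also have "\<dots> \<le> ((1 + ?S) * (1 + ?Q)) ^ 3" using one ij by (intro power_increasing) auto
    also have "\<dots> = (1 + ?S) ^ 3 * (1 + ?Q) ^ 3" by (simp add: power_mult_distrib)
    also have "(1 + ?Q) ^ 3 \<le> 4 * (1 + ?Q ^ 3)"
    proof -
      have "4 * (1 + ?Q ^ 3) - (1 + ?Q) ^ 3 = 3 * (1 + ?Q) * (?Q - 1)\<^sup>2"
        by (simp add: power3_eq_cube power2_eq_square algebra_simps)
      moreover have "0 \<le> 3 * (1 + ?Q) * (?Q - 1)\<^sup>2" using Q by simp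
      ultimately show ?thesis by (linarith | argo | smt (verit))
    qed
    finally show ?thesis using S by (simp add: algebra_simps)
  qed
  have ip: "integrable M (\<lambda>\<omega>. dt s (D \<omega>) ^ i * qn (D \<omega>) ^ j)" if "i + j \<le> 3" for s i j
    by (rule int[of "\<lambda>t. dt s t ^ i * qn t ^ j" "4 * (1 + qn s) ^ 3"]) (use dtq[OF that, of s] in auto)
  have i1: "integrable M (\<lambda>\<omega>. dt s (D \<omega>))" for s using ip[of 1 0 s] by simp
  have i2: "integrable M (\<lambda>\<omega>. dt s (D \<omega>) ^ 2)" for s using ip[of 2 0 s] by simp
  have i3: "integrable M (\<lambda>\<omega>. dt s (D \<omega>) * qn (D \<omega>))" for s using ip[of 1 1 s] by simp
  have i4: "integrable M (\<lambda>\<omega>. dt s (D \<omega>) ^ 3)" for s using ip[of 3 0 s] by simp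
  have i5: "integrable M (\<lambda>\<omega>. dt s (D \<omega>) ^ 2 * qn (D \<omega>))" for s using ip[of 2 1 s] by simp
  have i6: "integrable M (\<lambda>\<omega>. dt s (D \<omega>) * qn (D \<omega>) ^ 2)" for s using ip[of 1 2 s] by simp
  have b2: "b s t ^ 2 = 4 * dt s t ^ 2 + 4 * (dt s t * qn t) + qn t ^ 2" for s t
    by (simp add: b_def power2_eq_square algebra_simps)
  have b3: "b s t ^ 3 = 8 * dt s t ^ 3 + 12 * (dt s t ^ 2 * qn t) + 6 * (dt s t * qn t ^ 2) + qn t ^ 3" for s t
    by (simp add: b_def power2_eq_square power3_eq_cube algebra_simps)
  have ib: "integrable M (\<lambda>\<omega>. b s (D \<omega>))" "integrable M (\<lambda>\<omega>. b s (D \<omega>) ^ 2)" "integrable M (\<lambda>\<omega>. b s (D \<omega>) ^ 3)" for s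
    unfolding b2 b3 unfolding b_def using i1 i2 i3 i4 i5 i6 iq iq2 D6 by auto
  have Eb1: "expectation (\<lambda>\<omega>. b s (D \<omega>)) = d * v" for s
    unfolding b_def using i1[of s] iq odd[of "dt s"] Eq by simp
  have Eb2: "expectation (\<lambda>\<omega>. b s (D \<omega>) ^ 2) = 4 * (v * qn s) + m2" for s
    unfolding b2 using i2[of s] i3[of s] iq2 odd[of "\<lambda>t. dt s t * qn t"] Edt2[of s] by (simp add: m2_def)
  have Eb3: "expectation (\<lambda>\<omega>. b s (D \<omega>) ^ 3) \<le> 12 * (qn s * m2) + m3" for s
  proof -
    have "expectation (\<lambda>\<omega>. dt s (D \<omega>) ^ 2 * qn (D \<omega>)) \<le> expectation (\<lambda>\<omega>. qn s * qn (D \<omega>) ^ 2)"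
    proof (rule integral_mono)
      fix \<omega>
      have "dt s (D \<omega>) ^ 2 * qn (D \<omega>) \<le> (qn s * qn (D \<omega>)) * qn (D \<omega>)"
        by (intro mult_right_mono dt_CS) simp
      thus "dt s (D \<omega>) ^ 2 * qn (D \<omega>) \<le> qn s * qn (D \<omega>) ^ 2" by (simp add: power2_eq_square mult.assoc)
    qed (use i5 iq2 in auto)
    hence "expectation (\<lambda>\<omega>. dt s (D \<omega>) ^ 2 * qn (D \<omega>)) \<le> qn s * m2" by (simp add: m2_def)
    moreover have "expectation (\<lambda>\<omega>. b s (D \<omega>) ^ 3) = 12 * expectation (\<lambda>\<omega>. dt s (D \<omega>) ^ 2 * qn (D \<omega>)) + m3"
      unfolding b3 using i4[of s] i5[of s] i6[of s] D6 odd[of "\<lambda>t. dt s t ^ 3"] odd[of "\<lambda>t. dt s t * qn t ^ 2"]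
      by (simp add: m3_def)
    ultimately show ?thesis by simp
  qed
  define u where "u = (\<lambda>L (s::'n site). 1/2 + 1 / (2 * (1 + qn s)) - ln (1 + qn s) / L)"
  have iln: "integrable M (\<lambda>\<omega>. ln (1 + qn (s + D \<omega>)))" for s
  proof (rule int[of "\<lambda>t. ln (1 + qn (s + t))" "4 * (1 + qn s)"])
    fix t :: "'n site"
    have "\<bar>ln (1 + qn (s + t))\<bar> = ln (1 + qn (s + t))" by simp
    also have "\<dots> \<le> qn (s + t)" by (rule ln_add_one_self_le_self) simp
    also have "\<dots> \<le> 2 * (qn s + qn t)" using dt_le2[of s t] by (simp add: qn_add)
    also have "\<dots> \<le> 4 * (1 + qn s) * (1 + qn t ^ 3)"
    proof -
      have "0 \<le> qn s * qn t ^ 3" "0 \<le> qn s" "0 \<le> qn t ^ 3" by auto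
      moreover have "4 * (1 + qn s) * (1 + qn t ^ 3) = 4 + 4 * qn s + 4 * qn t ^ 3 + 4 * (qn s * qn t ^ 3)"
        by (simp add: algebra_simps)
      ultimately show ?thesis using q1[of t] by (linarith | argo | smt (verit))
    qed
    finally show "\<bar>ln (1 + qn (s + t))\<bar> \<le> 4 * (1 + qn s) * (1 + qn t ^ 3)" .
  qed
  have iinv: "integrable M (\<lambda>\<omega>. 1 / (1 + qn (s + D \<omega>)))" for s
  proof (rule int[of "\<lambda>t. 1 / (1 + qn (s + t))" 1])
    fix t :: "'n site"
    have "\<bar>1 / (1 + qn (s + t))\<bar> \<le> 1" using inv_qn_le(1)[of "s + t"] by simp
    also have "\<dots> \<le> 1 * (1 + qn t ^ 3)" by simp
    finally show "\<bar>1 / (1 + qn (s + t))\<bar> \<le> 1 * (1 + qn t ^ 3)" .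
  qed
  have iu: "integrable M (\<lambda>\<omega>. u L (s + D \<omega>))" for L s
  proof -
    have "integrable M (\<lambda>\<omega>. 1/2 + 1 / 2 * (1 / (1 + qn (s + D \<omega>))) - (1 / L) * ln (1 + qn (s + D \<omega>)))"
      using iln[of s] iinv[of s] by (intro Bochner_Integration.integrable_diff Bochner_Integration.integrable_add integrable_mult_right) auto
    thus ?thesis by (simp add: u_def)
  qed
  \<comment> \<open>Here the dimension decides. With \<open>y = 1 / (1 + qn s)\<close> the inverse
    gains \<open>(4 - d) * v * y^2\<close>, which is at least \<open>2 * v * y^2\<close>, and the
    logarithm has the leading term \<open>(d - 2) * v * y\<close>, which is not positive. All else
    is of the order of the error terms with \<open>K\<close>.\<close>
  have Einv: "1 / (1 + qn s) + (2 * v / (1 + qn s) ^ 2 - K / (1 + qn s) ^ 3) \<le> expectation (\<lambda>\<omega>. 1 / (1 + qn (s + D \<omega>)))"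
    and Eln: "expectation (\<lambda>\<omega>. ln (1 + qn (s + D \<omega>))) \<le> ln (1 + qn s) + K / (1 + qn s) ^ 2" for s
  proof -
    define y where "y = 1 / (1 + qn s)"
    have a1: "1 \<le> 1 + qn s" by simp
    have y: "0 < y" "y \<le> 1" using inv_qn_le(1)[of s] add_pos_nonneg[OF zero_less_one qn_nonneg[of s]] by (auto simp: y_def)
    have ay: "1 + qn s = 1 / y" by (simp add: y_def)
    have qy: "qn s * y = 1 - y" using y ay by (simp add: field_simps)
    have pos: "0 < 1 + b s t * y" for t
    proof -
      have "0 < 1 + qn (s + t)" by (simp add: add_pos_nonneg)
      also have "1 + qn (s + t) = (1 + qn s) + b s t" by (simp add: qn_add b_def)
      finally have "0 < ((1 + qn s) + b s t) * y" using y by simp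
      also have "\<dots> = (1 + qn s) * y + b s t * y" by (simp add: algebra_simps)
      also have "(1 + qn s) * y = 1" unfolding ay using y by simp
      finally show ?thesis .
    qed
    have split: "1 + qn (s + t) = (1 + qn s) * (1 + b s t * y)" for t
    proof -
      have "(1 + qn s) * (1 + b s t * y) = (1 + qn s) + ((1 + qn s) * y) * b s t" by (simp add: algebra_simps)
      also have "(1 + qn s) * y = 1" unfolding ay using y by simp
      finally show ?thesis by (simp add: qn_add b_def)
    qed
    have y23: "0 \<le> y ^ 2" "0 \<le> y ^ 3" "0 \<le> y ^ 4" "y ^ 4 \<le> y ^ 3" "y ^ 3 \<le> y ^ 2"
      using y by (auto intro: power_decreasing)
    have prods: "0 \<le> (2 - d) * v * y ^ 2" "0 \<le> (2 - d) * v * y" "0 \<le> m2 * y ^ 3" "0 \<le> m2 * y ^ 4" "0 \<le> m3 * (y ^ 3 - y ^ 4)"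
       "0 \<le> m3 * y ^ 3" "0 \<le> m3 * y ^ 4" "0 \<le> m2 * y ^ 2" "0 \<le> v * y ^ 2" "0 \<le> v * y ^ 3" "0 \<le> m3 * (y ^ 2 - y ^ 3)" "0 \<le> m3 * y ^ 2"
      using y23 y v m d by auto
    have "y - d * v * y ^ 2 + (4 * (v * qn s) + m2) * y ^ 3 - (12 * (qn s * m2) + m3) * y ^ 4
       \<le> y - expectation (\<lambda>\<omega>. b s (D \<omega>)) * y ^ 2 + expectation (\<lambda>\<omega>. b s (D \<omega>) ^ 2) * y ^ 3 - expectation (\<lambda>\<omega>. b s (D \<omega>) ^ 3) * y ^ 4"
      unfolding Eb1 Eb2 using mult_right_mono[OF Eb3[of s] y23(3)] by simp
    also have "\<dots> = expectation (\<lambda>\<omega>. y - b s (D \<omega>) * y ^ 2 + b s (D \<omega>) ^ 2 * y ^ 3 - b s (D \<omega>) ^ 3 * y ^ 4)"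
      using ib[of s] prob_space by simp
    also have "\<dots> \<le> expectation (\<lambda>\<omega>. 1 / (1 + qn (s + D \<omega>)))"
    proof (rule integral_mono)
      fix \<omega>
      let ?x = "b s (D \<omega>) * y"
      have "y * (1 - ?x + ?x ^ 2 - ?x ^ 3) \<le> y * (1 / (1 + ?x))"
        using inv_ge_cubic[OF pos[of "D \<omega>"]] y by (intro mult_left_mono) auto
      moreover have "y * (1 / (1 + ?x)) = 1 / (1 + qn (s + D \<omega>))"
        unfolding split ay using y by simp
      moreover have "y * (1 - ?x + ?x ^ 2 - ?x ^ 3) = y - b s (D \<omega>) * y ^ 2 + b s (D \<omega>) ^ 2 * y ^ 3 - b s (D \<omega>) ^ 3 * y ^ 4"
        by (simp add: algebra_simps power2_eq_square power3_eq_cube power4_eq_xxxx)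
      ultimately show "y - b s (D \<omega>) * y ^ 2 + b s (D \<omega>) ^ 2 * y ^ 3 - b s (D \<omega>) ^ 3 * y ^ 4 \<le> 1 / (1 + qn (s + D \<omega>))" by simp
    qed (use ib[of s] iinv[of s] in auto)
    finally have E1: "y - d * v * y ^ 2 + (4 * (v * qn s) + m2) * y ^ 3 - (12 * (qn s * m2) + m3) * y ^ 4
      \<le> expectation (\<lambda>\<omega>. 1 / (1 + qn (s + D \<omega>)))" .
    have r3: "qn s * y ^ 3 = y ^ 2 - y ^ 3" and r4: "qn s * y ^ 4 = y ^ 3 - y ^ 4" and r2: "qn s * y ^ 2 = y - y ^ 2"
    proof -
      have "qn s * y ^ 2 = (qn s * y) * y" "qn s * y ^ 3 = (qn s * y) * y ^ 2" "qn s * y ^ 4 = (qn s * y) * y ^ 3"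
        by (simp_all add: power2_eq_square power3_eq_cube power4_eq_xxxx)
      thus "qn s * y ^ 3 = y ^ 2 - y ^ 3" "qn s * y ^ 4 = y ^ 3 - y ^ 4" "qn s * y ^ 2 = y - y ^ 2"
        unfolding qy by (simp_all add: algebra_simps power2_eq_square power3_eq_cube power4_eq_xxxx)
    qed
    have e1: "(4 * (v * qn s) + m2) * y ^ 3 = 4 * v * (y ^ 2 - y ^ 3) + m2 * y ^ 3"
      unfolding r3[symmetric] by (simp add: algebra_simps)
    have e2: "(12 * (qn s * m2) + m3) * y ^ 4 = 12 * m2 * (y ^ 3 - y ^ 4) + m3 * y ^ 4"
      unfolding r4[symmetric] by (simp add: algebra_simps)
    have "y + (2 * v * y ^ 2 - K * y ^ 3) \<le> y - d * v * y ^ 2 + (4 * (v * qn s) + m2) * y ^ 3 - (12 * (qn s * m2) + m3) * y ^ 4"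
      unfolding e1 e2 K_def using prods by (simp add: algebra_simps)
    with E1 have "y + (2 * v * y ^ 2 - K * y ^ 3) \<le> expectation (\<lambda>\<omega>. 1 / (1 + qn (s + D \<omega>)))" by (linarith | argo | smt (verit))
    thus "1 / (1 + qn s) + (2 * v / (1 + qn s) ^ 2 - K / (1 + qn s) ^ 3) \<le> expectation (\<lambda>\<omega>. 1 / (1 + qn (s + D \<omega>)))"
      by (simp add: y_def power_one_over)
    have "expectation (\<lambda>\<omega>. ln (1 + qn (s + D \<omega>)))
       \<le> expectation (\<lambda>\<omega>. ln (1 + qn s) + b s (D \<omega>) * y - b s (D \<omega>) ^ 2 * (y ^ 2 / 2) + b s (D \<omega>) ^ 3 * (y ^ 3 / 3))"
    proof (rule integral_mono)
      fix \<omega>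
      let ?x = "b s (D \<omega>) * y"
      have "ln (1 + qn (s + D \<omega>)) = ln (1 + qn s) + ln (1 + ?x)"
        unfolding split by (rule ln_mult_pos[OF add_pos_nonneg[OF zero_less_one qn_nonneg] pos])
      also have "\<dots> \<le> ln (1 + qn s) + (?x - ?x ^ 2 / 2 + ?x ^ 3 / 3)" using ln_le_cubic[OF pos[of "D \<omega>"]] by simp
      finally show "ln (1 + qn (s + D \<omega>)) \<le> ln (1 + qn s) + b s (D \<omega>) * y - b s (D \<omega>) ^ 2 * (y ^ 2 / 2) + b s (D \<omega>) ^ 3 * (y ^ 3 / 3)"
        by (simp add: power_mult_distrib)
    qed (use ib[of s] iln[of s] in auto)
    also have "\<dots> = ln (1 + qn s) + d * v * y - (4 * (v * qn s) + m2) * (y ^ 2 / 2) + expectation (\<lambda>\<omega>. b s (D \<omega>) ^ 3) * (y ^ 3 / 3)"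
      using ib[of s] prob_space Eb1[of s] Eb2[of s] by simp
    also have "\<dots> \<le> ln (1 + qn s) + d * v * y - (4 * (v * qn s) + m2) * (y ^ 2 / 2) + (12 * (qn s * m2) + m3) * (y ^ 3 / 3)"
      using y by (intro add_left_mono mult_right_mono Eb3) auto
    finally have E2: "expectation (\<lambda>\<omega>. ln (1 + qn (s + D \<omega>))) \<le>
      ln (1 + qn s) + d * v * y - (4 * (v * qn s) + m2) * (y ^ 2 / 2) + (12 * (qn s * m2) + m3) * (y ^ 3 / 3)" .
    have e3: "(4 * (v * qn s) + m2) * (y ^ 2 / 2) = 2 * v * (y - y ^ 2) + m2 * y ^ 2 / 2"
      unfolding r2[symmetric] by (simp add: algebra_simps)
    have e4: "(12 * (qn s * m2) + m3) * (y ^ 3 / 3) = 4 * m2 * (y ^ 2 - y ^ 3) + m3 * y ^ 3 / 3"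
      unfolding r3[symmetric] by (simp add: algebra_simps)
    have "d * v * y - (2 * v * (y - y ^ 2) + m2 * y ^ 2 / 2) + (4 * m2 * (y ^ 2 - y ^ 3) + m3 * y ^ 3 / 3) \<le> K * y ^ 2"
      unfolding K_def using prods by (simp add: algebra_simps)
    with E2 have "expectation (\<lambda>\<omega>. ln (1 + qn (s + D \<omega>))) \<le> ln (1 + qn s) + K * y ^ 2"
      unfolding e3 e4 by (linarith | argo | smt (verit))
    thus "expectation (\<lambda>\<omega>. ln (1 + qn (s + D \<omega>))) \<le> ln (1 + qn s) + K / (1 + qn s) ^ 2"
      by (simp add: y_def power_one_over)
  qed
  \<comment> \<open>The factor 1/2 in \<open>u\<close> leaves a gain of
    \<open>v / (1 + qn s)\<^sup>2\<close>. The lower bounds on \<open>qn s\<close> and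
    \<open>L\<close> ensure that the errors of the inverse and of the logarithm each take away at
    most a quarter of it.\<close>
  have drift: "u L s + v / (2 * (1 + qn s) ^ 2) \<le> expectation (\<lambda>\<omega>. u L (s + D \<omega>))"
    if L: "4 * K / v \<le> L" and s: "2 * K / v \<le> qn s" for L s
  proof -
    have L0: "0 < L" using L K v by (smt (verit) divide_pos_pos mult_pos_pos)
    have a: "0 < 1 + qn s" by (simp add: add_pos_nonneg)
    have "expectation (\<lambda>\<omega>. u L (s + D \<omega>)) = 1/2 + expectation (\<lambda>\<omega>. 1 / (1 + qn (s + D \<omega>))) / 2 - expectation (\<lambda>\<omega>. ln (1 + qn (s + D \<omega>))) / L"
    proof -
      have "expectation (\<lambda>\<omega>. u L (s + D \<omega>)) = expectation (\<lambda>\<omega>. 1/2 + (1 / (1 + qn (s + D \<omega>))) / 2 - ln (1 + qn (s + D \<omega>)) / L)"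
        by (simp only: u_def divide_divide_eq_left mult.commute)
      also have "\<dots> = 1/2 + expectation (\<lambda>\<omega>. 1 / (1 + qn (s + D \<omega>))) / 2 - expectation (\<lambda>\<omega>. ln (1 + qn (s + D \<omega>))) / L"
      proof -
        have "expectation (\<lambda>\<omega>. 1/2 + f \<omega> / 2 - h \<omega> / L) = 1/2 + expectation f / 2 - expectation h / L"
          if "integrable M f" "integrable M h" for f h :: "'a \<Rightarrow> real"
          using that prob_space by simp
        from this[OF iinv[of s] iln[of s]] show ?thesis .
      qed
      finally show ?thesis .
    qed
    also have "\<dots> \<ge> 1/2 + (1 / (1 + qn s) + (2 * v / (1 + qn s) ^ 2 - K / (1 + qn s) ^ 3)) / 2 - (ln (1 + qn s) + K / (1 + qn s) ^ 2) / L"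
      using Einv[of s] Eln[of s] L0 by (intro diff_mono add_left_mono divide_right_mono) auto
    finally have *: "1/2 + (1 / (1 + qn s) + (2 * v / (1 + qn s) ^ 2 - K / (1 + qn s) ^ 3)) / 2 - (ln (1 + qn s) + K / (1 + qn s) ^ 2) / L
       \<le> expectation (\<lambda>\<omega>. u L (s + D \<omega>))" .
    have k1: "K / (1 + qn s) ^ 3 \<le> (v / 2) / (1 + qn s) ^ 2"
    proof -
      have "2 * K \<le> qn s * v" using s v by (simp add: pos_divide_le_eq)
      hence "K \<le> v / 2 * (1 + qn s)" using v by (simp add: algebra_simps)
      hence "K / (1 + qn s) ^ 3 \<le> v / 2 * (1 + qn s) / (1 + qn s) ^ 3" using a by (intro divide_right_mono) auto
      also have "\<dots> = (v / 2) / (1 + qn s) ^ 2" using a by (simp add: power3_eq_cube power2_eq_square)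
      finally show ?thesis .
    qed
    have k2: "K / (1 + qn s) ^ 2 / L \<le> (v / 4) / (1 + qn s) ^ 2"
    proof -
      have "4 * K \<le> L * v" using L v by (simp add: pos_divide_le_eq)
      hence "K / L \<le> v / 4" using L0 by (simp add: pos_divide_le_eq algebra_simps)
      hence "K / L / (1 + qn s) ^ 2 \<le> (v / 4) / (1 + qn s) ^ 2" by (intro divide_right_mono) auto
      thus ?thesis by (simp add: mult.commute)
    qed
    have "u L s + v / (2 * (1 + qn s) ^ 2) = 1/2 + (1 / (1 + qn s)) / 2 - ln (1 + qn s) / L + (v / 2) / (1 + qn s) ^ 2"
      by (simp add: u_def)
    moreover have "2 * v / (1 + qn s) ^ 2 = 4 * ((v / 2) / (1 + qn s) ^ 2)" "(v / 4) / (1 + qn s) ^ 2 = ((v / 2) / (1 + qn s) ^ 2) / 2"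
      by (simp_all add: field_simps)
    ultimately show ?thesis using * k1 k2 by (simp add: add_divide_distrib diff_divide_distrib)
  qed
  obtain K1 where K1: "\<And>s. K1 \<le> qn s \<Longrightarrow> prob (Bd s) \<le> (v / 4) / (1 + qn s)\<^sup>2"
    using Bd(2)[of "v / 4"] v by auto
  \<comment> \<open>From \<open>K2\<close> on both the killing and the expansion errors are under
    control. Only finitely many states between \<open>R0\<close> and \<open>K2\<close> remain, and
    there strict positivity of \<open>c\<close> supplies \<open>\<epsilon>\<close>.\<close>
  define K2 where "K2 = max (max K1 R0) (2 * K / v)"
  define F where "F = {s::'n site. s $ dd = 0 \<and> R0 \<le> qn s \<and> qn s < K2}"
  have F: "finite F" by (rule finite_subset[OF _ finite_qn[of K2]]) (auto simp: F_def)
  define \<epsilon> where "\<epsilon> = Min (insert 1 (c ` F))"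
  have eps: "0 < \<epsilon>" unfolding \<epsilon>_def using F pos by (subst Min_gr_iff) (auto simp: F_def)
  have epsF: "\<epsilon> \<le> c s" if "s \<in> F" for s unfolding \<epsilon>_def using F that by (intro Min_le) auto
  have u1: "u L s \<le> 1" if "0 < L" for L s
  proof -
    have "1 / (2 * (1 + qn s)) \<le> 1/2" by (rule inv_qn_le)
    moreover have "0 \<le> ln (1 + qn s) / L" using that by simp
    ultimately show ?thesis by (simp add: u_def)
  qed
  have main: "\<epsilon> * u L s \<le> c s" if L: "4 * K / v \<le> L" and s: "s $ dd = 0" "R0 \<le> qn s" for L s
  proof (rule ccontr)
    assume neg: "\<not> ?thesis"
    have L0: "0 < L" using L K v by (smt (verit) divide_pos_pos mult_pos_pos)
    \<comment> \<open>As \<open>u\<close> is not positive once \<open>qn\<close> reaches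
      \<open>exp L\<close>, the comparison can fail only on a finite set, so that a minimum is
      attained.\<close>
    define G where "G = {s::'n site. s $ dd = 0 \<and> K2 \<le> qn s \<and> 0 < u L s}"
    have "G \<subseteq> {s. s $ dd = 0 \<and> qn s < exp L}"
    proof
      fix t assume t: "t \<in> G"
      have "1 / (2 * (1 + qn t)) \<le> 1/2" by (rule inv_qn_le)
      hence "ln (1 + qn t) / L < 1" using t by (simp add: G_def u_def)
      hence "ln (1 + qn t) < L" using L0 by simp
      hence "1 + qn t < exp L" by (metis add_pos_nonneg exp_less_mono exp_ln qn_nonneg zero_less_one)
      thus "t \<in> {s. s $ dd = 0 \<and> qn s < exp L}" using t by (auto simp: G_def)
    qed
    hence G: "finite G" using finite_qn finite_subset by blast
    have out: "t \<in> G" if t: "t $ dd = 0" "R0 \<le> qn t" "c t < \<epsilon> * u L t" for t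
    proof -
      have up: "0 < u L t" using t(3) c(1)[of t] eps by (smt (verit) mult_nonneg_nonpos)
      have "t \<notin> F"
      proof
        assume "t \<in> F"
        hence "\<epsilon> * u L t \<le> c t" using epsF[of t] u1[OF L0, of t] eps by (smt (verit) mult_left_le)
        thus False using t(3) by simp
      qed
      thus ?thesis using t up by (auto simp: F_def G_def)
    qed
    have "s \<in> G" using out[OF s] neg by simp
    hence Gne: "G \<noteq> {}" by auto
    obtain w where w: "w \<in> G" "\<And>t. t \<in> G \<Longrightarrow> c w - \<epsilon> * u L w \<le> c t - \<epsilon> * u L t"
      using ex_is_arg_min_if_finite[OF G Gne, of "\<lambda>t. c t - \<epsilon> * u L t"] by (auto simp: is_arg_min_linorder)
    define m where "m = c w - \<epsilon> * u L w"
    have m0: "m < 0" using w(2)[OF \<open>s \<in> G\<close>] neg by (simp add: m_def)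
    have wd: "w $ dd = 0" "R0 \<le> qn w" "K1 \<le> qn w" "2 * K / v \<le> qn w" using w(1) by (auto simp: G_def K2_def)
    have low: "m \<le> c t - \<epsilon> * u L t" if "t $ dd = 0" "R0 \<le> qn t" for t
      using out[OF that] w(2)[of t] m0 by (cases "c t < \<epsilon> * u L t") (auto simp: m_def)
    have B0: "0 \<le> B" using c[of 0] by (linarith | argo | smt (verit))
    have iB: "integrable M (indicator (Bd w) :: 'a \<Rightarrow> real)"
      by (rule integrable_real_indicator) (use Bd(1) in \<open>auto simp: emeasure_eq_measure\<close>)
    have ic: "integrable M (\<lambda>\<omega>. indicator (- Bd w) \<omega> * c (w + D \<omega>))"
    proof (rule Bochner_Integration.integrable_bound[where f="\<lambda>_. B"])
      have "(\<lambda>\<omega>. c (w + D \<omega>)) \<in> borel_measurable M" by (rule fD[of "\<lambda>t. c (w + t)"])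
      moreover have "(\<lambda>\<omega>. indicator (- Bd w) \<omega> :: real) = (\<lambda>\<omega>. 1 - indicator (Bd w) \<omega>)"
        by (auto simp: indicator_def)
      ultimately show "(\<lambda>\<omega>. indicator (- Bd w) \<omega> * c (w + D \<omega>)) \<in> borel_measurable M"
        using Bd(1)[of w] by simp
      show "AE \<omega> in M. norm (indicator (- Bd w) \<omega> * c (w + D \<omega>)) \<le> norm B"
        using c B0 by (auto simp: indicator_def)
    qed simp
    \<comment> \<open>On the killed event the right-hand side vanishes, and the subtracted
      \<open>\<epsilon>\<close> outweighs \<open>\<epsilon> * u\<close> because
      \<open>u \<le> 1\<close>, while \<open>m\<close> is negative. Elsewhere the walk lands where
      \<open>m\<close> is a lower bound.\<close>
    have "expectation (\<lambda>\<omega>. \<epsilon> * u L (w + D \<omega>) - \<epsilon> * indicator (Bd w) \<omega> + m) \<le> expectation (\<lambda>\<omega>. indicator (- Bd w) \<omega> * c (w + D \<omega>))"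
    proof (rule integral_mono)
      fix \<omega> assume "\<omega> \<in> space M"
      show "\<epsilon> * u L (w + D \<omega>) - \<epsilon> * indicator (Bd w) \<omega> + m \<le> indicator (- Bd w) \<omega> * c (w + D \<omega>)"
      proof (cases "\<omega> \<in> Bd w")
        case True
        have "\<epsilon> * u L (w + D \<omega>) \<le> \<epsilon> * 1" using u1[OF L0] eps by (intro mult_left_mono) auto
        thus ?thesis using True m0 by simp
      next
        case False
        have "(w + D \<omega>) $ dd = 0" using wd Dd by simp
        from low[OF this land[OF wd(1,2) False]] show ?thesis using False by simp
      qed
    qed (intro Bochner_Integration.integrable_add Bochner_Integration.integrable_diff integrable_mult_right iu iB integrable_const, rule ic)
    also have "\<dots> \<le> c w" by (rule step[OF wd(1,2)])
    also have "expectation (\<lambda>\<omega>. \<epsilon> * u L (w + D \<omega>) - \<epsilon> * indicator (Bd w) \<omega> + m)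
       = \<epsilon> * expectation (\<lambda>\<omega>. u L (w + D \<omega>)) - \<epsilon> * prob (Bd w) + m"
      using iu[of L w] iB Bd(1)[of w] prob_space by simp
    finally have 1: "\<epsilon> * expectation (\<lambda>\<omega>. u L (w + D \<omega>)) - \<epsilon> * prob (Bd w) + m \<le> c w" .
    have "prob (Bd w) < v / (2 * (1 + qn w) ^ 2)"
    proof -
      have "0 < v / (1 + qn w)\<^sup>2"
        by (rule divide_pos_pos[OF v zero_less_power[OF add_pos_nonneg[OF zero_less_one qn_nonneg]]])
      moreover have "(v / 4) / (1 + qn w)\<^sup>2 = (v / (1 + qn w)\<^sup>2) / 4" "v / (2 * (1 + qn w) ^ 2) = (v / (1 + qn w)\<^sup>2) / 2"
        by simp_all
      ultimately show ?thesis using K1[OF wd(3)] by (linarith | argo | smt (verit))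
    qed
    hence "u L w < expectation (\<lambda>\<omega>. u L (w + D \<omega>)) - prob (Bd w)" using drift[OF L wd(4)] by (linarith | argo | smt (verit))
    hence "\<epsilon> * u L w < \<epsilon> * (expectation (\<lambda>\<omega>. u L (w + D \<omega>)) - prob (Bd w))" using eps by simp
    hence "\<epsilon> * u L w < \<epsilon> * expectation (\<lambda>\<omega>. u L (w + D \<omega>)) - \<epsilon> * prob (Bd w)" by (simp add: right_diff_distrib)
    thus False using 1 by (simp add: m_def)
  qed
  have "\<epsilon> / 2 \<le> c s" if s: "s $ dd = 0" "R0 \<le> qn s" for s
  proof -
    have "((\<lambda>L. \<epsilon> * (1/2 - ln (1 + qn s) / L)) \<longlongrightarrow> \<epsilon> * (1/2 - 0)) at_top"
      by (intro tendsto_intros tendsto_divide_0[OF tendsto_const] filterlim_at_top_imp_at_infinity filterlim_ident)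
    hence lim: "((\<lambda>L. \<epsilon> * (1/2 - ln (1 + qn s) / L)) \<longlongrightarrow> \<epsilon> / 2) at_top" by simp
    have ev: "\<forall>\<^sub>F L in at_top. \<epsilon> * (1/2 - ln (1 + qn s) / L) \<le> c s"
      using eventually_ge_at_top[of "4 * K / v"]
    proof eventually_elim
      case (elim L)
      have "0 \<le> 1 / (2 * (1 + qn s))" by simp
      hence "1/2 - ln (1 + qn s) / L \<le> u L s" by (simp add: u_def)
      hence "\<epsilon> * (1/2 - ln (1 + qn s) / L) \<le> \<epsilon> * u L s" using eps by (intro mult_left_mono) auto
      also have "\<dots> \<le> c s" by (rule main[OF elim s])
      finally show ?case .
    qed
    show ?thesis by (rule tendsto_upperbound[OF lim ev]) simp
  qed
  thus ?thesis using eps by (intro exI[of _ "\<epsilon> / 2"]) auto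
qed

subsection \<open>The first joint renewal\<close>

context dsf begin

text \<open>\<open>Gam\<close> at the new centres is left out, since it reads rows above
  \<open>lev k\<close> and belongs to the future. The environments are separate arguments so that
  the same event can be read in a single environment or in two independent ones; the bound
  \<open>m\<close> confines what it reads to boxes.\<close>

definition Past :: "nat \<Rightarrow> nat \<Rightarrow> 'n site \<Rightarrow> 'n site \<Rightarrow> 'n site \<Rightarrow> 'n site \<Rightarrow> 'n env \<Rightarrow> 'n env \<Rightarrow> bool" where
  "Past k m x1 x2 z1 z2 \<omega>1 \<omega>2 \<longleftrightarrow> Gam r \<omega>1 x1 \<and> Gam r \<omega>2 x2 \<and> (\<forall>j\<in>{1..<k}. \<not> JX \<omega>1 x1 \<omega>2 x2 j) \<and>
     Rgp A r \<omega>1 x1 (lev k) z1 \<and> Rgp A r \<omega>2 x2 (lev k) z2 \<and> \<not> Long \<omega>1 x1 (lev k) m \<and> \<not> Long \<omega>2 x2 (lev k) m"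

definition Fut :: "'n site \<Rightarrow> 'n site \<Rightarrow> 'n env \<Rightarrow> bool" where
  "Fut z1 z2 \<omega> \<longleftrightarrow> Gam r \<omega> (up z1) \<and> Gam r \<omega> (up z2) \<and> Coal \<omega> (up z1) (up z2)"

text \<open>The probability of coalescence given \<open>Gam\<close> at both starting points, provided these are so far
  apart that the two events are independent.\<close>

definition cc :: "'n site \<Rightarrow> real" where
  "cc s = measure PS {\<omega>. Gam r \<omega> 0 \<and> Gam r \<omega> s \<and> Coal \<omega> 0 s} / \<gamma>\<^sup>2"

abbreviation "W \<equiv> 9 * int A + int r + 20"

lemma Past_meas [measurable]: "Measurable.pred PS (\<lambda>\<omega>. Past k m x1 x2 z1 z2 \<omega> \<omega>)"
  unfolding Past_def by measurable

lemma Past_cp_meas [measurable]: "Measurable.pred PS (\<lambda>\<omega>. Past k m x1 x2 z1 z2 (cp b \<omega>) (cp b' \<omega>))"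
proof -
  note pred_cp[OF Gam_meas, measurable] pred_cp[OF Rgp_meas, measurable] pred_cp[OF Long_meas, measurable]
  show ?thesis unfolding Past_def by measurable
qed

lemma Fut_meas [measurable]: "Measurable.pred PS (Fut z1 z2)"
  unfolding Fut_def[abs_def] by measurable

lemma Past_rows: "Past k m x1 x2 z1 z2 \<omega>1 \<omega>2 \<Longrightarrow> z1 $ dd = lev k \<and> z2 $ dd = lev k"
  by (auto simp: Past_def Rgp_def)

lemma RG_ball:
  fixes \<omega> :: "'n env"
  assumes L: "\<not> Long \<omega> x n m" and n: "n' \<le> n" "x $ dd \<le> n' - 9"
    and eq: "\<And>w. w \<in> Bx x (9 * int m + W) \<Longrightarrow> \<omega> w = \<omega>' w"
  shows "Rgp A r \<omega> x n' z = Rgp A r \<omega>' x n' z" "RG A r \<omega> x n' z = RG A r \<omega>' x n' z" "\<not> Long \<omega>' x n m"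
proof -
  have sub: "Bx x (9 * int m) \<subseteq> Bx x (9 * int m + W)" by (rule Bx_mono) simp
  show L': "\<not> Long \<omega>' x n m"
  proof
    assume "Long \<omega>' x n m"
    hence "Long \<omega> x n m" by (rule Long_cong_ball) (use sub eq in auto)
    thus False using L by simp
  qed
  show 1: "Rgp A r \<omega> x n' z = Rgp A r \<omega>' x n' z"
    using Rgp_ball(1)[OF _ L n eq] Rgp_ball(1)[OF _ L' n eq[symmetric]] by blast
  show "RG A r \<omega> x n' z = RG A r \<omega>' x n' z"
    using 1 Rgp_ball(3)[OF _ L n eq] unfolding RG_def by blast
qed

lemma Gam_ball:
  fixes \<omega> :: "'n env"
  assumes "\<And>w. w \<in> Bx x (9 * int m + W) \<Longrightarrow> \<omega> w = \<omega>' w"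
  shows "Gam r \<omega> x = Gam r \<omega>' x"
proof (rule depD[OF Gam_dep])
  fix w assume "w \<in> {w. w $ dd \<in> {x $ dd, x $ dd + 1} \<and> h1 w x \<le> int r}"
  hence "w \<in> Bx x (int r + 1)" by (intro h1_Bx) auto
  moreover have "Bx x (int r + 1) \<subseteq> Bx x (9 * int m + W)" by (rule Bx_mono) simp
  ultimately show "\<omega> w = \<omega>' w" using assms by blast
qed

lemma lev_row: "x $ dd = 0 \<Longrightarrow> 1 \<le> j \<Longrightarrow> x $ dd \<le> lev j - 9" by (simp add: lev_def)

text \<open>The bound on the number of steps is itself part of the event, and it localises the
  renewals at all earlier levels as well.\<close>

lemma Past_dep1:
  fixes x1 :: "'n site"
  assumes x: "x1 $ dd = 0" and k: "1 \<le> k"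
  shows "dep (Bx x1 (9 * int m + W)) (\<lambda>\<omega>1. Past k m x1 x2 z1 z2 \<omega>1 \<omega>2)"
proof (rule depI)
  fix \<omega> \<omega>' :: "'n env"
  assume eq: "\<And>w. w \<in> Bx x1 (9 * int m + W) \<Longrightarrow> \<omega> w = \<omega>' w" and P: "Past k m x1 x2 z1 z2 \<omega> \<omega>2"
  have L: "\<not> Long \<omega> x1 (lev k) m" using P by (simp add: Past_def)
  have "JX \<omega> x1 \<omega>2 x2 j = JX \<omega>' x1 \<omega>2 x2 j" if "j \<in> {1..<k}" for j
  proof -
    have "lev j \<le> lev k" "1 \<le> j" using that by (auto simp: lev_def)
    from RG_ball(2)[OF L this(1) lev_row[OF x this(2)] eq] show ?thesis unfolding JX_def by simp
  qed
  moreover note RG_ball(1)[OF L order_refl lev_row[OF x k] eq] RG_ball(3)[OF L order_refl lev_row[OF x k] eq] Gam_ball[OF eq]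
  ultimately show "Past k m x1 x2 z1 z2 \<omega>' \<omega>2" using P unfolding Past_def by auto
qed

lemma Past_swap: "Past k m x1 x2 z1 z2 \<omega>1 \<omega>2 = Past k m x2 x1 z2 z1 \<omega>2 \<omega>1"
proof -
  have "JX \<omega>1 x1 \<omega>2 x2 j = JX \<omega>2 x2 \<omega>1 x1 j" for j by (auto simp: JX_def)
  thus ?thesis by (auto simp: Past_def)
qed

lemma Past_dep2:
  fixes x2 :: "'n site"
  assumes "x2 $ dd = 0" "1 \<le> k"
  shows "dep (Bx x2 (9 * int m + W)) (\<lambda>\<omega>2. Past k m x1 x2 z1 z2 \<omega>1 \<omega>2)"
  by (subst Past_swap) (rule Past_dep1[OF assms])

text \<open>Renewals at earlier levels read at most two rows above their own level, which still lie
  below \<open>lev k\<close>.\<close>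

lemma Past_dep_rows1:
  fixes x1 x2 :: "'n site"
  assumes x: "x1 $ dd = 0" "x2 $ dd = 0" and k: "1 \<le> k"
  shows "dep {w. w $ dd \<le> lev k} (\<lambda>\<omega>. Past k m x1 x2 z1 z2 \<omega> \<omega>2)"
proof -
  have row: "(x::'n site) $ dd < lev j" if "x $ dd = 0" "1 \<le> j" for x j using that by (simp add: lev_def)
  have "dep {w. w $ dd \<le> lev k} (\<lambda>\<omega>::'n env. Gam r \<omega> x1)"
    by (rule dep_mono[OF Gam_dep]) (use x k in \<open>auto simp: lev_def\<close>)
  moreover have "dep {w. w $ dd \<le> lev k} (\<lambda>\<omega>::'n env. RG A r \<omega> x1 (lev j) z)" if "j \<in> {1..<k}" for j z
    by (rule dep_mono[OF RG_dep]) (use that row x in \<open>auto simp: lev_def\<close>)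
  hence "dep {w. w $ dd \<le> lev k} (\<lambda>\<omega>. \<forall>j\<in>{1..<k}. \<not> JX \<omega> x1 \<omega>2 x2 j)"
    unfolding JX_def by (intro dep_ball dep_not dep_ex dep_conj dep_const)
  moreover have "dep {w. w $ dd \<le> lev k} (\<lambda>\<omega>::'n env. Rgp A r \<omega> x1 (lev k) z1)"
    by (rule Rgp_dep[OF row[OF x(1) k]])
  moreover have "dep {w. w $ dd \<le> lev k} (\<lambda>\<omega>::'n env. Long \<omega> x1 (lev k) m)"
    by (rule dep_mono[OF Long_dep[OF row[OF x(1) k]]]) auto
  ultimately show ?thesis unfolding Past_def by (intro dep_conj dep_not dep_const)
qed

lemma Past_dep_rows2:
  fixes x1 x2 :: "'n site"
  assumes "x1 $ dd = 0" "x2 $ dd = 0" "1 \<le> k"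
  shows "dep {w. w $ dd \<le> lev k} (\<lambda>\<omega>. Past k m x1 x2 z1 z2 \<omega>1 \<omega>)"
  by (subst Past_swap) (rule Past_dep_rows1[OF assms(2,1,3)])

lemma dep_diag:
  assumes "\<And>\<omega>2. dep X (\<lambda>\<omega>. P \<omega> \<omega>2)" "\<And>\<omega>1. dep X (\<lambda>\<omega>. P \<omega>1 \<omega>)"
  shows "dep X (\<lambda>\<omega>. P \<omega> \<omega>)"
  using assms unfolding dep_def by blast

lemma dep_cp2:
  fixes P :: "('i \<Rightarrow> 'c) \<Rightarrow> ('i \<Rightarrow> 'c) \<Rightarrow> bool"
  assumes "\<And>\<omega>2. dep X (\<lambda>\<omega>. P \<omega> \<omega>2)" "\<And>\<omega>1. dep X (\<lambda>\<omega>. P \<omega>1 \<omega>)"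
  shows "dep (X \<times> UNIV) (\<lambda>\<omega>. P (cp False \<omega>) (cp True \<omega>))"
  unfolding dep_def
proof (intro allI impI)
  fix \<omega> \<omega>' :: "'i \<times> bool \<Rightarrow> 'c" assume eq: "\<forall>i\<in>X \<times> UNIV. \<omega> i = \<omega>' i"
  have "P (cp False \<omega>) (cp True \<omega>) = P (cp False \<omega>') (cp True \<omega>)"
    by (rule depD[OF assms(1)]) (use eq in \<open>auto simp: cp_def\<close>)
  also have "\<dots> = P (cp False \<omega>') (cp True \<omega>')"
    by (rule depD[OF assms(2)]) (use eq in \<open>auto simp: cp_def\<close>)
  finally show "P (cp False \<omega>) (cp True \<omega>) = P (cp False \<omega>') (cp True \<omega>')" .
qed

lemma Fut_prob:
  assumes "z1 $ dd = z2 $ dd"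
  shows "measure PS {\<omega>. Fut z1 z2 \<omega>} = \<gamma>\<^sup>2 * cc (z2 - z1)"
proof -
  interpret T: symm ty "\<lambda>_. 1" id "up z1" by (rule symm_trans)
  have g: "T.g 0 = up z1" "T.g (z2 - z1) = up z2"
    unfolding T.g_def using assms by (auto simp: vec_eq_iff up_def)
  have "measure PS {\<omega>. Gam r \<omega> 0 \<and> Gam r \<omega> (z2 - z1) \<and> Coal \<omega> 0 (z2 - z1)} = measure PS {\<omega>. Fut z1 z2 \<omega>}"
    using T.prob_\<Phi>[of "\<lambda>\<omega>. Gam r \<omega> 0 \<and> Gam r \<omega> (z2 - z1) \<and> Coal \<omega> 0 (z2 - z1)"]
    by (simp add: T.Gam_\<Phi> T.Coal_\<Phi> g Fut_def)
  thus ?thesis using \<gamma>_pos by (simp add: cc_def)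
qed

lemma Fut_dep:
  fixes z1 z2 :: "'n site"
  assumes "z1 $ dd = n" "z2 $ dd = n"
  shows "dep {w. n < w $ dd} (Fut z1 z2)"
  using dep_mono[OF Coal_dep[of "up z1" "n + 1" "up z2" r], of "{w. n < w $ dd}"] assms
  unfolding Fut_def[abs_def] by fastforce

text \<open>While the regions explored by two paths are disjoint, the pair has the same law as a pair of
  paths in independent environments.\<close>

lemma Past_same:
  fixes s :: "'n site"
  assumes s: "s $ dd = 0" and k: "1 \<le> k" and disj: "Bx 0 (9 * int m + W) \<inter> Bx s (9 * int m + W) = {}"
  shows "measure PS {\<omega>. Past k m 0 s z1 (z2 + s) \<omega> \<omega>} = measure PS {\<omega>. Past k m 0 0 z1 z2 (cp False \<omega>) (cp True \<omega>)}"
proof -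
  interpret T: symm ty "\<lambda>_. 1" id s by (rule symm_trans)
  have "measure PS {\<omega>. Past k m 0 s z1 (z2 + s) \<omega> \<omega>}
     = measure PS {\<omega>. Past k m 0 s z1 (z2 + s) (\<lambda>w. \<omega> (w, False)) (\<lambda>w. \<omega> (w, True))}"
    by (rule glue_same[OF _ Past_dep1 Past_dep2 disj]) (use s k in auto)
  also have "\<dots> = measure PS {\<omega>. Past k m 0 s z1 (z2 + s) (cp False \<omega>) (cp True \<omega>)}"
    by (simp add: cp_def[abs_def])
  also have "\<dots> = measure PS {\<omega>. Past k m 0 0 z1 z2 (cp False \<omega>) (cp True \<omega>)}"
  proof -
    \<comment> \<open>Only the copy tagged \<open>True\<close> is translated, so that both paths now
      start from 0, each in its own copy.\<close>
    define g where "g = (\<lambda>(w::'n site, b). (if b then w + s else w, b))"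
    define \<Psi> where "\<Psi> = (\<lambda>(\<omega>::'n site \<times> bool \<Rightarrow> (real,'n) vec) p. \<omega> (g p))"
    have "inj g" by (auto simp: g_def inj_def split: if_splits)
    hence d: "distr PS PS \<Psi> = PS" unfolding \<Psi>_def by (rule distr_PS_reindex)
    have m: "\<Psi> \<in> PS \<rightarrow>\<^sub>M PS" by (rule measurable_PS_I) (simp add: \<Psi>_def)
    have F: "cp False (\<Psi> \<omega>) = cp False \<omega>" for \<omega> by (simp add: \<Psi>_def g_def cp_def fun_eq_iff)
    have Tr: "cp True (\<Psi> \<omega>) = T.\<Phi> (cp True \<omega>)" for \<omega>
      by (simp add: \<Psi>_def g_def cp_def fun_eq_iff T.\<Phi>_def T.g_def vec_eq_iff Lsym_def[where p=id])
    have g0: "T.g 0 = s" "T.g z2 = z2 + s" by (auto simp: T.g_def vec_eq_iff)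
    have RGT: "RG A r (T.\<Phi> \<omega>) 0 n z = RG A r \<omega> s n (T.g z)" for \<omega> n z
      unfolding RG_def T.Rgp_\<Phi> T.Gam_\<Phi> T.up_g g0 using s by simp
    have JXT: "JX \<omega>1 0 (T.\<Phi> \<omega>) 0 j = JX \<omega>1 0 \<omega> s j" for \<omega>1 \<omega> j
      unfolding JX_def RGT using T.ex_g[of "\<lambda>z. RG A r \<omega> s (lev j) z"] by auto
    have P: "Past k m 0 0 z1 z2 \<omega>1 (T.\<Phi> \<omega>2) = Past k m 0 s z1 (z2 + s) \<omega>1 \<omega>2" for \<omega>1 \<omega>2
      unfolding Past_def JXT T.Rgp_\<Phi> T.Gam_\<Phi> T.Long_\<Phi> g0 using s by simp
    have "measure PS {\<omega>. Past k m 0 0 z1 z2 (cp False \<omega>) (cp True \<omega>)}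
       = measure (distr PS PS \<Psi>) {\<omega>. Past k m 0 0 z1 z2 (cp False \<omega>) (cp True \<omega>)}" by (simp add: d)
    also have "\<dots> = measure PS (\<Psi> -` {\<omega>. Past k m 0 0 z1 z2 (cp False \<omega>) (cp True \<omega>)} \<inter> space PS)"
      by (rule measure_distr[OF m]) (rule sets_PS_I, rule Past_cp_meas)
    finally show ?thesis by (simp add: vimage_def F Tr P)
  qed
  finally show ?thesis .
qed

text \<open>The renewal identity for a fixed level and fixed centres. Past and future read disjoint
  rows, and the future has probability \<open>\<gamma>\<^sup>2\<close> times a value of
  \<open>cc\<close>. The factor \<open>\<gamma>\<^sup>2\<close> is then reinterpreted as
  \<open>Gam\<close> at the new centres in two independent copies, which completes the past to a
  first joint renewal there.\<close>

lemma piece: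
  fixes s :: "'n site"
  assumes s: "s $ dd = 0" and k: "1 \<le> k" and disj: "Bx 0 (9 * int m + W) \<inter> Bx s (9 * int m + W) = {}"
  shows "measure PS {\<omega>. Past k m 0 s z1 (z2 + s) \<omega> \<omega> \<and> Fut z1 (z2 + s) \<omega>}
    = measure PS {\<omega>. Past k m 0 0 z1 z2 (cp False \<omega>) (cp True \<omega>) \<and> Gam r (cp False \<omega>) (up z1) \<and> Gam r (cp True \<omega>) (up z2)} * cc (s + (z2 - z1))"
proof (cases "z1 $ dd = lev k \<and> z2 $ dd = lev k")
  case False
  have 1: "\<not> Past k m 0 0 z1 z2 \<omega>1 \<omega>2" for \<omega>1 \<omega>2 using False Past_rows by blast
  have 2: "\<not> Past k m 0 s z1 (z2 + s) \<omega>1 \<omega>2" for \<omega>1 \<omega>2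
    using False Past_rows[of k m 0 s z1 "z2 + s" \<omega>1 \<omega>2] s by auto
  show ?thesis by (simp add: 1 2)
next
  case True
  have "measure PS {\<omega>. Past k m 0 s z1 (z2 + s) \<omega> \<omega> \<and> Fut z1 (z2 + s) \<omega>}
     = measure PS {\<omega>. Past k m 0 s z1 (z2 + s) \<omega> \<omega>} * measure PS {\<omega>. Fut z1 (z2 + s) \<omega>}"
  proof (rule dep_indep)
    show "dep {w. w $ dd \<le> lev k} (\<lambda>\<omega>. Past k m 0 s z1 (z2 + s) \<omega> \<omega>)"
      by (rule dep_diag; rule Past_dep_rows1 Past_dep_rows2) (use s k in auto)
    show "dep {w. lev k < w $ dd} (Fut z1 (z2 + s))" by (rule Fut_dep) (use True s in auto)
  qed auto
  also have "measure PS {\<omega>. Fut z1 (z2 + s) \<omega>} = \<gamma>\<^sup>2 * cc (s + (z2 - z1))"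
    using Fut_prob[of z1 "z2 + s"] True s by (simp add: algebra_simps)
  also have "measure PS {\<omega>. Past k m 0 s z1 (z2 + s) \<omega> \<omega>} = measure PS {\<omega>. Past k m 0 0 z1 z2 (cp False \<omega>) (cp True \<omega>)}"
    by (rule Past_same[OF s k disj])
  also have "\<dots> * (\<gamma>\<^sup>2 * cc (s + (z2 - z1)))
     = (measure PS {\<omega>. Past k m 0 0 z1 z2 (cp False \<omega>) (cp True \<omega>)} * \<gamma>\<^sup>2) * cc (s + (z2 - z1))" by simp
  also have "measure PS {\<omega>. Past k m 0 0 z1 z2 (cp False \<omega>) (cp True \<omega>)} * \<gamma>\<^sup>2
     = measure PS {\<omega>. Past k m 0 0 z1 z2 (cp False \<omega>) (cp True \<omega>) \<and> (Gam r (cp False \<omega>) (up z1) \<and> Gam r (cp True \<omega>) (up z2))}"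
  proof -
    note pred_cp[OF Gam_meas, measurable]
    have Gd: "dep ({w. lev k < w $ dd} \<times> {b}) (\<lambda>\<omega>::'n site \<times> bool \<Rightarrow> (real,'n) vec. Gam r (cp b \<omega>) (up z))" if "z $ dd = lev k" for b z
    proof -
      have "dep {w. lev k < w $ dd} (\<lambda>\<omega>::'n env. Gam r \<omega> (up z))" by (rule dep_mono[OF Gam_dep]) (use that in auto)
      from dep_cp[OF this] show ?thesis .
    qed
    have "measure PS {\<omega>::'n site \<times> bool \<Rightarrow> (real,'n) vec. Gam r (cp False \<omega>) (up z1) \<and> Gam r (cp True \<omega>) (up z2)}
       = measure PS {\<omega>::'n site \<times> bool \<Rightarrow> (real,'n) vec. Gam r (cp False \<omega>) (up z1)} * measure PS {\<omega>::'n site \<times> bool \<Rightarrow> (real,'n) vec. Gam r (cp True \<omega>) (up z2)}"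
      by (rule dep_indep[OF _ _ Gd Gd]) (use True in auto)
    also have "\<dots> = \<gamma>\<^sup>2"
      using prob_cp[OF Gam_meas[of r "up z1"], of False] prob_cp[OF Gam_meas[of r "up z2"], of True] Gam_trans[of r "up z1"] Gam_trans[of r "up z2"]
      by (simp add: \<gamma>_def power2_eq_square)
    finally have G2: "measure PS {\<omega>::'n site \<times> bool \<Rightarrow> (real,'n) vec. Gam r (cp False \<omega>) (up z1) \<and> Gam r (cp True \<omega>) (up z2)} = \<gamma>\<^sup>2" .
    show ?thesis unfolding G2[symmetric]
    proof (rule dep_indep[symmetric])
      show "dep ({w. w $ dd \<le> lev k} \<times> UNIV) (\<lambda>\<omega>. Past k m 0 0 z1 z2 (cp False \<omega>) (cp True \<omega>))"
        by (rule dep_cp2; rule Past_dep_rows1 Past_dep_rows2) (use k in auto)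
      show "dep ({w. lev k < w $ dd} \<times> UNIV) (\<lambda>\<omega>::'n site \<times> bool \<Rightarrow> (real,'n) vec. Gam r (cp False \<omega>) (up z1) \<and> Gam r (cp True \<omega>) (up z2))"
        by (rule dep_conj; rule dep_mono[OF Gd]) (use True in auto)
    qed auto
  qed
  finally show ?thesis by simp
qed

end

section \<open>The gap at the first joint renewal: definition and moments\<close>

type_synonym 'n env2 = "(int ^ 'n) \<times> bool \<Rightarrow> real ^ 'n"

context dsf begin

definition FJ :: "nat \<Rightarrow> 'n site \<Rightarrow> 'n site \<Rightarrow> 'n site \<Rightarrow> 'n site \<Rightarrow> 'n env \<Rightarrow> 'n env \<Rightarrow> bool" where
  "FJ k x1 x2 z1 z2 \<omega>1 \<omega>2 \<longleftrightarrow> 1 \<le> k \<and> (\<forall>j\<in>{1..<k}. \<not> JX \<omega>1 x1 \<omega>2 x2 j) \<and>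
     RG A r \<omega>1 x1 (lev k) z1 \<and> RG A r \<omega>2 x2 (lev k) z2"

text \<open>The entry is unique, so two candidates for the centre are within horizontal distance 2,
  where two different tilted patches cannot coexist.\<close>

lemma RG_unique:
  assumes "RG A r \<omega> x n z" "RG A r \<omega> x n z'" shows "z = z'"
proof -
  obtain v where v: "Ent \<omega> x n v" "z $ dd = n" "h1 z v \<le> 1" "Tilt r \<omega> z" using assms(1) by (auto simp: RG_def Rgp_def)
  obtain v' where v': "Ent \<omega> x n v'" "z' $ dd = n" "h1 z' v' \<le> 1" "Tilt r \<omega> z'" using assms(2) by (auto simp: RG_def Rgp_def)
  have "v = v'" by (rule Ent_fun[OF v(1) v'(1)])
  hence "h1 z z' \<le> int r" using h1_triangle[of z z' v] v v' h1_sym[of z' v] r_ge by simp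
  thus ?thesis using Tilt_unique[OF v(4) v'(4)] v v' by simp
qed

lemma FJ_unique:
  assumes "FJ k x1 x2 z1 z2 \<omega>1 \<omega>2" "FJ k' x1 x2 z1' z2' \<omega>1 \<omega>2"
  shows "k = k' \<and> z1 = z1' \<and> z2 = z2'"
proof -
  have "JX \<omega>1 x1 \<omega>2 x2 k" "JX \<omega>1 x1 \<omega>2 x2 k'" using assms unfolding FJ_def JX_def by blast+
  hence "\<not> k < k'" "\<not> k' < k" using assms unfolding FJ_def by auto
  hence "k = k'" by simp
  thus ?thesis using assms RG_unique unfolding FJ_def by blast
qed

lemma FJ_exists:
  assumes "JX \<omega>1 x1 \<omega>2 x2 j" "1 \<le> j"
  shows "\<exists>k z1 z2. k \<le> j \<and> FJ k x1 x2 z1 z2 \<omega>1 \<omega>2"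
proof -
  define k where "k = (LEAST k. JX \<omega>1 x1 \<omega>2 x2 k \<and> 1 \<le> k)"
  have k: "JX \<omega>1 x1 \<omega>2 x2 k \<and> 1 \<le> k" unfolding k_def by (rule LeastI[of _ j]) (use assms in simp)
  have "k \<le> j" unfolding k_def by (rule Least_le) (use assms in simp)
  moreover have "\<not> JX \<omega>1 x1 \<omega>2 x2 i" if "i \<in> {1..<k}" for i
    using not_less_Least[of i "\<lambda>k. JX \<omega>1 x1 \<omega>2 x2 k \<and> 1 \<le> k"] that unfolding k_def[symmetric] by auto
  ultimately show ?thesis using k unfolding FJ_def JX_def by blast
qed

lemma FJ_cp_meas [measurable]: "Measurable.pred PS (\<lambda>\<omega>. FJ k x1 x2 z1 z2 (cp b \<omega>) (cp b' \<omega>))"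
  unfolding FJ_def using pred_cp[OF RG_meas, measurable] by measurable

definition DD :: "'n site \<Rightarrow> 'n env2 \<Rightarrow> bool" where
  "DD d \<omega> \<longleftrightarrow> (\<exists>k z1 z2. FJ k 0 0 z1 z2 (cp False \<omega>) (cp True \<omega>) \<and> d = z2 - z1)"

text \<open>The increment of the walk: the displacement between the two centres at the first joint
  renewal of two independent paths from 0. The value 0 is a default on the null event without such a
  renewal.\<close>

definition gap :: "'n env2 \<Rightarrow> 'n site" where
  "gap \<omega> = (if \<exists>d. DD d \<omega> then (SOME d. DD d \<omega>) else 0)"

lemma DD_unique: "DD d \<omega> \<Longrightarrow> DD d' \<omega> \<Longrightarrow> d = d'"
  unfolding DD_def using FJ_unique by blast

lemma gap_eq: "DD d \<omega> \<Longrightarrow> gap \<omega> = d"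
  unfolding gap_def using DD_unique by (metis someI)

lemma gap_iff: "gap \<omega> = d \<longleftrightarrow> DD d \<omega> \<or> (d = 0 \<and> \<not> (\<exists>e. DD e \<omega>))"
proof (cases "\<exists>e. DD e \<omega>")
  case True
  thus ?thesis using gap_eq by blast
qed (auto simp: gap_def)

lemma DD_meas [measurable]: "Measurable.pred PS (DD d)"
  unfolding DD_def[abs_def] by measurable

lemma gap_meas [measurable]: "gap \<in> PS \<rightarrow>\<^sub>M count_space UNIV"
proof -
  have "gap -` {d} \<inter> space PS \<in> sets PS" for d
  proof -
    have "gap -` {d} \<inter> space PS = {\<omega>. DD d \<omega> \<or> (d = 0 \<and> \<not> (\<exists>e. DD e \<omega>))}" using gap_iff by auto
    thus ?thesis by (simp only:) (rule sets_PS_I, measurable)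
  qed
  thus ?thesis by (subst measurable_count_space_eq_countable) auto
qed

lemma FJ_rows: "FJ k x1 x2 z1 z2 \<omega>1 \<omega>2 \<Longrightarrow> z1 $ dd = lev k \<and> z2 $ dd = lev k"
  by (auto simp: FJ_def RG_def Rgp_def)

lemma gap_dd [simp]: "gap \<omega> $ dd = 0"
proof (cases "\<exists>d. DD d \<omega>")
  case True
  then obtain d where d: "DD d \<omega>" by blast
  thus ?thesis using gap_eq[OF d] FJ_rows by (auto simp: DD_def)
qed (simp add: gap_def)

definition GG :: "'n env2 set" where "GG = {\<omega>. Gam r (cp False \<omega>) 0 \<and> Gam r (cp True \<omega>) 0}"

text \<open>After a renewal each path continues from a site at which \<open>Gam\<close> is known to
  hold; the conditioning puts the starts at 0 into the same state.\<close>

definition QQ :: "'n env2 measure" where "QQ = uniform_measure PS GG"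

lemma GG_sets [measurable, simp]: "GG \<in> sets PS"
  unfolding GG_def using pred_cp[OF Gam_meas, measurable] by (intro sets_PS_I) measurable

lemma GG_prob: "measure PS GG = \<gamma>\<^sup>2"
proof -
  note pred_cp[OF Gam_meas, measurable]
  have "measure PS GG = measure PS {\<omega>. Gam r (cp False \<omega> :: 'n env) 0} * measure PS {\<omega>. Gam r (cp True \<omega> :: 'n env) 0}"
    unfolding GG_def by (rule dep_indep[OF _ _ dep_cp[OF Gam_dep] dep_cp[OF Gam_dep]]) auto
  thus ?thesis using prob_cp[OF Gam_meas[of r "0::'n site"]] by (simp add: \<gamma>_def power2_eq_square)
qed

lemma GG_emeasure: "emeasure PS GG = ennreal (\<gamma>\<^sup>2)" "emeasure PS GG \<noteq> 0" "emeasure PS GG \<noteq> \<infinity>"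
  using GG_prob \<gamma>_pos by (auto simp: PS.emeasure_eq_measure)

lemma prob_QQ: "prob_space QQ"
  unfolding QQ_def by (rule prob_space_uniform_measure) (use GG_emeasure in auto)

sublocale QQ: prob_space QQ by (rule prob_QQ)

lemma sets_QQ [measurable_cong, simp]: "sets QQ = sets PS" by (simp add: QQ_def)

lemma space_QQ [simp]: "space QQ = UNIV" by (simp add: QQ_def)

lemma QQ_measure: "X \<in> sets PS \<Longrightarrow> measure QQ X = measure PS (GG \<inter> X) / \<gamma>\<^sup>2"
  unfolding QQ_def by (subst measure_uniform_measure) (use GG_emeasure GG_prob in auto)

text \<open>A single index controls time and space: the renewal occurs within \<open>l\<close>
  levels, and the paths up to level \<open>l\<close> are short enough to bound the gap linearly in
  \<open>l\<close>.\<close>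

definition Rd :: "nat \<Rightarrow> 'n env2 \<Rightarrow> bool" where
  "Rd l \<omega> \<longleftrightarrow> (\<exists>j\<in>{1..l}. JX (cp False \<omega>) 0 (cp True \<omega>) 0 j) \<and>
     \<not> Long (cp False \<omega>) 0 (lev l) (C * l) \<and> \<not> Long (cp True \<omega>) 0 (lev l) (C * l)"

lemma Rd_meas [measurable]: "Measurable.pred PS (Rd l)"
  unfolding Rd_def[abs_def] using pred_cp[OF Long_meas, measurable] by measurable

lemma not_Rd: "measure PS {\<omega>. \<not> Rd l \<omega>} \<le> 9 * \<theta> ^ l"
proof -
  note pred_cp[OF Long_meas, measurable]
  let ?J = "{\<omega>. \<forall>j\<in>{1..l}. \<not> JX (cp False \<omega> :: 'n env) 0 (cp True \<omega>) 0 j}"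
  let ?L = "\<lambda>b. {\<omega>. Long (cp b \<omega> :: 'n env) 0 (lev l) (C * l)}"
  have meas: "?J \<in> sets PS" "?L b \<in> sets PS" for b by (rule sets_PS_I, measurable)+
  have "measure PS {\<omega>. \<not> Rd l \<omega>} \<le> measure PS (?J \<union> (?L False \<union> ?L True))"
    by (rule PS.finite_measure_mono) (use meas in \<open>auto simp: Rd_def\<close>)
  also have "\<dots> \<le> measure PS ?J + (measure PS (?L False) + measure PS (?L True))"
    by (intro order_trans[OF measure_Un_le] add_mono order_refl) (use meas in auto)
  also have "\<dots> \<le> 7 * \<theta> ^ l + ((1/2) ^ l + (1/2) ^ l)"
  proof (intro add_mono tail)
    have L: "measure PS (?L b) \<le> (1/2) ^ l" for b
      using prob_cp[OF Long_meas[of "0::'n site" "lev l" "C * l"], of b] LongP[of 0 l] by simp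
    show "measure PS (?L False) \<le> (1/2) ^ l" "measure PS (?L True) \<le> (1/2) ^ l" by (rule L)+
  qed
  also have "\<dots> \<le> 7 * \<theta> ^ l + (\<theta> ^ l + \<theta> ^ l)"
    using \<theta> by (intro add_mono power_mono) auto
  finally show ?thesis by simp
qed

lemma AE_Rd: "AE \<omega> in PS. \<exists>l. Rd l \<omega>"
proof -
  have "measure PS {\<omega>. \<forall>l. \<not> Rd l \<omega>} \<le> 9 * \<theta> ^ l" for l
    by (rule order_trans[OF PS.finite_measure_mono not_Rd]) (auto intro!: sets_PS_I)
  moreover have "(\<lambda>l. 9 * \<theta> ^ l) \<longlonglongrightarrow> 9 * 0"
    by (intro tendsto_mult tendsto_const LIMSEQ_power_zero) (use \<theta> in auto)
  ultimately have "measure PS {\<omega>. \<forall>l. \<not> Rd l \<omega>} \<le> 9 * 0"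
    by (metis (no_types, lifting) LIMSEQ_le_const)
  hence "measure PS {\<omega>. \<forall>l. \<not> Rd l \<omega>} = 0" using measure_nonneg[of PS "{\<omega>. \<forall>l. \<not> Rd l \<omega>}"] by linarith
  moreover have m: "{\<omega>. \<forall>l. \<not> Rd l \<omega>} \<in> sets PS" by (rule sets_PS_I) measurable
  ultimately have "{\<omega>. \<forall>l. \<not> Rd l \<omega>} \<in> null_sets PS" by (auto simp: PS.emeasure_eq_measure)
  from AE_not_in[OF this] show ?thesis by auto
qed

lemma Rd_FJ:
  assumes "Rd l \<omega>"
  shows "\<exists>k z1 z2. k \<le> l \<and> FJ k 0 0 z1 z2 (cp False \<omega>) (cp True \<omega>) \<and> gap \<omega> = z2 - z1"
    and "\<bar>gap \<omega> $ i\<bar> \<le> 18 * int (C * l) + 16"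
proof -
  obtain j where j: "j \<in> {1..l}" "JX (cp False \<omega>) 0 (cp True \<omega>) 0 j" using assms by (auto simp: Rd_def)
  obtain k z1 z2 where k: "k \<le> j" and F: "FJ k 0 0 z1 z2 (cp False \<omega>) (cp True \<omega>)"
    using FJ_exists[OF j(2)] j(1) by auto
  hence "DD (z2 - z1) \<omega>" unfolding DD_def by blast
  note g = gap_eq[OF this]
  show "\<exists>k z1 z2. k \<le> l \<and> FJ k 0 0 z1 z2 (cp False \<omega>) (cp True \<omega>) \<and> gap \<omega> = z2 - z1"
    using F k j(1) g by (intro exI[of _ k] exI[of _ z1] exI[of _ z2]) auto
  have lev: "lev k \<le> lev l" "(0::'n site) $ dd \<le> lev k - 9" using k j(1) F by (auto simp: lev_def FJ_def)
  have z: "z1 \<in> Bx 0 (9 * int (C * l) + 8)" "z2 \<in> Bx 0 (9 * int (C * l) + 8)"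
    using Rgp_ball(2)[OF _ _ lev, of A r "cp False \<omega>" z1 "C * l" "cp False \<omega>"]
      Rgp_ball(2)[OF _ _ lev, of A r "cp True \<omega>" z2 "C * l" "cp True \<omega>"] F assms by (auto simp: FJ_def RG_def Rd_def)
  hence "\<bar>z1 $ i\<bar> \<le> 9 * int (C * l) + 8" "\<bar>z2 $ i\<bar> \<le> 9 * int (C * l) + 8" by (auto simp: Bx_def)
  thus "\<bar>gap \<omega> $ i\<bar> \<le> 18 * int (C * l) + 16" unfolding g by simp
qed

lemma qn_le_sup:
  fixes d :: "'n site"
  assumes "\<And>i. \<bar>d $ i\<bar> \<le> c" shows "qn d \<le> 2 * (real_of_int c)\<^sup>2"
  unfolding qn_def
proof (rule hsum_le)
  fix i
  have "(d $ i)\<^sup>2 \<le> c\<^sup>2" using assms[of i] by (metis abs_ge_zero power2_abs power_mono)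
  thus "(real_of_int (d $ i))\<^sup>2 \<le> (real_of_int c)\<^sup>2" by (metis of_int_le_iff of_int_power)
qed simp

text \<open>If \<open>l\<close> is least with \<open>Rd l\<close>, the gap is bounded linearly in
  \<open>l\<close>, while \<open>Rd (l - 1)\<close> fails with exponentially small probability for
  \<open>l > 0\<close>. Summing over \<open>l\<close> bounds the sixth power of the distance, which
  is the moment required by the expansions.\<close>

lemma gap_integrable: "integrable QQ (\<lambda>\<omega>. qn (gap \<omega>) ^ 3)"
proof -
  define b where "b = real C + 1"
  have b: "0 < b" by (simp add: b_def)
  define h where "h = (\<lambda>l::nat. (2 * (18 * (b * real l) + 16)\<^sup>2) ^ 3)"
  have h0: "0 \<le> h l" for l by (simp add: h_def)
  have m [measurable]: "(\<lambda>\<omega>. f (gap \<omega>)) \<in> borel_measurable PS" for f :: "'n site \<Rightarrow> real"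
    by (rule measurable_compose[OF gap_meas]) simp
  have le: "qn (gap \<omega>) ^ 3 \<le> h l" if "Rd l \<omega>" for l \<omega>
  proof -
    have "qn (gap \<omega>) \<le> 2 * (real_of_int (18 * int (C * l) + 16))\<^sup>2" by (rule qn_le_sup) (rule Rd_FJ(2)[OF that])
    also have "\<dots> \<le> 2 * (18 * (b * real l) + 16)\<^sup>2"
      by (intro mult_left_mono power_mono) (auto simp: b_def algebra_simps)
    finally show ?thesis unfolding h_def by (intro power_mono) auto
  qed
  have AE: "AE \<omega> in PS. ennreal (qn (gap \<omega>) ^ 3) \<le> ennreal (h 0) + (\<Sum>l. ennreal (h (Suc l)) * indicator {\<omega>. \<not> Rd l \<omega>} \<omega>)"
    using AE_Rd
  proof eventually_elim
    case (elim \<omega>)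
    define l where "l = (LEAST l. Rd l \<omega>)"
    have l: "Rd l \<omega>" unfolding l_def using elim by (metis LeastI)
    show ?case
    proof (cases l)
      case 0
      thus ?thesis using le[OF l] by (intro add_increasing2) (auto intro!: ennreal_leI)
    next
      case (Suc l')
      have "\<not> Rd l' \<omega>" using not_less_Least[of l' "\<lambda>l. Rd l \<omega>"] Suc unfolding l_def by simp
      hence "ennreal (qn (gap \<omega>) ^ 3) \<le> (\<Sum>l\<in>{l'}. ennreal (h (Suc l)) * indicator {\<omega>. \<not> Rd l \<omega>} \<omega>)"
        using le[OF l] Suc by (auto intro!: ennreal_leI)
      also have "\<dots> \<le> (\<Sum>l. ennreal (h (Suc l)) * indicator {\<omega>. \<not> Rd l \<omega>} \<omega>)"
        by (rule sum_le_suminf) auto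
      finally show ?thesis by (intro add_increasing) auto
    qed
  qed
  have [measurable]: "{\<omega>. \<not> Rd l \<omega>} \<in> sets PS" for l by (rule sets_PS_I) measurable
  have "(\<integral>\<^sup>+\<omega>. ennreal (qn (gap \<omega>) ^ 3) \<partial>PS) \<le> (\<integral>\<^sup>+\<omega>. ennreal (h 0) + (\<Sum>l. ennreal (h (Suc l)) * indicator {\<omega>. \<not> Rd l \<omega>} \<omega>) \<partial>PS)"
    by (rule nn_integral_mono_AE[OF AE])
  also have "\<dots> = ennreal (h 0) + (\<integral>\<^sup>+\<omega>. (\<Sum>l. ennreal (h (Suc l)) * indicator {\<omega>. \<not> Rd l \<omega>} \<omega>) \<partial>PS)"
    by (subst nn_integral_add) (auto simp: PS.emeasure_space_1[simplified])
  also have "(\<integral>\<^sup>+\<omega>. (\<Sum>l. ennreal (h (Suc l)) * indicator {\<omega>. \<not> Rd l \<omega>} \<omega>) \<partial>PS) = (\<Sum>l. \<integral>\<^sup>+\<omega>. ennreal (h (Suc l)) * indicator {\<omega>. \<not> Rd l \<omega>} \<omega> \<partial>PS)"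
    by (rule nn_integral_suminf) measurable
  also have "\<dots> = (\<Sum>l. ennreal (h (Suc l)) * emeasure PS {\<omega>. \<not> Rd l \<omega>})"
    by (simp add: nn_integral_cmult)
  also have "\<dots> \<le> (\<Sum>l. ennreal (h (Suc l) * (9 * \<theta> ^ l)))"
  proof (rule suminf_le)
    fix l
    have "ennreal (h (Suc l)) * emeasure PS {\<omega>. \<not> Rd l \<omega>} = ennreal (h (Suc l) * measure PS {\<omega>. \<not> Rd l \<omega>})"
      by (simp add: PS.emeasure_eq_measure ennreal_mult h0)
    also have "\<dots> \<le> ennreal (h (Suc l) * (9 * \<theta> ^ l))" by (intro ennreal_leI mult_left_mono not_Rd h0)
    finally show "ennreal (h (Suc l)) * emeasure PS {\<omega>. \<not> Rd l \<omega>} \<le> ennreal (h (Suc l) * (9 * \<theta> ^ l))" .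
  qed auto
  also have "\<dots> < \<infinity>"
  proof -
    have "summable (\<lambda>l. h (Suc l) * (9 * \<theta> ^ l))"
    proof (rule summable_comparison_test_bigo)
      \<comment> \<open>The polynomial factor is absorbed by giving up half of the exponential
        rate.\<close>
      show "summable (\<lambda>l. norm (sqrt \<theta> ^ l))" using \<theta> by (simp add: norm_power summable_geometric)
      define a where "a = - ln \<theta>"
      have a: "a > 0" "\<theta> = exp (- a)" "sqrt \<theta> = exp (- a / 2)"
      proof -
        show "a > 0" "\<theta> = exp (- a)" using \<theta> by (auto simp: a_def)
        hence "sqrt \<theta> = sqrt (exp (- a / 2) * exp (- a / 2))" by (simp add: exp_add[symmetric])
        thus "sqrt \<theta> = exp (- a / 2)" by simp
      qed
      have e: "\<theta> ^ l = exp (- a * real l)" "sqrt \<theta> ^ l = exp (- a / 2 * real l)" for l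
        using exp_of_nat2_mult[of "- a" l] exp_of_nat2_mult[of "- a / 2" l] a by simp_all
      have "(\<lambda>l::nat. (2 * (18 * (b * real (Suc l)) + 16)\<^sup>2) ^ 3 * (9 * exp (- a * real l))) \<in> O(\<lambda>l. exp (- a / 2 * real l))"
        using a(1) b by real_asymp
      thus "(\<lambda>l. h (Suc l) * (9 * \<theta> ^ l)) \<in> O(\<lambda>l. sqrt \<theta> ^ l)"
        unfolding h_def e by (simp add: mult_ac)
    qed
    thus ?thesis using h0 \<theta> by (subst suminf_ennreal2) auto
  qed
  finally have fin: "(\<integral>\<^sup>+\<omega>. ennreal (qn (gap \<omega>) ^ 3) \<partial>PS) < \<infinity>" by simp
  \<comment> \<open>Conditioning on \<open>GG\<close> costs at most the factor
    \<open>1 / \<gamma>\<^sup>2\<close>.\<close>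
  have "(\<integral>\<^sup>+\<omega>. ennreal (qn (gap \<omega>) ^ 3) \<partial>QQ) = (\<integral>\<^sup>+\<omega>. ennreal (qn (gap \<omega>) ^ 3) * indicator GG \<omega> \<partial>PS) / emeasure PS GG"
    unfolding QQ_def by (rule nn_integral_uniform_measure) measurable
  also have "\<dots> \<le> (\<integral>\<^sup>+\<omega>. ennreal (qn (gap \<omega>) ^ 3) \<partial>PS) / emeasure PS GG"
    by (intro divide_right_mono_ennreal nn_integral_mono) (auto simp: indicator_def)
  also have "\<dots> < \<infinity>" using fin \<gamma>_pos GG_emeasure
    by (simp add: ennreal_divide_eq_top_iff less_top[symmetric])
  finally have "(\<integral>\<^sup>+\<omega>. ennreal (qn (gap \<omega>) ^ 3) \<partial>QQ) < \<infinity>" .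
  thus ?thesis by (intro integrableI_nonneg) auto
qed

end

section \<open>Symmetry, isotropy and non-degeneracy of the gap\<close>

context dsf begin

lemma QQ_inv:
  assumes T [measurable]: "T \<in> PS \<rightarrow>\<^sub>M PS" and d: "distr PS PS T = PS" and G: "\<And>\<omega>. T \<omega> \<in> GG \<longleftrightarrow> \<omega> \<in> GG"
  shows "distr QQ PS T = QQ"
proof (rule measure_eqI)
  fix X assume "X \<in> sets (distr QQ PS T)"
  hence X [measurable]: "X \<in> sets PS" by simp
  have T': "T \<in> QQ \<rightarrow>\<^sub>M PS" using T by (simp add: QQ_def)
  have pre: "T -` X \<in> sets PS" using measurable_sets[OF T X] by simp
  have "emeasure (distr QQ PS T) X = emeasure QQ (T -` X)"
    using emeasure_distr[OF T' X] by simp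
  also have "\<dots> = emeasure PS (GG \<inter> T -` X) / emeasure PS GG"
    unfolding QQ_def by (rule emeasure_uniform_measure) (use pre in auto)
  also have "GG \<inter> T -` X = T -` (GG \<inter> X) \<inter> space PS" using G by auto
  also have "emeasure PS \<dots> = emeasure (distr PS PS T) (GG \<inter> X)"
    by (rule emeasure_distr[symmetric]) auto
  also have "\<dots> / emeasure PS GG = emeasure QQ X"
    unfolding QQ_def d by (rule emeasure_uniform_measure[symmetric]) auto
  finally show "emeasure (distr QQ PS T) X = emeasure QQ X" .
qed simp

text \<open>Exchanging the two copies preserves the conditioned law, keeps the level of the first
  joint renewal and interchanges its two centres.\<close>

lemma gap_sym: "distr QQ (count_space UNIV) gap = distr QQ (count_space UNIV) (\<lambda>\<omega>. - gap \<omega>)"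
proof -
  define g where "g = (\<lambda>(w::'n site, b). (w, \<not> b))"
  define T where "T = (\<lambda>(\<omega>::'n env2) p. \<omega> (g p))"
  have "inj g" by (auto simp: g_def inj_def)
  hence d: "distr PS PS T = PS" unfolding T_def by (rule distr_PS_reindex)
  have m [measurable]: "T \<in> PS \<rightarrow>\<^sub>M PS" by (rule measurable_PS_I) (simp add: T_def)
  have cpT: "cp b (T \<omega>) = cp (\<not> b) \<omega>" for b \<omega> by (simp add: T_def g_def cp_def fun_eq_iff)
  have "distr QQ PS T = QQ" by (rule QQ_inv[OF m d]) (auto simp: GG_def cpT)
  hence "distr QQ (count_space UNIV) gap = distr (distr QQ PS T) (count_space UNIV) gap" by simp
  also have "\<dots> = distr QQ (count_space UNIV) (gap \<circ> T)" by (rule distr_distr) measurable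
  also have "gap \<circ> T = (\<lambda>\<omega>. - gap \<omega>)"
  proof
    fix \<omega>
    have JX: "JX (cp True \<omega>) 0 (cp False \<omega>) 0 j = JX (cp False \<omega>) 0 (cp True \<omega>) 0 j" for j by (auto simp: JX_def)
    have "FJ k 0 0 z1 z2 (cp False (T \<omega>)) (cp True (T \<omega>)) = FJ k 0 0 z2 z1 (cp False \<omega>) (cp True \<omega>)" for k z1 z2
      unfolding cpT FJ_def by (auto simp: JX)
    hence DD: "DD d (T \<omega>) \<longleftrightarrow> DD (- d) \<omega>" for d
    proof -
      have "d = z2 - z1 \<longleftrightarrow> - d = z1 - z2" for z1 z2 :: "'n site" by (metis minus_diff_eq minus_minus)
      thus ?thesis unfolding DD_def \<open>\<And>z2 z1 k. FJ k 0 0 z1 z2 (cp False (T \<omega>)) (cp True (T \<omega>)) = FJ k 0 0 z2 z1 (cp False \<omega>) (cp True \<omega>)\<close> by blast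
    qed
    show "(gap \<circ> T) \<omega> = - gap \<omega>"
    proof (cases "\<exists>d. DD d \<omega>")
      case True
      then obtain d where "DD d \<omega>" by blast
      thus ?thesis using gap_eq[of "- d" "T \<omega>"] gap_eq[of d \<omega>] DD by simp
    qed (auto simp: gap_def DD)
  qed
  finally show ?thesis .
qed

text \<open>One and the same linear symmetry is applied to both copies. It fixes the common start 0,
  so the gap is transformed by the symmetry itself.\<close>

lemma gap_invariant:
  fixes f :: "'n site \<Rightarrow> real"
  assumes "symm s p"
  shows "QQ.expectation (\<lambda>\<omega>. f (gap \<omega>)) = QQ.expectation (\<lambda>\<omega>. f (Lsym s p (gap \<omega>)))"
proof -
  interpret S: symm ty s p 0 by (rule assms)
  define T where "T = (\<lambda>(\<omega>::'n env2) (w, b). Lsym S.sr p (\<omega> (S.g w, b)))"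
  have inj: "inj (\<lambda>(w, b::bool). (S.g w, b))" by (auto simp: inj_def S.g_inj)
  have d: "distr PS PS T = PS"
    using distr_PS_sym[OF inj, of "\<lambda>_. Lsym S.sr p", OF S.Lsym_meas S.distr_mu0_Lsym]
    unfolding T_def by (simp add: case_prod_unfold)
  have m [measurable]: "T \<in> PS \<rightarrow>\<^sub>M PS"
    by (rule measurable_PS_I) (auto simp: T_def case_prod_unfold intro: measurable_compose[OF measurable_PS_comp S.Lsym_meas])
  have cpT: "cp b (T \<omega>) = S.\<Phi> (cp b \<omega>)" for b \<omega> by (simp add: T_def cp_def fun_eq_iff S.\<Phi>_def)
  have g0: "S.g 0 = 0" and gL: "S.g d = Lsym s p d" for d by (simp_all add: S.g_def vec_eq_iff)
  have inv: "distr QQ PS T = QQ" by (rule QQ_inv[OF m d]) (auto simp: GG_def cpT S.Gam_\<Phi> g0)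
  have gap: "gap \<omega> = Lsym s p (gap (T \<omega>))" for \<omega>
  proof -
    have RG: "RG A r (S.\<Phi> \<omega>) 0 n z = RG A r \<omega> 0 n (S.g z)" for \<omega> n z
      unfolding RG_def S.Rgp_\<Phi> S.Gam_\<Phi> S.up_g g0 by simp
    have JX: "JX (S.\<Phi> \<omega>1) 0 (S.\<Phi> \<omega>2) 0 j = JX \<omega>1 0 \<omega>2 0 j" for \<omega>1 \<omega>2 j
      unfolding JX_def RG by (metis S.g_gi)
    have FJ: "FJ k 0 0 z1 z2 (cp False (T \<omega>)) (cp True (T \<omega>)) = FJ k 0 0 (S.g z1) (S.g z2) (cp False \<omega>) (cp True \<omega>)" for k z1 z2
      unfolding cpT FJ_def RG JX by simp
    have lin: "Lsym s p (z2 - z1) = S.g z2 - S.g z1" for z1 z2 by (simp add: gL vec_eq_iff algebra_simps)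
    have DD: "DD (Lsym s p d) \<omega>" if "DD d (T \<omega>)" for d
      using that unfolding DD_def FJ using lin by blast
    have DD': "\<exists>d. DD d (T \<omega>)" if "DD e \<omega>" for e
      using that unfolding DD_def FJ by (metis S.g_gi)
    show ?thesis
    proof (cases "\<exists>d. DD d (T \<omega>)")
      case True
      then obtain d where "DD d (T \<omega>)" by blast
      thus ?thesis using gap_eq[OF DD] gap_eq by simp
    next
      case False
      hence "gap \<omega> = 0" "gap (T \<omega>) = 0" using DD' unfolding gap_def by auto
      thus ?thesis by (simp add: vec_eq_iff)
    qed
  qed
  have fm [measurable]: "(\<lambda>\<omega>. h (gap \<omega>)) \<in> borel_measurable PS" for h :: "'n site \<Rightarrow> real"
    by (rule measurable_compose[OF gap_meas]) simp
  have mQ: "T \<in> QQ \<rightarrow>\<^sub>M PS" by measurable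
  have "QQ.expectation (\<lambda>\<omega>. f (gap \<omega>)) = QQ.expectation (\<lambda>\<omega>. f (Lsym s p (gap (T \<omega>))))"
    by (rule arg_cong[where f="integral\<^sup>L QQ"]) (simp add: fun_eq_iff gap[symmetric])
  also have "\<dots> = integral\<^sup>L (distr QQ PS T) (\<lambda>\<omega>. f (Lsym s p (gap \<omega>)))"
    by (rule integral_distr[OF mQ, symmetric]) (rule fm)
  finally show ?thesis by (simp add: inv)
qed

text \<open>Some level and some pair of entries occur with positive probability. Independently of
  the rows below, traps can be placed there with centres that differ in coordinate
  \<open>i0\<close>, thanks to the tolerance of one site in \<open>Rgp\<close>.\<close>

lemma gap_nontriv:
  assumes i0: "i0 \<noteq> dd"
  shows "0 < measure PS (GG \<inter> {\<omega>. gap \<omega> $ i0 \<noteq> 0})"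
proof -
  let ?EB = "\<lambda>k b v (\<omega>::'n env2). Ent (cp b \<omega>) 0 (lev k) v \<and> \<not> Bad A (cp b \<omega>) (lev k) v"
  let ?TG = "\<lambda>b z (\<omega>::'n env2). Tilt r (cp b \<omega>) z \<and> Gam r (cp b \<omega>) (up z)"
  let ?S = "\<lambda>k (\<omega>::'n env2). (Gam r (cp False \<omega>) 0 \<and> Gam r (cp True \<omega>) 0) \<and> (\<forall>j\<in>{1..<k}. \<not> JX (cp False \<omega>) 0 (cp True \<omega>) 0 j)"
  let ?X = "\<lambda>k v1 v2. {\<omega>. ?S k \<omega> \<and> ?EB k False v1 \<omega> \<and> ?EB k True v2 \<omega>}"
  note pred_cp[OF Ent_meas, measurable] pred_cp[OF Bad_meas, measurable] pred_cp[OF Tilt_meas, measurable]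
    pred_cp[OF Gam_meas, measurable]
  have Xm: "?X k v1 v2 \<in> sets PS" for k v1 v2 by (rule sets_PS_I) measurable
  have "\<exists>k\<ge>1. \<exists>v1 v2. measure PS (?X k v1 v2) \<noteq> 0"
  proof (rule ccontr)
    assume "\<not> ?thesis"
    hence "?X k v1 v2 \<in> null_sets PS" if "1 \<le> k" for k v1 v2
      using that Xm by (auto simp: PS.emeasure_eq_measure null_sets_def)
    hence "(\<Union>k\<in>{1..}. \<Union>v1. \<Union>v2. ?X k v1 v2) \<in> null_sets PS" by (intro null_sets_UN') auto
    from AE_not_in[OF this] AE_Rd have "AE \<omega> in PS. \<omega> \<notin> GG"
    proof eventually_elim
      case (elim \<omega>)
      then obtain l where "Rd l \<omega>" by blast
      then obtain k z1 z2 where F: "FJ k 0 0 z1 z2 (cp False \<omega>) (cp True \<omega>)" using Rd_FJ(1) by blast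
      then obtain v1 v2 where "?EB k False v1 \<omega>" "?EB k True v2 \<omega>" unfolding FJ_def RG_def Rgp_def by blast
      moreover have "1 \<le> k" using F by (simp add: FJ_def)
      ultimately show ?case using F elim(1) unfolding FJ_def GG_def by blast
    qed
    hence "measure PS GG = 0" using PS.prob_eq_0[OF GG_sets] by simp
    thus False using GG_prob \<gamma>_pos by simp
  qed
  then obtain k v1 v2 where k: "1 \<le> k" and P: "measure PS (?X k v1 v2) \<noteq> 0" by blast
  let ?n = "lev k"
  have row: "(0::'n site) $ dd < lev j" if "1 \<le> j" for j using that by (simp add: lev_def)
  define z1 where "z1 = cs ?n v1"
  \<comment> \<open>The centre is moved by one unit only when the two columns agree in coordinate
    \<open>i0\<close>.\<close>
  define z2 where "z2 = cs ?n v2 + axis i0 (if cs ?n v2 $ i0 = z1 $ i0 then 1 else 0)"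
  have z: "z1 $ dd = ?n" "z2 $ dd = ?n" "z2 $ i0 \<noteq> z1 $ i0" using i0 by (auto simp: z1_def z2_def axis_def)
  have h: "h1 z1 v1 \<le> 1" by (simp add: z1_def)
  have "h1 z2 (cs ?n v2) \<le> (\<Sum>i\<in>-{dd}. if i = i0 then 1 else 0)"
    unfolding h1_def z2_def by (rule sum_mono) (auto simp: axis_def)
  also have "\<dots> \<le> 1" using i0 by simp
  finally have h2: "h1 z2 v2 \<le> 1" using h1_triangle[of z2 v2 "cs ?n v2"] by simp
  have TGd: "dep ({w. z $ dd \<le> w $ dd} \<times> {b}) (?TG b z)" for b z
    by (rule dep_cp[OF TG_prob(3)])
  have "measure PS {\<omega>. ?TG False z1 \<omega> \<and> ?TG True z2 \<omega>}
     = measure PS {\<omega>. ?TG False z1 \<omega>} * measure PS {\<omega>. ?TG True z2 \<omega>}"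
    by (rule dep_indep[OF _ _ TGd TGd]) auto
  moreover have "measure PS {\<omega>. ?TG b z \<omega>} = \<tau> * \<gamma>" for b z
    using prob_cp[of "\<lambda>\<omega>. Tilt r \<omega> z \<and> Gam r \<omega> (up z)" b] TG_prob(1)[of r z] by (simp add: \<tau>_def \<gamma>_def)
  ultimately have TG: "measure PS {\<omega>. ?TG False z1 \<omega> \<and> ?TG True z2 \<omega>} = (\<tau> * \<gamma>)\<^sup>2"
    by (simp add: power2_eq_square)
  have EBd: "dep {p. fst p $ dd < ?n} (?EB k b v)" for b v
  proof -
    have "dep {w. w $ dd < ?n} (\<lambda>\<omega>::'n env. Ent \<omega> 0 ?n v \<and> \<not> Bad A \<omega> ?n v)"
      using row[OF k] by (intro dep_conj dep_not Ent_dep dep_mono[OF Bad_dep]) auto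
    from dep_cp[OF this, of b] show ?thesis by (rule dep_mono) auto
  qed
  have Sd: "dep {p. fst p $ dd < ?n} (?S k)"
  proof (intro dep_conj dep_ball dep_not)
    have Gd: "dep {p. fst p $ dd < ?n} (\<lambda>\<omega>. Gam r (cp b \<omega>) (0::'n site))" for b
      by (rule dep_mono[OF dep_cp[OF Gam_dep]]) (use k in \<open>auto simp: lev_def\<close>)
    show "dep {p. fst p $ dd < ?n} (\<lambda>\<omega>. Gam r (cp False \<omega>) (0::'n site))" "dep {p. fst p $ dd < ?n} (\<lambda>\<omega>. Gam r (cp True \<omega>) (0::'n site))" by (rule Gd)+
    fix j assume j: "j \<in> {1..<k}"
    have "dep {p. fst p $ dd < ?n} (\<lambda>\<omega>. RG A r (cp b \<omega>) 0 (lev j) (z::'n site))" for b z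
    proof -
      have "dep ({w. w $ dd \<le> lev j + 2} \<times> {b}) (\<lambda>\<omega>. RG A r (cp b \<omega>) 0 (lev j) z)"
        using dep_cp[OF RG_dep[OF row], of j b z] j by simp
      thus ?thesis by (rule dep_mono) (use j in \<open>auto simp: lev_def\<close>)
    qed
    thus "dep {p. fst p $ dd < ?n} (\<lambda>\<omega>. JX (cp False \<omega>) 0 (cp True \<omega>) 0 j)"
      unfolding JX_def by (intro dep_ex dep_conj)
  qed
  have d1: "dep {p. fst p $ dd < ?n} (\<lambda>\<omega>. ?S k \<omega> \<and> ?EB k False v1 \<omega> \<and> ?EB k True v2 \<omega>)"
    by (intro dep_conj[OF Sd] dep_conj[OF EBd EBd])
  have d2: "dep {p. ?n \<le> fst p $ dd} (\<lambda>\<omega>. ?TG False z1 \<omega> \<and> ?TG True z2 \<omega>)"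
    by (rule dep_conj; rule dep_mono[OF TGd]; use z in auto)
  have "0 < measure PS (?X k v1 v2) * (\<tau> * \<gamma>)\<^sup>2"
    by (intro mult_pos_pos tg(1)) (use P in \<open>simp only: zero_less_measure_iff not_False_eq_True\<close>)
  also have "\<dots> = measure PS {\<omega>. (?S k \<omega> \<and> ?EB k False v1 \<omega> \<and> ?EB k True v2 \<omega>) \<and> (?TG False z1 \<omega> \<and> ?TG True z2 \<omega>)}"
    unfolding TG[symmetric] by (rule dep_indep[OF _ _ d1 d2, symmetric]) auto
  also have "\<dots> \<le> measure PS (GG \<inter> {\<omega>. gap \<omega> $ i0 \<noteq> 0})"
  proof (rule PS.finite_measure_mono)
    show "GG \<inter> {\<omega>. gap \<omega> $ i0 \<noteq> 0} \<in> sets PS"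
    proof -
      have "Measurable.pred PS (\<lambda>\<omega>. gap \<omega> $ i0 \<noteq> 0)" by (rule measurable_compose[OF gap_meas]) simp
      thus ?thesis by (intro sets.Int GG_sets sets_PS_I)
    qed
    show "{\<omega>. (?S k \<omega> \<and> ?EB k False v1 \<omega> \<and> ?EB k True v2 \<omega>) \<and> (?TG False z1 \<omega> \<and> ?TG True z2 \<omega>)} \<subseteq> GG \<inter> {\<omega>. gap \<omega> $ i0 \<noteq> 0}"
    proof safe
      fix \<omega> :: "'n env2"
      assume *: "Gam r (cp False \<omega>) 0" "Gam r (cp True \<omega>) 0" "\<forall>j\<in>{1..<k}. \<not> JX (cp False \<omega>) 0 (cp True \<omega>) 0 j"
        "Ent (cp False \<omega>) 0 ?n v1" "\<not> Bad A (cp False \<omega>) ?n v1" "Ent (cp True \<omega>) 0 ?n v2" "\<not> Bad A (cp True \<omega>) ?n v2"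
        "Tilt r (cp False \<omega>) z1" "Gam r (cp False \<omega>) (up z1)" "Tilt r (cp True \<omega>) z2" "Gam r (cp True \<omega>) (up z2)"
      show "\<omega> \<in> GG" using * by (simp add: GG_def)
      have "FJ k 0 0 z1 z2 (cp False \<omega>) (cp True \<omega>)"
        unfolding FJ_def RG_def Rgp_def using * k z h h2 by blast
      hence "gap \<omega> = z2 - z1" by (intro gap_eq) (auto simp: DD_def)
      moreover assume "gap \<omega> $ i0 = 0"
      ultimately show False using z(3) by simp
    qed
  qed
  finally show ?thesis .
qed

lemma gap_int: "integrable QQ (\<lambda>\<omega>. real_of_int (gap \<omega> $ i) * real_of_int (gap \<omega> $ j))"
proof (rule Bochner_Integration.integrable_bound)
  show "integrable QQ (\<lambda>\<omega>. 1 + qn (gap \<omega>) ^ 3)" using gap_integrable by simp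
  have m: "(\<lambda>d. real_of_int (d $ i) * real_of_int (d $ j)) \<in> borel_measurable (count_space (UNIV :: 'n site set))" by simp
  show "(\<lambda>\<omega>. real_of_int (gap \<omega> $ i) * real_of_int (gap \<omega> $ j)) \<in> borel_measurable QQ"
    using measurable_compose[OF gap_meas m] by measurable
  have sq: "(real_of_int (gap \<omega> $ i))\<^sup>2 \<le> qn (gap \<omega>)" for \<omega> i
  proof (cases "i = dd")
    case False
    thus ?thesis unfolding qn_def by (intro member_le_sum) auto
  qed simp
  have "\<bar>real_of_int (gap \<omega> $ i) * real_of_int (gap \<omega> $ j)\<bar> \<le> 1 + qn (gap \<omega>) ^ 3" for \<omega>
  proof -
    have "\<bar>real_of_int (gap \<omega> $ i) * real_of_int (gap \<omega> $ j)\<bar> \<le> ((real_of_int (gap \<omega> $ i))\<^sup>2 + (real_of_int (gap \<omega> $ j))\<^sup>2) / 2"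
      using sum_squares_bound[of "\<bar>real_of_int (gap \<omega> $ i)\<bar>" "\<bar>real_of_int (gap \<omega> $ j)\<bar>"] by (simp add: abs_mult)
    also have "\<dots> \<le> qn (gap \<omega>)" using sq[of \<omega> i] sq[of \<omega> j] by simp
    also have "\<dots> \<le> 1 + qn (gap \<omega>) ^ 3"
    proof (cases "qn (gap \<omega>) \<le> 1")
      case True
      thus ?thesis using zero_le_power[OF qn_nonneg[of "gap \<omega>"], of 3] by linarith
    next
      case False
      hence "qn (gap \<omega>) ^ 1 \<le> qn (gap \<omega>) ^ 3" by (intro power_increasing) auto
      thus ?thesis by simp
    qed
    finally show ?thesis .
  qed
  thus "AE \<omega> in QQ. norm (real_of_int (gap \<omega> $ i) * real_of_int (gap \<omega> $ j)) \<le> norm (1 + qn (gap \<omega>) ^ 3)"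
    by (intro AE_I2) (smt (verit) real_norm_def)
qed

text \<open>Reflection in a single coordinate annihilates the mixed moments, and transposing two
  horizontal coordinates equates the diagonal ones.\<close>

lemma gap_iso:
  "\<exists>v>0. \<forall>i j. i \<noteq> dd \<longrightarrow> j \<noteq> dd \<longrightarrow>
     QQ.expectation (\<lambda>\<omega>. real_of_int (gap \<omega> $ i) * real_of_int (gap \<omega> $ j)) = (if i = j then v else 0)"
proof -
  define E where "E i j = QQ.expectation (\<lambda>\<omega>. real_of_int (gap \<omega> $ i) * real_of_int (gap \<omega> $ j))" for i j
  have "\<exists>i0::'n. i0 \<noteq> dd"
  proof (rule ccontr)
    assume "\<not> ?thesis"
    hence "(UNIV :: 'n set) = {dd}" by auto
    hence "CARD('n) = 1" by (metis card.empty card_insert_disjoint empty_iff finite.emptyI One_nat_def)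
    thus False using card23 by simp
  qed
  then obtain i0 :: 'n where i0: "i0 \<noteq> dd" by blast
  have off: "E i j = 0" if ij: "i \<noteq> dd" "j \<noteq> dd" "i \<noteq> j" for i j
  proof -
    define s where "s = (\<lambda>k. if k = i then -1 else 1 :: int)"
    have S: "symm s id" by unfold_locales (use ij in \<open>auto simp: s_def\<close>)
    have "E i j = - E i j"
      using gap_invariant[OF S, of "\<lambda>d. real_of_int (d $ i) * real_of_int (d $ j)"] ij
      by (simp add: E_def s_def)
    thus ?thesis by simp
  qed
  have diag: "E i i = E i0 i0" if i: "i \<noteq> dd" for i
  proof -
    define p where "p = (\<lambda>k. if k = i then i0 else if k = i0 then i else k)"
    have S: "symm (\<lambda>_. 1) p" by unfold_locales (use i i0 in \<open>auto simp: p_def\<close>)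
    show ?thesis
      using gap_invariant[OF S, of "\<lambda>d. real_of_int (d $ i) * real_of_int (d $ i)"]
      by (simp add: E_def p_def)
  qed
  have "0 \<le> E i0 i0" unfolding E_def by (rule integral_nonneg_AE) simp
  moreover have "E i0 i0 \<noteq> 0"
  proof
    assume "E i0 i0 = 0"
    hence "AE \<omega> in QQ. real_of_int (gap \<omega> $ i0) * real_of_int (gap \<omega> $ i0) = 0"
      unfolding E_def by (subst (asm) integral_nonneg_eq_0_iff_AE[OF gap_int]) auto
    hence "AE \<omega> in QQ. \<omega> \<notin> {\<omega>. gap \<omega> $ i0 \<noteq> 0}" by simp
    moreover have m: "{\<omega>. gap \<omega> $ i0 \<noteq> 0} \<in> sets PS"
    proof -
      have "Measurable.pred PS (\<lambda>\<omega>. gap \<omega> $ i0 \<noteq> 0)" by (rule measurable_compose[OF gap_meas]) simp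
      thus ?thesis by (rule sets_PS_I)
    qed
    ultimately have "measure QQ {\<omega>. gap \<omega> $ i0 \<noteq> 0} = 0" using QQ.prob_eq_0 by simp
    thus False using gap_nontriv[OF i0] \<gamma>_pos unfolding QQ_measure[OF m] by simp
  qed
  ultimately show ?thesis using off diag unfolding E_def[symmetric] by (intro exI[of _ "E i0 i0"]) (auto simp: less_le)
qed

end

section \<open>Positivity of coalescence and the one-step inequality\<close>

context dsf begin

lemma nice_count:
  "\<exists>K. \<forall>t. measure PS {\<omega>. \<not> t \<le> 2 * card {j\<in>{1..t}. Nice A \<omega> (x::'n site) j \<and> Nice A \<omega> y j}} \<le> K * (1/2) ^ t"
proof -
  define K where "K = exp (nbrs TYPE('n) * real_of_int \<bar>x $ dd\<bar>) + exp (nbrs TYPE('n) * real_of_int \<bar>y $ dd\<bar>) + 4"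
  note card_meas[where P="\<lambda>j \<omega>. Nice A \<omega> x j \<and> Nice A \<omega> y j", measurable]
    card_meas[where P="\<lambda>j \<omega>. Fail A \<omega> z j" for z :: "'n site", OF Fail_meas, measurable]
  have "measure PS {\<omega>. \<not> t \<le> 2 * card {j\<in>{1..t}. Nice A \<omega> x j \<and> Nice A \<omega> y j}} \<le> K * (1/2) ^ t" for t
  proof -
    let ?L = "\<lambda>z. {\<omega>::'n env. Long \<omega> z (lev t) (C * t)}"
    let ?F = "\<lambda>z. {\<omega>::'n env. \<not> Long \<omega> z (lev t) (C * t) \<and> t \<le> 4 * card {j\<in>{1..t}. Fail A \<omega> z j}}"
    have meas: "?L z \<in> sets PS" "?F z \<in> sets PS" for z by (rule sets_PS_I, measurable)+
    have "AE \<omega> in PS. \<omega> \<in> {\<omega>. \<not> t \<le> 2 * card {j\<in>{1..t}. Nice A \<omega> x j \<and> Nice A \<omega> y j}} \<longrightarrow> \<omega> \<in> (?L x \<union> ?L y) \<union> (?F x \<union> ?F y)"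
      using AE_notie
    proof eventually_elim
      case (elim \<omega>)
      show ?case
      proof (intro impI, rule ccontr)
        assume J: "\<omega> \<in> {\<omega>. \<not> t \<le> 2 * card {j\<in>{1..t}. Nice A \<omega> x j \<and> Nice A \<omega> y j}}" and n: "\<omega> \<notin> (?L x \<union> ?L y) \<union> (?F x \<union> ?F y)"
        have "t \<le> 2 * card {j\<in>{1..t}. Nice A \<omega> x j \<and> Nice A \<omega> y j}"
          by (rule many_nice[OF elim elim, of x t "C * t" y "C * t"]) (use n in \<open>auto simp: not_le\<close>)
        thus False using J by blast
      qed
    qed
    hence "measure PS {\<omega>. \<not> t \<le> 2 * card {j\<in>{1..t}. Nice A \<omega> x j \<and> Nice A \<omega> y j}} \<le> measure PS ((?L x \<union> ?L y) \<union> (?F x \<union> ?F y))"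
      by (rule PS.finite_measure_mono_AE) (use meas in auto)
    also have "\<dots> \<le> (measure PS (?L x) + measure PS (?L y)) + (measure PS (?F x) + measure PS (?F y))"
      by (intro order_trans[OF measure_Un_le] add_mono order_refl) (use meas in auto)
    also have "\<dots> \<le> (exp (nbrs TYPE('n) * real_of_int \<bar>x $ dd\<bar>) * (1/2) ^ t + exp (nbrs TYPE('n) * real_of_int \<bar>y $ dd\<bar>) * (1/2) ^ t) + (2 * (1/2) ^ t + 2 * (1/2) ^ t)"
      by (intro add_mono LongP FailP)
    also have "\<dots> = K * (1/2) ^ t" unfolding K_def by (simp add: algebra_simps)
    finally show ?thesis .
  qed
  thus ?thesis by blast
qed

text \<open>If no level from \<open>m\<close> on were nice for both paths, then for
  \<open>t > 2 * m\<close> fewer than half of the first \<open>t\<close> levels would be nice, which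
  is exponentially unlikely.\<close>

lemma AE_nice: "AE \<omega> in PS. \<exists>j\<ge>m. Nice A \<omega> (x::'n site) j \<and> Nice A \<omega> y j"
proof -
  let ?B = "{\<omega>. \<not> (\<exists>j\<ge>m. Nice A \<omega> x j \<and> Nice A \<omega> y j)}"
  obtain K where K: "\<And>t. measure PS {\<omega>. \<not> t \<le> 2 * card {j\<in>{1..t}. Nice A \<omega> x j \<and> Nice A \<omega> y j}} \<le> K * (1/2) ^ t"
    using nice_count by blast
  have B: "?B \<in> sets PS" by (rule sets_PS_I) measurable
  note card_meas[where P="\<lambda>j \<omega>. Nice A \<omega> x j \<and> Nice A \<omega> y j", measurable]
  have "measure PS ?B \<le> K * (1/2) ^ t" if t: "2 * m < t" for t
  proof (rule order_trans[OF PS.finite_measure_mono K])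
    show "?B \<subseteq> {\<omega>. \<not> t \<le> 2 * card {j\<in>{1..t}. Nice A \<omega> x j \<and> Nice A \<omega> y j}}"
    proof
      fix \<omega> assume "\<omega> \<in> ?B"
      hence "{j\<in>{1..t}. Nice A \<omega> x j \<and> Nice A \<omega> y j} \<subseteq> {..<m}" by (auto simp: not_le[symmetric])
      hence "card {j\<in>{1..t}. Nice A \<omega> x j \<and> Nice A \<omega> y j} \<le> m"
        using card_mono[of "{..<m}"] by fastforce
      thus "\<omega> \<in> {\<omega>. \<not> t \<le> 2 * card {j\<in>{1..t}. Nice A \<omega> x j \<and> Nice A \<omega> y j}}" using t by simp
    qed
    show "{\<omega>. \<not> t \<le> 2 * card {j\<in>{1..t}. Nice A \<omega> x j \<and> Nice A \<omega> y j}} \<in> sets PS"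
      by (rule sets_PS_I) measurable
  qed
  moreover have "(\<lambda>t. K * (1/2) ^ t) \<longlonglongrightarrow> K * 0"
    by (intro tendsto_mult tendsto_const LIMSEQ_power_zero) auto
  ultimately have "measure PS ?B \<le> K * 0"
    by (intro LIMSEQ_le_const[of _ "K * 0"]) (auto intro!: exI[of _ "Suc (2 * m)"])
  hence "measure PS ?B = 0" using measure_nonneg[of PS ?B] by linarith
  hence "AE \<omega> in PS. \<omega> \<notin> ?B" using PS.prob_eq_0[OF B] by simp
  thus ?thesis by eventually_elim blast
qed

text \<open>A trap wide enough to cover the columns of both entries leads both paths to its
  centre.\<close>

lemma merge:
  fixes \<omega> :: "'n env"
  assumes "notie \<omega>" "Ent \<omega> x n v1" "\<not> Bad A \<omega> n v1" "Ent \<omega> y n v2" "\<not> Bad A \<omega> n v2"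
    and "x $ dd \<le> n - 9" "y $ dd \<le> n - 9" and T: "Tilt R \<omega> (cs n v1)" "Gam R \<omega> (up (cs n v1))"
    and R: "h1 v1 v2 + 18 * int A + 60 \<le> int R"
  shows "Coal \<omega> x y"
proof -
  have h: "h1 v1 (cs n v1) = 0" "h1 v2 (cs n v1) \<le> h1 v1 v2"
    using h1_cs[of n v1] h1_triangle[of v2 "cs n v1" v1] h1_sym[of v1 "cs n v1"] h1_sym[of v2 v1] by auto
  have "(suc \<omega>)\<^sup>*\<^sup>* x (cs n v1)"
    by (rule trap(1)[OF assms(1) T cs_dd assms(2) assms(6) assms(3)]) (use h R h1_nonneg[of v1 v2] in linarith)
  moreover have "(suc \<omega>)\<^sup>*\<^sup>* y (cs n v1)"
    by (rule trap(1)[OF assms(1) T cs_dd assms(4) assms(7) assms(5)]) (use h R in linarith)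
  ultimately show ?thesis unfolding Coal_def by blast
qed

text \<open>A pair of entries of positive probability is fixed before the radius \<open>R\<close> of
  the trap is chosen. The resulting bound is not uniform, but the comparison argument uses strict
  positivity only at finitely many distances.\<close>

lemma pos_coal:
  fixes x y :: "'n site"
  assumes Hm [measurable]: "Measurable.pred PS H" and Hd: "dep {w. w $ dd < lev m} H" and Hp: "0 < measure PS {\<omega>. H \<omega>}"
    and x: "x $ dd \<le> lev m - 9" "y $ dd \<le> lev m - 9"
  shows "0 < measure PS {\<omega>. H \<omega> \<and> Coal \<omega> x y}"
proof -
  let ?EB = "\<lambda>j x v \<omega>. Ent \<omega> x (lev j) v \<and> \<not> Bad A \<omega> (lev j) v"
  let ?X = "\<lambda>j v1 v2. {\<omega>. H \<omega> \<and> ?EB j x v1 \<omega> \<and> ?EB j y v2 \<omega>}"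
  have Xm: "?X j v1 v2 \<in> sets PS" for j v1 v2 by (rule sets_PS_I) measurable
  have "\<exists>j\<ge>m. \<exists>v1 v2. measure PS (?X j v1 v2) \<noteq> 0"
  proof (rule ccontr)
    assume "\<not> ?thesis"
    hence "?X j v1 v2 \<in> null_sets PS" if "m \<le> j" for j v1 v2
      using that Xm by (auto simp: PS.emeasure_eq_measure null_sets_def)
    hence "(\<Union>j\<in>{m..}. \<Union>v1. \<Union>v2. ?X j v1 v2) \<in> null_sets PS" by (intro null_sets_UN') auto
    from AE_not_in[OF this] AE_nice[of m x y] have "AE \<omega> in PS. \<omega> \<notin> {\<omega>. H \<omega>}"
    proof eventually_elim
      case (elim \<omega>)
      then obtain j where j: "j \<ge> m" "Nice A \<omega> x j" "Nice A \<omega> y j" by blast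
      then obtain v1 v2 where "?EB j x v1 \<omega>" "?EB j y v2 \<omega>" unfolding Nice_def by blast
      thus ?case using j(1) elim(1) by blast
    qed
    hence "measure PS {\<omega>. H \<omega>} = 0" using PS.prob_eq_0[OF sets_PS_I[OF Hm]] by simp
    thus False using Hp by simp
  qed
  then obtain j v1 v2 where j: "m \<le> j" and P: "measure PS (?X j v1 v2) \<noteq> 0" by blast
  let ?n = "lev j"
  let ?z = "cs ?n v1"
  define R where "R = nat (h1 v1 v2) + 18 * A + 60"
  have R: "h1 v1 v2 + 18 * int A + 60 \<le> int R" by (simp add: R_def)
  have lev: "lev m \<le> ?n" using j by (simp add: lev_def)
  have row: "x $ dd < ?n" "y $ dd < ?n" using x lev by auto
  have d1: "dep {w. w $ dd < ?n} (\<lambda>\<omega>. H \<omega> \<and> ?EB j x v1 \<omega> \<and> ?EB j y v2 \<omega>)"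
  proof (intro dep_conj dep_not)
    show "dep {w. w $ dd < ?n} H" by (rule dep_mono[OF Hd]) (use lev in auto)
    show "dep {w. w $ dd < ?n} (\<lambda>\<omega>. Ent \<omega> x ?n v1)" by (rule Ent_dep[OF row(1)])
    show "dep {w. w $ dd < ?n} (\<lambda>\<omega>. Ent \<omega> y ?n v2)" by (rule Ent_dep[OF row(2)])
    show "dep {w. w $ dd < ?n} (\<lambda>\<omega>. Bad A \<omega> ?n v1)" "dep {w. w $ dd < ?n} (\<lambda>\<omega>. Bad A \<omega> ?n v2)"
      by (rule dep_mono[OF Bad_dep]; auto)+
  qed
  have "0 < measure PS (?X j v1 v2) * measure PS {\<omega>. Tilt R \<omega> ?z \<and> Gam R \<omega> (up ?z)}"
    by (intro mult_pos_pos TG_prob(2)) (use P in \<open>simp only: zero_less_measure_iff not_False_eq_True\<close>)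
  also have "\<dots> = measure PS {\<omega>. (H \<omega> \<and> ?EB j x v1 \<omega> \<and> ?EB j y v2 \<omega>) \<and> (Tilt R \<omega> ?z \<and> Gam R \<omega> (up ?z))}"
    by (rule dep_indep[OF _ _ d1 TG_prob(3), symmetric]) auto
  also have "\<dots> \<le> measure PS {\<omega>. H \<omega> \<and> Coal \<omega> x y}"
  proof (rule PS.finite_measure_mono_AE)
    show "{\<omega>. H \<omega> \<and> Coal \<omega> x y} \<in> sets PS" by (rule sets_PS_I) measurable
    show "AE \<omega> in PS. \<omega> \<in> {\<omega>. (H \<omega> \<and> ?EB j x v1 \<omega> \<and> ?EB j y v2 \<omega>) \<and> (Tilt R \<omega> ?z \<and> Gam R \<omega> (up ?z))} \<longrightarrow> \<omega> \<in> {\<omega>. H \<omega> \<and> Coal \<omega> x y}"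
      using AE_notie
    proof eventually_elim
      case (elim \<omega>)
      show ?case using merge[OF elim _ _ _ _ _ _ _ _ R, of x ?n y] x lev by auto
    qed
  qed
  finally show ?thesis .
qed

text \<open>Beyond this squared distance the regions that \<open>Gam\<close> reads around the two
  sites are disjoint: a horizontal l1 distance of at most \<open>2 * r\<close> gives a squared
  length of at most \<open>2 * (2 * r)\<^sup>2\<close>.\<close>

definition R0 :: real where "R0 = 8 * (real r)\<^sup>2 + 1"

lemma R0_h1:
  fixes s :: "'n site"
  assumes "R0 \<le> qn s" shows "2 * int r < h1 s 0"
proof (rule ccontr)
  assume n: "\<not> 2 * int r < h1 s 0"
  have "qn s \<le> 2 * (2 * real r)\<^sup>2"
    unfolding qn_def
  proof (rule hsum_le)
    fix i :: 'n assume i: "i \<noteq> dd"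
    have "\<bar>s $ i\<bar> \<le> h1 s 0" using member_le_sum[of i "-{dd}" "\<lambda>j. \<bar>s $ j - (0::'n site) $ j\<bar>"] i by (simp add: h1_def)
    hence "\<bar>real_of_int (s $ i)\<bar> \<le> 2 * real r" using n by linarith
    hence "\<bar>real_of_int (s $ i)\<bar>\<^sup>2 \<le> (2 * real r)\<^sup>2" by (rule power_mono) simp
    thus "(real_of_int (s $ i))\<^sup>2 \<le> (2 * real r)\<^sup>2" by simp
  qed simp
  thus False using assms by (simp add: R0_def power_mult_distrib)
qed

lemma cc_nonneg: "0 \<le> cc s" by (simp add: cc_def)

lemma cc_le: "cc s \<le> 1 / \<gamma>\<^sup>2"
  unfolding cc_def by (rule divide_right_mono) auto

lemma Gam_far:
  fixes y1 y2 :: "'n site"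
  assumes "2 * int r < h1 y1 y2"
  shows "measure PS {\<omega>. Gam r \<omega> y1 \<and> Gam r \<omega> y2} = \<gamma>\<^sup>2"
proof -
  have "measure PS {\<omega>. Gam r \<omega> y1 \<and> Gam r \<omega> y2} = measure PS {\<omega>. Gam r \<omega> y1} * measure PS {\<omega>. Gam r \<omega> y2}"
  proof (rule dep_indep[OF _ _ Gam_dep Gam_dep])
    have "False" if "h1 w y1 \<le> int r" "h1 w y2 \<le> int r" for w
      using that h1_triangle[of y1 y2 w] h1_sym[of y1 w] assms by linarith
    thus "{w. w $ dd \<in> {y1 $ dd, y1 $ dd + 1} \<and> h1 w y1 \<le> int r} \<inter> {w. w $ dd \<in> {y2 $ dd, y2 $ dd + 1} \<and> h1 w y2 \<le> int r} = {}"
      by blast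
  qed auto
  thus ?thesis by (simp add: Gam_trans[of r y1] Gam_trans[of r y2] \<gamma>_def power2_eq_square)
qed

lemma cc_pos:
  fixes s :: "'n site"
  assumes s: "s $ dd = 0" "R0 \<le> qn s" shows "0 < cc s"
proof -
  have "2 * int r < h1 0 s" using R0_h1[OF s(2)] h1_sym[of s 0] by simp
  note G = Gam_far[OF this]
  have "0 < measure PS {\<omega>. (Gam r \<omega> 0 \<and> Gam r \<omega> s) \<and> Coal \<omega> 0 s}"
  proof (rule pos_coal[of _ 1])
    show "dep {w. w $ dd < lev 1} (\<lambda>\<omega>. Gam r \<omega> 0 \<and> Gam r \<omega> s)"
      by (rule dep_conj; rule dep_mono[OF Gam_dep]) (use s in \<open>auto simp: lev_def\<close>)
  qed (use G \<gamma>_pos s in \<open>auto simp: lev_def\<close>)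
  thus ?thesis using \<gamma>_pos by (simp add: cc_def conj_assoc)
qed

definition PF :: "nat \<Rightarrow> nat \<Rightarrow> 'n site \<Rightarrow> 'n site \<Rightarrow> 'n env2 \<Rightarrow> bool" where
  "PF m k z1 z2 \<omega> \<longleftrightarrow> 1 \<le> k \<and> Past k m 0 0 z1 z2 (cp False \<omega>) (cp True \<omega>) \<and>
     Gam r (cp False \<omega>) (up z1) \<and> Gam r (cp True \<omega>) (up z2)"

lemma PF_iff: "PF m k z1 z2 \<omega> \<longleftrightarrow> \<omega> \<in> GG \<and> FJ k 0 0 z1 z2 (cp False \<omega>) (cp True \<omega>) \<and>
     \<not> Long (cp False \<omega>) 0 (lev k) m \<and> \<not> Long (cp True \<omega>) 0 (lev k) m"
  by (auto simp: PF_def Past_def GG_def FJ_def RG_def)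

lemma PF_meas [measurable]: "Measurable.pred PS (PF m k z1 z2)"
  unfolding PF_def[abs_def] using pred_cp[OF Gam_meas, measurable] by measurable

text \<open>A cap on the number of steps, proportional to the distance of the starts, so that the
  explored boxes stay disjoint. The value 0 turns every path into a \<open>Long\<close> one, which
  means that close pairs are always killed.\<close>

definition mm :: "'n site \<Rightarrow> nat" where
  "mm s = (if 4 * real_of_int W \<le> sqrt (qn s) then nat \<lfloor>sqrt (qn s) / 1000\<rfloor> else 0)"

text \<open>Besides slow renewals, gaps that bring the pair closer than \<open>R0\<close> are killed
  too, so the surviving walk stays where \<open>Gam\<close> at the two sites is independent.\<close>

definition Bd :: "'n site \<Rightarrow> 'n env2 set" where
  "Bd s = - ({\<omega>. \<exists>k z1 z2. PF (mm s) k z1 z2 \<omega>} \<inter> {\<omega>. R0 \<le> qn (s + gap \<omega>)})"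

lemma Bd_sets [measurable, simp]: "Bd s \<in> sets PS"
proof -
  have "Measurable.pred PS (\<lambda>\<omega>. R0 \<le> qn (s + gap \<omega>))" by (rule measurable_compose[OF gap_meas]) simp
  hence [measurable]: "{\<omega>. R0 \<le> qn (s + gap \<omega>)} \<in> sets PS" by (rule sets_PS_I)
  have [measurable]: "{\<omega>. \<exists>k z1 z2. PF (mm s) k z1 z2 \<omega>} \<in> sets PS" by (rule sets_PS_I) measurable
  have "Bd s = space PS - ({\<omega>. \<exists>k z1 z2. PF (mm s) k z1 z2 \<omega>} \<inter> {\<omega>. R0 \<le> qn (s + gap \<omega>)})" by (auto simp: Bd_def)
  also have "\<dots> \<in> sets PS" by (intro sets.compl_sets sets.Int) fact+
  finally show ?thesis .
qed

text \<open>With \<open>L\<close> the common radius of the boxes, an intersection would force the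
  length of \<open>s\<close> below \<open>3 * L\<close>, that is \<open>27 * mm s + 3 * W\<close>.
  But the first term is at most 27/1000 and the second at most 3/4 of that length.\<close>

lemma mm_disj:
  fixes s :: "'n site"
  assumes "mm s \<noteq> 0"
  shows "Bx 0 (9 * int (mm s) + W) \<inter> Bx s (9 * int (mm s) + W) = {}"
proof (rule ccontr)
  assume "Bx 0 (9 * int (mm s) + W) \<inter> Bx s (9 * int (mm s) + W) \<noteq> {}"
  then obtain w where w: "w \<in> Bx 0 (9 * int (mm s) + W)" "w \<in> Bx s (9 * int (mm s) + W)" by blast
  let ?q = "sqrt (qn s)"
  define L where "L = real_of_int (9 * int (mm s) + W)"
  have q: "4 * real_of_int W \<le> ?q" "mm s = nat \<lfloor>?q / 1000\<rfloor>" using assms by (auto simp: mm_def split: if_splits)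
  have q0: "0 \<le> ?q" by simp
  hence m: "real (mm s) \<le> ?q / 1000" unfolding q(2) by (intro of_nat_floor) simp
  have L0: "0 < L" by (simp add: L_def)
  have "\<bar>s $ i\<bar> \<le> 2 * (9 * int (mm s) + W)" for i
  proof -
    have "\<bar>a\<bar> \<le> c \<Longrightarrow> \<bar>a - b\<bar> \<le> c \<Longrightarrow> \<bar>b\<bar> \<le> 2 * c" for a b c :: int by arith
    from this[of "w $ i" "9 * int (mm s) + W" "s $ i"] show ?thesis using w by (auto simp: Bx_def)
  qed
  from qn_le_sup[OF this] have "qn s \<le> 2 * (2 * L)\<^sup>2" by (simp add: L_def)
  also have "\<dots> < (3 * L)\<^sup>2" using L0 by (simp add: power_mult_distrib)
  finally have "?q < 3 * L" using L0 by (intro real_less_lsqrt) auto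
  moreover have "L = 9 * real (mm s) + real_of_int W" by (simp add: L_def)
  moreover have "0 < real_of_int W" by simp
  ultimately show False using q(1) m by argo
qed

lemma step_event:
  fixes s z1 z2 :: "'n site" and \<omega> :: "'n env"
  assumes s: "s $ dd = 0" and nt: "notie \<omega>" and k: "1 \<le> k" and P: "Past k m 0 s z1 z2 \<omega> \<omega>" and F: "Fut z1 z2 \<omega>"
  shows "Gam r \<omega> 0 \<and> Gam r \<omega> s \<and> Coal \<omega> 0 s"
proof -
  have reach: "(suc \<omega>)\<^sup>*\<^sup>* x (up z)" if R: "Rgp A r \<omega> x (lev k) z" and G: "Gam r \<omega> (up z)" and x: "x $ dd = 0" for x z
  proof -
    obtain v where v: "Ent \<omega> x (lev k) v" "\<not> Bad A \<omega> (lev k) v" "z $ dd = lev k" "h1 z v \<le> 1" "Tilt r \<omega> z"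
      using R by (auto simp: Rgp_def)
    have h: "h1 v z + 18 * int A + 60 \<le> int r" using v(4) h1_sym[of z v] r_ge by simp
    note trap[OF nt v(5) G v(3) v(1) lev_row[OF x k] v(2) h]
    thus ?thesis by (rule rtranclp.rtrancl_into_rtrancl)
  qed
  have "(suc \<omega>)\<^sup>*\<^sup>* 0 (up z1)" "(suc \<omega>)\<^sup>*\<^sup>* s (up z2)"
    using P F s by (auto simp: Past_def Fut_def intro!: reach)
  moreover have "Coal \<omega> (up z1) (up z2)" using F by (simp add: Fut_def)
  ultimately have "Coal \<omega> 0 s" unfolding Coal_def by (meson rtranclp_trans)
  thus ?thesis using P by (simp add: Past_def)
qed

text \<open>The identity \<open>piece\<close> is summed over all levels and centres of the first
  joint renewal. In two copies the sum dominates the expectation, and in one environment it is the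
  probability of disjoint events, each of which implies coalescence.\<close>

lemma step:
  fixes s :: "'n site"
  assumes s: "s $ dd = 0"
  shows "QQ.expectation (\<lambda>\<omega>. indicator (- Bd s) \<omega> * cc (s + gap \<omega>)) \<le> cc s"
proof -
  let ?m = "mm s"
  let ?f = "\<lambda>\<omega>. indicator (- Bd s) \<omega> * cc (s + gap \<omega>)"
  let ?PF = "\<lambda>(k, z1, z2). {\<omega>. PF ?m k z1 z2 \<omega>}"
  let ?E = "\<lambda>(k, z1, z2). {\<omega>. (1 \<le> k \<and> Past k ?m 0 s z1 (z2 + s) \<omega> \<omega>) \<and> Fut z1 (z2 + s) \<omega>}"
  let ?c = "\<lambda>(k::nat, z1, z2). ennreal (cc (s + (z2 - z1)))"
  have [measurable]: "(\<lambda>\<omega>. cc (s + gap \<omega>)) \<in> borel_measurable PS" by (rule measurable_compose[OF gap_meas]) simp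
  have PFm [measurable]: "?PF \<kappa> \<in> sets PS" for \<kappa> by (cases \<kappa>; simp) (rule sets_PS_I, measurable)
  have Em [measurable]: "?E \<kappa> \<in> sets PS" for \<kappa> by (cases \<kappa>; simp) (rule sets_PS_I, measurable)
  have f0: "0 \<le> ?f \<omega>" and f1: "?f \<omega> \<le> 1 / \<gamma>\<^sup>2" for \<omega>
    using cc_nonneg[of "s + gap \<omega>"] cc_le[of "s + gap \<omega>"] by (auto simp: indicator_def)
  have int: "integrable QQ ?f"
    by (rule QQ.integrable_const_bound[of _ "1 / \<gamma>\<^sup>2"]) (use f0 f1 in \<open>auto intro!: AE_I2\<close>)
  have pt: "ennreal (?f \<omega>) * indicator GG \<omega> \<le> (\<integral>\<^sup>+\<kappa>. ?c \<kappa> * indicator (?PF \<kappa>) \<omega> \<partial>count_space UNIV)" for \<omega>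
  proof (cases "\<omega> \<in> Bd s")
    case False
    then obtain k z1 z2 where F: "PF ?m k z1 z2 \<omega>" by (auto simp: Bd_def)
    hence "DD (z2 - z1) \<omega>" unfolding PF_iff DD_def by blast
    hence g: "gap \<omega> = z2 - z1" by (rule gap_eq)
    have "ennreal (?f \<omega>) * indicator GG \<omega> \<le> ?c (k, z1, z2) * indicator (?PF (k, z1, z2)) \<omega>"
      using F False by (simp add: g indicator_def)
    also have "\<dots> \<le> (\<integral>\<^sup>+\<kappa>. ?c \<kappa> * indicator (?PF \<kappa>) \<omega> \<partial>count_space UNIV)"
      by (rule nn_integral_ge_point) simp
    finally show ?thesis .
  qed simp
  have eq: "?c \<kappa> * emeasure PS (?PF \<kappa>) = emeasure PS (?E \<kappa>)" for \<kappa>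
  proof -
    obtain k z1 z2 where \<kappa>: "\<kappa> = (k, z1, z2)" by (cases \<kappa>)
    show ?thesis
    proof (cases "1 \<le> k \<and> ?m \<noteq> 0")
      case True
      hence "measure PS {\<omega>. (1 \<le> k \<and> Past k ?m 0 s z1 (z2 + s) \<omega> \<omega>) \<and> Fut z1 (z2 + s) \<omega>} = measure PS {\<omega>. PF ?m k z1 z2 \<omega>} * cc (s + (z2 - z1))"
        using piece[OF s _ mm_disj, of k z1 z2] by (simp add: PF_def)
      thus ?thesis by (simp add: \<kappa> PS.emeasure_eq_measure ennreal_mult'' cc_nonneg mult.commute)
    next
      case False
      \<comment> \<open>With the cap 0 both sides vanish, because every path makes at least zero
        steps.\<close>
      have "Long \<omega> x n 0" for \<omega> :: "'n env" and x n by (simp add: Long_def)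
      hence "?PF \<kappa> = {}" "?E \<kappa> = {}" using False by (auto simp: \<kappa> PF_def Past_def)
      thus ?thesis by simp
    qed
  qed
  have disj: "disjoint_family ?E"
    unfolding disjoint_family_on_def
  proof (intro ballI impI equals0I)
    fix \<kappa> \<kappa>' :: "nat \<times> 'n site \<times> 'n site" and \<omega>
    assume ne: "\<kappa> \<noteq> \<kappa>'" and e: "\<omega> \<in> ?E \<kappa> \<inter> ?E \<kappa>'"
    obtain k z1 z2 k' z1' z2' where \<kappa>: "\<kappa> = (k, z1, z2)" "\<kappa>' = (k', z1', z2')" by (metis prod.exhaust)
    have "FJ k 0 s z1 (z2 + s) \<omega> \<omega>" "FJ k' 0 s z1' (z2' + s) \<omega> \<omega>"
      using e by (auto simp: \<kappa> FJ_def Past_def Fut_def RG_def)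
    from FJ_unique[OF this] ne show False by (simp add: \<kappa>)
  qed
  have "ennreal (QQ.expectation ?f) = (\<integral>\<^sup>+\<omega>. ennreal (?f \<omega>) \<partial>QQ)"
    by (rule nn_integral_eq_integral[symmetric, OF int]) (use f0 in auto)
  also have "\<dots> = (\<integral>\<^sup>+\<omega>. ennreal (?f \<omega>) * indicator GG \<omega> \<partial>PS) / emeasure PS GG"
    unfolding QQ_def by (rule nn_integral_uniform_measure) measurable
  also have "\<dots> \<le> (\<integral>\<^sup>+\<omega>. (\<integral>\<^sup>+\<kappa>. ?c \<kappa> * indicator (?PF \<kappa>) \<omega> \<partial>count_space UNIV) \<partial>PS) / emeasure PS GG"
    by (intro divide_right_mono_ennreal nn_integral_mono pt)
  also have "(\<integral>\<^sup>+\<omega>. (\<integral>\<^sup>+\<kappa>. ?c \<kappa> * indicator (?PF \<kappa>) \<omega> \<partial>count_space UNIV) \<partial>PS)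
     = (\<integral>\<^sup>+\<kappa>. (\<integral>\<^sup>+\<omega>. ?c \<kappa> * indicator (?PF \<kappa>) \<omega> \<partial>PS) \<partial>count_space UNIV)"
    by (rule nn_integral_count_space_nn_integral) (auto simp: PFm)
  also have "\<dots> = (\<integral>\<^sup>+\<kappa>. emeasure PS (?E \<kappa>) \<partial>count_space UNIV)"
    by (simp only: nn_integral_cmult_indicator[OF PFm] eq)
  also have "\<dots> = emeasure PS (\<Union>\<kappa>. ?E \<kappa>)"
    by (rule emeasure_UN_countable[symmetric]) (use Em disj in auto)
  also have "\<dots> \<le> emeasure PS {\<omega>. Gam r \<omega> 0 \<and> Gam r \<omega> s \<and> Coal \<omega> 0 s}"
  proof (rule emeasure_mono_AE)
    show "{\<omega>. Gam r \<omega> 0 \<and> Gam r \<omega> s \<and> Coal \<omega> 0 s} \<in> sets PS" by (rule sets_PS_I) measurable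
    show "AE \<omega> in PS. \<omega> \<in> (\<Union>\<kappa>. ?E \<kappa>) \<longrightarrow> \<omega> \<in> {\<omega>. Gam r \<omega> 0 \<and> Gam r \<omega> s \<and> Coal \<omega> 0 s}"
      using AE_notie
    proof eventually_elim
      case (elim \<omega>)
      show ?case using step_event[OF s elim] by auto
    qed
  qed
  also have "emeasure PS {\<omega>. Gam r \<omega> 0 \<and> Gam r \<omega> s \<and> Coal \<omega> 0 s} = ennreal (cc s * \<gamma>\<^sup>2)"
    using \<gamma>_pos by (simp add: cc_def PS.emeasure_eq_measure)
  also have "\<dots> / emeasure PS GG = ennreal (cc s)"
    unfolding GG_emeasure(1) using \<gamma>_pos cc_nonneg by (subst divide_ennreal) auto
  finally show ?thesis using cc_nonneg by (simp add: divide_right_mono_ennreal)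
qed

end

section \<open>Decay of the killing probability and almost sure coalescence\<close>

context dsf begin

text \<open>For this index \<open>l\<close>, the event \<open>Rd l\<close> makes the renewal happen
  within the cap, since \<open>C * l \<le> mm s\<close>, and keeps the squared gap below
  \<open>qn s / 50\<close>. The inner product with \<open>s\<close> is then at most
  \<open>qn s / 7\<close>, so the pair stays at squared distance at least 5/7 of
  \<open>qn s\<close>, beyond \<open>R0\<close>.\<close>

lemma Bd_small:
  assumes big: "4 * real_of_int W \<le> sqrt (qn s)" "200 \<le> sqrt (qn s)" "2 * R0 \<le> qn s"
  shows "QQ.prob (Bd s) \<le> 9 * \<theta> ^ (mm s div (C + 1)) / \<gamma>\<^sup>2"
proof -
  define l where "l = mm s div (C + 1)"
  let ?q = "sqrt (qn s)"
  have q2: "?q\<^sup>2 = qn s" by simp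
  have m: "real (mm s) \<le> ?q / 1000" unfolding mm_def using of_nat_floor[of "?q / 1000"] by simp
  have Cl: "C * l \<le> mm s"
  proof -
    have "C * l \<le> (C + 1) * l" by simp
    also have "\<dots> \<le> mm s" unfolding l_def by (rule times_div_less_eq_dividend)
    finally show ?thesis .
  qed
  have sub: "GG \<inter> Bd s \<subseteq> {\<omega>. \<not> Rd l \<omega>}"
  proof
    fix \<omega> assume \<omega>: "\<omega> \<in> GG \<inter> Bd s"
    show "\<omega> \<in> {\<omega>. \<not> Rd l \<omega>}"
    proof (rule ccontr)
      assume "\<omega> \<notin> {\<omega>. \<not> Rd l \<omega>}"
      hence R: "Rd l \<omega>" by simp
      obtain k z1 z2 where k: "k \<le> l" and F: "FJ k 0 0 z1 z2 (cp False \<omega>) (cp True \<omega>)"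
        using Rd_FJ(1)[OF R] by blast
      have "lev k \<le> lev l" using k by (simp add: lev_def)
      hence L: "\<not> Long (cp b \<omega>) 0 (lev k) (mm s)" if "\<not> Long (cp b \<omega>) 0 (lev l) (C * l)" for b
        using that Long_mono Cl by blast
      have 1: "PF (mm s) k z1 z2 \<omega>" unfolding PF_iff using \<omega> F L R by (auto simp: Rd_def)
      have "qn (gap \<omega>) \<le> 2 * (real_of_int (18 * int (C * l) + 16))\<^sup>2" by (rule qn_le_sup) (rule Rd_FJ(2)[OF R])
      also have "\<dots> \<le> 2 * (?q / 10)\<^sup>2"
      proof (intro mult_left_mono power_mono)
        \<comment> \<open>The two summands are then at most 18/1000 of the length of
          \<open>s\<close> and, as that length is at least 200, 8/100 of it.\<close>
        have "real (C * l) \<le> ?q / 1000" using m Cl by linarith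
        thus "real_of_int (18 * int (C * l) + 16) \<le> ?q / 10" using big(2) by simp
      qed auto
      also have "\<dots> = qn s / 50" by (simp add: power_divide)
      finally have g: "qn (gap \<omega>) \<le> qn s / 50" .
      have "(dt s (gap \<omega>))\<^sup>2 \<le> qn s * qn (gap \<omega>)" by (rule dt_CS)
      also have "\<dots> \<le> qn s * (qn s / 50)" by (intro mult_left_mono g) simp
      also have "\<dots> \<le> (qn s / 7)\<^sup>2" by (simp add: power2_eq_square)
      finally have "\<bar>dt s (gap \<omega>)\<bar> \<le> qn s / 7" by (rule abs_le_square_iff[THEN iffD2, THEN order_trans]) simp
      hence "R0 \<le> qn (s + gap \<omega>)" unfolding qn_add using big(3) qn_nonneg[of "gap \<omega>"] qn_nonneg[of s] by linarith
      hence "\<omega> \<notin> Bd s" using 1 by (auto simp: Bd_def)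
      thus False using \<omega> by blast
    qed
  qed
  have "QQ.prob (Bd s) = measure PS (GG \<inter> Bd s) / \<gamma>\<^sup>2" by (rule QQ_measure) simp
  also have "\<dots> \<le> measure PS {\<omega>. \<not> Rd l \<omega>} / \<gamma>\<^sup>2"
    by (intro divide_right_mono PS.finite_measure_mono[OF sub]) (auto intro!: sets_PS_I)
  also have "\<dots> \<le> 9 * \<theta> ^ l / \<gamma>\<^sup>2" by (intro divide_right_mono not_Rd) auto
  finally show ?thesis by (simp add: l_def)
qed

text \<open>The exponent of \<open>\<theta>\<close> grows linearly in \<open>sqrt (qn s)\<close>,
  and this stretched exponential in \<open>qn s\<close> beats every power.\<close>

lemma Bd_decay:
  assumes "0 < \<eta>"
  shows "\<exists>K. \<forall>s. K \<le> qn s \<longrightarrow> QQ.prob (Bd s) \<le> \<eta> / (1 + qn s)\<^sup>2"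
proof -
  define a where "a = - ln \<theta>"
  have a: "a > 0" "\<theta> = exp (- a)" using \<theta> by (auto simp: a_def)
  define c1 where "c1 = real C + 1"
  have c1: "0 < c1" by (simp add: c1_def)
  define g where "g = 9 / \<gamma>\<^sup>2"
  have g: "0 < g" using \<gamma>_pos by (simp add: g_def)
  have "((\<lambda>x. g * exp (- a * ((sqrt x / 1000 - 1) / c1 - 1)) * (1 + x)\<^sup>2) \<longlongrightarrow> 0) at_top"
    using a(1) c1 g by real_asymp
  hence "\<forall>\<^sub>F x in at_top. g * exp (- a * ((sqrt x / 1000 - 1) / c1 - 1)) * (1 + x)\<^sup>2 < \<eta>"
    using assms by (rule order_tendstoD)
  then obtain K where K: "\<And>x. K \<le> x \<Longrightarrow> g * exp (- a * ((sqrt x / 1000 - 1) / c1 - 1)) * (1 + x)\<^sup>2 < \<eta>"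
    unfolding eventually_at_top_linorder by blast
  define K' where "K' = max K (max ((4 * real_of_int W)\<^sup>2) (max (200\<^sup>2) (2 * R0)))"
  have "QQ.prob (Bd s) \<le> \<eta> / (1 + qn s)\<^sup>2" if s: "K' \<le> qn s" for s
  proof -
    let ?q = "sqrt (qn s)"
    have big: "4 * real_of_int W \<le> ?q" "200 \<le> ?q" "2 * R0 \<le> qn s" "K \<le> qn s"
      using s by (auto simp: K'_def intro!: real_le_rsqrt)
    define l where "l = mm s div (C + 1)"
    have mm: "mm s = nat \<lfloor>?q / 1000\<rfloor>" using big(1) by (simp add: mm_def)
    have m: "?q / 1000 - 1 \<le> real (mm s)" unfolding mm by linarith
    have "mm s < (C + 1) * (l + 1)" unfolding l_def
      using dividend_less_times_div[of "C + 1" "mm s"] by simp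
    hence "real (mm s) < real ((C + 1) * (l + 1))" by (simp only: of_nat_less_iff)
    also have "\<dots> = c1 * (real l + 1)" by (simp add: c1_def algebra_simps)
    finally have "real (mm s) \<le> c1 * (real l + 1)" by simp
    hence "?q / 1000 - 1 \<le> (real l + 1) * c1" using m by (simp add: mult.commute)
    hence "(?q / 1000 - 1) / c1 \<le> real l + 1" unfolding pos_divide_le_eq[OF c1] .
    hence "(?q / 1000 - 1) / c1 - 1 \<le> real l" by simp
    hence "exp (- a * real l) \<le> exp (- a * ((?q / 1000 - 1) / c1 - 1))" using a(1) by simp
    moreover have "\<theta> ^ l = exp (- a * real l)" using exp_of_nat2_mult[of "- a" l] a(2) by simp
    ultimately have t: "\<theta> ^ l \<le> exp (- a * ((?q / 1000 - 1) / c1 - 1))" by simp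
    have "0 < 1 + qn s" by (rule add_pos_nonneg) auto
    hence p: "0 < (1 + qn s)\<^sup>2" by simp
    have "QQ.prob (Bd s) \<le> g * \<theta> ^ l" using Bd_small[OF big(1-3)] by (simp add: g_def l_def)
    also have "\<dots> \<le> g * exp (- a * ((?q / 1000 - 1) / c1 - 1))" by (intro mult_left_mono t) (use g in simp)
    also have "\<dots> \<le> \<eta> / (1 + qn s)\<^sup>2" using K[OF big(4)] unfolding pos_le_divide_eq[OF p] by simp
    finally show ?thesis .
  qed
  thus ?thesis by blast
qed

lemma cc_lower: "\<exists>\<epsilon>>0. \<forall>s. s $ dd = 0 \<longrightarrow> R0 \<le> qn s \<longrightarrow> \<epsilon> \<le> cc s"
proof -
  obtain v where v: "0 < v" "\<And>i j. i \<noteq> dd \<Longrightarrow> j \<noteq> dd \<Longrightarrow>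
     QQ.expectation (\<lambda>\<omega>. real_of_int (gap \<omega> $ i) * real_of_int (gap \<omega> $ j)) = (if i = j then v else 0)"
    using gap_iso by blast
  have m: "gap \<in> QQ \<rightarrow>\<^sub>M count_space UNIV" by measurable
  show ?thesis
  proof (rule QQ.killed_walk[OF m gap_dd gap_integrable gap_sym v(2) v(1) card_hor cc_nonneg cc_le _ Bd_decay step])
    show "Bd s \<in> QQ.events" for s by simp
    show "R0 \<le> qn (s + gap \<omega>)" if "\<omega> \<notin> Bd s" for s \<omega> using that by (auto simp: Bd_def)
    show "0 < cc s" if "s $ dd = 0" "R0 \<le> qn s" for s by (rule cc_pos[OF that])
  qed auto
qed

text \<open>Two entries whose columns are at squared distance below \<open>R0\<close> differ by at
  most \<open>\<lceil>R0\<rceil>\<close> in each of two coordinates, and the rest is the margin that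
  \<open>merge\<close> asks for.\<close>

definition Rnear :: nat where "Rnear = 2 * nat \<lceil>R0\<rceil> + 18 * A + 60"

text \<open>Distant entries receive a trap each, and their meeting is left to the lower bound on
  \<open>cc\<close>, which is available from \<open>R0\<close> on. For close entries, where two
  patches might overlap, a single wide trap merges the paths directly.\<close>

definition SE :: "int \<Rightarrow> 'n site \<Rightarrow> 'n site \<Rightarrow> 'n env \<Rightarrow> bool" where
  "SE n v1 v2 \<omega> \<longleftrightarrow> (if R0 \<le> qn (cs n v2 - cs n v1)
     then (Tilt r \<omega> (cs n v1) \<and> Tilt r \<omega> (cs n v2)) \<and> Fut (cs n v1) (cs n v2) \<omega>
     else Tilt Rnear \<omega> (cs n v1) \<and> Gam Rnear \<omega> (up (cs n v1)))"

lemma SE_meas [measurable]: "Measurable.pred PS (SE n v1 v2)"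
  unfolding SE_def[abs_def] by measurable

lemma SE_dep: "dep {w. n \<le> w $ dd} (SE n v1 v2)"
proof -
  have "dep {w. n \<le> w $ dd} (\<lambda>\<omega>. (Tilt r \<omega> (cs n v1) \<and> Tilt r \<omega> (cs n v2)) \<and> Fut (cs n v1) (cs n v2) \<omega>)"
    by (intro dep_conj; rule dep_mono[OF Tilt_dep] dep_mono[OF Fut_dep[OF cs_dd cs_dd]]) auto
  moreover have "dep {w. n \<le> w $ dd} (\<lambda>\<omega>. Tilt Rnear \<omega> (cs n v1) \<and> Gam Rnear \<omega> (up (cs n v1)))"
    using TG_prob(3)[where R=Rnear and z="cs n v1"] by simp
  ultimately show ?thesis unfolding SE_def[abs_def] by (cases "R0 \<le> qn (cs n v2 - cs n v1)") simp_all
qed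

lemma h1_cs2: "h1 (cs n v1) (cs n v2) = h1 v1 v2"
  unfolding h1_def by (rule sum.cong) (auto simp: cs_def)

lemma h1_minus: "h1 (a - b) 0 = h1 a b"
  unfolding h1_def by simp

lemma SE_prob: "\<exists>\<epsilon>>0. \<forall>n v1 v2. \<epsilon> \<le> measure PS {\<omega>. SE n v1 v2 \<omega>}"
proof -
  obtain \<epsilon> where \<epsilon>: "0 < \<epsilon>" "\<And>s. s $ dd = 0 \<Longrightarrow> R0 \<le> qn s \<Longrightarrow> \<epsilon> \<le> cc s" using cc_lower by blast
  define e1 where "e1 = measure PS {\<omega>::'n env. Tilt Rnear \<omega> 0} * measure PS {\<omega>::'n env. Gam Rnear \<omega> 0}"
  define e2 where "e2 = \<tau>\<^sup>2 * (\<gamma>\<^sup>2 * \<epsilon>)"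
  have pos: "0 < min e1 e2" using \<epsilon>(1) \<tau>_pos \<gamma>_pos Tilt_pos[of Rnear "0::'n site"] Gam_pos[of Rnear "0::'n site"]
    by (simp add: e1_def e2_def)
  have "min e1 e2 \<le> measure PS {\<omega>. SE n v1 v2 \<omega>}" for n v1 v2
  proof (cases "R0 \<le> qn (cs n v2 - cs n v1)")
    case True
    let ?z1 = "cs n v1" and ?z2 = "cs n v2"
    have far: "2 * int r < h1 ?z2 ?z1" using R0_h1[OF True] by (simp add: h1_minus)
    have TT: "measure PS {\<omega>. Tilt r \<omega> ?z1 \<and> Tilt r \<omega> ?z2} = \<tau>\<^sup>2"
    proof -
      have "measure PS {\<omega>. Tilt r \<omega> ?z1 \<and> Tilt r \<omega> ?z2} = measure PS {\<omega>. Tilt r \<omega> ?z1} * measure PS {\<omega>. Tilt r \<omega> ?z2}"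
      proof (rule dep_indep[OF _ _ Tilt_dep Tilt_dep])
        have "False" if "h1 w ?z1 \<le> int r" "h1 w ?z2 \<le> int r" for w
          using that h1_triangle[of ?z2 ?z1 w] h1_sym[of ?z2 w] far by linarith
        thus "{w. w $ dd = ?z1 $ dd \<and> h1 w ?z1 \<le> int r} \<inter> {w. w $ dd = ?z2 $ dd \<and> h1 w ?z2 \<le> int r} = {}" by blast
      qed auto
      thus ?thesis by (simp add: Tilt_trans[of r ?z1] Tilt_trans[of r ?z2] \<tau>_def power2_eq_square)
    qed
    have d1: "dep {w. w $ dd \<le> n} (\<lambda>\<omega>. Tilt r \<omega> ?z1 \<and> Tilt r \<omega> ?z2)"
      by (intro dep_conj dep_mono[OF Tilt_dep]) auto
    have "measure PS {\<omega>. SE n v1 v2 \<omega>} = measure PS {\<omega>. (Tilt r \<omega> ?z1 \<and> Tilt r \<omega> ?z2) \<and> Fut ?z1 ?z2 \<omega>}"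
      using True by (simp add: SE_def)
    also have "\<dots> = \<tau>\<^sup>2 * measure PS {\<omega>. Fut ?z1 ?z2 \<omega>}"
      unfolding TT[symmetric] by (rule dep_indep[OF _ _ d1 Fut_dep[OF cs_dd cs_dd]]) auto
    also have "measure PS {\<omega>. Fut ?z1 ?z2 \<omega>} = \<gamma>\<^sup>2 * cc (?z2 - ?z1)" by (rule Fut_prob) simp
    also have "\<tau>\<^sup>2 * \<dots> \<ge> e2" unfolding e2_def
      by (intro mult_left_mono \<epsilon>(2)) (use True in auto)
    finally show ?thesis by simp
  next
    case False
    thus ?thesis using TG_prob(1)[of Rnear "cs n v1"] by (simp add: SE_def e1_def)
  qed
  thus ?thesis using pos by blast
qed

lemma R0_ceiling: "0 \<le> \<lceil>R0\<rceil>"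
proof -
  have "0 \<le> R0" by (simp add: R0_def)
  thus ?thesis unfolding zero_le_ceiling by linarith
qed

lemma near_h1:
  fixes s :: "'n site"
  assumes "qn s < R0" shows "h1 s 0 \<le> 2 * \<lceil>R0\<rceil>"
  unfolding h1_def
proof (rule hsum_le_int)
  fix i :: 'n assume i: "i \<noteq> dd"
  have "\<bar>s $ i\<bar> \<le> (s $ i)\<^sup>2"
  proof (cases "s $ i = 0")
    case False
    hence "\<bar>s $ i\<bar> * 1 \<le> \<bar>s $ i\<bar> * \<bar>s $ i\<bar>" by (intro mult_left_mono) auto
    thus ?thesis by (simp add: power2_eq_square)
  qed simp
  hence "real_of_int \<bar>s $ i\<bar> \<le> (real_of_int (s $ i))\<^sup>2" by (metis of_int_le_iff of_int_power)
  also have "\<dots> \<le> qn s" unfolding qn_def by (rule member_le_sum) (use i in auto)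
  finally have "real_of_int \<bar>s $ i\<bar> \<le> R0" using assms by simp
  hence "\<bar>s $ i\<bar> \<le> \<lceil>R0\<rceil>" by (simp add: le_ceiling_iff)
  thus "\<bar>s $ i - 0 $ i\<bar> \<le> \<lceil>R0\<rceil>" by simp
qed (rule R0_ceiling)

lemma SE_Coal:
  fixes \<omega> :: "'n env"
  assumes nt: "notie \<omega>" and e1: "Ent \<omega> x n v1" "\<not> Bad A \<omega> n v1" and e2: "Ent \<omega> y n v2" "\<not> Bad A \<omega> n v2"
    and x: "x $ dd \<le> n - 9" "y $ dd \<le> n - 9" and S: "SE n v1 v2 \<omega>"
  shows "Coal \<omega> x y"
proof (cases "R0 \<le> qn (cs n v2 - cs n v1)")
  case True
  hence S': "Tilt r \<omega> (cs n v1)" "Tilt r \<omega> (cs n v2)" "Fut (cs n v1) (cs n v2) \<omega>" using S by (auto simp: SE_def)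
  have reach: "(suc \<omega>)\<^sup>*\<^sup>* x (up (cs n v))" if E: "Ent \<omega> x n v" "\<not> Bad A \<omega> n v" "x $ dd \<le> n - 9" "Tilt r \<omega> (cs n v)" "Gam r \<omega> (up (cs n v))" for x v
  proof -
    have "h1 v (cs n v) + 18 * int A + 60 \<le> int r" using h1_cs[of n v] h1_sym[of v "cs n v"] r_ge by simp
    note trap[OF nt E(4,5) cs_dd E(1,3,2) this]
    thus ?thesis by (rule rtranclp.rtrancl_into_rtrancl)
  qed
  have "(suc \<omega>)\<^sup>*\<^sup>* x (up (cs n v1))" "(suc \<omega>)\<^sup>*\<^sup>* y (up (cs n v2))"
    using S' e1 e2 x by (auto simp: Fut_def intro!: reach)
  moreover have "Coal \<omega> (up (cs n v1)) (up (cs n v2))" using S' by (simp add: Fut_def)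
  ultimately show ?thesis unfolding Coal_def by (meson rtranclp_trans)
next
  case False
  hence T: "Tilt Rnear \<omega> (cs n v1)" "Gam Rnear \<omega> (up (cs n v1))" using S by (auto simp: SE_def)
  have "h1 (cs n v2 - cs n v1) 0 \<le> 2 * \<lceil>R0\<rceil>" by (rule near_h1) (use False in simp)
  hence "h1 v1 v2 \<le> 2 * \<lceil>R0\<rceil>" by (simp add: h1_minus h1_cs2 h1_sym[of v1 v2])
  moreover note R0_ceiling
  ultimately have "h1 v1 v2 + 18 * int A + 60 \<le> int Rnear" by (simp add: Rnear_def)
  thus ?thesis by (rule merge[OF nt e1 e2 x T])
qed

text \<open>The past is split according to the first level from \<open>m\<close> on at which both
  entries are nice, and according to these entries; being first makes the pieces disjoint. Each
  piece is decided below its level, whereas \<open>SE\<close> reads only the rows from that level on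
  and has a uniformly positive probability.\<close>

lemma uniform_coal:
  "\<exists>\<epsilon>>0. \<forall>H m (x::'n site) y. Measurable.pred PS H \<longrightarrow> dep {w. w $ dd < lev m} H \<longrightarrow>
     x $ dd \<le> lev m - 9 \<longrightarrow> y $ dd \<le> lev m - 9 \<longrightarrow>
     \<epsilon> * measure PS {\<omega>. H \<omega>} \<le> measure PS {\<omega>. H \<omega> \<and> Coal \<omega> x y}"
proof -
  obtain \<epsilon> where \<epsilon>: "0 < \<epsilon>" "\<And>n v1 v2. \<epsilon> \<le> measure PS {\<omega>. SE n v1 v2 \<omega>}" using SE_prob by blast
  have "\<epsilon> * measure PS {\<omega>. H \<omega>} \<le> measure PS {\<omega>. H \<omega> \<and> Coal \<omega> x y}"
    if Hm [measurable]: "Measurable.pred PS H" and Hd: "dep {w. w $ dd < lev m} H"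
      and x: "x $ dd \<le> lev m - 9" "y $ dd \<le> lev m - 9" for H m and x y :: "'n site"
  proof -
    let ?EB = "\<lambda>j x v \<omega>. Ent \<omega> x (lev j) v \<and> \<not> Bad A \<omega> (lev j) v"
    let ?F = "\<lambda>j v1 v2 \<omega>. (H \<omega> \<and> m \<le> j \<and> (\<forall>i\<in>{m..<j}. \<not> (Nice A \<omega> x i \<and> Nice A \<omega> y i))) \<and> ?EB j x v1 \<omega> \<and> ?EB j y v2 \<omega>"
    define X where "X = (\<lambda>(j, v1, v2). {\<omega>. ?F j v1 v2 \<omega>})"
    define Y where "Y = (\<lambda>(j, v1, v2). {\<omega>. ?F j v1 v2 \<omega> \<and> SE (lev j) v1 v2 \<omega>})"
    have Xm: "X \<kappa> \<in> sets PS" and Ym: "Y \<kappa> \<in> sets PS" for \<kappa>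
    proof -
      obtain j v1 v2 where \<kappa>: "\<kappa> = (j, v1, v2)" by (cases \<kappa>)
      show "X \<kappa> \<in> sets PS" "Y \<kappa> \<in> sets PS" unfolding X_def Y_def \<kappa> prod.case by (rule sets_PS_I, measurable)+
    qed
    have Xd: "disjoint_family X"
      unfolding disjoint_family_on_def
    proof (intro ballI impI equals0I)
      fix \<kappa> \<kappa>' :: "nat \<times> 'n site \<times> 'n site" and \<omega>
      assume ne: "\<kappa> \<noteq> \<kappa>'" and e: "\<omega> \<in> X \<kappa> \<inter> X \<kappa>'"
      obtain j v1 v2 j' v1' v2' where \<kappa>: "\<kappa> = (j, v1, v2)" "\<kappa>' = (j', v1', v2')" by (metis prod.exhaust)
      have N: "Nice A \<omega> x j \<and> Nice A \<omega> y j" "Nice A \<omega> x j' \<and> Nice A \<omega> y j'" using e unfolding \<kappa> Nice_def X_def by auto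
      have "\<not> j < j'" "\<not> j' < j" using e N unfolding \<kappa> X_def by auto
      hence "j = j'" by simp
      hence "v1 = v1'" "v2 = v2'" using e Ent_fun unfolding \<kappa> X_def by auto
      thus False using ne \<open>j = j'\<close> \<kappa> by simp
    qed
    have YX: "Y \<kappa> \<subseteq> X \<kappa>" for \<kappa> unfolding X_def Y_def by (cases \<kappa>) auto
    hence Yd: "disjoint_family Y" using Xd unfolding disjoint_family_on_def by blast
    have "\<epsilon> * measure PS (X \<kappa>) \<le> measure PS (Y \<kappa>)" for \<kappa>
    proof -
      obtain j v1 v2 where \<kappa>: "\<kappa> = (j, v1, v2)" by (cases \<kappa>)
      show ?thesis
      proof (cases "m \<le> j")
        case True
        hence lev: "lev m \<le> lev j" by (simp add: lev_def)
        have row: "z $ dd < lev i" if "z \<in> {x, y}" "m \<le> i" for z i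
        proof -
          have "lev m \<le> lev i" using that by (simp add: lev_def)
          thus ?thesis using x that by auto
        qed
        have d1: "dep {w. w $ dd < lev j} (?F j v1 v2)"
        proof (intro dep_conj dep_not dep_const dep_ball)
          show "dep {w. w $ dd < lev j} H" by (rule dep_mono[OF Hd]) (use lev in auto)
          show "dep {w. w $ dd < lev j} (\<lambda>\<omega>. Ent \<omega> x (lev j) v1)" "dep {w. w $ dd < lev j} (\<lambda>\<omega>. Ent \<omega> y (lev j) v2)"
            by (rule Ent_dep, use row True in simp)+
          show "dep {w. w $ dd < lev j} (\<lambda>\<omega>. Bad A \<omega> (lev j) v1)" "dep {w. w $ dd < lev j} (\<lambda>\<omega>. Bad A \<omega> (lev j) v2)"
            by (rule dep_mono[OF Bad_dep]; auto)+
          fix i assume i: "i \<in> {m..<j}"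
          hence "lev i \<le> lev j" by (simp add: lev_def)
          thus "dep {w. w $ dd < lev j} (\<lambda>\<omega>. Nice A \<omega> x i)" "dep {w. w $ dd < lev j} (\<lambda>\<omega>. Nice A \<omega> y i)"
            by (rule_tac [!] dep_mono[OF Nice_dep]) (use row i in auto)
        qed
        have "\<epsilon> * measure PS (X \<kappa>) \<le> measure PS {\<omega>. SE (lev j) v1 v2 \<omega>} * measure PS (X \<kappa>)"
          by (intro mult_right_mono \<epsilon>(2)) simp
        also have "\<dots> = measure PS {\<omega>. ?F j v1 v2 \<omega>} * measure PS {\<omega>. SE (lev j) v1 v2 \<omega>}" by (simp add: \<kappa> X_def)
        also have "\<dots> = measure PS {\<omega>. ?F j v1 v2 \<omega> \<and> SE (lev j) v1 v2 \<omega>}"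
          by (rule dep_indep[OF _ _ d1 SE_dep, symmetric]) auto
        finally show ?thesis by (simp add: \<kappa> Y_def)
      qed (simp add: \<kappa> X_def)
    qed
    from PS.disj_mono[OF Xm Ym Xd Yd _ this]
    have le: "\<epsilon> * measure PS (\<Union>\<kappa>. X \<kappa>) \<le> measure PS (\<Union>\<kappa>. Y \<kappa>)" using \<epsilon>(1) by simp
    have "measure PS {\<omega>. H \<omega>} \<le> measure PS (\<Union>\<kappa>. X \<kappa>)"
    proof (rule PS.finite_measure_mono_AE)
      show "(\<Union>\<kappa>. X \<kappa>) \<in> sets PS" by (rule sets.countable_UN') (use Xm in auto)
      show "AE \<omega> in PS. \<omega> \<in> {\<omega>. H \<omega>} \<longrightarrow> \<omega> \<in> (\<Union>\<kappa>. X \<kappa>)"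
        using AE_nice[of m x y]
      proof eventually_elim
        case (elim \<omega>)
        define j where "j = (LEAST j. m \<le> j \<and> Nice A \<omega> x j \<and> Nice A \<omega> y j)"
        have j: "m \<le> j" "Nice A \<omega> x j" "Nice A \<omega> y j" unfolding j_def using LeastI_ex[OF elim[unfolded Bex_def]] by auto
        have nj: "\<not> (Nice A \<omega> x i \<and> Nice A \<omega> y i)" if "i \<in> {m..<j}" for i
          using not_less_Least[of i "\<lambda>j. m \<le> j \<and> Nice A \<omega> x j \<and> Nice A \<omega> y j"] that unfolding j_def[symmetric] by auto
        obtain v1 v2 where "?EB j x v1 \<omega>" "?EB j y v2 \<omega>" using j unfolding Nice_def by blast
        show ?case
        proof
          assume "\<omega> \<in> {\<omega>. H \<omega>}"
          hence "\<omega> \<in> X (j, v1, v2)" using j nj \<open>?EB j x v1 \<omega>\<close> \<open>?EB j y v2 \<omega>\<close> by (simp add: X_def)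
          thus "\<omega> \<in> (\<Union>\<kappa>. X \<kappa>)" by blast
        qed
      qed
    qed
    moreover have "measure PS (\<Union>\<kappa>. Y \<kappa>) \<le> measure PS {\<omega>. H \<omega> \<and> Coal \<omega> x y}"
    proof (rule PS.finite_measure_mono_AE)
      show "{\<omega>. H \<omega> \<and> Coal \<omega> x y} \<in> sets PS" by (rule sets_PS_I) measurable
      show "AE \<omega> in PS. \<omega> \<in> (\<Union>\<kappa>. Y \<kappa>) \<longrightarrow> \<omega> \<in> {\<omega>. H \<omega> \<and> Coal \<omega> x y}"
        using AE_notie
      proof eventually_elim
        case (elim \<omega>)
        show ?case
        proof
          assume "\<omega> \<in> (\<Union>\<kappa>. Y \<kappa>)"
          then obtain j v1 v2 where F: "?F j v1 v2 \<omega>" "SE (lev j) v1 v2 \<omega>" unfolding Y_def by auto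
          have "lev m \<le> lev j" using F by (simp add: lev_def)
          hence "Coal \<omega> x y" using F x by (intro SE_Coal[OF elim, of x "lev j" v1 y v2]) auto
          thus "\<omega> \<in> {\<omega>. H \<omega> \<and> Coal \<omega> x y}" using F by simp
        qed
      qed
    qed
    ultimately show ?thesis using le mult_left_mono[of "measure PS {\<omega>. H \<omega>}" "measure PS (\<Union>\<kappa>. X \<kappa>)" \<epsilon>] \<epsilon>(1) by linarith
  qed
  thus ?thesis using \<epsilon>(1) by blast
qed

text \<open>\<open>Cm m\<close>, a meeting decided below level \<open>m\<close>, increases to
  coalescence. The event of meeting, but not by level \<open>m\<close>, therefore shrinks to the
  empty set, although its probability is at least \<open>\<epsilon>\<close> times that of never
  meeting.\<close>

lemma AE_Coal:
  fixes x y :: "'n site"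
  shows "AE \<omega> in PS. Coal \<omega> x y"
proof -
  define Cm where "Cm m \<omega> \<longleftrightarrow> (\<exists>u. (sucL \<omega> (lev m))\<^sup>*\<^sup>* x u \<and> (sucL \<omega> (lev m))\<^sup>*\<^sup>* y u)" for m and \<omega> :: "'n env"
  have [measurable]: "Measurable.pred PS (Cm m)" for m
    unfolding Cm_def[abs_def] using pred_rtranclp[OF sucL_meas, measurable] by measurable
  obtain \<epsilon> where \<epsilon>: "0 < \<epsilon>" and un: "\<And>H m. Measurable.pred PS H \<Longrightarrow> dep {w. w $ dd < lev m} H \<Longrightarrow>
     x $ dd \<le> lev m - 9 \<Longrightarrow> y $ dd \<le> lev m - 9 \<Longrightarrow> \<epsilon> * measure PS {\<omega>. H \<omega>} \<le> measure PS {\<omega>. H \<omega> \<and> Coal \<omega> x y}"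
    using uniform_coal by meson
  have mono: "Cm m' \<omega>" if "Cm m \<omega>" "m \<le> m'" for m m' \<omega>
  proof -
    have "sucL \<omega> (lev m) \<le> sucL \<omega> (lev m')"
    proof (intro predicate2I)
      fix a b assume "sucL \<omega> (lev m) a b"
      moreover have "lev m \<le> lev m'" using that(2) by (simp add: lev_def)
      ultimately show "sucL \<omega> (lev m') a b" by (auto simp: sucL_def)
    qed
    from rtranclp_mono[OF this] show ?thesis using that(1) unfolding Cm_def by blast
  qed
  have CmC: "Coal \<omega> x y" if "Cm m \<omega>" for m \<omega>
  proof -
    have "sucL \<omega> (lev m) \<le> suc \<omega>" by (auto simp: sucL_def)
    from rtranclp_mono[OF this] show ?thesis using that unfolding Cm_def Coal_def by blast
  qed
  have ex: "\<exists>m. Cm m \<omega>" if C: "Coal \<omega> x y" for \<omega>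
  proof -
    obtain u where u: "(suc \<omega>)\<^sup>*\<^sup>* x u" "(suc \<omega>)\<^sup>*\<^sup>* y u" using C by (auto simp: Coal_def)
    \<comment> \<open>The 9 is made up of the 8 in the cutoff of \<open>sucL\<close> and the 1 in
      the offset of \<open>lev\<close>.\<close>
    obtain m :: nat where m: "ht \<omega> u + 9 \<le> real m" using real_arch_simple by blast
    have bnd: "(sucL \<omega> (lev m))\<^sup>*\<^sup>* a b" if "(suc \<omega>)\<^sup>*\<^sup>* a b" "ht \<omega> b \<le> real_of_int (lev m) - 8" for a b
      using that
    proof (induction rule: rtranclp_induct)
      case (step b c)
      have "ht \<omega> b < ht \<omega> c" by (rule suc_ht[OF step.hyps(2)])
      hence "ht \<omega> b \<le> real_of_int (lev m) - 8" using step.prems by linarith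
      hence "(sucL \<omega> (lev m))\<^sup>*\<^sup>* a b" "sucL \<omega> (lev m) b c" using step.IH step.hyps(2) by (blast, simp add: sucL_def)
      thus ?case by (rule rtranclp.rtrancl_into_rtrancl)
    qed simp
    have "ht \<omega> u \<le> real_of_int (lev m) - 8" using m by (simp add: lev_def)
    thus ?thesis using bnd u unfolding Cm_def by blast
  qed
  let ?A = "\<lambda>m. {\<omega>. \<not> Cm m \<omega> \<and> Coal \<omega> x y}"
  have Am: "?A m \<in> sets PS" for m by (rule sets_PS_I) measurable
  have "decseq ?A" unfolding decseq_def using mono by blast
  moreover have "(\<Inter>m. ?A m) = {}" using ex by auto
  ultimately have lim: "(\<lambda>m. measure PS (?A m)) \<longlonglongrightarrow> 0"
    using PS.finite_Lim_measure_decseq[of ?A] Am by (simp add: image_subset_iff)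
  define N where "N = measure PS {\<omega>. \<not> Coal \<omega> x y}"
  define m0 where "m0 = nat (max (x $ dd) (y $ dd) + 10)"
  have "\<epsilon> * N \<le> measure PS (?A m)" if m: "m0 \<le> m" for m
  proof -
    have x: "x $ dd \<le> lev m - 9" "y $ dd \<le> lev m - 9" using m by (auto simp: m0_def lev_def)
    have dC: "dep {w. w $ dd < lev m} (Cm m)"
      unfolding Cm_def[abs_def] rtranclp_power
    proof (rule depI)
      fix \<omega> \<omega>' :: "'n env"
      assume eq: "\<And>w. w \<in> {w. w $ dd < lev m} \<Longrightarrow> \<omega> w = \<omega>' w"
        and "\<exists>u. (\<exists>n. (sucL \<omega> (lev m) ^^ n) x u) \<and> (\<exists>n. (sucL \<omega> (lev m) ^^ n) y u)"
      moreover have "(sucL \<omega>' (lev m) ^^ n) z u" if "(sucL \<omega> (lev m) ^^ n) z u" "z $ dd < lev m" for z n u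
        using sucL_pow_row[of "lev m" \<omega> \<omega>' z n u] that eq by auto
      moreover have "x $ dd < lev m" "y $ dd < lev m" using x by auto
      ultimately show "\<exists>u. (\<exists>n. (sucL \<omega>' (lev m) ^^ n) x u) \<and> (\<exists>n. (sucL \<omega>' (lev m) ^^ n) y u)" by metis
    qed
    have "N \<le> measure PS {\<omega>. \<not> Cm m \<omega>}" unfolding N_def
      by (rule PS.finite_measure_mono) (use CmC in \<open>auto intro!: sets_PS_I\<close>)
    hence "\<epsilon> * N \<le> \<epsilon> * measure PS {\<omega>. \<not> Cm m \<omega>}" using \<epsilon> by simp
    also have "\<dots> \<le> measure PS (?A m)" by (rule un[OF _ dep_not[OF dC] x]) measurable
    finally show ?thesis .
  qed
  hence "\<epsilon> * N \<le> 0" by (intro LIMSEQ_le_const[OF lim]) blast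
  hence "N \<le> 0" using \<epsilon> by (simp add: mult_le_0_iff)
  hence "N = 0" unfolding N_def using measure_nonneg[of PS] by (simp add: order_antisym)
  moreover have "{\<omega>. \<not> Coal \<omega> x y} \<in> sets PS" by (rule sets_PS_I) measurable
  ultimately have "AE \<omega> in PS. \<omega> \<notin> {\<omega>. \<not> Coal \<omega> x y}" unfolding N_def using PS.prob_eq_0 by blast
  thus ?thesis by simp
qed

lemma AE_Coal_all: "AE \<omega> in PS. \<forall>x y :: 'n site. Coal \<omega> x y"
  unfolding AE_all_countable using AE_Coal by blast

end

section \<open>From successors of sites to the random graph\<close>

context lowdim begin

lemma last_coord_pos: "last_coord (pos \<omega> w) = ht (\<omega> :: 'n env) w"
  by (simp add: last_coord_def ht_def dd_def)

text \<open>The minimum is strict among the points of the vertex set, so the choice hidden in the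
  minimum operator is forced.\<close>

lemma next_point_pos:
  fixes \<omega> :: "'n env"
  assumes "suc \<omega> w v"
  shows "next_point (range (pos \<omega>)) (pos \<omega> w) = pos \<omega> v"
proof -
  let ?P = "\<lambda>y. y \<in> range (pos \<omega>) \<and> last_coord y > last_coord (pos \<omega> w)"
  let ?f = "\<lambda>y. l1_norm (y - pos \<omega> w)"
  have v: "?P (pos \<omega> v)" using suc_ht[OF assms] by (simp add: last_coord_pos)
  have u: "?f (pos \<omega> v) < ?f y" if y: "?P y" "y \<noteq> pos \<omega> v" for y
  proof -
    obtain z where z: "y = pos \<omega> z" using y by blast
    thus ?thesis using suc_global[OF assms, of z] y by (auto simp: last_coord_pos ds_def)
  qed
  show ?thesis unfolding next_point_def arg_min_def is_arg_min_def
  proof (rule some_equality)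
    show "?P (pos \<omega> v) \<and> \<not> (\<exists>y. ?P y \<and> ?f y < ?f (pos \<omega> v))"
      using v u by (metis less_asym order_less_irrefl)
    show "y = pos \<omega> v" if "?P y \<and> \<not> (\<exists>z. ?P z \<and> ?f z < ?f y)" for y
      using that v u by blast
  qed
qed

end

text \<open>Indexed access to the vertices of a walk, which is what an argument about the cyclic
  neighbours of a vertex needs. Arcs are pairs here, so consecutive vertices recover the
  arc.\<close>

lemma walk_nth:
  fixes H :: "'v pair_pre_digraph"
  assumes "pre_digraph.cas (with_proj H) a p b"
  defines "vs \<equiv> pre_digraph.awalk_verts (with_proj H) a p"
  shows "length vs = Suc (length p) \<and> vs ! 0 = a \<and> vs ! length p = b \<and> (\<forall>k<length p. (vs ! k, vs ! Suc k) = p ! k)"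
  using assms(1) unfolding vs_def
proof (induction p arbitrary: a)
  case Nil
  thus ?case by (simp add: pre_digraph.cas.simps pre_digraph.awalk_verts.simps)
next
  case (Cons e p)
  have c: "fst e = a" "pre_digraph.cas (with_proj H) (snd e) p b"
    using Cons.prems by (simp_all add: pre_digraph.cas.simps)
  note IH = Cons.IH[OF c(2)]
  show ?case
  proof (intro conjI allI impI)
    fix k assume k: "k < length (e # p)"
    show "(pre_digraph.awalk_verts (with_proj H) a (e # p) ! k, pre_digraph.awalk_verts (with_proj H) a (e # p) ! Suc k) = (e # p) ! k"
      using IH k by (cases k) (auto simp: pre_digraph.awalk_verts.simps)
  qed (use IH c in \<open>auto simp: pre_digraph.awalk_verts.simps\<close>)
qed

text \<open>In a cycle of length at least three, the two neighbours of a lowest vertex are distinct and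
  would both be its successor.\<close>

lemma forest_if_ascending:
  fixes G :: "('v, 'b) pre_digraph" and h :: "'v \<Rightarrow> real" and f :: "'v \<Rightarrow> 'v"
  assumes E: "\<And>e. e \<in> arcs G \<Longrightarrow> h (tail G e) < h (head G e) \<and> head G e = f (tail G e)"
  shows "undirected_forest G"
  unfolding undirected_forest_def
proof safe
  fix p assume cyc: "pre_digraph.cycle (with_proj (mk_symmetric G)) p" and len: "length p \<noteq> 2"
  let ?H = "with_proj (mk_symmetric G)"
  have link: "h x < h y \<and> y = f x \<or> h y < h x \<and> x = f y" if xy: "(x, y) \<in> arcs ?H" for x y
  proof -
    obtain e where e: "e \<in> arcs G" "x = tail G e \<and> y = head G e \<or> x = head G e \<and> y = tail G e"
      using xy by (auto simp: mk_symmetric_def)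
    show ?thesis using E[OF e(1)] e(2) by metis
  qed
  obtain a where a: "pre_digraph.awalk ?H a p a" "distinct (tl (pre_digraph.awalk_verts ?H a p))" "p \<noteq> []"
    using cyc by (auto simp: pre_digraph.cycle_def)
  define vs where "vs = pre_digraph.awalk_verts ?H a p"
  define n where "n = length p"
  have cas: "pre_digraph.cas ?H a p a" and sub: "set p \<subseteq> arcs ?H" using a(1) by (auto simp: pre_digraph.awalk_def)
  from walk_nth[OF cas] have vs: "length vs = Suc n" "vs ! 0 = a" "vs ! n = a"
    and nth: "\<And>k. k < n \<Longrightarrow> (vs ! k, vs ! Suc k) = p ! k" by (auto simp: vs_def n_def)
  have lk: "h (vs ! k) < h (vs ! Suc k) \<and> vs ! Suc k = f (vs ! k) \<or> h (vs ! Suc k) < h (vs ! k) \<and> vs ! k = f (vs ! Suc k)" if "k < n" for k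
  proof (rule link)
    show "(vs ! k, vs ! Suc k) \<in> arcs ?H" unfolding nth[OF that] using sub nth_mem[of k p] that by (auto simp: n_def)
  qed
  have dist: "i = j" if "vs ! i = vs ! j" "i \<in> {1..n}" "j \<in> {1..n}" for i j
  proof -
    have "tl vs ! (i - 1) = vs ! i" if "i \<in> {1..n}" for i by (subst nth_tl) (use that vs(1) in auto)
    hence "tl vs ! (i - 1) = tl vs ! (j - 1)" using that by simp
    moreover have "i - 1 < length (tl vs)" "j - 1 < length (tl vs)" using that vs(1) by auto
    ultimately have "i - 1 = j - 1" using a(2) nth_eq_iff_index_eq[of "tl vs" "i - 1" "j - 1"] by (simp add: vs_def)
    thus ?thesis using that by auto
  qed
  have n: "1 \<le> n" using a(3) by (cases p) (auto simp: n_def)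
  \<comment> \<open>A loop would have to increase \<open>h\<close> strictly along itself.\<close>
  have "n \<noteq> 1" using lk[of 0] vs by auto
  hence n3: "3 \<le> n" using n len by (simp add: n_def)
  obtain i where i: "i \<in> {1..n}" "\<And>j. j \<in> {1..n} \<Longrightarrow> h (vs ! i) \<le> h (vs ! j)"
    using ex_is_arg_min_if_finite[of "{1..n}" "\<lambda>i. h (vs ! i)"] n by (auto simp: is_arg_min_linorder)
  \<comment> \<open>Positions 0 and \<open>n\<close> carry the same vertex, so positions 1 to
    \<open>n\<close> list the cycle once, and \<open>j\<close> and \<open>k\<close> are the cyclic
    neighbours of \<open>i\<close>. They differ because the cycle has length at least 3.\<close>
  define j where "j = (if i = 1 then n else i - 1)"
  define k where "k = (if i = n then 1 else Suc i)"
  have jk: "j \<in> {1..n}" "k \<in> {1..n}" "j \<noteq> k" using i(1) n3 by (auto simp: j_def k_def split: if_splits)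
  have e: "vs ! (i - 1) = vs ! j" "Suc (i - 1) = i" "i - 1 < n" using vs i(1) by (auto simp: j_def)
  have J: "vs ! j = f (vs ! i)" using lk[OF e(3)] i(2)[OF jk(1)] unfolding e(1,2) by linarith
  have K: "vs ! k = f (vs ! i)"
  proof (cases "i = n")
    case True
    hence "vs ! i = vs ! 0" using vs by simp
    thus ?thesis using lk[of 0] i(2)[OF jk(2)] n True by (auto simp: k_def)
  next
    case False
    thus ?thesis using lk[of i] i(1) i(2)[OF jk(2)] by (auto simp: k_def)
  qed
  show False using dist[of j k] J K jk by simp
qed

context lowdim begin

text \<open>Connectedness is coalescence read in the symmetrised graph. Acyclicity is deterministic:
  each vertex has a single outgoing arc, and that arc leads upwards.\<close>

lemma DSF_tree:
  fixes \<omega> :: "'n env"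
  assumes nt: "notie \<omega>" and ub: "\<And>w. \<omega> w \<in> ubox" and C: "\<And>x y. Coal \<omega> x y"
  shows "Digraph_Component.connected (perturbed_DSF \<omega>)" "undirected_tree (perturbed_DSF \<omega>)"
proof -
  let ?G = "perturbed_DSF \<omega>" and ?V = "range (pos \<omega>)"
  let ?E = "{(pos \<omega> w, pos \<omega> v) |w v. suc \<omega> w v}"
  have V: "perturbed_lattice \<omega> = ?V"
    unfolding perturbed_lattice_def pos_def by (simp add: clip_id[OF ub])
  have E: "{(x, next_point ?V x) |x. x \<in> ?V} = ?E"
  proof (intro set_eqI iffI)
    fix e assume "e \<in> {(x, next_point ?V x) |x. x \<in> ?V}"
    then obtain w where e: "e = (pos \<omega> w, next_point ?V (pos \<omega> w))" by blast
    obtain v where "suc \<omega> w v" using suc_exists[OF nt] by blast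
    thus "e \<in> ?E" using next_point_pos e by auto
  next
    fix e assume "e \<in> ?E"
    then obtain w v where "e = (pos \<omega> w, pos \<omega> v)" "suc \<omega> w v" by blast
    thus "e \<in> {(x, next_point ?V x) |x. x \<in> ?V}" using next_point_pos by auto
  qed
  have G: "?G = with_proj \<lparr> pverts = ?V, parcs = ?E \<rparr>"
    unfolding perturbed_DSF_def Let_def V E ..
  have forest: "undirected_forest ?G"
  proof (rule forest_if_ascending)
    fix e assume "e \<in> arcs ?G"
    then obtain w v where "e = (pos \<omega> w, pos \<omega> v)" "suc \<omega> w v" unfolding G by auto
    thus "last_coord (tail ?G e) < last_coord (head ?G e) \<and> head ?G e = next_point ?V (tail ?G e)"
      using suc_ht[of \<omega> w v] next_point_pos[of \<omega> w v] by (simp add: G last_coord_pos)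
  qed
  let ?R = "parcs (mk_symmetric ?G)"
  have R: "(pos \<omega> w, pos \<omega> v) \<in> ?R" "(pos \<omega> v, pos \<omega> w) \<in> ?R" if "suc \<omega> w v" for w v
    using that by (auto simp: mk_symmetric_def G)
  have reach: "(pos \<omega> x, pos \<omega> u) \<in> rtrancl_on ?V ?R \<and> (pos \<omega> u, pos \<omega> x) \<in> rtrancl_on ?V ?R"
    if "(suc \<omega>)\<^sup>*\<^sup>* x u" for x u
    using that
  proof (induction rule: rtranclp_induct)
    case (step y z)
    thus ?case using R[OF step.hyps(2)]
      by (auto intro: rtrancl_on_into_rtrancl_on converse_rtrancl_on_into_rtrancl_on)
  qed auto
  have "(pos \<omega> x, pos \<omega> y) \<in> rtrancl_on ?V ?R" for x y
  proof -
    obtain u where "(suc \<omega>)\<^sup>*\<^sup>* x u" "(suc \<omega>)\<^sup>*\<^sup>* y u" using C[of x y] by (auto simp: Coal_def)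
    thus ?thesis using reach rtrancl_on_trans by meson
  qed
  moreover have "pverts (mk_symmetric ?G) = ?V" by (simp add: mk_symmetric_def G)
  ultimately show conn: "Digraph_Component.connected ?G"
    unfolding connected_def strongly_connected_def reachable_def by auto
  show "undirected_tree ?G" unfolding undirected_tree_def using conn forest by simp
qed

end

theorem theorem1p1:
  fixes M :: "'a measure"
    and U :: "int ^ 'n::{finite,linorder} \<Rightarrow> 'a \<Rightarrow> real ^ 'n::{finite,linorder}"
  assumes dim: "CARD('n) = 2 \<or> CARD('n) = 3"
    and prob: "prob_space M"
    and indep: "prob_space.indep_vars M (\<lambda>_. borel) U UNIV"
    and unif: "\<And>w. distr M borel (U w) = uniform_measure lborel (cbox (\<chi> i. -1) (\<chi> i. 1))"
  shows "AE \<omega> in M. Digraph_Component.connected (perturbed_DSF (\<lambda>w. U w \<omega>)) \<and>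
           undirected_tree (perturbed_DSF (\<lambda>w. U w \<omega>))"
proof -
  interpret prob_space M by (rule prob)
  interpret lowdim "TYPE('n)" by unfold_locales (rule dim)
  obtain C A :: nat where CA: "\<forall>x::'n site. \<forall>t. measure PS {\<omega>. Long \<omega> x (lev t) (C * t)} \<le> exp (nbrs TYPE('n) * real_of_int \<bar>x $ dd\<bar>) * (1/2) ^ t
    \<and> measure PS {\<omega>. \<not> Long \<omega> x (lev t) (C * t) \<and> t \<le> 4 * card {j\<in>{1..t}. Fail A \<omega> x j}} \<le> 2 * (1/2) ^ t"
    using good_levels by blast
  interpret dsf "TYPE('n)" C A "18 * A + 100"
    by unfold_locales (use CA in auto)
  have U [measurable]: "U w \<in> M \<rightarrow>\<^sub>M borel" for w
    using indep by (auto simp: indep_vars_def)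
  let ?X = "\<lambda>\<omega> w. U w \<omega>"
  \<comment> \<open>Independence identifies the joint law of the family with a product measure, so
    the almost sure statements about \<open>PS\<close> can be pulled back to
    \<open>M\<close>.\<close>
  have "distr M (\<Pi>\<^sub>M w\<in>UNIV. borel) (\<lambda>\<omega>. \<lambda>w\<in>UNIV. U w \<omega>) = (\<Pi>\<^sub>M w\<in>UNIV. distr M borel (U w))"
    using indep by (subst indep_vars_iff_distr_eq_PiM'[symmetric]) auto
  hence d0: "distr M (\<Pi>\<^sub>M w\<in>UNIV. borel) ?X = PS"
    by (simp add: unif PS_def mu0_def ubox_def restrict_UNIV)
  have "sets (\<Pi>\<^sub>M w\<in>UNIV. borel) = sets (PS :: 'n env measure)"
    unfolding PS_def by (rule sets_PiM_cong) auto
  hence d: "distr M PS ?X = PS" using d0 by (metis (no_types, lifting) distr_cong)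
  have m: "?X \<in> M \<rightarrow>\<^sub>M PS" by (rule measurable_PS_I) (rule U)
  have "AE \<omega> in distr M PS ?X. notie \<omega> \<and> (\<forall>x y. Coal \<omega> x y)"
    unfolding d using AE_notie AE_Coal_all by eventually_elim simp
  from AE_distrD[OF m this] have 1: "AE \<omega> in M. notie (?X \<omega>) \<and> (\<forall>x y. Coal (?X \<omega>) x y)" .
  \<comment> \<open>Almost surely no perturbation is altered by \<open>clip\<close>, and then the
    points \<open>pos\<close> are exactly those of the perturbed lattice.\<close>
  have "AE \<omega> in M. U w \<omega> \<in> ubox" for w
  proof (rule AE_distrD[OF U])
    have "AE x in (uniform_measure lborel ubox :: (real,'n) vec measure). x \<in> ubox" by (rule AE_mu0[unfolded mu0_def])
    thus "AE x in distr M borel (U w). x \<in> ubox" unfolding unif ubox_def .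
  qed
  hence "AE \<omega> in M. \<forall>w. U w \<omega> \<in> ubox" unfolding AE_all_countable by blast
  with 1 show ?thesis
  proof eventually_elim
    case (elim \<omega>)
    thus ?case using DSF_tree[of "?X \<omega>"] by blast
  qed
qed

end
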